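(* Let $\mathfrak{G}$ be a metric graph. For any Borel probability measures $\mu,\nu\in\mathcal{P}(\mathfrak{G})$, $$W_2^2(\mu,\nu)=\min\left\{\int_0^1\int_{\mathfrak{E}}|v_t|^2\,\mathrm{d}\mu_t\,\mathrm{d}t\right\},$$ where the minimum runs over all weak solutions $(\mu_t,v_t\mu_t)_{t\in[0,1]}$ of the continuity equation satisfying $\mu_0=\mu$ and $\mu_1=\nu$ (in particular, the minimum is attained).
   Context: Metric graph: let $(\mathsf V,\mathsf E)$ be a finite connected oriented graph with edge lengths $\ell_e>0$, $e\in\mathsf E$. Identify each edge $e=(e_{\rm init},e_{\rm term})$ with $(0,\ell_e)$, with $e_{\rm init},e_{\rm term}$ corresponding to $0,\ell_e$. Set $\mathfrak E=\coprod_{e}(0,\ell_e)$ (open metric edges) and $\overline{\mathfrak E}=\coprod_e[0,\ell_e]$ (closed metric edges). The metric graph $\mathfrak G$ is the quotient of $\overline{\mathfrak E}$ obtained by identifying all endpoints that correspond to the same vertex, with the shortest-path distance $\mathsf d$ (a compact geodesic metric space). $\mathcal P(\mathfrak G)$ is the set of Borel probability measures on $\mathfrak G$, and $W_2(\mu,\nu)^2=\inf_\sigma\int \mathsf d(x,y)^2\,\mathrm d\sigma(x,y)$ over all couplings $\sigma$ of $\mu$ and $\nu$. $C^1(\overline{\mathfrak E})$ is the space of functions on $\overline{\mathfrak E}$ whose restriction to each closed edge is $C^1$; $C^1(\overline{\mathfrak E})\cap C(\mathfrak G)$ denotes those which moreover descend to continuous functions on $\mathfrak G$. $\nabla$ is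 the edgewise derivative. Weak solution of the continuity equation $\partial_t\mu_t+\nabla\cdot J_t=0$ on $(0,T)$: a pair $(\mu_t,J_t)_{t\in(0,T)}$ of probability measures $\mu_t$ on $\mathfrak G$ and signed measures $J_t$ on $\overline{\mathfrak E}$, with $t\mapsto(\mu_t(A),J_t(A))$ measurable for all Borel $A$, such that (i) $t\mapsto\int_{\mathfrak G}\psi\,\mathrm d\mu_t$ is absolutely continuous for every $\psi\in C^1(\overline{\mathfrak E})\cap C(\mathfrak G)$; (ii) $\int_0^T|J_t|(\overline{\mathfrak E})\,\mathrm dt<\infty$; (iii) for every such $\psi$ and a.e. $t$, $\frac{\mathrm d}{\mathrm dt}\int_{\mathfrak G}\psi\,\mathrm d\mu_t=\int_{\overline{\mathfrak E}}\nabla\psi\cdot\mathrm dJ_t$. For $v_t\in L^2(\mu_t)$, $v_t\mu_t$ denotes the signed measure with density $v_t$ with respect to the restriction of $\mu_t$ to the open edges $\mathfrak E$ (it gives no mass to endpoints of edges). A weak solution on $[0,1]$ means a weak solution on $(0,1)$ such that $t\mapsto\mu_t$ is weakly continuous on the closed interval $[0,1]$. *)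

theory Defs
  imports "HOL-Probability.Probability" "Graph_Theory.Graph_Theory"
begin

section \<open>Measures on topological spaces, signed measures, absolute continuity\<close>

definition borel_measure_space :: "'a topology \<Rightarrow> 'a measure" where
  "borel_measure_space X = sigma (topspace X) {U. openin X U}"

definition signed_measure :: "'a measure \<Rightarrow> ('a set \<Rightarrow> real) \<Rightarrow> bool" where
  "signed_measure M J \<longleftrightarrow> J {} = 0 \<and>
     (\<forall>A :: nat \<Rightarrow> 'a set. range A \<subseteq> sets M \<longrightarrow> disjoint_family A \<longrightarrow> (\<lambda>n. J (A n)) sums J (\<Union>n. A n))"

text \<open>Jordan decomposition: the positive part of \<open>J\<close> is \<open>A \<mapsto> sup {J B | B \<subseteq> A measurable}\<close>.
  The function \<^const>\<open>ennreal\<close> cuts off negative values, which does not affect the supremum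
  because \<open>J {} = 0\<close>.\<close>

definition positive_part :: "'a measure \<Rightarrow> ('a set \<Rightarrow> real) \<Rightarrow> 'a measure" where
  "positive_part M J =
     measure_of (space M) (sets M) (\<lambda>A. SUP B \<in> {B \<in> sets M. B \<subseteq> A}. ennreal (J B))"

definition negative_part :: "'a measure \<Rightarrow> ('a set \<Rightarrow> real) \<Rightarrow> 'a measure" where
  "negative_part M J = positive_part M (\<lambda>A. - J A)"

definition total_variation :: "'a measure \<Rightarrow> ('a set \<Rightarrow> real) \<Rightarrow> 'a set \<Rightarrow> ennreal" where
  "total_variation M J A = emeasure (positive_part M J) A + emeasure (negative_part M J) A"

definition signed_integral :: "'a measure \<Rightarrow> ('a set \<Rightarrow> real) \<Rightarrow> ('a \<Rightarrow> real) \<Rightarrow> real" where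
  "signed_integral M J f = (\<integral>x. f x \<partial>positive_part M J) - (\<integral>x. f x \<partial>negative_part M J)"

definition L2 :: "'a measure \<Rightarrow> ('a \<Rightarrow> real) set" where
  "L2 M = {f \<in> borel_measurable M. integrable M (\<lambda>x. (f x)\<^sup>2)}"

definition absolutely_continuous_on :: "real set \<Rightarrow> (real \<Rightarrow> real) \<Rightarrow> bool" where
  "absolutely_continuous_on S f \<longleftrightarrow>
     (\<forall>\<epsilon>>0. \<exists>\<delta>>0. \<forall>I. finite I \<longrightarrow>
        (\<forall>(a, b) \<in> I. a < b \<and> {a..b} \<subseteq> S) \<longrightarrow>
        disjoint_family_on (\<lambda>(a, b). {a<..<b}) I \<longrightarrow>
        (\<Sum>(a, b) \<in> I. b - a) < \<delta> \<longrightarrow>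
        (\<Sum>(a, b) \<in> I. \<bar>f b - f a\<bar>) < \<epsilon>)"

section \<open>Metric graphs\<close>

text \<open>The orientation of an edge is given by its tail (initial vertex) and head (terminal vertex);
  connectedness is that of the underlying undirected graph. Loops and parallel edges are allowed.\<close>

locale metric_graph = fin_digraph G for G :: "('v, 'e) pre_digraph" +
  fixes len :: "'e \<Rightarrow> real"
  assumes connected_graph: "Digraph_Component.connected G"
    and len_pos: "e \<in> arcs G \<Longrightarrow> 0 < len e"

context
  fixes G :: "('v, 'e) pre_digraph" and len :: "'e \<Rightarrow> real"
begin

definition open_edges :: "('e \<times> real) set" where
  "open_edges = (SIGMA e : arcs G. {0<..<len e})"

definition closed_edges :: "('e \<times> real) topology" where
  "closed_edges = sum_topology (\<lambda>e. top_of_set {0..len e}) (arcs G)"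

definition lies_at :: "'e \<times> real \<Rightarrow> 'v \<Rightarrow> bool" where
  "lies_at p v \<longleftrightarrow> fst p \<in> arcs G \<and>
     (snd p = 0 \<and> tail G (fst p) = v \<or> snd p = len (fst p) \<and> head G (fst p) = v)"

definition glue :: "(('e \<times> real) \<times> ('e \<times> real)) set" where
  "glue = {(p, q). p \<in> topspace closed_edges \<and> q \<in> topspace closed_edges \<and>
                   (p = q \<or> (\<exists>v. lies_at p v \<and> lies_at q v))}"

definition graph_points :: "('e \<times> real) set set" where
  "graph_points = topspace closed_edges // glue"

definition quot :: "'e \<times> real \<Rightarrow> ('e \<times> real) set" where
  "quot p = glue `` {p}"

text \<open>A path from \<open>x\<close> to \<open>y\<close> is a list of segments \<open>(e, s, t)\<close>, each running inside the closed edge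
  \<open>e\<close> from the parameter \<open>s\<close> to the parameter \<open>t\<close> (in either direction), such that consecutive
  segments meet in the quotient.\<close>

fun is_path :: "('e \<times> real) set \<Rightarrow> ('e \<times> real \<times> real) list \<Rightarrow> ('e \<times> real) set \<Rightarrow> bool" where
  "is_path x [] y \<longleftrightarrow> x = y"
| "is_path x ((e, s, t) # p) y \<longleftrightarrow>
     e \<in> arcs G \<and> s \<in> {0..len e} \<and> t \<in> {0..len e} \<and> quot (e, s) = x \<and> is_path (quot (e, t)) p y"

definition path_length :: "('e \<times> real \<times> real) list \<Rightarrow> real" where
  "path_length p = (\<Sum>(e, s, t) \<leftarrow> p. \<bar>t - s\<bar>)"

definition graph_dist :: "('e \<times> real) set \<Rightarrow> ('e \<times> real) set \<Rightarrow> real" where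
  "graph_dist x y =
     (if x \<in> graph_points \<and> y \<in> graph_points then INF p \<in> {p. is_path x p y}. path_length p else 0)"

definition graph_topology :: "('e \<times> real) set topology" where
  "graph_topology = Metric_space.mtopology graph_points graph_dist"

definition graph_borel :: "('e \<times> real) set measure" where
  "graph_borel = borel_measure_space graph_topology"

definition edge_borel :: "('e \<times> real) measure" where
  "edge_borel = borel_measure_space closed_edges"

section \<open>Wasserstein distance\<close>

definition prob_measures :: "('e \<times> real) set measure set" where
  "prob_measures = space (prob_algebra graph_borel)"

definition couplings ::
  "('e \<times> real) set measure \<Rightarrow> ('e \<times> real) set measure \<Rightarrow>
   (('e \<times> real) set \<times> ('e \<times> real) set) measure set" where
  "couplings \<mu> \<nu> = {\<sigma> \<in> space (prob_algebra (graph_borel \<Otimes>\<^sub>M graph_borel)).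
     distr \<sigma> graph_borel fst = \<mu> \<and> distr \<sigma> graph_borel snd = \<nu>}"

definition W2_squared :: "('e \<times> real) set measure \<Rightarrow> ('e \<times> real) set measure \<Rightarrow> ennreal" where
  "W2_squared \<mu> \<nu> = (INF \<sigma> \<in> couplings \<mu> \<nu>. \<integral>\<^sup>+(x, y). ennreal ((graph_dist x y)\<^sup>2) \<partial>\<sigma>)"

section \<open>Continuity equation\<close>

definition grad :: "('e \<times> real \<Rightarrow> real) \<Rightarrow> 'e \<times> real \<Rightarrow> real" where
  "grad f = (\<lambda>(e, s). vector_derivative (\<lambda>r. f (e, r)) (at s within {0..len e}))"

definition C1_edges :: "('e \<times> real \<Rightarrow> real) set" where
  "C1_edges = {f. \<forall>e \<in> arcs G.
     (\<lambda>r. f (e, r)) differentiable_on {0..len e} \<and>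
     continuous_on {0..len e} (\<lambda>r. grad f (e, r))}"

definition test_functions :: "(('e \<times> real) set \<Rightarrow> real) set" where
  "test_functions = {\<psi>. continuous_map graph_topology euclideanreal \<psi> \<and> \<psi> \<circ> quot \<in> C1_edges}"

definition weak_solution ::
  "real \<Rightarrow> (real \<Rightarrow> ('e \<times> real) set measure) \<Rightarrow> (real \<Rightarrow> ('e \<times> real) set \<Rightarrow> real) \<Rightarrow> bool" where
  "weak_solution T \<mu> J \<longleftrightarrow>
     (\<forall>t \<in> {0<..<T}. \<mu> t \<in> prob_measures \<and> signed_measure edge_borel (J t)) \<and>
     (\<forall>A \<in> sets graph_borel.
        (\<lambda>t. measure (\<mu> t) A) \<in> borel_measurable (restrict_space borel {0<..<T})) \<and>
     (\<forall>A \<in> sets edge_borel.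
        (\<lambda>t. J t A) \<in> borel_measurable (restrict_space borel {0<..<T})) \<and>
     (\<forall>\<psi> \<in> test_functions. absolutely_continuous_on {0<..<T} (\<lambda>t. \<integral>x. \<psi> x \<partial>\<mu> t)) \<and>
     (\<integral>\<^sup>+t \<in> {0<..<T}. total_variation edge_borel (J t) (space edge_borel) \<partial>lborel) < \<infinity> \<and>
     (\<forall>\<psi> \<in> test_functions. AE t in lborel. t \<in> {0<..<T} \<longrightarrow>
        ((\<lambda>s. \<integral>x. \<psi> x \<partial>\<mu> s) has_real_derivative
           signed_integral edge_borel (J t) (grad (\<psi> \<circ> quot))) (at t))"

text \<open>The space is compact, so weak continuity may be tested with all continuous functions.\<close>

definition weakly_continuous_on :: "real set \<Rightarrow> (real \<Rightarrow> ('e \<times> real) set measure) \<Rightarrow> bool" where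
  "weakly_continuous_on S \<mu> \<longleftrightarrow>
     (\<forall>t \<in> S. \<mu> t \<in> prob_measures) \<and>
     (\<forall>\<phi>. continuous_map graph_topology euclideanreal \<phi> \<longrightarrow>
        continuous_on S (\<lambda>t. \<integral>x. \<phi> x \<partial>\<mu> t))"

definition weak_solution_closed ::
  "real \<Rightarrow> (real \<Rightarrow> ('e \<times> real) set measure) \<Rightarrow> (real \<Rightarrow> ('e \<times> real) set \<Rightarrow> real) \<Rightarrow> bool" where
  "weak_solution_closed T \<mu> J \<longleftrightarrow> weak_solution T \<mu> J \<and> weakly_continuous_on {0..T} \<mu>"

text \<open>The signed measure \<open>v \<mu>\<close> on the closed edges; \<^const>\<open>quot\<close> is injective on the open edges.\<close>

definition flux :: "(('e \<times> real) set \<Rightarrow> real) \<Rightarrow> ('e \<times> real) set measure \<Rightarrow> ('e \<times> real) set \<Rightarrow> real" where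
  "flux v \<mu> A = (LINT x : quot ` (A \<inter> open_edges) | \<mu>. v x)"

definition action ::
  "(real \<Rightarrow> ('e \<times> real) set measure) \<Rightarrow> (real \<Rightarrow> ('e \<times> real) set \<Rightarrow> real) \<Rightarrow> ennreal" where
  "action \<mu> v =
     (\<integral>\<^sup>+t \<in> {0<..<1}. (\<integral>\<^sup>+x \<in> quot ` open_edges. ennreal (\<bar>v t x\<bar>\<^sup>2) \<partial>\<mu> t) \<partial>lborel)"

definition admissible ::
  "('e \<times> real) set measure \<Rightarrow> ('e \<times> real) set measure \<Rightarrow>
   ((real \<Rightarrow> ('e \<times> real) set measure) \<times> (real \<Rightarrow> ('e \<times> real) set \<Rightarrow> real)) set" where
  "admissible \<mu>0 \<mu>1 = {(\<mu>, v).
     (\<forall>t \<in> {0<..<1}. v t \<in> L2 (\<mu> t)) \<and>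
     weak_solution_closed 1 \<mu> (\<lambda>t. flux (v t) (\<mu> t)) \<and>
     \<mu> 0 = \<mu>0 \<and> \<mu> 1 = \<mu>1}"

end

end

theory Submission
  imports Defs
begin

text \<open>Lower bound: by finite transport duality on a partition into small cells, the transport cost is, up to a
  small error, a supremum of \<open>\<integral>\<psi> d\<nu> - \<integral>\<phi> d\<mu>\<close> over potentials with \<open>\<psi> j - \<phi> i \<le> d(y i, y j)\<^sup>2\<close>, where \<open>y i\<close> is a
  point of cell \<open>i\<close>. The Hopf--Lax evolution of \<open>\<phi> / 2\<close> stays above \<open>\<psi> / 2\<close> at time 1. Smoothed into admissible
  test functions \<open>u\<close> with \<open>\<partial>\<^sub>t u + |\<nabla>u|\<^sup>2 / 2 \<le> 0\<close>, it can be inserted into the continuity equation, and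
  \<open>\<nabla>u v - |\<nabla>u|\<^sup>2 / 2 \<le> v\<^sup>2 / 2\<close> bounds the dual value by the action.

  Attainment: mass is transported according to an optimal coupling along measurably selected constant-speed
  geodesics. The velocity field at time \<open>t\<close> is the conditional expectation of the speed given the position, so
  that its action is at most the transport cost by Jensen's inequality.\<close>

section \<open>Absolutely continuous functions\<close>

text \<open>Hopf--Lax evolutions are only Lipschitz, whereas test functions must be C1 on every
  closed edge and continuous across vertices, where convolution has no meaning. Hence distances are
  smoothed edge by edge by Bernstein polynomials, which keep endpoint values and slope bounds, and
  the minimum becomes a soft minimum; the Hamilton--Jacobi equation survives as an inequality in the
  useful direction. The null set of times excluded in the continuity equation depends on the test
  function, so a moving \<open>u\<close> cannot be inserted directly: it is frozen on short
  intervals, whose errors add up to a small multiple of the total length. The inner integral of the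
  action is not known to be measurable in time, so every estimate passes through measurable
  minorants of it. For attainment, an optimal coupling comes from weak compactness, carried to the
  real line because the graph is a quotient whose points are sets and not a type with a topology.
  Geodesics can be selected measurably because each pair of points is joined by a shortest path
  among at most five explicit routes.\<close>

lemma absolutely_continuous_fundamental_theorem:
  fixes f g :: "real \<Rightarrow> real"
  assumes ac: "absolutely_continuous_on S f" and ab: "a \<le> b" "{a..b} \<subseteq> S"
    and der: "AE t in lborel. t \<in> S \<longrightarrow> (f has_real_derivative g t) (at t)"
  shows "(g has_integral (f b - f a)) {a..b}"
proof -
  have "AE t in lebesgue. t \<in> S \<longrightarrow> (f has_real_derivative g t) (at t)"
    using der by (rule AE_completion)
  then obtain N where N: "{t \<in> space lebesgue. \<not> (t \<in> S \<longrightarrow> (f has_real_derivative g t) (at t))} \<subseteq> N"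
      "emeasure lebesgue N = 0" "N \<in> sets lebesgue"
    by (auto elim: AE_E)
  have negN: "negligible N"
    using N by (auto simp: negligible_iff_null_sets)
  have dN: "(f has_real_derivative g t) (at t)" if "t \<in> S" "t \<notin> N" for t
    using N(1) that by auto
  \<comment> \<open>A gauge integral does not see changes on a null set. With the value 0 on
    \<open>N\<close>, a tag in \<open>N\<close> contributes only an increment of \<open>f\<close>.
    These increments are controlled by absolute continuity, the tags outside \<open>N\<close> by
    differentiability.\<close>
  define h where "h t = (if t \<in> N then 0 else g t)" for t
  have "(h has_integral (f b - f a)) {a..b}"
    unfolding has_integral_factor_content_real
  proof (intro allI impI)
    fix e :: real assume e: "e > 0"
    show "\<exists>d. gauge d \<and> (\<forall>p. p tagged_division_of {a..b} \<and> d fine p \<longrightarrow>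
            norm (sum (\<lambda>(x,k). measure lborel k *\<^sub>R h x) p - (f b - f a)) \<le> e * measure lborel {a..b})"
    proof (cases "a = b")
      case True
      have "sum (\<lambda>(x,k). measure lborel k *\<^sub>R h x) p = 0" if p: "p tagged_division_of {a..b}" for p
      proof (rule sum.neutral, safe)
        fix x k assume xk: "(x,k) \<in> p"
        then obtain u v where "k = cbox u v" "k \<subseteq> {a..b}"
          using tagged_division_ofD(3,4)[OF p xk] by blast
        then have "u \<in> {a..b} \<and> v \<in> {a..b}" if "u \<le> v"
          using that by (metis atLeastAtMost_iff cbox_interval order_refl subsetD)
        then have "v \<le> u" using True by force
        with \<open>k = cbox u v\<close> have "measure lborel k = 0" by (cases "u = v") auto
        then show "measure lborel k *\<^sub>R h x = 0" by simp
      qed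
      then show ?thesis using True
        by (intro exI[of _ "\<lambda>x. ball x 1"]) (auto simp: gauge_ball)
    next
      case False
      with ab have lt: "a < b" by simp
      \<comment> \<open>Half of the error budget \<open>e * (b - a)\<close>; the other half pays for
        the tags outside \<open>N\<close>.\<close>
      define e1 where "e1 = e * (b - a) / 2"
      have "e1 > 0" using e lt by (simp add: e1_def)
      with ac[unfolded absolutely_continuous_on_def] obtain \<delta> where \<delta>: "\<delta> > 0" and ac0:
        "\<forall>I. finite I \<longrightarrow> (\<forall>(a, b) \<in> I. a < b \<and> {a..b} \<subseteq> S) \<longrightarrow>
          disjoint_family_on (\<lambda>(a, b). {a<..<b}) I \<longrightarrow> (\<Sum>(a, b) \<in> I. b - a) < \<delta> \<longrightarrow>
          (\<Sum>(a, b) \<in> I. \<bar>f b - f a\<bar>) < e1"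
        by blast
      \<comment> \<open>The gauge will confine all intervals tagged in \<open>N\<close> to the open
        set \<open>U\<close>, so their total length stays below the threshold \<delta> of absolute
        continuity.\<close>
      obtain U where U: "open U" "N \<subseteq> U" "(U - N) \<in> lmeasurable" "emeasure lebesgue (U - N) < ennreal \<delta>"
        using sets_lebesgue_outer_open[OF N(3) \<delta>] by blast
      have Umeas: "U \<in> lmeasurable" "measure lebesgue U < \<delta>"
      proof -
        have NN: "N \<in> lmeasurable" "measure lebesgue N = 0"
          using negN by (auto simp: negligible_imp_measurable negligible_imp_measure0)
        have UU: "U = (U - N) \<union> N" using U(2) by blast
        show U1: "U \<in> lmeasurable"
          by (subst UU) (rule fmeasurable.Un[OF U(3) NN(1)])
        have "measure lebesgue (U - N) < \<delta>"
          using U(3,4) \<delta> by (simp add: emeasure_eq_measure2 ennreal_less_iff)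
        moreover have "measure lebesgue U = measure lebesgue (U - N)"
          using negN by (metis measure_Diff_null_set N(2,3) U1 fmeasurableD null_setsI)
        ultimately show "measure lebesgue U < \<delta>" by simp
      qed
      have "\<exists>d>0. (x \<in> N \<longrightarrow> ball x d \<subseteq> U) \<and> (x \<in> {a..b} - N \<longrightarrow>
         (\<forall>y. \<bar>y - x\<bar> < d \<longrightarrow> \<bar>f y - f x - g x * (y - x)\<bar> \<le> e / 2 * \<bar>y - x\<bar>))" for x
      proof (cases "x \<in> N")
        case True
        then show ?thesis using U(1,2) by (metis DiffD2 openE subsetD)
      next
        case nN: False
        show ?thesis
        proof (cases "x \<in> {a..b}")
          case True
          then have "(f has_derivative (*) (g x)) (at x)"
            using dN[of x] nN ab(2) by (auto simp: has_field_derivative_def)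
          then have "\<forall>e>0. \<exists>d>0. \<forall>y. norm (y - x) < d \<longrightarrow> norm (f y - f x - g x * (y - x)) \<le> e * norm (y - x)"
            unfolding has_derivative_at_alt by blast
          then obtain d where "d > 0" "\<forall>y. norm (y - x) < d \<longrightarrow> norm (f y - f x - g x * (y - x)) \<le> e/2 * norm (y - x)"
            using e half_gt_zero by blast
          then show ?thesis using nN by (intro exI[of _ d]) auto
        qed (use nN in \<open>auto intro: exI[of _ 1]\<close>)
      qed
      then obtain d where d: "\<And>x. d x > 0" "\<And>x. x \<in> N \<Longrightarrow> ball x (d x) \<subseteq> U"
        "\<And>x y. x \<in> {a..b} - N \<Longrightarrow> \<bar>y - x\<bar> < d x \<Longrightarrow> \<bar>f y - f x - g x * (y - x)\<bar> \<le> e / 2 * \<bar>y - x\<bar>"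
        by metis
      show ?thesis
      proof (intro exI conjI allI impI)
        show "gauge (\<lambda>x. ball x (d x))" using d(1) gauge_ball_dependent by blast
        fix p assume "p tagged_division_of {a..b} \<and> (\<lambda>x. ball x (d x)) fine p"
        then have p: "p tagged_division_of {a..b}" and fine: "(\<lambda>x. ball x (d x)) fine p" by auto
        have finp: "finite p" using p by blast
        have K: "\<exists>u v. k = {u..v} \<and> u \<le> v \<and> x \<in> {u..v} \<and> {u..v} \<subseteq> {a..b} \<and> {u..v} \<subseteq> ball x (d x)"
          if xk: "(x,k) \<in> p" for x k
        proof -
          obtain u v where "k = cbox u v" using tagged_division_ofD(4)[OF p xk] by blast
          moreover have "x \<in> k" "k \<subseteq> {a..b}" using tagged_division_ofD(2,3)[OF p xk] by auto
          moreover have "k \<subseteq> ball x (d x)" using fine xk by (auto simp: fine_def)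
          ultimately show ?thesis by (intro exI[of _ u] exI[of _ v]) auto
        qed
        define c where "c = (\<lambda>(x::real,k::real set). measure lborel k *\<^sub>R h x - (f (Sup k) - f (Inf k)))"
        have tot: "f b - f a = (\<Sum>(x,k)\<in>p. f (Sup k) - f (Inf k))" "b - a = (\<Sum>(x,k)\<in>p. Sup k - Inf k)"
          using additive_tagged_division_1[OF ab(1) p, of f] additive_tagged_division_1[OF ab(1) p, of "\<lambda>x. x"] by auto
        have "sum (\<lambda>(x,k). measure lborel k *\<^sub>R h x) p - (f b - f a) = sum c p"
          unfolding tot(1) c_def by (simp add: sum_subtractf case_prod_unfold)
        also have "\<dots> = (\<Sum>z\<in>{z\<in>p. fst z \<notin> N}. c z) + (\<Sum>z\<in>{z\<in>p. fst z \<in> N}. c z)"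
          by (subst sum.union_disjoint[symmetric]) (use finp in \<open>auto intro!: sum.cong\<close>)
        also have "norm \<dots> \<le> (e/2) * (b - a) + e1"
        proof (rule order_trans[OF norm_triangle_ineq add_mono])
          have "norm (\<Sum>z\<in>{z\<in>p. fst z \<notin> N}. c z) \<le> (\<Sum>z\<in>{z\<in>p. fst z \<notin> N}. e/2 * (case z of (x,k) \<Rightarrow> Sup k - Inf k))"
          proof (rule sum_norm_le, safe)
            fix x k assume xk: "(x,k) \<in> p" "fst (x,k) \<notin> N"
            obtain u v where uv: "k = {u..v}" "u \<le> v" "x \<in> {u..v}" "{u..v} \<subseteq> {a..b}" "{u..v} \<subseteq> ball x (d x)"
              using K[OF xk(1)] by blast
            have xN: "x \<in> {a..b} - N" using uv xk by auto
            have "u \<in> {u..v}" "v \<in> {u..v}" using uv by auto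
            then have "u \<in> ball x (d x)" "v \<in> ball x (d x)" using uv(5) by blast+
            then have "\<bar>u - x\<bar> < d x" "\<bar>v - x\<bar> < d x" by (auto simp: dist_real_def)
            then have 1: "\<bar>f u - f x - g x * (u - x)\<bar> \<le> e / 2 * (x - u)" "\<bar>f v - f x - g x * (v - x)\<bar> \<le> e / 2 * (v - x)"
              using d(3)[OF xN, of u] d(3)[OF xN, of v] uv(3) by auto
            have "c (x,k) = (v - u) * g x - (f v - f u)"
              using uv xN by (simp add: c_def h_def)
            also have "\<dots> = (f u - f x - g x * (u - x)) - (f v - f x - g x * (v - x))" by algebra
            finally have "norm (c (x,k)) \<le> e/2 * (x - u) + e/2 * (v - x)" using 1 unfolding real_norm_def abs_le_iff by linarith
            also have "\<dots> = e/2 * (v - u)" by (simp add: distrib_left[symmetric] del: times_divide_eq_left)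
            finally show "norm (c (x, k)) \<le> e / 2 * (Sup k - Inf k)" using uv by simp
          qed
          also have "\<dots> \<le> (\<Sum>z\<in>p. e/2 * (case z of (x,k) \<Rightarrow> Sup k - Inf k))"
          proof (rule sum_mono2[OF finp])
            fix z assume "z \<in> p - {z \<in> p. fst z \<notin> N}"
            then show "0 \<le> e/2 * (case z of (x,k) \<Rightarrow> Sup k - Inf k)"
              using K[of "fst z" "snd z"] e by (cases z) auto
          qed auto
          also have "\<dots> = (e/2) * (b - a)" by (simp add: tot(2) sum_distrib_left)
          finally show "norm (\<Sum>z\<in>{z\<in>p. fst z \<notin> N}. c z) \<le> (e/2) * (b - a)" .
        next
          \<comment> \<open>Degenerate intervals are dropped:
            \<open>absolutely_continuous_on\<close> speaks of a set of pairs \<open>a < b\<close>,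
            and only for nondegenerate intervals with disjoint interiors is the passage to pairs of
            endpoints injective.\<close>
          define Q where "Q = {z\<in>p. fst z \<in> N \<and> Inf (snd z) < Sup (snd z)}"
          define I where "I = (\<lambda>z. (Inf (snd z), Sup (snd z))) ` Q"
          have finQ: "finite Q" using finp by (auto simp: Q_def)
          have QK: "snd z = {Inf (snd z)..Sup (snd z)}" "{Inf (snd z)..Sup (snd z)} \<subseteq> {a..b}"
             "{Inf (snd z)..Sup (snd z)} \<subseteq> U" if "z \<in> Q" for z
            using K[of "fst z" "snd z"] d(2)[of "fst z"] that by (auto simp: Q_def)
          have intQ: "interior (snd z) \<inter> interior (snd w) = {}" if "z \<in> Q" "w \<in> Q" "z \<noteq> w" for z w
            using tagged_division_ofD(5)[OF p, of "fst z" "snd z" "fst w" "snd w"] that by (auto simp: Q_def)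
          have intQ': "{Inf (snd z)<..<Sup (snd z)} = interior (snd z)" if "z \<in> Q" for z
            using QK(1)[OF that] by (metis interior_atLeastAtMost_real)
          have disj: "{Inf (snd z)<..<Sup (snd z)} \<inter> {Inf (snd w)<..<Sup (snd w)} = {}" if "z \<in> Q" "w \<in> Q" "z \<noteq> w" for z w
            using intQ[OF that] intQ' that by simp
          have inj: "inj_on (\<lambda>z. (Inf (snd z), Sup (snd z))) Q"
          proof (rule inj_onI)
            fix z w assume zw: "z \<in> Q" "w \<in> Q" "(Inf (snd z), Sup (snd z)) = (Inf (snd w), Sup (snd w))"
            show "z = w"
            proof (rule ccontr)
              assume "z \<noteq> w"
              from disj[OF zw(1,2) this] zw(3) have "{Inf (snd z)<..<Sup (snd z)} = {}" by simp
              then show False using zw(1) by (simp add: Q_def)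
            qed
          qed
          have "(\<Sum>(a,b)\<in>I. \<bar>f b - f a\<bar>) < e1"
          proof (rule ac0[THEN spec, THEN mp, THEN mp, THEN mp, THEN mp])
            show "finite I" using finQ by (simp add: I_def)
            show "\<forall>(a, b)\<in>I. a < b \<and> {a..b} \<subseteq> S" using QK(2) ab(2) by (fastforce simp: I_def Q_def)
            show dj: "disjoint_family_on (\<lambda>(a, b). {a<..<b}) I"
              using disj by (fastforce simp: disjoint_family_on_def I_def)
            have "(\<Sum>(a,b)\<in>I. b - a) = (\<Sum>(a,b)\<in>I. measure lebesgue {a<..<b})"
              by (intro sum.cong) (auto simp: I_def Q_def)
            also have "\<dots> = measure lebesgue (\<Union>z\<in>I. (\<lambda>(a,b). {a<..<b}) z)"
              using dj finQ
              by (subst measure_UNION') (auto simp: I_def disjoint_family_on_def pairwise_def disjnt_def case_prod_unfold)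
            also have "\<dots> \<le> measure lebesgue U"
            proof (rule measure_mono_fmeasurable)
              show "(\<Union>z\<in>I. (\<lambda>(a,b). {a<..<b}) z) \<subseteq> U"
                using QK(3) unfolding I_def by force
              show "(\<Union>z\<in>I. (\<lambda>(a,b). {a<..<b}) z) \<in> sets lebesgue"
                using finQ by (intro sets.finite_UN) (auto simp: I_def)
            qed (rule Umeas)
            finally show "(\<Sum>(a,b)\<in>I. b - a) < \<delta>" using Umeas(2) by simp
          qed
          moreover have "(\<Sum>(a,b)\<in>I. \<bar>f b - f a\<bar>) = (\<Sum>z\<in>Q. norm (c z))"
            unfolding I_def by (subst sum.reindex[OF inj]) (auto simp: c_def h_def Q_def intro!: sum.cong)
          moreover have "(\<Sum>z\<in>{z\<in>p. fst z \<in> N}. c z) = (\<Sum>z\<in>Q. c z)"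
          proof (rule sum.mono_neutral_right)
            show "\<forall>i\<in>{z \<in> p. fst z \<in> N} - Q. c i = 0"
            proof
              fix z assume z: "z \<in> {z \<in> p. fst z \<in> N} - Q"
              then obtain u v where "snd z = {u..v}" "u \<le> v" using K[of "fst z" "snd z"] by auto
              with z have "Inf (snd z) = Sup (snd z)" by (auto simp: Q_def)
              then show "c z = 0" using z by (cases z) (auto simp: c_def h_def)
            qed
          qed (use finp in \<open>auto simp: Q_def\<close>)
          moreover note norm_sum[of c Q]
          ultimately show "norm (\<Sum>z\<in>{z\<in>p. fst z \<in> N}. c z) \<le> e1" by (metis order_le_less_trans less_imp_le)
        qed
        also have "\<dots> = e * measure lborel {a..b}" using lt by (simp add: e1_def field_simps)
        finally show "norm (sum (\<lambda>(x,k). measure lborel k *\<^sub>R h x) p - (f b - f a)) \<le> e * measure lborel {a..b}" .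
      qed
    qed
  qed
  then show ?thesis
    by (rule has_integral_spike[OF negN, rotated]) (auto simp: h_def)
qed

section \<open>Smooth approximation of Lipschitz functions\<close>

text \<open>The product rule gives two terms, and the absorption identities for binomial
  coefficients turn each into \<open>Suc n\<close> times a Bernstein polynomial of degree
  \<open>n\<close>. The index \<open>k\<close> is unrestricted because the polynomials with index
  above the degree vanish.\<close>

lemma Bernstein_derivative:
  "((\<lambda>x. Bernstein (Suc n) k x) has_real_derivative
     real (Suc n) * ((case k of 0 \<Rightarrow> 0 | Suc j \<Rightarrow> Bernstein n j x) - Bernstein n k x)) (at x)"
proof -
  have 1: "((\<lambda>x. real (Suc n choose k) * x ^ k * (1 - x) ^ (Suc n - k)) has_real_derivative
     real (Suc n choose k) * (real k * x ^ (k - 1)) * (1 - x) ^ (Suc n - k)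
     - real (Suc n choose k) * x ^ k * (real (Suc n - k) * (1 - x) ^ (Suc n - k - 1))) (at x)"
    by (rule derivative_eq_intros refl | simp)+
  have 2: "real (Suc n choose k) * (real k * x ^ (k - 1)) * (1 - x) ^ (Suc n - k) =
      real (Suc n) * (case k of 0 \<Rightarrow> 0 | Suc j \<Rightarrow> Bernstein n j x)"
  proof (cases k)
    case (Suc j)
    have "(Suc n choose Suc j) * Suc j = Suc n * (n choose j)"
      by (metis Suc_times_binomial mult.commute)
    then have "real (Suc n choose Suc j) * real (Suc j) = real (Suc n) * real (n choose j)"
      by (simp only: of_nat_mult[symmetric] of_nat_eq_iff)
    then show ?thesis unfolding Suc Bernstein_def by (simp del: binomial_Suc_Suc of_nat_Suc)
  qed simp
  have 3: "real (Suc n choose k) * x ^ k * (real (Suc n - k) * (1 - x) ^ (Suc n - k - 1)) =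
      real (Suc n) * Bernstein n k x"
  proof (cases "k \<le> n")
    case True
    have "(Suc n choose k) * (Suc n - k) = Suc n * (n choose k)"
      by (metis True binomial_absorb_comp diff_Suc_1 mult.commute)
    then have "real (Suc n choose k) * real (Suc n - k) = real (Suc n) * real (n choose k)"
      by (simp only: of_nat_mult[symmetric] of_nat_eq_iff)
    moreover have "Suc n - k - 1 = n - k" by simp
    ultimately show ?thesis by (simp only: Bernstein_def mult.assoc[symmetric]) (simp only: mult_ac)
  next
    case False
    then show ?thesis by (simp add: Bernstein_def binomial_eq_0)
  qed
  show ?thesis
    using 1 unfolding 2 3 right_diff_distrib by (simp only: Bernstein_def)
qed

definition bernstein_poly :: "nat \<Rightarrow> (real \<Rightarrow> real) \<Rightarrow> real \<Rightarrow> real" where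
  "bernstein_poly n f x = (\<Sum>k\<le>n. f (k / n) * Bernstein n k x)"

text \<open>Summation by parts: the derivative is an average of difference quotients of
  \<open>f\<close> on the grid of mesh \<open>1 / Suc n\<close>, weighted by Bernstein polynomials.
  This is why a Lipschitz bound on \<open>f\<close> passes to the derivative.\<close>

lemma bernstein_poly_derivative:
  "(bernstein_poly (Suc n) f has_real_derivative
     (\<Sum>k\<le>n. real (Suc n) * (f (real (Suc k) / real (Suc n)) - f (real k / real (Suc n))) * Bernstein n k x)) (at x)"
proof -
  define N where "N = real (Suc n)"
  have "(\<Sum>k\<le>Suc n. f (k / N) * (N * ((case k of 0 \<Rightarrow> 0 | Suc j \<Rightarrow> Bernstein n j x) - Bernstein n k x)))
     = (\<Sum>k\<le>Suc n. f (k / N) * (N * (case k of 0 \<Rightarrow> 0 | Suc j \<Rightarrow> Bernstein n j x))) - (\<Sum>k\<le>Suc n. f (k / N) * (N * Bernstein n k x))"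
    by (simp add: sum_subtractf algebra_simps del: sum.atMost_Suc)
  also have "(\<Sum>k\<le>Suc n. f (k / N) * (N * (case k of 0 \<Rightarrow> 0 | Suc j \<Rightarrow> Bernstein n j x))) = (\<Sum>k\<le>n. f (Suc k / N) * (N * Bernstein n k x))"
    by (simp only: sum.atMost_Suc_shift) simp
  also have "(\<Sum>k\<le>Suc n. f (k / N) * (N * Bernstein n k x)) = (\<Sum>k\<le>n. f (k / N) * (N * Bernstein n k x))"
    by (simp add: Bernstein_def)
  also have "(\<Sum>k\<le>n. f (Suc k / N) * (N * Bernstein n k x)) - (\<Sum>k\<le>n. f (k / N) * (N * Bernstein n k x))
     = (\<Sum>k\<le>n. N * (f (Suc k / N) - f (k / N)) * Bernstein n k x)"
    by (simp add: sum_subtractf[symmetric] algebra_simps)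
  finally have eq: "(\<Sum>k\<le>Suc n. f (k / N) * (N * ((case k of 0 \<Rightarrow> 0 | Suc j \<Rightarrow> Bernstein n j x) - Bernstein n k x)))
     = (\<Sum>k\<le>n. N * (f (Suc k / N) - f (k / N)) * Bernstein n k x)" .
  show ?thesis
    unfolding bernstein_poly_def[abs_def] N_def[symmetric] eq[symmetric]
    unfolding N_def
    by (intro DERIV_sum DERIV_cmult Bernstein_derivative)
qed

lemma bernstein_poly_endpoints:
  "bernstein_poly (Suc n) f 0 = f 0" "bernstein_poly (Suc n) f 1 = f 1"
proof -
  have "bernstein_poly (Suc n) f 0 = (\<Sum>k\<le>Suc n. if k = 0 then f 0 else 0)"
    unfolding bernstein_poly_def by (intro sum.cong) (auto simp: Bernstein_def)
  then show "bernstein_poly (Suc n) f 0 = f 0" by (simp del: sum.atMost_Suc)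
  have "bernstein_poly (Suc n) f 1 = (\<Sum>k\<le>Suc n. if k = Suc n then f 1 else 0)"
    unfolding bernstein_poly_def by (intro sum.cong) (auto simp: Bernstein_def)
  then show "bernstein_poly (Suc n) f 1 = f 1" by (simp del: sum.atMost_Suc)
qed

text \<open>Endpoint values must be kept exactly, so that approximants on different edges fit
  together at the vertices. Bernstein polynomials interpolate at both ends and do not increase the
  Lipschitz constant.\<close>

lemma C1_approximation_fixing_endpoints:
  fixes f :: "real \<Rightarrow> real"
  assumes "0 < l" "0 < \<beta>" and lip: "\<And>x y. x \<in> {0..l} \<Longrightarrow> y \<in> {0..l} \<Longrightarrow> \<bar>f x - f y\<bar> \<le> \<bar>x - y\<bar>"
  obtains g g' where "\<And>x. (g has_real_derivative g' x) (at x)" "continuous_on UNIV g'"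
    "\<And>x. x \<in> {0..l} \<Longrightarrow> \<bar>g' x\<bar> \<le> 1" "\<And>x. x \<in> {0..l} \<Longrightarrow> \<bar>g x - f x\<bar> \<le> \<beta>"
    "g 0 = f 0" "g l = f l"
proof -
  define F where "F x = f (l * x)" for x
  have lipF: "\<bar>F x - F y\<bar> \<le> l * \<bar>x - y\<bar>" if "x \<in> {0..1}" "y \<in> {0..1}" for x y
  proof -
    have "\<bar>F x - F y\<bar> \<le> \<bar>l * x - l * y\<bar>"
      unfolding F_def using that assms(1) by (intro lip) (auto simp: mult_left_le)
    also have "\<dots> = l * \<bar>x - y\<bar>" using assms(1) by (simp add: abs_mult flip: right_diff_distrib)
    finally show ?thesis .
  qed
  have "l-lipschitz_on {0..1} F"
    using lipF assms(1) by (intro lipschitz_onI) (auto simp: dist_real_def)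
  then have "continuous_on {0..1} F" by (rule lipschitz_on_continuous_on)
  from Bernstein_Weierstrass[OF this \<open>0 < \<beta>\<close>] obtain N where
    N: "\<And>n x. N \<le> n \<Longrightarrow> x \<in> {0..1} \<Longrightarrow> \<bar>F x - (\<Sum>k\<le>n. F(k/n) * Bernstein n k x)\<bar> < \<beta>" by blast
  define D where "D x = (\<Sum>k\<le>N. real (Suc N) * (F (real (Suc k) / real (Suc N)) - F (real k / real (Suc N))) * Bernstein N k x)" for x
  define g where "g x = bernstein_poly (Suc N) F (x / l)" for x
  define g' where "g' x = D (x / l) / l" for x
  show thesis
  proof (rule that[of g g'])
    fix x
    show "(g has_real_derivative g' x) (at x)"
    proof -
      have "((\<lambda>x. x / l) has_real_derivative 1 / l) (at x)"
        by (rule DERIV_cdivide[OF DERIV_ident])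
      from DERIV_chain2[OF bernstein_poly_derivative this] show ?thesis
        unfolding g_def g'_def D_def by simp
    qed
  next
    show "continuous_on UNIV g'"
      unfolding g'_def D_def Bernstein_def by (intro continuous_intros) (use assms in auto)
  next
    fix x assume x: "x \<in> {0..l}"
    then have xl: "x / l \<in> {0..1}" using assms(1) by auto
    have "\<bar>D (x/l)\<bar> \<le> (\<Sum>k\<le>N. \<bar>real (Suc N) * (F (real (Suc k) / real (Suc N)) - F (real k / real (Suc N))) * Bernstein N k (x/l)\<bar>)"
      unfolding D_def by (rule sum_abs)
    also have "\<dots> \<le> (\<Sum>k\<le>N. l * Bernstein N k (x/l))"
    proof (rule sum_mono)
      fix k assume "k \<in> {..N}"
      then have "\<bar>F (real (Suc k) / real (Suc N)) - F (real k / real (Suc N))\<bar> \<le> l * \<bar>real (Suc k) / real (Suc N) - real k / real (Suc N)\<bar>"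
        by (intro lipF) auto
      also have "\<dots> = l / real (Suc N)" by (simp add: diff_divide_distrib[symmetric])
      finally have "real (Suc N) * \<bar>F (real (Suc k) / real (Suc N)) - F (real k / real (Suc N))\<bar> \<le> l"
        by (simp add: field_simps)
      moreover have "0 \<le> Bernstein N k (x/l)" using xl by (intro Bernstein_nonneg) auto
      ultimately show "\<bar>real (Suc N) * (F (real (Suc k) / real (Suc N)) - F (real k / real (Suc N))) * Bernstein N k (x/l)\<bar> \<le> l * Bernstein N k (x/l)"
        by (simp add: abs_mult mult_right_mono)
    qed
    also have "\<dots> = l" by (simp add: sum_distrib_left[symmetric])
    finally show "\<bar>g' x\<bar> \<le> 1" using assms(1) by (simp add: g'_def)
    have "\<bar>F (x/l) - g x\<bar> < \<beta>"
      unfolding g_def bernstein_poly_def using xl by (intro N) auto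
    then show "\<bar>g x - f x\<bar> \<le> \<beta>" using assms(1) by (simp add: F_def)
  next
    show "g 0 = f 0" "g l = f l" using assms(1) by (simp_all add: g_def bernstein_poly_endpoints F_def)
  qed
qed

section \<open>Finite transport duality\<close>

text \<open>The first-order condition at a one-sided minimum: \<open>h * x + h\<^sup>2 * y\<close>
  is the increment of a quadratic functional along an admissible direction.\<close>

lemma nonneg_of_linear_plus_quadratic:
  fixes x y d :: real
  assumes "0 < d" and "\<And>h. 0 < h \<Longrightarrow> h \<le> d \<Longrightarrow> 0 \<le> h * x + h\<^sup>2 * y"
  shows "0 \<le> x"
proof (rule ccontr)
  assume "\<not> 0 \<le> x"
  \<comment> \<open>At this \<open>h\<close> the quadratic term is at most half of the linear one in
    size.\<close>
  define h where "h = min d (- x / (2 * (\<bar>y\<bar> + 1)))"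
  have h: "0 < h" "h \<le> d" using assms(1) \<open>\<not> 0 \<le> x\<close> by (auto simp: h_def field_simps)
  have "h * (\<bar>y\<bar> + 1) \<le> - x / 2"
  proof -
    have "h \<le> - x / (2 * (\<bar>y\<bar> + 1))" by (simp add: h_def)
    then have "h * (\<bar>y\<bar> + 1) \<le> - x / (2 * (\<bar>y\<bar> + 1)) * (\<bar>y\<bar> + 1)" by (intro mult_right_mono) auto
    also have "\<dots> = - x / 2" by (simp add: field_simps)
    finally show ?thesis .
  qed
  moreover have "h * y \<le> h * (\<bar>y\<bar> + 1)" using h(1) by (intro mult_left_mono) auto
  ultimately have "x + h * y < 0" using \<open>\<not> 0 \<le> x\<close> by linarith
  then have "h * (x + h * y) < 0" using h(1) by (simp add: mult_pos_neg)
  moreover have "h * (x + h * y) = h * x + h\<^sup>2 * y" by (simp add: algebra_simps power2_eq_square)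
  ultimately show False using assms(2)[OF h] by linarith
qed

text \<open>The dual certificate is the residual of a minimizer of a quadratic penalty functional.\<close>

lemma finite_transport_duality:
  fixes a b :: "'i \<Rightarrow> real" and c :: "'i \<Rightarrow> 'i \<Rightarrow> real"
  assumes fin: "finite I"
    and a: "\<And>i. i \<in> I \<Longrightarrow> 0 \<le> a i" "sum a I = 1" and b: "\<And>i. i \<in> I \<Longrightarrow> 0 \<le> b i" "sum b I = 1"
    and c: "\<And>i j. i \<in> I \<Longrightarrow> j \<in> I \<Longrightarrow> 0 \<le> c i j"
    and dual: "\<And>\<phi> \<psi>. (\<And>i j. i \<in> I \<Longrightarrow> j \<in> I \<Longrightarrow> \<psi> j - \<phi> i \<le> c i j) \<Longrightarrow>
      (\<Sum>j\<in>I. \<psi> j * b j) - (\<Sum>i\<in>I. \<phi> i * a i) \<le> C"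
  obtains \<pi> where "\<And>i j. 0 \<le> \<pi> (i, j)" "\<And>i. i \<in> I \<Longrightarrow> (\<Sum>j\<in>I. \<pi> (i, j)) = a i"
    "\<And>j. j \<in> I \<Longrightarrow> (\<Sum>i\<in>I. \<pi> (i, j)) = b j" "(\<Sum>i\<in>I. \<Sum>j\<in>I. c i j * \<pi> (i, j)) \<le> C"
proof -
  have C: "0 \<le> C" using dual[of "\<lambda>_. 0" "\<lambda>_. 0"] c by simp
  define r where "r \<pi> i = (\<Sum>j\<in>I. \<pi> (i, j))" for \<pi> :: "'i \<times> 'i \<Rightarrow> real" and i
  define s where "s \<pi> j = (\<Sum>i\<in>I. \<pi> (i, j))" for \<pi> :: "'i \<times> 'i \<Rightarrow> real" and j
  define k where "k \<pi> = (\<Sum>i\<in>I. \<Sum>j\<in>I. c i j * \<pi> (i, j))" for \<pi> :: "'i \<times> 'i \<Rightarrow> real"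
  \<comment> \<open>The penalty vanishes exactly when \<pi> has both marginals and cost at most
    \<open>C\<close>. Half of its gradient with respect to entry (i, j) is
    \<open>\<phi> i - \<psi> j + l * c i j\<close>, built from the residuals defined below.\<close>
  define Q where "Q \<pi> = (\<Sum>i\<in>I. (r \<pi> i - a i)\<^sup>2) + (\<Sum>j\<in>I. (s \<pi> j - b j)\<^sup>2) + (max 0 (k \<pi> - C))\<^sup>2" for \<pi>
  \<comment> \<open>The bound 4 makes the domain compact and is not active at a minimizer: the
    penalty at the zero plan is at most 2, whereas an entry equal to 4 forces a row residual of at
    least 3 and a penalty of at least 9.\<close>
  define K :: "('i \<times> 'i \<Rightarrow> real) set" where "K = PiE UNIV (\<lambda>z. if z \<in> I \<times> I then {0..4} else {0})"
  have "compactin (product_topology (\<lambda>_. euclidean) UNIV) K"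
    unfolding K_def by (subst compactin_PiE) auto
  then have cK: "compact K" by (simp add: euclidean_product_topology)
  have "continuous_on K Q"
    unfolding Q_def r_def s_def k_def
    by (intro continuous_intros continuous_on_subset[OF continuous_on_product_coordinates]) auto
  moreover have "(\<lambda>_. 0) \<in> K" by (auto simp: K_def)
  ultimately obtain p where p: "p \<in> K" and pmin: "\<And>q. q \<in> K \<Longrightarrow> Q p \<le> Q q"
    using continuous_attains_inf[OF cK] by blast
  have pz: "p z \<in> (if z \<in> I \<times> I then {0..4} else {0})" for z
    using p unfolding K_def by (rule PiE_mem) simp
  have p0: "0 \<le> p z" for z using pz[of z] by (auto split: if_splits)
  have pout: "p z = 0" if "z \<notin> I \<times> I" for z using pz[of z] that by simp
  have p4: "p z \<le> 4" if "z \<in> I \<times> I" for z using pz[of z] that by simp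
  have KI: "q \<in> K" if "\<And>z. z \<in> I \<times> I \<Longrightarrow> 0 \<le> q z \<and> q z \<le> 4" "\<And>z. z \<notin> I \<times> I \<Longrightarrow> q z = 0" for q
    using that by (auto simp: K_def PiE_iff)
  have sq1: "(\<Sum>i\<in>I. (f i)\<^sup>2) \<le> 1" if "\<And>i. i \<in> I \<Longrightarrow> 0 \<le> f i" "sum f I = 1" for f :: "'i \<Rightarrow> real"
  proof -
    have "f i \<le> 1" if "i \<in> I" for i
      using member_le_sum[OF that _ fin, of f] \<open>\<And>i. i \<in> I \<Longrightarrow> 0 \<le> f i\<close> \<open>sum f I = 1\<close> by auto
    then have "(\<Sum>i\<in>I. (f i)\<^sup>2) \<le> (\<Sum>i\<in>I. f i)"
      using that(1) by (intro sum_mono) (auto simp: power2_eq_square mult_left_le)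
    then show ?thesis using that(2) by simp
  qed
  have "Q p \<le> Q (\<lambda>_. 0)" using pmin \<open>(\<lambda>_. 0) \<in> K\<close> by blast
  also have "\<dots> = (\<Sum>i\<in>I. (a i)\<^sup>2) + (\<Sum>i\<in>I. (b i)\<^sup>2)"
    using C by (simp add: Q_def r_def s_def k_def)
  finally have Q2: "Q p \<le> 2" using sq1[of a] sq1[of b] a b by force
  define \<phi> where "\<phi> i = r p i - a i" for i
  define \<psi> where "\<psi> j = b j - s p j" for j
  define l where "l = max 0 (k p - C)"
  have lt4: "p (i, j) < 4" if ij: "i \<in> I" "j \<in> I" for i j
  proof (rule ccontr)
    assume "\<not> p (i, j) < 4"
    moreover have "p (i, j) \<le> r p i"
      unfolding r_def using fin ij p0 by (intro member_le_sum[of j I "\<lambda>j. p (i, j)"]) auto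
    moreover have "a i \<le> 1"
      using member_le_sum[OF ij(1) _ fin, of a] a by auto
    ultimately have "3\<^sup>2 \<le> (r p i - a i)\<^sup>2" by (intro power_mono) auto
    also have "\<dots> \<le> (\<Sum>i\<in>I. (r p i - a i)\<^sup>2)"
      using fin ij by (intro member_le_sum[of i I "\<lambda>i. (r p i - a i)\<^sup>2"]) auto
    also have "\<dots> \<le> Q p" by (simp add: Q_def sum_nonneg)
    finally show False using Q2 by simp
  qed
  \<comment> \<open>Raising a single entry is possible because it lies strictly below 4. Minimality
    then gives the dual constraint for the cost multiplied by \<open>l\<close>.\<close>
  have feas: "\<psi> j - \<phi> i \<le> l * c i j" if ij: "i \<in> I" "j \<in> I" for i j
  proof -
    have "0 \<le> 2 * (\<phi> i - \<psi> j + l * c i j)"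
    proof (rule nonneg_of_linear_plus_quadratic[of "4 - p (i, j)"])
      show "0 < 4 - p (i, j)" using lt4[OF ij] by simp
      fix h :: real assume h: "0 < h" "h \<le> 4 - p (i, j)"
      define q where "q = p((i, j) := p (i, j) + h)"
      have rq: "r q i' = r p i' + (if i' = i then h else 0)" for i'
      proof -
        have "r q i' = (\<Sum>j'\<in>I. p (i', j') + (if j' = j then (if i' = i then h else 0) else 0))"
          unfolding r_def q_def by (intro sum.cong) auto
        then show ?thesis using fin ij by (simp add: sum.distrib r_def)
      qed
      have sq: "s q j' = s p j' + (if j' = j then h else 0)" for j'
      proof -
        have "s q j' = (\<Sum>i'\<in>I. p (i', j') + (if i' = i then (if j' = j then h else 0) else 0))"
          unfolding s_def q_def by (intro sum.cong) auto
        then show ?thesis using fin ij by (simp add: sum.distrib s_def)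
      qed
      have kq: "k q = k p + c i j * h"
      proof -
        have "k q = (\<Sum>i'\<in>I. (\<Sum>j'\<in>I. c i' j' * p (i', j') + (if j' = j then (if i' = i then c i j * h else 0) else 0)))"
          unfolding k_def q_def by (intro sum.cong) (auto simp: algebra_simps)
        then show ?thesis using fin ij by (simp add: sum.distrib k_def)
      qed
      have "q \<in> K" using p0 p4 pout h ij by (intro KI) (auto simp: q_def add_increasing)
      then have "Q p \<le> Q q" by (rule pmin)
      moreover have "(\<Sum>i'\<in>I. (r q i' - a i')\<^sup>2) = (\<Sum>i'\<in>I. (r p i' - a i')\<^sup>2) + (2 * h * \<phi> i + h\<^sup>2)"
      proof -
        have "(\<Sum>i'\<in>I. (r q i' - a i')\<^sup>2) = (\<Sum>i'\<in>I. (r p i' - a i')\<^sup>2 + (if i' = i then 2 * h * \<phi> i + h\<^sup>2 else 0))"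
          unfolding rq by (intro sum.cong) (auto simp: \<phi>_def power2_eq_square algebra_simps)
        then show ?thesis using fin ij by (simp add: sum.distrib)
      qed
      moreover have "(\<Sum>j'\<in>I. (s q j' - b j')\<^sup>2) = (\<Sum>j'\<in>I. (s p j' - b j')\<^sup>2) + (h\<^sup>2 - 2 * h * \<psi> j)"
      proof -
        have "(\<Sum>j'\<in>I. (s q j' - b j')\<^sup>2) = (\<Sum>j'\<in>I. (s p j' - b j')\<^sup>2 + (if j' = j then h\<^sup>2 - 2 * h * \<psi> j else 0))"
          unfolding sq by (intro sum.cong) (auto simp: \<psi>_def power2_eq_square algebra_simps)
        then show ?thesis using fin ij by (simp add: sum.distrib)
      qed
      moreover have "(max 0 (k q - C))\<^sup>2 \<le> (l + c i j * h)\<^sup>2"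
      proof (rule power_mono)
        have "0 \<le> c i j * h" using c[OF ij] h by simp
        then show "max 0 (k q - C) \<le> l + c i j * h" by (auto simp: l_def kq)
      qed simp
      moreover have "(l + c i j * h)\<^sup>2 = (max 0 (k p - C))\<^sup>2 + 2 * h * (l * c i j) + h\<^sup>2 * (c i j)\<^sup>2"
        unfolding l_def[symmetric] by (simp add: power2_eq_square algebra_simps)
      ultimately have "0 \<le> 2 * h * \<phi> i + h\<^sup>2 + (h\<^sup>2 - 2 * h * \<psi> j) + (2 * h * (l * c i j) + h\<^sup>2 * (c i j)\<^sup>2)"
        unfolding Q_def by linarith
      also have "\<dots> = h * (2 * (\<phi> i - \<psi> j + l * c i j)) + h\<^sup>2 * (2 + (c i j)\<^sup>2)"
        by (simp add: algebra_simps)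
      finally show "0 \<le> h * (2 * (\<phi> i - \<psi> j + l * c i j)) + h\<^sup>2 * (2 + (c i j)\<^sup>2)" .
    qed
    then show ?thesis by simp
  qed
  \<comment> \<open>Shrinking the whole plan towards 0 gives the complementary inequality: the
    pairing of the residuals with the plan itself is at most 0.\<close>
  have "0 \<le> - 2 * ((\<Sum>i\<in>I. \<phi> i * r p i) - (\<Sum>j\<in>I. \<psi> j * s p j) + l * k p)"
  proof (rule nonneg_of_linear_plus_quadratic[of 1])
    fix h :: real assume h: "0 < h" "h \<le> 1"
    define q where "q z = (1 - h) * p z" for z
    have rq: "r q i = r p i - h * r p i" for i by (simp add: r_def q_def sum_distrib_left sum_subtractf left_diff_distrib)
    have sq: "s q i = s p i - h * s p i" for i by (simp add: s_def q_def sum_distrib_left sum_subtractf left_diff_distrib)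
    have kq: "k q = k p - h * k p"
    proof -
      have "k q = (\<Sum>i\<in>I. \<Sum>j\<in>I. (1 - h) * (c i j * p (i, j)))" unfolding k_def q_def by (intro sum.cong) auto
      then show ?thesis by (simp add: k_def sum_distrib_left sum_subtractf left_diff_distrib)
    qed
    have "q \<in> K"
    proof (rule KI)
      fix z assume z: "z \<in> I \<times> I"
      have "(1 - h) * p z \<le> 1 * p z" using h p0 by (intro mult_right_mono) auto
      then show "0 \<le> q z \<and> q z \<le> 4" using h p0[of z] p4[OF z] by (auto simp: q_def)
    qed (simp add: q_def pout)
    then have "Q p \<le> Q q" by (rule pmin)
    moreover have "(\<Sum>i\<in>I. (r q i - a i)\<^sup>2) = (\<Sum>i\<in>I. (r p i - a i)\<^sup>2) - 2 * h * (\<Sum>i\<in>I. \<phi> i * r p i) + h\<^sup>2 * (\<Sum>i\<in>I. (r p i)\<^sup>2)"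
      unfolding rq \<phi>_def sum_distrib_left sum.distrib[symmetric] sum_subtractf[symmetric]
      by (intro sum.cong) (auto simp: power2_eq_square algebra_simps)
    moreover have "(\<Sum>i\<in>I. (s q i - b i)\<^sup>2) = (\<Sum>i\<in>I. (s p i - b i)\<^sup>2) + 2 * h * (\<Sum>i\<in>I. \<psi> i * s p i) + h\<^sup>2 * (\<Sum>i\<in>I. (s p i)\<^sup>2)"
      unfolding sq \<psi>_def sum_distrib_left sum.distrib[symmetric] sum_subtractf[symmetric]
      by (intro sum.cong) (auto simp: power2_eq_square algebra_simps)
    moreover have "(max 0 (k q - C))\<^sup>2 \<le> (l - h * k p)\<^sup>2"
    proof (cases "k q - C \<le> 0")
      case False
      have "0 \<le> k p" unfolding k_def using c p0 by (intro sum_nonneg mult_nonneg_nonneg) auto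
      then have "0 \<le> h * k p" using h by simp
      then show ?thesis using False by (simp add: l_def kq max_def algebra_simps)
    qed simp
    moreover have "(l - h * k p)\<^sup>2 = (max 0 (k p - C))\<^sup>2 - 2 * h * (l * k p) + h\<^sup>2 * (k p)\<^sup>2"
      unfolding l_def[symmetric] by (simp add: power2_eq_square algebra_simps)
    ultimately have "0 \<le> - 2 * h * (\<Sum>i\<in>I. \<phi> i * r p i) + h\<^sup>2 * (\<Sum>i\<in>I. (r p i)\<^sup>2)
       + (2 * h * (\<Sum>i\<in>I. \<psi> i * s p i) + h\<^sup>2 * (\<Sum>i\<in>I. (s p i)\<^sup>2)) + (- 2 * h * (l * k p) + h\<^sup>2 * (k p)\<^sup>2)"
      unfolding Q_def by linarith
    also have "\<dots> = h * (- 2 * ((\<Sum>i\<in>I. \<phi> i * r p i) - (\<Sum>j\<in>I. \<psi> j * s p j) + l * k p))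
       + h\<^sup>2 * ((\<Sum>i\<in>I. (r p i)\<^sup>2) + (\<Sum>i\<in>I. (s p i)\<^sup>2) + (k p)\<^sup>2)" by (simp add: algebra_simps)
    finally show "0 \<le> h * (- 2 * ((\<Sum>i\<in>I. \<phi> i * r p i) - (\<Sum>j\<in>I. \<psi> j * s p j) + l * k p))
       + h\<^sup>2 * ((\<Sum>i\<in>I. (r p i)\<^sup>2) + (\<Sum>i\<in>I. (s p i)\<^sup>2) + (k p)\<^sup>2)" .
  qed simp
  then have "(\<Sum>i\<in>I. \<phi> i * r p i) - (\<Sum>j\<in>I. \<psi> j * s p j) + l * k p \<le> 0" by simp
  moreover have "(\<Sum>i\<in>I. \<phi> i * r p i) = (\<Sum>i\<in>I. \<phi> i * a i) + (\<Sum>i\<in>I. (r p i - a i)\<^sup>2)"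
    unfolding sum.distrib[symmetric] by (intro sum.cong) (auto simp: \<phi>_def power2_eq_square algebra_simps)
  moreover have "(\<Sum>j\<in>I. \<psi> j * s p j) = (\<Sum>j\<in>I. \<psi> j * b j) - (\<Sum>j\<in>I. (s p j - b j)\<^sup>2)"
    unfolding sum_subtractf[symmetric] by (intro sum.cong) (auto simp: \<psi>_def power2_eq_square algebra_simps)
  moreover have "l * k p = l * C + (max 0 (k p - C))\<^sup>2"
    by (auto simp: l_def max_def power2_eq_square algebra_simps)
  \<comment> \<open>So the dual value of (\<phi>, \<psi>) exceeds \<open>l * C\<close> by at least
    the penalty.\<close>
  ultimately have QB: "Q p + l * C \<le> (\<Sum>j\<in>I. \<psi> j * b j) - (\<Sum>i\<in>I. \<phi> i * a i)"
    unfolding Q_def by linarith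
  have scaled: "t * ((\<Sum>j\<in>I. \<psi> j * b j) - (\<Sum>i\<in>I. \<phi> i * a i)) \<le> C" if t: "0 \<le> t" "t * l \<le> 1" for t
  proof -
    have "(\<Sum>j\<in>I. (t * \<psi> j) * b j) - (\<Sum>i\<in>I. (t * \<phi> i) * a i) \<le> C"
    proof (rule dual)
      fix i j assume ij: "i \<in> I" "j \<in> I"
      have "t * \<psi> j - t * \<phi> i \<le> t * (l * c i j)"
        using mult_left_mono[OF feas[OF ij] t(1)] by (simp add: algebra_simps)
      also have "\<dots> \<le> c i j" using mult_right_mono[OF t(2) c[OF ij]] by (simp add: mult.assoc)
      finally show "t * \<psi> j - t * \<phi> i \<le> c i j" .
    qed
    then show ?thesis by (simp add: sum_distrib_left algebra_simps)
  qed
  \<comment> \<open>The pair is feasible for the cost \<open>l * c\<close>. If \<open>l > 0\<close>,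
    dividing by \<open>l\<close> makes it feasible for \<open>c\<close>. If \<open>l = 0\<close>,
    all positive multiples are feasible, and a large one would violate the bound \<open>C\<close>
    unless the penalty is 0.\<close>
  have "Q p \<le> 0"
  proof (cases "l = 0")
    case True
    show ?thesis
    proof (rule ccontr)
      assume "\<not> Q p \<le> 0"
      then have "(C + 1) / Q p * Q p \<le> (C + 1) / Q p * ((\<Sum>j\<in>I. \<psi> j * b j) - (\<Sum>i\<in>I. \<phi> i * a i))"
        using QB True C by (intro mult_left_mono) auto
      also have "\<dots> \<le> C" using \<open>\<not> Q p \<le> 0\<close> C True by (intro scaled) auto
      finally show False using \<open>\<not> Q p \<le> 0\<close> by simp
    qed
  next
    case False
    then have l: "0 < l" by (simp add: l_def)
    have "(1 / l) * (Q p + l * C) \<le> (1 / l) * ((\<Sum>j\<in>I. \<psi> j * b j) - (\<Sum>i\<in>I. \<phi> i * a i))"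
      using QB l by (intro mult_left_mono) auto
    also have "\<dots> \<le> C" using l by (intro scaled) auto
    finally show ?thesis using l by (simp add: field_simps)
  qed
  moreover have "0 \<le> (\<Sum>i\<in>I. (r p i - a i)\<^sup>2)" "0 \<le> (\<Sum>j\<in>I. (s p j - b j)\<^sup>2)" "0 \<le> (max 0 (k p - C))\<^sup>2"
    by (auto intro: sum_nonneg)
  ultimately have "(\<Sum>i\<in>I. (r p i - a i)\<^sup>2) = 0" "(\<Sum>j\<in>I. (s p j - b j)\<^sup>2) = 0" "(max 0 (k p - C))\<^sup>2 = 0"
    unfolding Q_def by linarith+
  then have "\<And>i. i \<in> I \<Longrightarrow> r p i = a i" "\<And>j. j \<in> I \<Longrightarrow> s p j = b j" "k p \<le> C"
    using fin by (auto simp: sum_nonneg_eq_0_iff max_def split: if_splits)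
  then show thesis using p0 unfolding r_def s_def k_def by (intro that[of p]) auto
qed

section \<open>Weak compactness of probability measures on a compact set\<close>

text \<open>The membership pattern of a point in the sets \<open>B n\<close>, read as ternary digits
  0 and 2, that is, as a point of the Cantor set. Leaving out the digit 1 ensures that close codes
  share their leading digits.\<close>

definition ternary_code :: "(nat \<Rightarrow> 'a set) \<Rightarrow> 'a \<Rightarrow> real" where
  "ternary_code B z = (\<Sum>n. indicator (B n) z * (2 / 3 ^ Suc n))"

lemma sums_two_thirds: "(\<lambda>n. 2 / 3 ^ Suc (n + m)) sums (1 / 3 ^ m :: real)"
proof -
  have "(\<lambda>n. (2 / 3 ^ Suc m) * (1 / 3) ^ n) sums ((2 / 3 ^ Suc m) * (1 / (1 - 1/3)) :: real)"
    by (intro sums_mult geometric_sums) auto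
  then show ?thesis by (simp add: power_add power_one_over field_simps)
qed

lemma summable_ternary: "summable (\<lambda>n. indicator (B n) z * (2 / 3 ^ Suc n) :: real)"
  by (rule summable_comparison_test'[OF sums_summable[OF sums_two_thirds[of 0]], of 0])
     (auto simp: indicator_def)

lemma ternary_code_range: "ternary_code B z \<in> {0..1}"
proof -
  have "ternary_code B z \<le> (\<Sum>n. 2 / 3 ^ Suc (n + 0))"
    unfolding ternary_code_def
    by (intro suminf_le summable_ternary sums_summable[OF sums_two_thirds]) (auto simp: indicator_def)
  then have "ternary_code B z \<le> 1" using sums_unique[OF sums_two_thirds[of 0]] by simp
  moreover have "0 \<le> ternary_code B z"
    unfolding ternary_code_def by (intro suminf_nonneg summable_ternary) auto
  ultimately show ?thesis by simp
qed

text \<open>At the first index \<open>m\<close> where the patterns differ, the codes move apart by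
  \<open>2 / 3 ^ Suc m\<close>, and all later digits together can compensate at most half of
  that.\<close>

lemma ternary_code_close:
  assumes "\<bar>ternary_code B z - ternary_code B z'\<bar> < 1 / 3 ^ N" and "n < N"
  shows "z \<in> B n \<longleftrightarrow> z' \<in> B n"
proof (rule ccontr)
  assume neq: "\<not> ?thesis"
  define m where "m = (LEAST n. (z \<in> B n) \<noteq> (z' \<in> B n))"
  have m: "(z \<in> B m) \<noteq> (z' \<in> B m)" unfolding m_def using neq by (rule LeastI)
  have mN: "m < N" using Least_le[of "\<lambda>n. (z \<in> B n) \<noteq> (z' \<in> B n)" n] neq assms(2) by (simp add: m_def)
  define d where "d n = (indicator (B n) z - indicator (B n) z') * (2 / 3 ^ Suc n :: real)" for n
  have d0: "d i = 0" if "i < m" for i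
    using not_less_Least[of i "\<lambda>n. (z \<in> B n) \<noteq> (z' \<in> B n)"] that by (auto simp: d_def m_def indicator_def)
  have sd: "summable d" unfolding d_def left_diff_distrib by (intro summable_diff summable_ternary)
  have "ternary_code B z - ternary_code B z' = suminf d"
    unfolding ternary_code_def d_def left_diff_distrib by (intro suminf_diff summable_ternary)
  also have "\<dots> = (\<Sum>n. d (n + Suc m)) + sum d {..<Suc m}"
    by (rule suminf_split_initial_segment[OF sd])
  also have "sum d {..<Suc m} = d m" using d0 by simp
  finally have eq: "ternary_code B z - ternary_code B z' = (\<Sum>n. d (n + Suc m)) + d m" .
  have "norm (\<Sum>n. d (n + Suc m)) \<le> (\<Sum>n. 2 / 3 ^ Suc (n + Suc m))"
    by (rule norm_suminf_le[OF _ sums_summable[OF sums_two_thirds]]) (auto simp: d_def indicator_def)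
  also have "\<dots> = 1 / 3 ^ Suc m" using sums_unique[OF sums_two_thirds[of "Suc m"]] by simp
  finally have "\<bar>\<Sum>n. d (n + Suc m)\<bar> \<le> 1 / 3 ^ Suc m" by simp
  moreover have "\<bar>d m\<bar> = 2 * (1 / 3 ^ Suc m)" using m by (auto simp: d_def indicator_def)
  ultimately have "1 / 3 ^ Suc m \<le> \<bar>ternary_code B z - ternary_code B z'\<bar>" unfolding eq by linarith
  moreover have "(1::real) / 3 ^ N \<le> 1 / 3 ^ Suc m" using mN by (intro divide_left_mono power_increasing) auto
  ultimately show False using assms(1) by linarith
qed

text \<open>The sets are countably many balls containing a finite cover of \<open>K\<close> at every
  scale \<open>1 / Suc k\<close>. Agreement on the balls of one scale puts both points into a common
  ball.\<close>

lemma compact_coding: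
  fixes K :: "'a::metric_space set"
  assumes "compact K" "K \<noteq> {}"
  shows "\<exists>B :: nat \<Rightarrow> 'a set. (\<forall>n. open (B n)) \<and>
    (\<forall>\<epsilon>>0. \<exists>N. \<forall>z\<in>K. \<forall>z'\<in>K. (\<forall>n<N. z \<in> B n \<longleftrightarrow> z' \<in> B n) \<longrightarrow> dist z z' < \<epsilon>)"
proof -
  have "\<exists>T. finite T \<and> K \<subseteq> (\<Union>x\<in>T. ball x (1 / Suc k))" for k
    using assms(1) unfolding compact_eq_totally_bounded by simp
  then obtain T where T: "\<And>k. finite (T k)" "\<And>k. K \<subseteq> (\<Union>x\<in>T k. ball x (1 / Suc k))" by metis
  define F where "F = (\<Union>k. (\<lambda>x. ball x (1 / Suc k)) ` T k)"
  have cF: "countable F" unfolding F_def using T(1) by (intro countable_UN countable_image) (auto intro: countable_finite)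
  have neF: "F \<noteq> {}" using T(2)[of 0] assms(2) by (auto simp: F_def)
  define B where "B = from_nat_into F"
  show ?thesis
  proof (intro exI[of _ B] conjI allI impI)
    fix n show "open (B n)" using from_nat_into[OF neF, of n] by (auto simp: B_def F_def)
  next
    fix \<epsilon> :: real assume "0 < \<epsilon>"
    then obtain k where k: "2 / real (Suc k) < \<epsilon>"
      using reals_Archimedean[of "\<epsilon>/2"] by (auto simp: field_simps)
    have "\<exists>n. B n = ball x (1 / Suc k)" if "x \<in> T k" for x
      unfolding B_def using that by (intro from_nat_into_surj[OF cF]) (auto simp: F_def)
    then obtain i where i: "\<And>x. x \<in> T k \<Longrightarrow> B (i x) = ball x (1 / Suc k)" by metis
    define N where "N = Suc (Max (insert 0 (i ` T k)))"
    have iN: "i x < N" if "x \<in> T k" for x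
      using T(1)[of k] that by (auto simp: N_def less_Suc_eq_le intro!: Max_ge)
    show "\<exists>N. \<forall>z\<in>K. \<forall>z'\<in>K. (\<forall>n<N. z \<in> B n \<longleftrightarrow> z' \<in> B n) \<longrightarrow> dist z z' < \<epsilon>"
    proof (intro exI[of _ N] ballI impI)
      fix z z' assume z: "z \<in> K" "z' \<in> K" "\<forall>n<N. z \<in> B n \<longleftrightarrow> z' \<in> B n"
      obtain x where x: "x \<in> T k" "z \<in> ball x (1 / Suc k)" using T(2)[of k] z(1) by blast
      then have "z' \<in> ball x (1 / Suc k)" using z(3) iN[OF x(1)] i[OF x(1)] by blast
      with x(2) have "dist z z' < 1 / Suc k + 1 / Suc k"
        by (intro dist_triangle_less_add[of z x _ z']) (auto simp: dist_commute)
      then show "dist z z' < \<epsilon>" using k by simp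
    qed
  qed
qed

text \<open>A ternary code embeds \<open>K\<close> into the real line with an inverse that is uniformly continuous on the image;
  this reduces compactness to Helly's selection theorem.\<close>

lemma compact_probability_subsequence:
  fixes M :: "nat \<Rightarrow> 'a::{complete_space, second_countable_topology} measure"
  assumes K: "compact K" and M: "\<And>n. sets (M n) = sets borel" "\<And>n. prob_space (M n)"
    and MK: "\<And>n. AE x in M n. x \<in> K"
  obtains r N where "strict_mono (r :: nat \<Rightarrow> nat)" "prob_space N" "sets N = sets borel" "AE x in N. x \<in> K"
    "\<And>f :: 'a \<Rightarrow> real. continuous_on K f \<Longrightarrow> (\<lambda>n. LINT x:K|M (r n). f x) \<longlonglongrightarrow> (LINT x:K|N. f x)"
proof -
  have ne: "K \<noteq> {}"
  proof
    assume "K = {}"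
    then have "AE x in M 0. False" using MK[of 0] by simp
    then show False using prob_space.AE_False[OF M(2)[of 0]] by simp
  qed
  have Kc: "closed K" using K by (rule compact_imp_closed)
  have [measurable]: "K \<in> sets borel" using Kc by simp
  note [measurable_cong] = M(1)
  obtain B :: "nat \<Rightarrow> 'a set" where B0: "(\<forall>n. open (B n)) \<and>
    (\<forall>\<epsilon>>0. \<exists>N. \<forall>z\<in>K. \<forall>z'\<in>K. (\<forall>n<N. z \<in> B n \<longleftrightarrow> z' \<in> B n) \<longrightarrow> dist z z' < \<epsilon>)"
    using compact_coding[OF K ne] by (rule exE)
  note B = conjunct1[OF B0, rule_format] conjunct2[OF B0, rule_format]
  define s where "s = ternary_code B"
  have [measurable]: "B n \<in> sets borel" for n using B(1) by simp
  have sm[measurable]: "s \<in> borel_measurable borel"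
    unfolding s_def ternary_code_def[abs_def] by measurable
  have close: "\<exists>d>0. \<forall>z\<in>K. \<forall>z'\<in>K. \<bar>s z - s z'\<bar> < d \<longrightarrow> dist z z' < \<epsilon>" if \<epsilon>: "0 < \<epsilon>" for \<epsilon>
  proof -
    obtain N where "\<forall>z\<in>K. \<forall>z'\<in>K. (\<forall>n<N. z \<in> B n \<longleftrightarrow> z' \<in> B n) \<longrightarrow> dist z z' < \<epsilon>" using B(2)[OF \<epsilon>] by blast
    then show ?thesis
      using ternary_code_close[of B _ _ N] by (intro exI[of _ "1 / 3 ^ N"]) (auto simp: s_def)
  qed
  have inj: "inj_on s K"
  proof (rule inj_onI)
    fix x y assume "x \<in> K" "y \<in> K" "s x = s y"
    then have "dist x y < \<epsilon>" if "0 < \<epsilon>" for \<epsilon> using close[OF that] by auto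
    then show "x = y" by (metis dist_pos_lt less_irrefl)
  qed
  have uc: "uniformly_continuous_on (s ` K) (the_inv_into K s)"
    unfolding uniformly_continuous_on_def
    using close by (fastforce simp: the_inv_into_f_f[OF inj] dist_real_def)
  \<comment> \<open>The code \<open>s\<close> is Borel but in general not continuous, so its image
    need not be closed. The inverse is uniformly continuous and therefore extends to the closure
    \<open>C\<close>, where weak limits of the coded laws live.\<close>
  obtain g where g: "uniformly_continuous_on (closure (s ` K)) g"
    "\<And>x. x \<in> s ` K \<Longrightarrow> the_inv_into K s x = g x"
    by (rule uniformly_continuous_on_extension_on_closure[OF uc]) blast
  define C where "C = closure (s ` K)"
  have Cc: "closed C" and Cne: "C \<noteq> {}" using ne by (auto simp: C_def)
  have [measurable]: "C \<in> sets borel" using Cc by simp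
  have gs: "g (s x) = x" if "x \<in> K" for x using g(2)[of "s x"] that by (simp add: the_inv_into_f_f[OF inj])
  have gC: "continuous_on C g" using g(1) uniformly_continuous_imp_continuous by (auto simp: C_def)
  have gK: "g x \<in> K" if "x \<in> C" for x
  proof -
    have "g ` C \<subseteq> closure (g ` (s ` K))" using gC unfolding C_def by (rule continuous_image_closure_subset) auto
    also have "g ` (s ` K) = K" using gs by force
    finally show ?thesis using that Kc by auto
  qed
  obtain a0 where a0: "a0 \<in> K" using ne by blast
  \<comment> \<open>The value \<open>a0\<close> off \<open>C\<close> makes \<open>h\<close> a total
    Borel map into \<open>K\<close>; the limit law will not charge that region.\<close>
  define h where "h x = (if x \<in> C then g x else a0)" for x
  have hm[measurable]: "h \<in> borel_measurable borel"
    unfolding h_def[abs_def] by (rule borel_measurable_continuous_on_if[OF _ gC]) auto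
  define \<tau> where "\<tau> n = distr (M n) borel s" for n
  have rd: "real_distribution (\<tau> n)" for n
    unfolding \<tau>_def real_distribution_def real_distribution_axioms_def
    by (auto intro!: prob_space.prob_space_distr M(2))
  have tight: "tight \<tau>"
    unfolding tight_def
  proof (intro conjI allI impI rd)
    fix \<epsilon> :: real assume "0 < \<epsilon>"
    have "measure (\<tau> n) {-1<..2} = 1" for n
    proof -
      interpret prob_space "M n" by (rule M(2))
      have "s -` {-1<..2} \<inter> space (M n) = space (M n)"
      proof -
        have "-1 < s x \<and> s x \<le> 2" for x using ternary_code_range[of B x] by (simp add: s_def)
        then show ?thesis by auto
      qed
      then show ?thesis by (simp add: \<tau>_def measure_distr prob_space)
    qed
    then show "\<exists>a b::real. a < b \<and> (\<forall>n. measure (\<tau> n) {a<..b} > 1 - \<epsilon>)"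
      using \<open>0 < \<epsilon>\<close> by (intro exI[of _ "-1"] exI[of _ 2]) auto
  qed
  obtain r L where r: "strict_mono r" and L: "real_distribution L" and conv: "weak_conv_m (\<tau> \<circ> r) L"
    using tight_imp_convergent_subsubsequence[OF tight strict_mono_id] by (auto simp: o_def id_def)
  interpret L: real_distribution L by (rule L)
  have lim: "(\<lambda>n. \<integral>x. F (s x) \<partial>M (r n)) \<longlonglongrightarrow> (\<integral>x. F x \<partial>L)"
    if F: "continuous_on UNIV F" "\<And>x. \<bar>F x\<bar> \<le> b" for F :: "real \<Rightarrow> real" and b
  proof -
    have [measurable]: "F \<in> borel_measurable borel" using F(1) by (rule borel_measurable_continuous_onI)
    have "(\<lambda>n. integral\<^sup>L ((\<tau> \<circ> r) n) F) \<longlonglongrightarrow> integral\<^sup>L L F"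
      using F rd
      by (intro weak_conv_imp_integral_bdd_continuous_conv[OF _ L conv, where B = b]) (auto simp: continuous_on_eq_continuous_at)
    then show ?thesis by (simp add: \<tau>_def integral_distr)
  qed
  have LC: "AE x in L. x \<in> C"
  proof -
    \<comment> \<open>A bounded continuous function that vanishes exactly on \<open>C\<close>. Its
      integrals along the sequence are 0, hence so is its integral against the limit law.\<close>
    define F where "F x = min 1 (infdist x C)" for x :: real
    have F: "continuous_on UNIV F" "\<bar>F x\<bar> \<le> 1" for x
      unfolding F_def by (auto intro!: continuous_intros simp: infdist_nonneg)
    have [measurable]: "F \<in> borel_measurable borel" using F(1) by (rule borel_measurable_continuous_onI)
    have "(\<integral>x. F (s x) \<partial>M (r n)) = (\<integral>x. 0 \<partial>M (r n))" for n
    proof (rule integral_cong_AE)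
      show "AE x in M (r n). F (s x) = 0"
        using MK[of "r n"]
      proof eventually_elim
        case (elim x)
        then have "s x \<in> C" using closure_subset[of "s ` K"] by (auto simp: C_def)
        then show ?case by (simp add: F_def)
      qed
    qed auto
    then have "(\<integral>x. F x \<partial>L) = 0"
      using lim[OF F] LIMSEQ_unique[OF tendsto_const, of 0 "\<integral>x. F x \<partial>L"] by simp
    then have "AE x in L. F x = 0"
      using F(2) by (subst (asm) integral_nonneg_eq_0_iff_AE)
        (auto intro!: L.integrable_const_bound[of _ 1] simp: F_def infdist_nonneg)
    then show ?thesis
    proof eventually_elim
      case (elim x)
      then show ?case using Cc Cne by (auto simp: F_def min_def in_closed_iff_infdist_zero split: if_splits)
    qed
  qed
  show thesis
  proof (rule that[of r "distr L borel h"])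
    show "strict_mono r" by (rule r)
    show "prob_space (distr L borel h)" by (intro L.prob_space_distr) simp
    show "sets (distr L borel h) = sets borel" by simp
    show "AE x in distr L borel h. x \<in> K"
      using gK a0 by (subst AE_distr_iff) (auto simp: h_def)
    fix f :: "'a \<Rightarrow> real" assume f: "continuous_on K f"
    have fK: "(\<lambda>x. indicator K x *\<^sub>R f x) \<in> borel_measurable borel"
      by (rule borel_measurable_continuous_on_indicator[OF _ f]) simp
    have "bounded (f ` K)" using f K compact_continuous_image compact_imp_bounded by blast
    then obtain b where b: "0 \<le> b" "\<And>x. x \<in> K \<Longrightarrow> \<bar>f x\<bar> \<le> b" by (auto simp: bounded_pos intro: less_imp_le)
    have fg: "continuous_on C (\<lambda>x. f (g x))"
      using continuous_on_compose2[OF f gC] gK by auto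
    \<comment> \<open>Weak convergence on the line needs a bounded continuous function on all of it,
      while \<open>f\<close> composed with \<open>g\<close> is continuous only on
      \<open>C\<close>.\<close>
    obtain F where F: "continuous_on UNIV F" "\<And>x. x \<in> C \<Longrightarrow> F x = f (g x)" "\<And>x. norm (F x) \<le> b"
      using Tietze[OF fg, of UNIV b] Cc b gK by auto
    have "(\<integral>x. F (s x) \<partial>M (r n)) = (LINT x:K|M (r n). f x)" for n
      unfolding set_lebesgue_integral_def
    proof (rule integral_cong_AE)
      show "AE x in M (r n). F (s x) = indicat_real K x *\<^sub>R f x"
        using MK[of "r n"]
      proof eventually_elim
        case (elim x)
        then have "s x \<in> C" using closure_subset[of "s ` K"] by (auto simp: C_def)
        then show ?case using elim by (simp add: F(2) gs)
      qed
    qed (use fK borel_measurable_continuous_onI[OF F(1)] in measurable)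
    moreover have "(\<integral>x. F x \<partial>L) = (LINT x:K|distr L borel h. f x)"
    proof -
      have "(LINT x:K|distr L borel h. f x) = (\<integral>x. indicator K (h x) *\<^sub>R f (h x) \<partial>L)"
        unfolding set_lebesgue_integral_def using fK by (intro integral_distr) auto
      also have "\<dots> = (\<integral>x. F x \<partial>L)"
      proof (rule integral_cong_AE)
        show "AE x in L. indicat_real K (h x) *\<^sub>R f (h x) = F x"
          using LC by eventually_elim (use gK in \<open>auto simp: h_def F(2)\<close>)
        show "(\<lambda>x. indicat_real K (h x) *\<^sub>R f (h x)) \<in> borel_measurable L"
          using measurable_compose[OF hm fK] by simp
      qed (use borel_measurable_continuous_onI[OF F(1)] in simp)
      finally show ?thesis ..
    qed
    ultimately show "(\<lambda>n. LINT x:K|M (r n). f x) \<longlonglongrightarrow> (LINT x:K|distr L borel h. f x)"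
      using lim[OF F(1), of b] F(3) by simp
  qed
qed

section \<open>Signed measures with a density\<close>

text \<open>The supremum in \<open>positive_part\<close> is attained on the part of \<open>A\<close>
  where \<open>v\<close> is nonnegative, a Hahn set for the signed measure.\<close>

lemma positive_part_density:
  fixes v :: "'a \<Rightarrow> real"
  assumes sets: "sets M = sets N" and v: "integrable M v"
    and J: "\<And>A. A \<in> sets N \<Longrightarrow> J A = (\<integral>x. indicator A x * v x \<partial>M)"
  shows "positive_part N J = density M (\<lambda>x. ennreal (v x))"
proof -
  have [measurable]: "v \<in> borel_measurable M" using v by simp
  have "(SUP B \<in> {B \<in> sets N. B \<subseteq> A}. ennreal (J B)) = emeasure (density M (\<lambda>x. ennreal (v x))) A"
    if A: "A \<in> sets N" for A
  proof (rule antisym)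
    have [measurable]: "A \<in> sets M" using A sets by simp
    show "(SUP B \<in> {B \<in> sets N. B \<subseteq> A}. ennreal (J B)) \<le> emeasure (density M (\<lambda>x. ennreal (v x))) A"
    proof (rule SUP_least)
      fix B assume B: "B \<in> {B \<in> sets N. B \<subseteq> A}"
      then have [measurable]: "B \<in> sets M" using sets by simp
      have int: "integrable M (\<lambda>x. indicator B x * max 0 (v x))"
        using integrable_real_mult_indicator[of B M "\<lambda>x. max 0 (v x)"] v by (simp add: mult.commute)
      have "J B = (\<integral>x. indicator B x * v x \<partial>M)" using B by (simp add: J)
      also have "\<dots> \<le> (\<integral>x. indicator B x * max 0 (v x) \<partial>M)"
      proof (rule integral_mono_AE)
        show "integrable M (\<lambda>x. indicator B x * v x)"
          using integrable_real_mult_indicator[OF _ v, of B] by (simp add: mult.commute)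
      qed (use int in \<open>auto simp: indicator_def\<close>)
      finally have "ennreal (J B) \<le> ennreal (\<integral>x. indicator B x * max 0 (v x) \<partial>M)" by (rule ennreal_leI)
      also have "\<dots> = (\<integral>\<^sup>+x. ennreal (indicator B x * max 0 (v x)) \<partial>M)"
        by (rule nn_integral_eq_integral[symmetric, OF int]) auto
      also have "\<dots> \<le> (\<integral>\<^sup>+x. ennreal (v x) * indicator A x \<partial>M)"
        using B by (intro nn_integral_mono) (auto simp: indicator_def max_def ennreal_neg)
      also have "\<dots> = emeasure (density M (\<lambda>x. ennreal (v x))) A" by (simp add: emeasure_density)
      finally show "ennreal (J B) \<le> emeasure (density M (\<lambda>x. ennreal (v x))) A" .
    qed
    define B where "B = {x \<in> A. 0 \<le> v x}"
    have "B = A \<inter> (v -` {0..} \<inter> space M)" using sets.sets_into_space[of A M] by (auto simp: B_def)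
    then have BM[measurable]: "B \<in> sets M" by simp
    have int: "integrable M (\<lambda>x. indicator B x * v x)"
      using integrable_real_mult_indicator[OF _ v, of B] by (simp add: mult.commute)
    have "emeasure (density M (\<lambda>x. ennreal (v x))) A = (\<integral>\<^sup>+x. ennreal (v x) * indicator A x \<partial>M)"
      by (simp add: emeasure_density)
    also have "\<dots> = (\<integral>\<^sup>+x. ennreal (indicator B x * v x) \<partial>M)"
      by (intro nn_integral_cong) (auto simp: B_def indicator_def ennreal_neg)
    also have "\<dots> = ennreal (J B)"
    proof -
      have "J B = (\<integral>x. indicator B x * v x \<partial>M)" using BM sets by (intro J) simp
      moreover have "AE x in M. 0 \<le> indicator B x * v x" by (rule AE_I2) (auto simp: B_def indicator_def)
      ultimately show ?thesis using nn_integral_eq_integral[OF int] by simp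
    qed
    also have "\<dots> \<le> (SUP B \<in> {B \<in> sets N. B \<subseteq> A}. ennreal (J B))"
      using BM sets by (intro SUP_upper) (auto simp: B_def)
    finally show "emeasure (density M (\<lambda>x. ennreal (v x))) A \<le> (SUP B \<in> {B \<in> sets N. B \<subseteq> A}. ennreal (J B))" .
  qed
  then have "positive_part N J = measure_of (space N) (sets N) (emeasure (density M (\<lambda>x. ennreal (v x))))"
    unfolding positive_part_def by (intro measure_of_eq sets.space_closed) (simp add: sets.sigma_sets_eq)
  also have "\<dots> = density M (\<lambda>x. ennreal (v x))"
    using measure_of_of_measure[of "density M (\<lambda>x. ennreal (v x))"] sets sets_eq_imp_space_eq[OF sets] by simp
  finally show ?thesis .
qed

lemma negative_part_density:
  fixes v :: "'a \<Rightarrow> real"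
  assumes "sets M = sets N" "integrable M v" "\<And>A. A \<in> sets N \<Longrightarrow> J A = (\<integral>x. indicator A x * v x \<partial>M)"
  shows "negative_part N J = density M (\<lambda>x. ennreal (- v x))"
  unfolding negative_part_def using assms by (intro positive_part_density) auto

lemma total_variation_density:
  fixes v :: "'a \<Rightarrow> real"
  assumes sets: "sets M = sets N" and v: "integrable M v"
    and J: "\<And>A. A \<in> sets N \<Longrightarrow> J A = (\<integral>x. indicator A x * v x \<partial>M)"
  shows "total_variation N J (space N) = (\<integral>\<^sup>+x. ennreal \<bar>v x\<bar> \<partial>M)"
proof -
  have [measurable]: "v \<in> borel_measurable M" using v by simp
  have "total_variation N J (space N) = (\<integral>\<^sup>+x. ennreal (v x) \<partial>M) + (\<integral>\<^sup>+x. ennreal (- v x) \<partial>M)"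
  proof -
    have pp: "positive_part N J = density M (\<lambda>x. ennreal (v x))"
      by (rule positive_part_density[OF sets v J])
    have np: "negative_part N J = density M (\<lambda>x. ennreal (- v x))"
      by (rule negative_part_density[OF sets v J])
    show ?thesis
      unfolding total_variation_def pp np sets_eq_imp_space_eq[OF sets, symmetric]
      by (subst (1 2) emeasure_density) (auto cong: nn_integral_cong)
  qed
  also have "\<dots> = (\<integral>\<^sup>+x. ennreal (v x) + ennreal (- v x) \<partial>M)" by (simp add: nn_integral_add)
  also have "\<dots> = (\<integral>\<^sup>+x. ennreal \<bar>v x\<bar> \<partial>M)"
    by (intro nn_integral_cong) (auto simp: abs_if ennreal_neg)
  finally show ?thesis .
qed

lemma signed_integral_density:
  fixes v f :: "'a \<Rightarrow> real"
  assumes sets: "sets M = sets N" and v: "integrable M v"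
    and J: "\<And>A. A \<in> sets N \<Longrightarrow> J A = (\<integral>x. indicator A x * v x \<partial>M)"
    and f: "f \<in> borel_measurable N" "\<And>x. x \<in> space N \<Longrightarrow> \<bar>f x\<bar> \<le> B"
  shows "signed_integral N J f = (\<integral>x. v x * f x \<partial>M)"
proof -
  have [measurable]: "v \<in> borel_measurable M" using v by simp
  have fM[measurable]: "f \<in> borel_measurable M" using f(1) by (simp cong: measurable_cong_sets add: sets)
  have e: "(\<lambda>x. ennreal (v x)) = (\<lambda>x. ennreal (max 0 (v x)))" "(\<lambda>x. ennreal (- v x)) = (\<lambda>x. ennreal (max 0 (- v x)))"
    by (auto simp: fun_eq_iff max_def ennreal_neg)
  have int: "integrable M (\<lambda>x. w x * f x)" if "integrable M w" for w :: "'a \<Rightarrow> real"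
  proof (rule Bochner_Integration.integrable_bound[of M "\<lambda>x. B * w x"])
    show "integrable M (\<lambda>x. B * w x)" using that by simp
    show "AE x in M. norm (w x * f x) \<le> norm (B * w x)"
    proof (rule AE_I2)
      fix x assume "x \<in> space M"
      then have "\<bar>f x\<bar> \<le> B" using f(2) sets_eq_imp_space_eq[OF sets] by simp
      then have "\<bar>w x\<bar> * \<bar>f x\<bar> \<le> \<bar>w x\<bar> * \<bar>B\<bar>" by (intro mult_left_mono) auto
      then show "norm (w x * f x) \<le> norm (B * w x)" by (simp add: abs_mult mult.commute)
    qed
  qed (use that in measurable)
  have "signed_integral N J f = (\<integral>x. max 0 (v x) * f x \<partial>M) - (\<integral>x. max 0 (- v x) * f x \<partial>M)"
  proof -
    have pp: "positive_part N J = density M (\<lambda>x. ennreal (max 0 (v x)))"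
      unfolding e(1)[symmetric] by (rule positive_part_density[OF sets v J])
    have np: "negative_part N J = density M (\<lambda>x. ennreal (max 0 (- v x)))"
      unfolding e(2)[symmetric] by (rule negative_part_density[OF sets v J])
    show ?thesis
      unfolding signed_integral_def pp np by (subst (1 2) integral_density) auto
  qed
  also have "\<dots> = (\<integral>x. max 0 (v x) * f x - max 0 (- v x) * f x \<partial>M)"
    using v by (intro Bochner_Integration.integral_diff[symmetric] int) auto
  also have "\<dots> = (\<integral>x. v x * f x \<partial>M)"
    by (intro Bochner_Integration.integral_cong) (auto simp: max_def)
  finally show ?thesis .
qed

lemma signed_measure_density:
  fixes v :: "'a \<Rightarrow> real"
  assumes sets: "sets M = sets N" and v: "integrable M v"
    and J: "\<And>A. A \<in> sets N \<Longrightarrow> J A = (\<integral>x. indicator A x * v x \<partial>M)"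
  shows "signed_measure N J"
  unfolding signed_measure_def
proof (intro conjI allI impI)
  show "J {} = 0" by (simp add: J)
  fix A :: "nat \<Rightarrow> 'a set" assume A: "range A \<subseteq> sets N" "disjoint_family A"
  have [measurable]: "A n \<in> sets M" for n using A(1) sets by auto
  have [measurable]: "v \<in> borel_measurable M" using v by simp
  have int: "integrable M (\<lambda>x. indicator (A n) x * v x)" for n
    using integrable_real_mult_indicator[OF _ v, of "A n"] by (simp add: mult.commute)
  have pt: "(\<lambda>i. indicator (A i) x :: real) sums indicator (\<Union>i. A i) x" for x
    using A(2) by (intro indicator_sums) (auto simp: disjoint_family_on_def)
  have "(\<lambda>n. \<integral>x. (\<Sum>i<n. indicator (A i) x) * v x \<partial>M) \<longlonglongrightarrow> (\<integral>x. indicator (\<Union>i. A i) x * v x \<partial>M)"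
  proof (rule integral_dominated_convergence[where w="\<lambda>x. \<bar>v x\<bar>"])
    show "AE x in M. (\<lambda>n. (\<Sum>i<n. indicator (A i) x) * v x) \<longlonglongrightarrow> indicator (\<Union>i. A i) x * v x"
      using pt by (intro AE_I2 tendsto_mult tendsto_const) (simp add: sums_def)
    fix n show "AE x in M. norm ((\<Sum>i<n. indicator (A i) x) * v x) \<le> \<bar>v x\<bar>"
    proof (rule AE_I2)
      fix x
      have "(\<Sum>i<n. indicator (A i) x :: real) \<le> indicator (\<Union>i. A i) x"
        using sum_le_suminf[OF sums_summable[OF pt], of "{..<n}"] sums_unique[OF pt] by simp
      also have "\<dots> \<le> 1" by (simp add: indicator_def)
      finally have "(\<Sum>i<n. indicator (A i) x :: real) * \<bar>v x\<bar> \<le> 1 * \<bar>v x\<bar>" by (rule mult_right_mono) simp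
      then show "norm ((\<Sum>i<n. indicator (A i) x) * v x) \<le> \<bar>v x\<bar>"
        by (simp add: abs_mult sum_nonneg abs_of_nonneg)
    qed
  qed (use v in auto)
  moreover have "(\<integral>x. (\<Sum>i<n. indicator (A i) x) * v x \<partial>M) = (\<Sum>i<n. J (A i))" for n
  proof -
    have "(\<integral>x. (\<Sum>i<n. indicator (A i) x) * v x \<partial>M) = (\<Sum>i<n. \<integral>x. indicator (A i) x * v x \<partial>M)"
      unfolding sum_distrib_right using int by (rule Bochner_Integration.integral_sum)
    then show ?thesis using A(1) by (simp add: J range_subsetD)
  qed
  moreover have "(\<Union>n. A n) \<in> sets N" using A(1) by auto
  ultimately show "(\<lambda>n. J (A n)) sums J (\<Union>n. A n)"
    by (simp add: sums_def J)
qed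

section \<open>Projection of a bounded function along a map\<close>

text \<open>\<open>v\<close> is a Radon--Nikodym derivative: the measure with density
  \<open>w\<close> is pushed forward by \<gamma> and compared with the image of \<open>S\<close>.
  Its bound by \<open>K\<close> holds a priori only almost everywhere, hence the truncation
  \<open>min K\<close> at the end.\<close>

lemma nonneg_projection:
  fixes w :: "'a \<Rightarrow> real"
  assumes "prob_space S" and \<gamma>[measurable]: "\<gamma> \<in> measurable S N" and w[measurable]: "w \<in> borel_measurable S"
    and wK: "\<And>x. 0 \<le> w x" "\<And>x. w x \<le> K"
  obtains v where "v \<in> borel_measurable N" "\<And>x. 0 \<le> v x" "\<And>x. v x \<le> K"
    "\<And>h :: 'b \<Rightarrow> real. h \<in> borel_measurable N \<Longrightarrow> (\<integral>x. w x * h (\<gamma> x) \<partial>S) = (\<integral>y. v y * h y \<partial>distr S N \<gamma>)"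
proof -
  interpret S: prob_space S by fact
  define m where "m = distr S N \<gamma>"
  define P where "P = distr (density S (\<lambda>x. ennreal (w x))) N \<gamma>"
  interpret m: prob_space m unfolding m_def by (rule S.prob_space_distr) simp
  have K: "0 \<le> K" using wK[of undefined] by linarith
  have wint: "integrable S w" using wK by (intro S.integrable_const_bound[of _ K]) auto
  have finP: "finite_measure P"
  proof (rule finite_measureI)
    have "emeasure P (space P) = (\<integral>\<^sup>+x. ennreal (w x) \<partial>S)"
      unfolding P_def by (simp add: emeasure_distr emeasure_density measurable_space[OF \<gamma>] cong: nn_integral_cong)
    then show "emeasure P (space P) \<noteq> \<infinity>" using wint wK by (simp add: nn_integral_eq_integral)
  qed
  have ac: "absolutely_continuous m P"
    unfolding absolutely_continuous_def
  proof
    fix A assume "A \<in> null_sets m"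
    then have A[measurable]: "A \<in> sets N" and "AE x in S. \<gamma> x \<notin> A"
      by (auto simp: m_def null_sets_distr_iff AE_iff_null_sets[symmetric] vimage_def elim!: AE_mp[OF AE_not_in])
    then have "emeasure P A = 0"
      unfolding P_def by (subst emeasure_distr) (auto simp: emeasure_density nn_integral_0_iff_AE elim!: eventually_mono)
    then show "A \<in> null_sets P" using A by (auto simp: P_def)
  qed
  have sP: "sets P = sets m" by (simp add: P_def m_def)
  obtain d where d[measurable]: "d \<in> borel_measurable m" and RN: "AE x in m. RN_deriv m P x = ennreal (d x)" and d0: "\<And>x. 0 \<le> d x"
    using m.real_RN_deriv[OF finP ac sP] by metis
  have dP: "density m (\<lambda>x. ennreal (d x)) = P"
  proof -
    have "density m (\<lambda>x. ennreal (d x)) = density m (RN_deriv m P)"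
      using RN by (intro density_cong) auto
    then show ?thesis using m.density_RN_deriv[OF ac sP] by simp
  qed
  have dN[measurable]: "d \<in> borel_measurable N" using d by (simp add: m_def)
  have main: "(\<integral>x. w x * h (\<gamma> x) \<partial>S) = (\<integral>y. d y * h y \<partial>m)" if h[measurable]: "h \<in> borel_measurable N" for h :: "'b \<Rightarrow> real"
  proof -
    have "(\<integral>y. d y * h y \<partial>m) = (\<integral>y. h y \<partial>P)"
      unfolding dP[symmetric] using d0 by (subst integral_density) (auto simp: m_def)
    also have "\<dots> = (\<integral>x. h (\<gamma> x) \<partial>density S (\<lambda>x. ennreal (w x)))"
      unfolding P_def by (rule integral_distr) auto
    also have "\<dots> = (\<integral>x. w x * h (\<gamma> x) \<partial>S)"
      using wK by (subst integral_density) auto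
    finally show ?thesis ..
  qed
  have dint: "integrable m d"
  proof (rule integrableI_nonneg)
    have "(\<integral>\<^sup>+x. ennreal (d x) \<partial>m) = emeasure P (space P)"
      unfolding dP[symmetric] by (simp add: emeasure_density cong: nn_integral_cong)
    then show "(\<integral>\<^sup>+x. ennreal (d x) \<partial>m) < \<infinity>" using finP by (simp add: finite_measure.emeasure_finite less_top[symmetric])
  qed (use d0 in auto)
  have dK: "AE x in m. d x \<le> K"
  proof -
    \<comment> \<open>Testing with the indicator of the set where the density exceeds
      \<open>K\<close> shows that this set is null.\<close>
    define A where "A = {x \<in> space N. K < d x}"
    have A[measurable]: "A \<in> sets N" unfolding A_def by measurable
    have A': "A \<in> sets m" using A by (simp add: m_def)
    have "(\<integral>y. d y * indicator A y \<partial>m) = (\<integral>x. w x * indicator A (\<gamma> x) \<partial>S)"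
      by (rule main[symmetric]) simp
    also have "\<dots> \<le> (\<integral>x. K * indicator A (\<gamma> x) \<partial>S)"
      using wK K
      by (intro integral_mono_AE S.integrable_const_bound[of _ K]) (auto simp: indicator_def)
    also have "\<dots> = (\<integral>y. K * indicator A y \<partial>m)" unfolding m_def by (rule integral_distr[symmetric]) auto
    finally have le: "(\<integral>y. d y * indicator A y \<partial>m) \<le> (\<integral>y. K * indicator A y \<partial>m)" .
    have i1: "integrable m (\<lambda>y. d y * indicator A y)" by (rule integrable_real_mult_indicator[OF A' dint])
    have i2: "integrable m (\<lambda>y. K * indicator A y)" using A' by (intro m.integrable_const_bound[of _ K]) (auto simp: indicator_def K)
    have "(\<integral>y. d y * indicator A y - K * indicator A y \<partial>m) \<le> 0"
      using le unfolding Bochner_Integration.integral_diff[OF i1 i2] by linarith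
    moreover have nn: "0 \<le> d y * indicator A y - K * indicator A y" for y by (auto simp: A_def indicator_def)
    ultimately have "(\<integral>y. d y * indicator A y - K * indicator A y \<partial>m) = 0"
      by (meson Bochner_Integration.integral_nonneg order_antisym)
    then have "AE y in m. d y * indicator A y - K * indicator A y = 0"
      by (subst (asm) integral_nonneg_eq_0_iff_AE) (use i1 i2 nn in auto)
    then show ?thesis
    proof (rule AE_mp, intro AE_I2 impI)
      fix x assume "x \<in> space m" "d x * indicator A x - K * indicator A x = 0"
      then show "d x \<le> K" by (auto simp: A_def m_def indicator_def split: if_splits)
    qed
  qed
  show thesis
  proof (rule that[of "\<lambda>x. min K (d x)"])
    fix h :: "'b \<Rightarrow> real" assume h[measurable]: "h \<in> borel_measurable N"
    have "(\<integral>y. min K (d y) * h y \<partial>m) = (\<integral>y. d y * h y \<partial>m)"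
      using dK by (intro integral_cong_AE) (auto simp: m_def min_def elim!: eventually_mono)
    then show "(\<integral>x. w x * h (\<gamma> x) \<partial>S) = (\<integral>y. min K (d y) * h y \<partial>distr S N \<gamma>)"
      using main[OF h] by (simp add: m_def)
  qed (use d0 K in auto)
qed

text \<open>\<open>v\<close> is the conditional expectation of \<open>w\<close> given \<open>\<gamma>\<close>.\<close>

lemma velocity_projection:
  fixes w :: "'a \<Rightarrow> real"
  assumes S: "prob_space S" and \<gamma>[measurable]: "\<gamma> \<in> measurable S N" and w[measurable]: "w \<in> borel_measurable S"
    and wK: "\<And>x. \<bar>w x\<bar> \<le> K"
  obtains v where "v \<in> borel_measurable N" "\<And>x. \<bar>v x\<bar> \<le> K"
    "\<And>(h :: 'b \<Rightarrow> real) B. h \<in> borel_measurable N \<Longrightarrow> (\<And>y. \<bar>h y\<bar> \<le> B) \<Longrightarrow>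
       (\<integral>x. w x * h (\<gamma> x) \<partial>S) = (\<integral>y. v y * h y \<partial>distr S N \<gamma>)"
    "(\<integral>y. (v y)\<^sup>2 \<partial>distr S N \<gamma>) \<le> (\<integral>x. (w x)\<^sup>2 \<partial>S)"
proof -
  interpret S: prob_space S by fact
  interpret m: prob_space "distr S N \<gamma>" by (rule S.prob_space_distr) simp
  have K: "0 \<le> K" using wK[of undefined] by linarith
  have bd: "0 \<le> max 0 (w x)" "max 0 (w x) \<le> K" "0 \<le> max 0 (- w x)" "max 0 (- w x) \<le> K" for x
    using wK[of x] K by auto
  obtain v1 where v1[measurable]: "v1 \<in> borel_measurable N" and b1: "\<And>x. 0 \<le> v1 x" "\<And>x. v1 x \<le> K"
    and h1: "\<And>h :: 'b \<Rightarrow> real. h \<in> borel_measurable N \<Longrightarrow> (\<integral>x. max 0 (w x) * h (\<gamma> x) \<partial>S) = (\<integral>y. v1 y * h y \<partial>distr S N \<gamma>)"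
    by (rule nonneg_projection[OF S \<gamma>, of "\<lambda>x. max 0 (w x)" K]) (use bd in auto)
  obtain v2 where v2[measurable]: "v2 \<in> borel_measurable N" and b2: "\<And>x. 0 \<le> v2 x" "\<And>x. v2 x \<le> K"
    and h2: "\<And>h :: 'b \<Rightarrow> real. h \<in> borel_measurable N \<Longrightarrow> (\<integral>x. max 0 (- w x) * h (\<gamma> x) \<partial>S) = (\<integral>y. v2 y * h y \<partial>distr S N \<gamma>)"
    by (rule nonneg_projection[OF S \<gamma>, of "\<lambda>x. max 0 (- w x)" K]) (use bd in auto)
  define v where "v y = v1 y - v2 y" for y
  have vm[measurable]: "v \<in> borel_measurable N" unfolding v_def[abs_def] by simp
  have vK: "\<bar>v y\<bar> \<le> K" for y using b1[of y] b2[of y] by (auto simp: v_def)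
  have main: "(\<integral>x. w x * h (\<gamma> x) \<partial>S) = (\<integral>y. v y * h y \<partial>distr S N \<gamma>)"
    if h[measurable]: "h \<in> borel_measurable N" and hB: "\<And>y. \<bar>h y\<bar> \<le> C" for h :: "'b \<Rightarrow> real" and C
  proof -
    have C: "0 \<le> C" using hB[of undefined] by linarith
    have i: "integrable S (\<lambda>x. u x * h (\<gamma> x))" if "u \<in> borel_measurable S" "\<And>x. 0 \<le> u x" "\<And>x. u x \<le> K" for u
      using that hB C K by (intro S.integrable_const_bound[of _ "K * C"]) (auto simp: abs_mult intro!: mult_mono AE_I2)
    have j: "integrable (distr S N \<gamma>) (\<lambda>x. u x * h x)" if "u \<in> borel_measurable N" "\<And>x. 0 \<le> u x" "\<And>x. u x \<le> K" for u
      using that hB C K by (intro m.integrable_const_bound[of _ "K * C"]) (auto simp: abs_mult intro!: mult_mono AE_I2)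
    have "(\<integral>x. w x * h (\<gamma> x) \<partial>S) = (\<integral>x. max 0 (w x) * h (\<gamma> x) - max 0 (- w x) * h (\<gamma> x) \<partial>S)"
      by (intro Bochner_Integration.integral_cong) (auto simp: max_def)
    also have "\<dots> = (\<integral>x. max 0 (w x) * h (\<gamma> x) \<partial>S) - (\<integral>x. max 0 (- w x) * h (\<gamma> x) \<partial>S)"
      using bd by (intro Bochner_Integration.integral_diff i) auto
    also have "\<dots> = (\<integral>y. v1 y * h y \<partial>distr S N \<gamma>) - (\<integral>y. v2 y * h y \<partial>distr S N \<gamma>)" by (simp add: h1 h2)
    also have "\<dots> = (\<integral>y. v1 y * h y - v2 y * h y \<partial>distr S N \<gamma>)"
      using b1 b2 by (intro Bochner_Integration.integral_diff[symmetric] j) auto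
    finally show ?thesis by (simp add: v_def left_diff_distrib)
  qed
  have bv: "(\<integral>x. w x * v (\<gamma> x) \<partial>S) = (\<integral>y. (v y)\<^sup>2 \<partial>distr S N \<gamma>)"
    using main[of v K] vK by (simp add: power2_eq_square)
  have dv: "(\<integral>x. (v (\<gamma> x))\<^sup>2 \<partial>S) = (\<integral>y. (v y)\<^sup>2 \<partial>distr S N \<gamma>)" by (subst integral_distr) auto
  have sq: "(u x)\<^sup>2 \<le> K\<^sup>2" if "\<bar>u x\<bar> \<le> K" for u :: "'a \<Rightarrow> real" and x using power_mono[OF that, of 2] by simp
  have i1: "integrable S (\<lambda>x. (w x)\<^sup>2)" using wK sq by (intro S.integrable_const_bound[of _ "K\<^sup>2"]) auto
  have i2: "integrable S (\<lambda>x. (v (\<gamma> x))\<^sup>2)" using vK sq[of "\<lambda>x. v (\<gamma> x)"] by (intro S.integrable_const_bound[of _ "K\<^sup>2"]) auto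
  have i3: "integrable S (\<lambda>x. w x * v (\<gamma> x))"
    using vK wK K by (intro S.integrable_const_bound[of _ "K * K"]) (auto simp: abs_mult intro!: mult_mono AE_I2)
  \<comment> \<open>The cross term and the square of \<open>v\<close> along \<gamma> both integrate
    to the integral of \<open>(v y)\<^sup>2\<close>, so nonnegativity of this square is the
    contraction property of the projection.\<close>
  have "0 \<le> (\<integral>x. (w x - v (\<gamma> x))\<^sup>2 \<partial>S)" by simp
  also have "\<dots> = (\<integral>x. (w x)\<^sup>2 + (v (\<gamma> x))\<^sup>2 - 2 * (w x * v (\<gamma> x)) \<partial>S)"
    by (intro Bochner_Integration.integral_cong) (auto simp: power2_eq_square algebra_simps)
  also have "\<dots> = (\<integral>x. (w x)\<^sup>2 \<partial>S) + (\<integral>x. (v (\<gamma> x))\<^sup>2 \<partial>S) - 2 * (\<integral>x. w x * v (\<gamma> x) \<partial>S)"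
    using i1 i2 i3 by simp
  finally have "(\<integral>y. (v y)\<^sup>2 \<partial>distr S N \<gamma>) \<le> (\<integral>x. (w x)\<^sup>2 \<partial>S)" unfolding bv dv by simp
  then show thesis using that[of v] vK main by auto
qed

section \<open>The distance of a metric graph\<close>

context metric_graph
begin

abbreviation "X \<equiv> graph_points G len"
abbreviation "D \<equiv> graph_dist G len"
abbreviation "q \<equiv> quot G len"
abbreviation "CE \<equiv> Sigma (arcs G) (\<lambda>e. {0..len e})"

text \<open>The flag selects an end of the edge, \<open>True\<close> the terminal one. Naming ends
  by flags and not by vertices keeps the two ends of a loop apart.\<close>

definition end_param :: "'e \<Rightarrow> bool \<Rightarrow> real" where
  "end_param e \<beta> = (if \<beta> then len e else 0)"

definition end_vertex :: "'e \<Rightarrow> bool \<Rightarrow> 'v" where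
  "end_vertex e \<beta> = (if \<beta> then head G e else tail G e)"

lemma end_param_in: "e \<in> arcs G \<Longrightarrow> end_param e \<beta> \<in> {0..len e}"
  using len_pos[of e] by (auto simp: end_param_def)

lemma end_param_bounds: "e \<in> arcs G \<Longrightarrow> 0 \<le> end_param e \<beta>" "e \<in> arcs G \<Longrightarrow> end_param e \<beta> \<le> len e"
  using end_param_in by auto

lemma end_vertex_in: "e \<in> arcs G \<Longrightarrow> end_vertex e \<beta> \<in> verts G"
  by (auto simp: end_vertex_def)

lemma end_param_inj: "e \<in> arcs G \<Longrightarrow> end_param e \<alpha> = end_param e \<beta> \<longleftrightarrow> \<alpha> = \<beta>"
  using len_pos[of e] by (auto simp: end_param_def)

lemma end_param_diff: "e \<in> arcs G \<Longrightarrow> \<bar>end_param e \<beta> - end_param e (\<not> \<beta>)\<bar> = len e"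
  using len_pos[of e] by (auto simp: end_param_def)

lemma topspace_closed_edges: "topspace (closed_edges G len) = CE"
  by (auto simp: closed_edges_def)

lemma lies_at_iff: "lies_at G len (e, s) v \<longleftrightarrow> e \<in> arcs G \<and> (\<exists>\<beta>. s = end_param e \<beta> \<and> end_vertex e \<beta> = v)"
  by (auto simp: lies_at_def end_param_def end_vertex_def split: if_splits)

text \<open>Positive edge length makes the two ends of an edge distinct parameters. This is what
  makes \<open>glue\<close> transitive.\<close>

lemma lies_at_unique: "lies_at G len p v \<Longrightarrow> lies_at G len p w \<Longrightarrow> v = w"
  by (cases p) (auto simp: lies_at_iff end_param_inj)

lemma glue_equiv: "equiv CE (glue G len)"
proof (rule equivI)
  show "refl_on CE (glue G len)" by (auto simp: refl_on_def glue_def topspace_closed_edges)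
  show "sym (glue G len)" by (auto simp: sym_def glue_def)
  show "trans (glue G len)"
  proof (rule transI)
    fix x y z assume xy: "(x, y) \<in> glue G len" and yz: "(y, z) \<in> glue G len"
    show "(x, z) \<in> glue G len"
    proof (cases "x = y \<or> y = z")
      case False
      then obtain v w where v: "lies_at G len x v" "lies_at G len y v" and w: "lies_at G len y w" "lies_at G len z w"
        using xy yz unfolding glue_def by blast
      have "v = w" using lies_at_unique v w by blast
      then show ?thesis using xy yz v w unfolding glue_def by blast
    qed (use xy yz in auto)
  qed
qed (auto simp: glue_def topspace_closed_edges)

lemma q_in: "p \<in> CE \<Longrightarrow> q p \<in> X"
  by (auto simp: quot_def graph_points_def topspace_closed_edges quotient_def)

lemma X_cases: assumes "x \<in> X" obtains e s where "e \<in> arcs G" "s \<in> {0..len e}" "x = q (e, s)"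
proof -
  from assms obtain p where "p \<in> CE" "x = q p"
    by (auto simp: quot_def graph_points_def topspace_closed_edges quotient_def)
  then show thesis using that[of "fst p" "snd p"] by (cases p) auto
qed

lemma q_eq_iff: "p \<in> CE \<Longrightarrow> p' \<in> CE \<Longrightarrow> q p = q p' \<longleftrightarrow> p = p' \<or> (\<exists>v. lies_at G len p v \<and> lies_at G len p' v)"
  unfolding quot_def by (subst eq_equiv_class_iff[OF glue_equiv]) (auto simp: glue_def topspace_closed_edges)

lemma q_mem_iff: "p \<in> CE \<Longrightarrow> p' \<in> q p \<longleftrightarrow> p' \<in> CE \<and> q p' = q p"
  unfolding quot_def using glue_equiv
  by (metis (no_types, lifting) Image_singleton_iff equiv_class_eq_iff)

lemma q_eq_open_edges: "p \<in> open_edges G len \<Longrightarrow> p' \<in> CE \<Longrightarrow> q p = q p' \<Longrightarrow> p = p'"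
  by (subst (asm) q_eq_iff) (auto simp: open_edges_def lies_at_def)

text \<open>A section of the quotient map. Over an open edge its value is forced; at a vertex it is
  an arbitrary one of the glued endpoints.\<close>

definition rep :: "('e \<times> real) set \<Rightarrow> 'e \<times> real" where
  "rep z = (SOME p. p \<in> z)"

lemma rep: assumes "z \<in> X" shows "rep z \<in> CE" "q (rep z) = z"
proof -
  obtain e s where es: "e \<in> arcs G" "s \<in> {0..len e}" "z = q (e, s)" using assms by (rule X_cases)
  then have "(e, s) \<in> z" by (simp add: q_mem_iff)
  then have "rep z \<in> z" unfolding rep_def by (rule someI)
  then show "rep z \<in> CE" "q (rep z) = z" using es by (auto simp: q_mem_iff)
qed

lemma rep_open: "p \<in> open_edges G len \<Longrightarrow> rep (q p) = p"
proof -
  assume p: "p \<in> open_edges G len"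
  then have "p \<in> CE" by (auto simp: open_edges_def)
  from rep[OF q_in[OF this]] show ?thesis using q_eq_open_edges[OF p] by metis
qed

subsection \<open>Shortest walks between vertices\<close>

fun walk :: "'v \<Rightarrow> ('e \<times> bool) list \<Rightarrow> 'v \<Rightarrow> bool" where
  "walk a [] b \<longleftrightarrow> a = b"
| "walk a ((e, \<beta>) # p) b \<longleftrightarrow> e \<in> arcs G \<and> end_vertex e \<beta> = a \<and> walk (end_vertex e (\<not> \<beta>)) p b"

definition walk_length :: "('e \<times> bool) list \<Rightarrow> real" where
  "walk_length p = (\<Sum>(e, \<beta>)\<leftarrow>p. len e)"

lemma walk_length_simps[simp]: "walk_length [] = 0" "walk_length ((e, \<beta>) # p) = len e + walk_length p"
  by (simp_all add: walk_length_def)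

lemma walk_arcs: "walk a p b \<Longrightarrow> set p \<subseteq> arcs G \<times> UNIV"
  by (induction a p b rule: walk.induct) auto

lemma walk_exists:
  assumes "a \<in> verts G" "b \<in> verts G" shows "\<exists>p. walk a p b"
proof -
  have "a \<rightarrow>\<^sup>*\<^bsub>mk_symmetric G\<^esub> b"
    using connected_graph assms by (simp add: connected_def strongly_connected_def)
  then have "(a, b) \<in> (arcs_ends (mk_symmetric G))\<^sup>*" by (rule reachable_rtranclI)
  then show ?thesis
  proof (induction rule: converse_rtrancl_induct)
    case base
    show ?case by (intro exI[of _ "[]"]) simp
  next
    case (step y z)
    then obtain p where p: "walk z p b" by blast
    from step(1) obtain e where e: "e \<in> arcs G" "(y, z) = (tail G e, head G e) \<or> (y, z) = (head G e, tail G e)"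
      by (auto simp: parcs_mk_symmetric)
    then show ?case
    proof (elim disjE)
      assume "(y, z) = (tail G e, head G e)"
      then show ?thesis using p e(1) by (intro exI[of _ "(e, False) # p"]) (auto simp: end_vertex_def)
    next
      assume "(y, z) = (head G e, tail G e)"
      then show ?thesis using p e(1) by (intro exI[of _ "(e, True) # p"]) (auto simp: end_vertex_def)
    qed
  qed
qed

text \<open>A walk may repeat arcs, so there can be infinitely many. Those no longer than a given
  one have boundedly many arcs, since edge lengths are bounded below, and so they form a finite
  set.\<close>

lemma shortest_walk_exists:
  assumes "a \<in> verts G" "b \<in> verts G"
  shows "\<exists>p. walk a p b \<and> (\<forall>p'. walk a p' b \<longrightarrow> walk_length p \<le> walk_length p')"
proof -
  obtain p0 where p0: "walk a p0 b" using walk_exists[OF assms] by blast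
  \<comment> \<open>The inserted 1 keeps the set nonempty if the graph has no arcs.\<close>
  define m where "m = Min (insert 1 (len ` arcs G))"
  have m: "0 < m" "\<And>e. e \<in> arcs G \<Longrightarrow> m \<le> len e"
    using len_pos finite_arcs by (auto simp: m_def)
  have lb: "m * real (length p) \<le> walk_length p" if "set p \<subseteq> arcs G \<times> UNIV" for p
    using that
  proof (induction p)
    case (Cons x p)
    then show ?case using m(2)[of "fst x"] by (cases x) (auto simp: algebra_simps)
  qed simp
  define S where "S = {p. walk a p b \<and> walk_length p \<le> walk_length p0}"
  have "S \<subseteq> {p. set p \<subseteq> arcs G \<times> UNIV \<and> length p \<le> nat \<lceil>walk_length p0 / m\<rceil>}"
  proof
    fix p assume p: "p \<in> S"
    then have "set p \<subseteq> arcs G \<times> UNIV" using walk_arcs by (auto simp: S_def)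
    moreover from lb[OF this] p have "m * real (length p) \<le> walk_length p0" by (auto simp: S_def)
    then have "real (length p) \<le> walk_length p0 / m" using m(1) by (simp add: field_simps)
    then have "length p \<le> nat \<lceil>walk_length p0 / m\<rceil>" by linarith
    ultimately show "p \<in> {p. set p \<subseteq> arcs G \<times> UNIV \<and> length p \<le> nat \<lceil>walk_length p0 / m\<rceil>}" by blast
  qed
  moreover have "finite {p. set p \<subseteq> arcs G \<times> (UNIV :: bool set) \<and> length p \<le> nat \<lceil>walk_length p0 / m\<rceil>}"
    using finite_arcs by (intro finite_lists_length_le) auto
  ultimately have "finite S" by (rule finite_subset)
  moreover have "p0 \<in> S" using p0 by (simp add: S_def)
  ultimately obtain p where "p \<in> S" "\<forall>p'\<in>S. walk_length p \<le> walk_length p'"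
    using arg_min_if_finite[of S walk_length] by (metis empty_iff linorder_not_less)
  then show ?thesis by (intro exI[of _ p]) (force simp: S_def)
qed

definition shortest_walk :: "'v \<Rightarrow> 'v \<Rightarrow> ('e \<times> bool) list" where
  "shortest_walk a b = (SOME p. walk a p b \<and> (\<forall>p'. walk a p' b \<longrightarrow> walk_length p \<le> walk_length p'))"

definition vertex_dist :: "'v \<Rightarrow> 'v \<Rightarrow> real" where
  "vertex_dist a b = walk_length (shortest_walk a b)"

lemma shortest_walk:
  assumes "a \<in> verts G" "b \<in> verts G"
  shows "walk a (shortest_walk a b) b" "walk a p b \<Longrightarrow> vertex_dist a b \<le> walk_length p"
  using someI_ex[OF shortest_walk_exists[OF assms]] unfolding shortest_walk_def vertex_dist_def by auto

lemma walk_length_nonneg: "walk a p b \<Longrightarrow> 0 \<le> walk_length p"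
  by (induction a p b rule: walk.induct) (auto dest: len_pos)

lemma vertex_dist_nonneg: "a \<in> verts G \<Longrightarrow> b \<in> verts G \<Longrightarrow> 0 \<le> vertex_dist a b"
  using walk_length_nonneg[OF shortest_walk(1)] by (simp add: vertex_dist_def)

lemma vertex_dist_refl: "a \<in> verts G \<Longrightarrow> vertex_dist a a = 0"
  using shortest_walk(2)[of a a "[]"] vertex_dist_nonneg[of a a] by simp

lemma vertex_dist_step:
  "e \<in> arcs G \<Longrightarrow> b \<in> verts G \<Longrightarrow> vertex_dist (end_vertex e \<beta>) b \<le> len e + vertex_dist (end_vertex e (\<not> \<beta>)) b"
  using shortest_walk(2)[of "end_vertex e \<beta>" b "(e, \<beta>) # shortest_walk (end_vertex e (\<not> \<beta>)) b"]
    shortest_walk(1)[of "end_vertex e (\<not> \<beta>)" b]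
  by (simp add: end_vertex_in vertex_dist_def)

subsection \<open>Routes\<close>

text \<open>A geodesic between two points either stays inside one edge, or leaves its first edge through the
  end \<open>\<alpha>\<close>, follows a shortest walk and enters its last edge through the end \<open>\<beta>\<close>.\<close>

fun route :: "(bool \<times> bool) option \<Rightarrow> 'e \<times> real \<Rightarrow> 'e \<times> real \<Rightarrow> ('e \<times> real \<times> real) list" where
  "route None (e, s) (f, t) = [(e, s, t)]"
| "route (Some (\<alpha>, \<beta>)) (e, s) (f, t) =
     (e, s, end_param e \<alpha>) #
     map (\<lambda>(g, \<gamma>). (g, end_param g \<gamma>, end_param g (\<not> \<gamma>))) (shortest_walk (end_vertex e \<alpha>) (end_vertex f \<beta>))
     @ [(f, end_param f \<beta>, t)]"

definition route_valid :: "(bool \<times> bool) option \<Rightarrow> 'e \<times> real \<Rightarrow> 'e \<times> real \<Rightarrow> bool" where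
  "route_valid k p p' \<longleftrightarrow> k = None \<longrightarrow> fst p = fst p'"

fun route_length :: "(bool \<times> bool) option \<Rightarrow> 'e \<times> real \<Rightarrow> 'e \<times> real \<Rightarrow> real" where
  "route_length None (e, s) (f, t) = \<bar>t - s\<bar>"
| "route_length (Some (\<alpha>, \<beta>)) (e, s) (f, t) =
     \<bar>end_param e \<alpha> - s\<bar> + vertex_dist (end_vertex e \<alpha>) (end_vertex f \<beta>) + \<bar>t - end_param f \<beta>\<bar>"

lemma path_length_simps[simp]:
  "path_length [] = 0" "path_length ((e, s, t) # p) = \<bar>t - s\<bar> + path_length p"
  "path_length (p @ p') = path_length p + path_length p'"
  by (simp_all add: path_length_def)

lemma path_length_nonneg: "0 \<le> path_length p"
  unfolding path_length_def by (intro sum_list_nonneg) auto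

lemma is_path_append: "is_path G len x p y \<Longrightarrow> is_path G len y p' z \<Longrightarrow> is_path G len x (p @ p') z"
  by (induction p arbitrary: x) auto

lemma q_end: "e \<in> arcs G \<Longrightarrow> f \<in> arcs G \<Longrightarrow> end_vertex e \<alpha> = end_vertex f \<beta> \<Longrightarrow>
    q (e, end_param e \<alpha>) = q (f, end_param f \<beta>)"
  by (subst q_eq_iff) (auto simp: end_param_bounds lies_at_iff)

lemma walk_path:
  assumes "walk a p b" "e \<in> arcs G" "end_vertex e \<alpha> = a" "f \<in> arcs G" "end_vertex f \<beta> = b"
  shows "is_path G len (q (e, end_param e \<alpha>)) (map (\<lambda>(g, \<gamma>). (g, end_param g \<gamma>, end_param g (\<not> \<gamma>))) p) (q (f, end_param f \<beta>))"
    and "path_length (map (\<lambda>(g, \<gamma>). (g, end_param g \<gamma>, end_param g (\<not> \<gamma>))) p) = walk_length p"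
proof -
  show "is_path G len (q (e, end_param e \<alpha>)) (map (\<lambda>(g, \<gamma>). (g, end_param g \<gamma>, end_param g (\<not> \<gamma>))) p) (q (f, end_param f \<beta>))"
    using assms
  proof (induction a p b arbitrary: e \<alpha> rule: walk.induct)
    case (1 a b)
    then show ?case by (simp add: q_end)
  next
    case (2 a g \<gamma> p b)
    then show ?case using q_end[of g e \<gamma> \<alpha>] end_param_in[of g] by auto
  qed
  show "path_length (map (\<lambda>(g, \<gamma>). (g, end_param g \<gamma>, end_param g (\<not> \<gamma>))) p) = walk_length p"
    using assms(1)
    by (induction a p b rule: walk.induct) (auto simp: end_param_diff abs_minus_commute)
qed

lemma route_path:
  assumes "p \<in> CE" "p' \<in> CE" "route_valid k p p'"
  shows "is_path G len (q p) (route k p p') (q p')" "path_length (route k p p') = route_length k p p'"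
proof -
  obtain e s f t where p: "p = (e, s)" "p' = (f, t)" by (metis surj_pair)
  have "is_path G len (q p) (route k p p') (q p') \<and> path_length (route k p p') = route_length k p p'"
  proof (cases k)
    case None
    then show ?thesis using assms by (auto simp: p route_valid_def)
  next
    case (Some ab)
    then obtain \<alpha> \<beta> where k: "k = Some (\<alpha>, \<beta>)" by (cases ab) auto
    have ef: "e \<in> arcs G" "f \<in> arcs G" using assms by (auto simp: p)
    note w = walk_path[OF shortest_walk(1)[OF end_vertex_in[OF ef(1)] end_vertex_in[OF ef(2)]] ef(1) refl ef(2) refl, of \<alpha> \<beta>]
    have "is_path G len (q (e, end_param e \<alpha>)) (map (\<lambda>(g, \<gamma>). (g, end_param g \<gamma>, end_param g (\<not> \<gamma>)))
        (shortest_walk (end_vertex e \<alpha>) (end_vertex f \<beta>)) @ [(f, end_param f \<beta>, t)]) (q (f, t))"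
      by (rule is_path_append[OF w(1)]) (use assms end_param_in[OF ef(2)] in \<open>auto simp: p\<close>)
    then show ?thesis using w(2) assms end_param_in[OF ef(1)] by (auto simp: p k vertex_dist_def)
  qed
  then show "is_path G len (q p) (route k p p') (q p')" "path_length (route k p p') = route_length k p p'" by auto
qed

lemma route_length_move:
  "route_length k (e, s) p' \<le> \<bar>s' - s\<bar> + route_length k (e, s') p'"
  by (cases p'; cases k) auto

text \<open>Changing the representative of the starting point costs no length. The delicate case is
  a route that crosses the whole old edge and leaves through its far end: that edge is then absorbed
  into the vertex distance by \<open>vertex_dist_step\<close>.\<close>

lemma route_length_glue:
  assumes "p \<in> CE" "p1 \<in> CE" "p' \<in> CE" "q p = q p1" "route_valid k p p'"
  shows "\<exists>k'. route_valid k' p1 p' \<and> route_length k' p1 p' \<le> route_length k p p'"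
proof (cases "p = p1")
  case True
  then show ?thesis using assms by blast
next
  case False
  obtain e s e1 s1 f t where p: "p = (e, s)" "p1 = (e1, s1)" "p' = (f, t)" by (metis surj_pair)
  from False obtain v where "lies_at G len p v" "lies_at G len p1 v"
    using assms by (auto simp: q_eq_iff)
  then obtain \<alpha> \<alpha>1 where *: "e \<in> arcs G" "e1 \<in> arcs G" "s = end_param e \<alpha>" "s1 = end_param e1 \<alpha>1"
    "end_vertex e \<alpha> = end_vertex e1 \<alpha>1" unfolding p by (auto simp: lies_at_iff)
  have f: "f \<in> arcs G" using assms(3) by (auto simp: p)
  show ?thesis
  proof (cases k)
    case None
    then have "f = e" using assms(5) by (simp add: p route_valid_def)
    then show ?thesis using * None
      by (intro exI[of _ "Some (\<alpha>1, \<alpha>)"]) (auto simp: p route_valid_def vertex_dist_refl end_vertex_in)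
  next
    case (Some ab)
    then obtain \<gamma> \<beta> where k: "k = Some (\<gamma>, \<beta>)" by (cases ab) auto
    show ?thesis
    proof (cases "\<gamma> = \<alpha>")
      case True
      then show ?thesis using * k by (intro exI[of _ "Some (\<alpha>1, \<beta>)"]) (auto simp: p route_valid_def)
    next
      case False
      then have "\<gamma> = (\<not> \<alpha>)" by auto
      then show ?thesis
        using * k vertex_dist_step[of e "end_vertex f \<beta>" \<alpha>] end_vertex_in[OF f] end_param_diff[OF *(1), of \<alpha>]
        by (intro exI[of _ "Some (\<alpha>1, \<beta>)"]) (auto simp: p route_valid_def abs_minus_commute)
    qed
  qed
qed

text \<open>Induction on the path, with the target fixed: a new first segment slides the starting
  point within its edge, which changes a route length by at most the length of the segment, and
  consecutive segments are joined by \<open>route_length_glue\<close>.\<close>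

lemma route_below_path:
  assumes "is_path G len x p (q p')" "p' \<in> CE" "p0 \<in> CE" "q p0 = x"
  shows "\<exists>k. route_valid k p0 p' \<and> route_length k p0 p' \<le> path_length p"
  using assms
proof (induction p arbitrary: x p0)
  case Nil
  have "route_valid None p' p' \<and> route_length None p' p' = 0" by (cases p') (auto simp: route_valid_def)
  with route_length_glue[of p' p0 p' None] Nil show ?case by auto
next
  case (Cons seg p)
  obtain e s t where seg: "seg = (e, s, t)" by (metis surj_pair)
  with Cons.prems have es: "e \<in> arcs G" "s \<in> {0..len e}" "t \<in> {0..len e}" "q (e, s) = x" "is_path G len (q (e, t)) p (q p')"
    by auto
  from Cons.IH[OF es(5) Cons.prems(2), of "(e, t)"] es obtain k where
    k: "route_valid k (e, t) p'" "route_length k (e, t) p' \<le> path_length p" by auto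
  have "route_length k (e, s) p' \<le> path_length (seg # p)"
    using route_length_move[of k e s p' t] k(2) by (simp add: seg)
  moreover have "route_valid k (e, s) p'" using k(1) by (simp add: route_valid_def)
  moreover obtain k' where "route_valid k' p0 p'" "route_length k' p0 p' \<le> route_length k (e, s) p'"
    using route_length_glue[of "(e, s)" p0 p' k] es Cons.prems \<open>route_valid k (e, s) p'\<close> by auto
  ultimately show ?case by (intro exI[of _ k']) auto
qed

text \<open>Every valid route is a path and no path is shorter than all routes, so the infimum is a
  minimum over at most five routes. Existence of geodesics, measurability of the distance and the
  selection of geodesics all rest on this.\<close>

lemma graph_dist_routes:
  assumes "p \<in> CE" "p' \<in> CE"
  shows "\<exists>k. route_valid k p p' \<and> D (q p) (q p') = route_length k p p'"
    and "route_valid k p p' \<Longrightarrow> D (q p) (q p') \<le> route_length k p p'"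
    and "is_path G len (q p) l (q p') \<Longrightarrow> D (q p) (q p') \<le> path_length l"
proof -
  have D: "D (q p) (q p') = (INF l \<in> {l. is_path G len (q p) l (q p')}. path_length l)"
    using assms by (simp add: graph_dist_def q_in)
  have bdd: "bdd_below (path_length ` {l. is_path G len (q p) l (q p')})"
    by (rule bdd_belowI[of _ 0]) (auto simp: path_length_nonneg)
  show 3: "D (q p) (q p') \<le> path_length l" if "is_path G len (q p) l (q p')" for l
    unfolding D using that by (intro cINF_lower[OF bdd]) auto
  show 2: "D (q p) (q p') \<le> route_length k p p'" if "route_valid k p p'" for k
    using 3[OF route_path(1)[OF assms that]] route_path(2)[OF assms that] by simp
  define V where "V = {k. route_valid k p p'}"
  have "Some (True, True) \<in> V" by (simp add: V_def route_valid_def)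
  then obtain k where k: "k \<in> V" "\<forall>k'\<in>V. route_length k p p' \<le> route_length k' p p'"
    using arg_min_if_finite[of V "\<lambda>k. route_length k p p'"] by (metis empty_iff finite linorder_not_less)
  have "route_length k p p' \<le> D (q p) (q p')"
    unfolding D
  proof (rule cINF_greatest)
    show "{l. is_path G len (q p) l (q p')} \<noteq> {}" using route_path(1)[OF assms] k(1) by (auto simp: V_def)
    fix l assume "l \<in> {l. is_path G len (q p) l (q p')}"
    then show "route_length k p p' \<le> path_length l"
      using route_below_path[of "q p" l p' p] assms k(2) by (force simp: V_def)
  qed
  with 2[of k] k(1) show "\<exists>k. route_valid k p p' \<and> D (q p) (q p') = route_length k p p'"
    by (intro exI[of _ k]) (auto simp: V_def)
qed

lemma graph_dist_edge: "e \<in> arcs G \<Longrightarrow> s \<in> {0..len e} \<Longrightarrow> t \<in> {0..len e} \<Longrightarrow> D (q (e, s)) (q (e, t)) \<le> \<bar>t - s\<bar>"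
  using graph_dist_routes(2)[of "(e, s)" "(e, t)" None] by (simp add: route_valid_def)

lemma is_path_points:
  "is_path G len x p y \<Longrightarrow> x \<in> X \<Longrightarrow> y \<in> X"
proof (induction p arbitrary: x)
  case (Cons seg p)
  then show ?case using q_in by (cases seg) auto
qed simp

lemma graph_dist_le_path: "x \<in> X \<Longrightarrow> is_path G len x l y \<Longrightarrow> D x y \<le> path_length l"
  using graph_dist_routes(3)[of "rep x" "rep y" l] rep[of x] rep[of y] is_path_points by metis

lemma graph_dist_path: assumes "x \<in> X" "y \<in> X" obtains l where "is_path G len x l y" "path_length l = D x y"
proof -
  obtain k where k: "route_valid k (rep x) (rep y)" "D x y = route_length k (rep x) (rep y)"
    using graph_dist_routes(1)[of "rep x" "rep y"] rep assms by metis
  then show thesis using route_path[of "rep x" "rep y" k] rep assms that by metis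
qed

lemma is_path_rev:
  "is_path G len x p y \<Longrightarrow> is_path G len y (rev (map (\<lambda>(e, s, t). (e, t, s)) p)) x"
proof (induction p arbitrary: x)
  case (Cons seg p)
  obtain e s t where seg: "seg = (e, s, t)" by (metis surj_pair)
  from Cons show ?case by (auto simp: seg intro!: is_path_append)
qed simp

lemma path_length_rev: "path_length (rev (map (\<lambda>(e, s, t). (e, t, s)) p)) = path_length p"
  by (induction p) (auto simp: abs_minus_commute)

lemma graph_dist_zero_path: "is_path G len x l y \<Longrightarrow> path_length l = 0 \<Longrightarrow> x = y"
proof (induction l arbitrary: x)
  case (Cons seg l)
  obtain e s t where seg: "seg = (e, s, t)" by (metis surj_pair)
  have "\<bar>t - s\<bar> = 0" "path_length l = 0"
    using Cons.prems(2) path_length_nonneg[of l] by (auto simp: seg)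
  with Cons show ?case by (auto simp: seg)
qed simp

lemma graph_dist_nonneg: "0 \<le> D x y"
proof (cases "x \<in> X \<and> y \<in> X")
  case True
  then have xy: "x \<in> X" "y \<in> X" by auto
  obtain l where "is_path G len x l y" "path_length l = D x y" by (rule graph_dist_path[OF xy])
  then show ?thesis using path_length_nonneg[of l] by simp
qed (auto simp: graph_dist_def)

sublocale GM: Metric_space X D
proof
  show "0 \<le> D x y" for x y by (rule graph_dist_nonneg)
  have le: "D x y \<le> D y x" if "x \<in> X" "y \<in> X" for x y
    using graph_dist_path[OF that(2,1)] graph_dist_le_path[OF that(1) is_path_rev] path_length_rev by metis
  show "D x y = D y x" for x y
  proof (cases "x \<in> X \<and> y \<in> X")
    case True then show ?thesis using le[of x y] le[of y x] by auto
  qed (auto simp: graph_dist_def)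
  show "D x y = 0 \<longleftrightarrow> x = y" if "x \<in> X" "y \<in> X" for x y
  proof
    assume "D x y = 0" then show "x = y" using graph_dist_path[OF that] graph_dist_zero_path by metis
  next
    assume "x = y" then show "D x y = 0"
      using graph_dist_le_path[of x "[]" y] that graph_dist_nonneg[of x y] by simp
  qed
  show "D x z \<le> D x y + D y z" if xyz: "x \<in> X" "y \<in> X" "z \<in> X" for x y z
  proof -
    obtain l where l: "is_path G len x l y" "path_length l = D x y" using graph_dist_path[OF xyz(1,2)] .
    obtain l' where l': "is_path G len y l' z" "path_length l' = D y z" using graph_dist_path[OF xyz(2,3)] .
    show ?thesis using graph_dist_le_path[OF xyz(1) is_path_append[OF l(1) l'(1)]] l(2) l'(2) by simp
  qed
qed

text \<open>The distance is the length of some path, and the increments of \<open>g\<close> add up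
  along its segments.\<close>

lemma edgewise_lipschitz:
  assumes L: "0 \<le> L" and "\<And>e s t. e \<in> arcs G \<Longrightarrow> s \<in> {0..len e} \<Longrightarrow> t \<in> {0..len e} \<Longrightarrow>
     \<bar>g (q (e, t)) - g (q (e, s))\<bar> \<le> L * \<bar>t - s\<bar>"
    and "x \<in> X" "y \<in> X"
  shows "\<bar>g y - g x\<bar> \<le> L * D x y"
proof -
  have *: "\<bar>g y - g x\<bar> \<le> L * path_length l" if "is_path G len x l y" for x l
    using that
  proof (induction l arbitrary: x)
    case (Cons seg l)
    obtain e s t where seg: "seg = (e, s, t)" by (metis surj_pair)
    from Cons.prems have es: "e \<in> arcs G" "s \<in> {0..len e}" "t \<in> {0..len e}" "q (e, s) = x" "is_path G len (q (e, t)) l y"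
      by (auto simp: seg)
    have "\<bar>g y - g x\<bar> \<le> \<bar>g y - g (q (e, t))\<bar> + \<bar>g (q (e, t)) - g (q (e, s))\<bar>" using es(4) by simp
    also have "\<dots> \<le> L * path_length l + L * \<bar>t - s\<bar>"
      using Cons.IH[OF es(5)] assms(2)[OF es(1-3)] by simp
    finally show ?case by (simp add: seg algebra_simps)
  qed simp
  show ?thesis using graph_dist_path[OF assms(3,4)] * by metis
qed

end

section \<open>The Borel structure of a metric graph\<close>

lemma space_borel_measure_space[simp]: "space (borel_measure_space T) = topspace T"
  by (simp add: borel_measure_space_def space_measure_of_conv)

lemma sets_borel_measure_space: "sets (borel_measure_space T) = sigma_sets (topspace T) {U. openin T U}"
  unfolding borel_measure_space_def by (rule sets_measure_of) (auto dest: openin_subset)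

lemma openin_borel_measure_space: "openin T U \<Longrightarrow> U \<in> sets (borel_measure_space T)"
  by (auto simp: sets_borel_measure_space)

lemma measurable_borel_measure_spaceI:
  assumes "f \<in> space M \<rightarrow> topspace T" "\<And>U. openin T U \<Longrightarrow> f -` U \<inter> space M \<in> sets M"
  shows "f \<in> measurable M (borel_measure_space T)"
  unfolding borel_measure_space_def
  by (rule measurable_measure_of) (use assms in \<open>auto dest: openin_subset\<close>)

lemma continuous_map_borel_measurable:
  fixes f :: "'a \<Rightarrow> 'b::topological_space"
  assumes "continuous_map T euclidean f"
  shows "f \<in> borel_measurable (borel_measure_space T)"
proof (rule borel_measurableI)
  fix S :: "'b set" assume "open S"
  then have "openin T {x \<in> topspace T. f x \<in> S}"
    using assms by (simp add: continuous_map_def)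
  moreover have "f -` S \<inter> space (borel_measure_space T) = {x \<in> topspace T. f x \<in> S}" by auto
  ultimately show "f -` S \<inter> space (borel_measure_space T) \<in> sets (borel_measure_space T)"
    by (simp add: openin_borel_measure_space)
qed

lemma closedin_borel_measure_space: "closedin T U \<Longrightarrow> U \<in> sets (borel_measure_space T)"
  using openin_borel_measure_space[of T "topspace T - U"] sets.compl_sets[of "topspace T - U" "borel_measure_space T"]
  by (auto simp: closedin_def double_diff)

context metric_graph
begin

abbreviation "GB \<equiv> graph_borel G len"
abbreviation "EB \<equiv> edge_borel G len"

lemma graph_topology_eq: "graph_topology G len = GM.mtopology"
  by (simp add: graph_topology_def)

lemma space_GB[simp]: "space GB = X" by (simp add: graph_borel_def graph_topology_eq)

lemma space_EB[simp]: "space EB = CE" by (simp add: edge_borel_def topspace_closed_edges)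

lemma lipschitz_continuous_map:
  assumes "\<And>x y. x \<in> X \<Longrightarrow> y \<in> X \<Longrightarrow> \<bar>g y - g x\<bar> \<le> L * D x y"
  shows "continuous_map (graph_topology G len) euclideanreal g"
proof -
  have "continuous_map GM.mtopology (Metric_space.mtopology (UNIV :: real set) dist) g"
  proof (subst GM.metric_continuous_map[OF Met_TC.Metric_space_axioms], intro conjI ballI allI impI)
    fix x and \<epsilon> :: real assume x: "x \<in> X" "0 < \<epsilon>"
    have "dist (g x) (g y) < \<epsilon>" if "y \<in> X" "D x y < \<epsilon> / (\<bar>L\<bar> + 1)" for y
    proof -
      have "\<bar>g y - g x\<bar> \<le> L * D x y" using assms[OF x(1) that(1)] .
      also have "\<dots> \<le> (\<bar>L\<bar> + 1) * D x y" by (intro mult_right_mono) auto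
      also have "\<dots> < \<epsilon>" using that(2) by (simp add: field_simps)
      finally show ?thesis by (simp add: dist_real_def abs_minus_commute)
    qed
    then show "\<exists>\<delta>>0. \<forall>y. y \<in> X \<and> D x y < \<delta> \<longrightarrow> dist (g x) (g y) < \<epsilon>"
      using x(2) by (intro exI[of _ "\<epsilon> / (\<bar>L\<bar> + 1)"]) auto
  qed auto
  then show ?thesis by (simp add: graph_topology_eq)
qed

lemma edgewise_lipschitz_continuous_map:
  assumes "0 \<le> L" "\<And>e s t. e \<in> arcs G \<Longrightarrow> s \<in> {0..len e} \<Longrightarrow> t \<in> {0..len e} \<Longrightarrow>
     \<bar>g (q (e, t)) - g (q (e, s))\<bar> \<le> L * \<bar>t - s\<bar>"
  shows "continuous_map (graph_topology G len) euclideanreal g"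
  by (rule lipschitz_continuous_map[of g L]) (rule edgewise_lipschitz[OF assms])

lemma continuous_map_GB: "continuous_map (graph_topology G len) euclideanreal g \<Longrightarrow> g \<in> borel_measurable GB"
  unfolding graph_borel_def by (rule continuous_map_borel_measurable)

lemma continuous_map_edge: "e \<in> arcs G \<Longrightarrow> continuous_map (top_of_set {0..len e}) (graph_topology G len) (\<lambda>s. q (e, s))"
proof -
  assume e: "e \<in> arcs G"
  interpret S: Submetric UNIV dist "{0..len e}" by unfold_locales auto
  have "continuous_map S.sub.mtopology GM.mtopology (\<lambda>s. q (e, s))"
  proof (subst S.sub.metric_continuous_map[OF GM.Metric_space_axioms], intro conjI ballI allI impI)
    show "(\<lambda>s. q (e, s)) ` {0..len e} \<subseteq> X" using e by (auto intro: q_in)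
    fix s and \<epsilon> :: real assume s: "s \<in> {0..len e}" "0 < \<epsilon>"
    then show "\<exists>\<delta>>0. \<forall>y. y \<in> {0..len e} \<and> dist s y < \<delta> \<longrightarrow> D (q (e, s)) (q (e, y)) < \<epsilon>"
      using graph_dist_edge[OF e s(1)]
      by (intro exI[of _ \<epsilon>]) (fastforce simp: dist_real_def abs_minus_commute)
  qed
  moreover have "S.sub.mtopology = top_of_set {0..len e}"
    using S.mtopology_submetric by simp
  ultimately show ?thesis by (simp add: graph_topology_eq)
qed

lemma snd_EB[measurable]: "snd \<in> borel_measurable EB"
  unfolding edge_borel_def
proof (rule continuous_map_borel_measurable)
  show "continuous_map (closed_edges G len) euclidean (snd :: 'e \<times> real \<Rightarrow> real)"
    unfolding continuous_map_def
  proof (intro conjI allI impI)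
    fix U :: "real set" assume "openin euclidean U"
    then show "openin (closed_edges G len) {p \<in> topspace (closed_edges G len). snd p \<in> U}"
      unfolding topspace_closed_edges
      by (auto simp: closed_edges_def openin_sum_topology Collect_conj_eq openin_open)
  qed auto
qed

lemma edge_section_openin:
  "openin (closed_edges G len) U \<Longrightarrow> e \<in> arcs G \<Longrightarrow> openin (top_of_set {0..len e}) {s. (e, s) \<in> U}"
  by (simp add: closed_edges_def openin_sum_topology)

lemma edge_EB[measurable]: "{e} \<times> {0..len e} \<in> sets EB" if "e \<in> arcs G"
proof -
  have "{x. e' = e \<and> x \<in> {0..len e}} = (if e' = e then {0..len e} else {})" for e' by auto
  then have "openin (closed_edges G len) ({e} \<times> {0..len e})"
    using that unfolding closed_edges_def openin_sum_topology
    by (auto simp: openin_subtopology_self Collect_conv_if)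
  then show ?thesis unfolding edge_borel_def by (rule openin_borel_measure_space)
qed

lemma edge_inclusion_measurable: "e \<in> arcs G \<Longrightarrow> Pair e \<in> measurable (restrict_space borel {0..len e}) EB"
  unfolding edge_borel_def
proof (rule measurable_borel_measure_spaceI)
  assume e: "e \<in> arcs G"
  show "Pair e \<in> space (restrict_space borel {0..len e}) \<rightarrow> topspace (closed_edges G len)"
    using e by (auto simp: topspace_closed_edges space_restrict_space)
  fix U assume "openin (closed_edges G len) U"
  from edge_section_openin[OF this e] obtain T where "open T" "{s. (e, s) \<in> U} = {0..len e} \<inter> T"
    by (auto simp: openin_open)
  then show "Pair e -` U \<inter> space (restrict_space borel {0..len e}) \<in> sets (restrict_space borel {0..len e})"
    by (auto simp: sets_restrict_space space_restrict_space vimage_def intro!: image_eqI[of _ _ T])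
qed

lemma measurable_EB:
  assumes "\<And>e. e \<in> arcs G \<Longrightarrow> (\<lambda>s. f (e, s)) \<in> measurable (restrict_space borel {0..len e}) N"
  shows "f \<in> measurable EB N"
proof (rule measurableI)
  fix p assume "p \<in> space EB"
  then show "f p \<in> space N" using assms[of "fst p"] by (cases p) (auto simp: measurable_def space_restrict_space)
next
  fix A assume A: "A \<in> sets N"
  have "\<exists>B. B \<in> sets borel \<and> {s \<in> {0..len e}. f (e, s) \<in> A} = {0..len e} \<inter> B" if "e \<in> arcs G" for e
  proof -
    have "{s \<in> {0..len e}. f (e, s) \<in> A} = (\<lambda>s. f (e, s)) -` A \<inter> space (restrict_space borel {0..len e})"
      by (auto simp: space_restrict_space)
    with measurable_sets[OF assms[OF that] A] show ?thesis by (auto simp: sets_restrict_space)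
  qed
  then obtain B where B: "\<And>e. e \<in> arcs G \<Longrightarrow> B e \<in> sets borel"
     "\<And>e. e \<in> arcs G \<Longrightarrow> {s \<in> {0..len e}. f (e, s) \<in> A} = {0..len e} \<inter> B e" by metis
  have "f -` A \<inter> space EB = (\<Union>e\<in>arcs G. ({e} \<times> {0..len e}) \<inter> (snd -` B e \<inter> space EB))"
    using B(2) by (auto simp: set_eq_iff)
  also have "\<dots> \<in> sets EB"
    by (intro sets.finite_UN sets.Int finite_arcs edge_EB measurable_sets[OF snd_EB] B(1))
  finally show "f -` A \<inter> space EB \<in> sets EB" .
qed

lemma q_measurable[measurable]: "q \<in> measurable EB GB"
proof (rule measurable_EB)
  fix e assume e: "e \<in> arcs G"
  show "(\<lambda>s. q (e, s)) \<in> measurable (restrict_space borel {0..len e}) GB"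
    unfolding graph_borel_def
  proof (rule measurable_borel_measure_spaceI)
    show "(\<lambda>s. q (e, s)) \<in> space (restrict_space borel {0..len e}) \<rightarrow> topspace (graph_topology G len)"
      using e by (auto simp: space_restrict_space graph_topology_eq intro: q_in)
    fix U assume "openin (graph_topology G len) U"
    then have "openin (top_of_set {0..len e}) {s \<in> {0..len e}. q (e, s) \<in> U}"
      using continuous_map_edge[OF e] by (simp add: continuous_map_def)
    then obtain T where T: "open T" "{s \<in> {0..len e}. q (e, s) \<in> U} = {0..len e} \<inter> T"
      by (auto simp: openin_open)
    have "(\<lambda>s. q (e, s)) -` U \<inter> space (restrict_space borel {0..len e}) = {s \<in> {0..len e}. q (e, s) \<in> U}"
      by (auto simp: space_restrict_space)
    then show "(\<lambda>s. q (e, s)) -` U \<inter> space (restrict_space borel {0..len e}) \<in> sets (restrict_space borel {0..len e})"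
      unfolding T(2) using T(1) by (auto simp: sets_restrict_space)
  qed
qed

text \<open>A function that is constant on glued points does not see the arbitrary choice of
  \<open>rep\<close> at the vertices.\<close>

lemma rep_invariant:
  assumes "\<And>p p'. p \<in> CE \<Longrightarrow> p' \<in> CE \<Longrightarrow> q p = q p' \<Longrightarrow> F p = F p'" "p \<in> CE"
  shows "F (rep (q p)) = F p"
  using assms rep[OF q_in[OF assms(2)]] by metis

lemma constant_at_ends_invariant:
  assumes "\<And>e \<beta>. e \<in> arcs G \<Longrightarrow> F (e, end_param e \<beta>) = c" "p \<in> CE" "p' \<in> CE" "q p = q p'"
  shows "F p = F p'"
  using assms by (cases p; cases p') (auto simp: q_eq_iff lies_at_iff)

section \<open>Borel coordinates on the open edges\<close>

definition open_edge :: "'e \<Rightarrow> ('e \<times> real) set set" where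
  "open_edge e = (\<lambda>s. q (e, s)) ` {0<..<len e}"

text \<open>\<open>tent e\<close> is positive exactly on the open edge \<open>e\<close>, and
  \<open>ramp e\<close> divided by \<open>tent e\<close> is the coordinate along it. Both vanish at
  all ends and so descend to continuous functions on the graph, whereas the coordinate, extended by
  0 to the other edges, would jump at the terminal vertex.\<close>

definition tent :: "'e \<Rightarrow> 'e \<times> real \<Rightarrow> real" where
  "tent e = (\<lambda>(e', s). if e' = e then min s (len e - s) else 0)"

definition ramp :: "'e \<Rightarrow> 'e \<times> real \<Rightarrow> real" where
  "ramp e = (\<lambda>(e', s). if e' = e then s * min s (len e - s) else 0)"

lemma tent_rep: "p \<in> CE \<Longrightarrow> tent e (rep (q p)) = tent e p"
  by (rule rep_invariant, rule constant_at_ends_invariant[of _ 0]) (auto simp: tent_def end_param_def min_def dest: len_pos)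

lemma ramp_rep: "p \<in> CE \<Longrightarrow> ramp e (rep (q p)) = ramp e p"
  by (rule rep_invariant, rule constant_at_ends_invariant[of _ 0]) (auto simp: ramp_def end_param_def min_def dest: len_pos)

lemma tent_q: "e' \<in> arcs G \<Longrightarrow> s \<in> {0..len e'} \<Longrightarrow> tent e (rep (q (e', s))) = (if e' = e then min s (len e - s) else 0)"
  by (subst tent_rep) (auto simp: tent_def)

lemma ramp_q: "e' \<in> arcs G \<Longrightarrow> s \<in> {0..len e'} \<Longrightarrow> ramp e (rep (q (e', s))) = (if e' = e then s * min s (len e - s) else 0)"
  by (subst ramp_rep) (auto simp: ramp_def)

lemma tent_continuous: "continuous_map (graph_topology G len) euclideanreal (\<lambda>z. tent e (rep z))"
  by (rule edgewise_lipschitz_continuous_map[of 1]) (auto simp: tent_q min_def)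

lemma ramp_continuous: "continuous_map (graph_topology G len) euclideanreal (\<lambda>z. ramp e (rep z))"
proof (rule edgewise_lipschitz_continuous_map[of "2 * \<bar>len e\<bar>"])
  fix e' s t assume *: "e' \<in> arcs G" "s \<in> {0..len e'}" "t \<in> {0..len e'}"
  show "\<bar>ramp e (rep (q (e', t))) - ramp e (rep (q (e', s)))\<bar> \<le> 2 * \<bar>len e\<bar> * \<bar>t - s\<bar>"
  proof (cases "e' = e")
    case True
    define m where "m s = min s (len e - s)" for s
    have "t * m t - s * m s = t * (m t - m s) + (t - s) * m s" by (simp add: algebra_simps)
    then have "\<bar>t * m t - s * m s\<bar> \<le> \<bar>t\<bar> * \<bar>m t - m s\<bar> + \<bar>t - s\<bar> * \<bar>m s\<bar>"
      by (metis abs_mult abs_triangle_ineq)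
    also have "\<dots> \<le> \<bar>len e\<bar> * \<bar>t - s\<bar> + \<bar>t - s\<bar> * \<bar>len e\<bar>"
      using * True by (intro add_mono mult_mono) (auto simp: m_def min_def)
    finally show ?thesis using * True by (simp add: ramp_q m_def)
  qed (use * in \<open>simp add: ramp_q\<close>)
qed simp

lemma open_edge_iff: "z \<in> X \<Longrightarrow> e \<in> arcs G \<Longrightarrow> z \<in> open_edge e \<longleftrightarrow> 0 < tent e (rep z)"
proof -
  assume z: "z \<in> X" "e \<in> arcs G"
  show ?thesis
  proof
    assume "z \<in> open_edge e"
    then obtain s where "0 < s" "s < len e" "z = q (e, s)" by (auto simp: open_edge_def)
    then show "0 < tent e (rep z)" using z(2) by (simp add: tent_q)
  next
    assume *: "0 < tent e (rep z)"
    then show "z \<in> open_edge e" using rep[OF z(1)]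
      by (cases "rep z") (auto simp: tent_def open_edge_def split: if_splits intro!: image_eqI[of _ _ "snd (rep z)"])
  qed
qed

lemma open_edge_rep: "z \<in> open_edge e \<Longrightarrow> e \<in> arcs G \<Longrightarrow> rep z = (e, snd (rep z)) \<and> 0 < snd (rep z) \<and> snd (rep z) < len e"
  by (auto simp: open_edge_def rep_open open_edges_def)

lemma open_edge_subset: "e \<in> arcs G \<Longrightarrow> open_edge e \<subseteq> X"
  by (auto simp: open_edge_def intro: q_in)

lemma open_edge_measurable[measurable]: "e \<in> arcs G \<Longrightarrow> open_edge e \<in> sets GB"
proof -
  assume e: "e \<in> arcs G"
  have "open_edge e = {z \<in> X. tent e (rep z) \<in> {0<..}}"
    using open_edge_iff[OF _ e] open_edge_subset[OF e] by auto
  moreover have "openin (graph_topology G len) {z \<in> X. tent e (rep z) \<in> {0<..}}"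
    using openin_continuous_map_preimage[OF tent_continuous[of e], of "{0<..}"] by (simp add: graph_topology_eq)
  ultimately show ?thesis unfolding graph_borel_def by (simp add: openin_borel_measure_space)
qed

abbreviation "OX \<equiv> q ` open_edges G len"

lemma OX_eq: "OX = (\<Union>e\<in>arcs G. open_edge e)"
  by (auto simp: open_edges_def open_edge_def)

lemma OX_measurable[measurable]: "OX \<in> sets GB"
  unfolding OX_eq using finite_arcs by (intro sets.finite_UN) auto

lemma OX_subset: "OX \<subseteq> X" unfolding OX_eq using open_edge_subset by blast

lemma vertices_finite: "finite (X - OX)"
proof (rule finite_subset)
  show "X - OX \<subseteq> (\<lambda>(e, \<beta>). q (e, end_param e \<beta>)) ` (arcs G \<times> UNIV)"
  proof
    fix z assume z: "z \<in> X - OX"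
    then obtain e s where es: "e \<in> arcs G" "s \<in> {0..len e}" "z = q (e, s)" using X_cases by blast
    then have "s = 0 \<or> s = len e" using z by (force simp: open_edges_def)
    then have "\<exists>\<beta>. s = end_param e \<beta>" by (auto simp: end_param_def)
    then show "z \<in> (\<lambda>(e, \<beta>). q (e, end_param e \<beta>)) ` (arcs G \<times> UNIV)" using es by auto
  qed
qed (use finite_arcs in auto)

lemma finite_GB: "finite S \<Longrightarrow> S \<subseteq> X \<Longrightarrow> S \<in> sets GB"
proof -
  assume "finite S" "S \<subseteq> X"
  then have "closedin GM.mtopology S"
    by (intro closedin_Hausdorff_finite GM.Hausdorff_space_mtopology) auto
  then show ?thesis unfolding graph_borel_def graph_topology_eq by (rule closedin_borel_measure_space)
qed

text \<open>On each open edge the coordinate of \<open>rep\<close> is a quotient of two continuous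
  functions. What remains is a finite set of vertices, all of whose subsets are closed, so the
  arbitrary choice there does no harm.\<close>

lemma rep_measurable[measurable]: "rep \<in> measurable GB EB"
proof (rule measurableI)
  fix z assume "z \<in> space GB" then show "rep z \<in> space EB" using rep by simp
next
  fix A assume A: "A \<in> sets EB"
  define \<sigma> where "\<sigma> e z = ramp e (rep z) / tent e (rep z)" for e z
  have \<sigma>[measurable]: "\<sigma> e \<in> borel_measurable GB" for e
    unfolding \<sigma>_def[abs_def] using continuous_map_GB[OF ramp_continuous] continuous_map_GB[OF tent_continuous]
    by (rule borel_measurable_divide)
  have \<sigma>_eq: "rep z = (e, \<sigma> e z)" if z: "z \<in> open_edge e" "e \<in> arcs G" for e z
  proof -
    obtain s where s: "rep z = (e, s)" "0 < s" "s < len e" using open_edge_rep[OF z] by metis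
    then have "\<sigma> e z = s" by (simp add: \<sigma>_def ramp_def tent_def)
    then show ?thesis using s by simp
  qed
  have "\<exists>B. B \<in> sets borel \<and> {s \<in> {0..len e}. (e, s) \<in> A} = {0..len e} \<inter> B" if "e \<in> arcs G" for e
  proof -
    have "{s \<in> {0..len e}. (e, s) \<in> A} = Pair e -` A \<inter> space (restrict_space borel {0..len e})"
      by (auto simp: space_restrict_space)
    with measurable_sets[OF edge_inclusion_measurable[OF that] A] show ?thesis by (auto simp: sets_restrict_space)
  qed
  then obtain B where B: "\<And>e. e \<in> arcs G \<Longrightarrow> B e \<in> sets borel"
     "\<And>e. e \<in> arcs G \<Longrightarrow> {s \<in> {0..len e}. (e, s) \<in> A} = {0..len e} \<inter> B e" by metis
  have B': "rep z \<in> A \<longleftrightarrow> \<sigma> e z \<in> B e" if "z \<in> open_edge e" "e \<in> arcs G" for e z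
  proof -
    have "\<sigma> e z \<in> {0..len e}" using \<sigma>_eq[OF that] open_edge_rep[OF that] by auto
    then have "(e, \<sigma> e z) \<in> A \<longleftrightarrow> \<sigma> e z \<in> B e"
      using arg_cong[OF B(2)[OF that(2)], of "\<lambda>S. \<sigma> e z \<in> S"] by simp
    then show ?thesis by (simp add: \<sigma>_eq[OF that])
  qed
  have "rep -` A \<inter> space GB = (\<Union>e\<in>arcs G. open_edge e \<inter> (\<sigma> e -` B e \<inter> space GB)) \<union> {z \<in> X - OX. rep z \<in> A}"
    using B' open_edge_subset unfolding OX_eq space_GB vimage_def by blast
  also have "\<dots> \<in> sets GB"
    by (intro sets.Un sets.finite_UN sets.Int finite_GB measurable_sets[OF \<sigma>] finite_arcs open_edge_measurable B(1)
          finite_subset[OF _ vertices_finite]) auto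
  finally show "rep -` A \<inter> space GB \<in> sets GB" .
qed

lemma rep_arc_measurable[measurable]: "(\<lambda>z. fst (rep z)) \<in> measurable GB (count_space (arcs G))"
  "fst \<in> measurable EB (count_space (arcs G))"
proof -
  show *: "fst \<in> measurable EB (count_space (arcs G))"
    by (rule measurable_EB) (auto simp: measurable_const)
  show "(\<lambda>z. fst (rep z)) \<in> measurable GB (count_space (arcs G))"
    using measurable_compose[OF rep_measurable *] .
qed

text \<open>Turns the image under \<open>q\<close> that occurs in \<open>flux\<close> into a
  preimage under \<open>rep\<close>, which is how its measurability is seen.\<close>

lemma image_open_edges_measurable:
  assumes "A \<in> sets EB" shows "q ` (A \<inter> open_edges G len) \<in> sets GB"
    and "q ` (A \<inter> open_edges G len) = OX \<inter> (rep -` A \<inter> space GB)"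
proof -
  show *: "q ` (A \<inter> open_edges G len) = OX \<inter> (rep -` A \<inter> space GB)"
    using rep_open OX_subset by (force simp: image_iff)
  show "q ` (A \<inter> open_edges G len) \<in> sets GB"
    unfolding * using assms by (intro sets.Int measurable_sets[OF rep_measurable] OX_measurable)
qed

definition diam_bound :: real where
  "diam_bound = 2 * (\<Sum>e\<in>arcs G. len e) + (\<Sum>(a, b)\<in>verts G \<times> verts G. vertex_dist a b)"

lemma diam_bound: assumes "x \<in> X" "y \<in> X" shows "D x y \<le> diam_bound"
proof -
  obtain e s where x: "e \<in> arcs G" "s \<in> {0..len e}" "x = q (e, s)" using assms X_cases by blast
  obtain f t where y: "f \<in> arcs G" "t \<in> {0..len f}" "y = q (f, t)" using assms X_cases by blast
  have "D x y \<le> route_length (Some (True, True)) (e, s) (f, t)"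
    unfolding x y using x y by (intro graph_dist_routes(2)) (auto simp: route_valid_def)
  also have "\<dots> \<le> len e + vertex_dist (head G e) (head G f) + len f"
    using x y by (auto simp: end_param_def end_vertex_def)
  also have "\<dots> \<le> (\<Sum>e\<in>arcs G. len e) + (\<Sum>(a, b)\<in>verts G \<times> verts G. vertex_dist a b) + (\<Sum>e\<in>arcs G. len e)"
    using x y finite_arcs finite_verts len_pos
      member_le_sum[of "(head G e, head G f)" "verts G \<times> verts G" "\<lambda>(a, b). vertex_dist a b"]
    by (intro add_mono member_le_sum) (auto intro: vertex_dist_nonneg less_imp_le)
  finally show ?thesis by (simp add: diam_bound_def)
qed

lemma diam_bound_nonneg: "0 \<le> diam_bound"
  unfolding diam_bound_def using len_pos
  by (intro add_nonneg_nonneg sum_nonneg mult_nonneg_nonneg) (auto intro: vertex_dist_nonneg less_imp_le)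

lemma continuous_map_bounded:
  assumes "continuous_map (graph_topology G len) euclideanreal g"
  obtains b where "0 \<le> b" "\<And>x. x \<in> X \<Longrightarrow> \<bar>g x\<bar> \<le> b"
proof -
  have "\<exists>b. \<forall>s\<in>{0..len e}. \<bar>g (q (e, s))\<bar> \<le> b" if "e \<in> arcs G" for e
  proof -
    have "continuous_on {0..len e} (\<lambda>s. g (q (e, s)))"
      using continuous_map_compose[OF continuous_map_edge[OF that] assms] by (simp add: o_def)
    then have "bounded ((\<lambda>s. g (q (e, s))) ` {0..len e})"
      using compact_continuous_image compact_imp_bounded compact_Icc by blast
    then show ?thesis by (auto simp: bounded_iff)
  qed
  then obtain b where b: "\<And>e s. e \<in> arcs G \<Longrightarrow> s \<in> {0..len e} \<Longrightarrow> \<bar>g (q (e, s))\<bar> \<le> b e" by metis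
  show thesis
  proof (rule that[of "\<Sum>e\<in>arcs G. \<bar>b e\<bar>"])
    fix x assume "x \<in> X"
    then obtain e s where x: "e \<in> arcs G" "s \<in> {0..len e}" "x = q (e, s)" using X_cases by blast
    then have "\<bar>g x\<bar> \<le> \<bar>b e\<bar>" using b[OF x(1,2)] by simp
    also have "\<dots> \<le> (\<Sum>e\<in>arcs G. \<bar>b e\<bar>)" using x finite_arcs by (intro member_le_sum) auto
    finally show "\<bar>g x\<bar> \<le> (\<Sum>e\<in>arcs G. \<bar>b e\<bar>)" .
  qed (simp add: sum_nonneg)
qed

lemma prob_measuresD:
  assumes "M \<in> prob_measures G len"
  shows "prob_space M" "sets M = sets GB" "space M = X"
  using assms by (auto simp: prob_measures_def space_prob_algebra dest: sets_eq_imp_space_eq)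

lemma prob_measuresI: "prob_space M \<Longrightarrow> sets M = sets GB \<Longrightarrow> M \<in> prob_measures G len"
  by (simp add: prob_measures_def space_prob_algebra)

section \<open>Fluxes and edgewise gradients\<close>

text \<open>The restriction of \<open>M\<close> to the open edges, carried to the disjoint union of
  closed edges; it charges no endpoint. The flux of \<open>v\<close> has the density
  \<open>v\<close> composed with \<open>q\<close> with respect to it.\<close>

definition edge_part :: "('e \<times> real) set measure \<Rightarrow> ('e \<times> real) measure" where
  "edge_part M = distr (density M (indicator OX)) EB rep"

context
  fixes M :: "('e \<times> real) set measure"
  assumes M: "M \<in> prob_measures G len"
begin

lemma M_sets[measurable_cong]: "sets M = sets GB" and M_space: "space M = X"
  using prob_measuresD[OF M] by auto

lemma sets_edge_part: "sets (edge_part M) = sets EB" by (simp add: edge_part_def)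

lemma OX_M[measurable]: "OX \<in> sets M" by (simp add: M_sets)

lemma rep_M[measurable]: "rep \<in> measurable M EB"
  using rep_measurable measurable_cong_sets[OF M_sets refl] by blast

lemma integral_edge_part:
  fixes f :: "'e \<times> real \<Rightarrow> real"
  assumes [measurable]: "f \<in> borel_measurable EB"
  shows "(\<integral>p. f p \<partial>edge_part M) = (\<integral>x. indicator OX x * f (rep x) \<partial>M)"
proof -
  have "(\<integral>p. f p \<partial>edge_part M) = (\<integral>x. f (rep x) \<partial>density M (\<lambda>x. ennreal (indicator OX x)))"
    unfolding edge_part_def ennreal_indicator by (rule integral_distr) auto
  also have "\<dots> = (\<integral>x. indicator OX x * f (rep x) \<partial>M)"
    by (subst integral_density) auto
  finally show ?thesis .
qed

lemma nn_integral_edge_part: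
  assumes [measurable]: "f \<in> borel_measurable EB"
  shows "(\<integral>\<^sup>+p. f p \<partial>edge_part M) = (\<integral>\<^sup>+x. indicator OX x * f (rep x) \<partial>M)"
proof -
  have "(\<integral>\<^sup>+p. f p \<partial>edge_part M) = (\<integral>\<^sup>+x. f (rep x) \<partial>density M (indicator OX))"
    unfolding edge_part_def by (rule nn_integral_distr) auto
  also have "\<dots> = (\<integral>\<^sup>+x. indicator OX x * f (rep x) \<partial>M)"
    by (subst nn_integral_density) auto
  finally show ?thesis .
qed

context
  fixes v :: "('e \<times> real) set \<Rightarrow> real"
  assumes v: "v \<in> L2 M"
begin

lemma v_measurable[measurable]: "v \<in> borel_measurable M" "v \<in> borel_measurable GB"
  using v measurable_cong_sets[OF M_sets refl] by (auto simp: L2_def)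

lemma v_integrable: "integrable M v"
proof -
  interpret prob_space M using prob_measuresD[OF M] by simp
  show ?thesis
    by (rule square_integrable_imp_integrable) (use v in \<open>auto simp: L2_def\<close>)
qed

lemma vq_integrable: "integrable (edge_part M) (\<lambda>p. v (q p))"
proof (rule integrableI_bounded)
  have "(\<integral>\<^sup>+p. ennreal (norm (v (q p))) \<partial>edge_part M) = (\<integral>\<^sup>+x. indicator OX x * ennreal (norm (v (q (rep x)))) \<partial>M)"
    by (rule nn_integral_edge_part) measurable
  also have "\<dots> \<le> (\<integral>\<^sup>+x. ennreal (norm (v x)) \<partial>M)"
    using rep(2) M_space by (intro nn_integral_mono) (auto simp: indicator_def)
  also have "\<dots> < \<infinity>" using v_integrable by (simp add: integrable_iff_bounded)
  finally show "(\<integral>\<^sup>+p. ennreal (norm (v (q p))) \<partial>edge_part M) < \<infinity>" .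
qed (simp add: measurable_cong_sets[OF sets_edge_part refl])

lemma flux_eq:
  assumes [measurable]: "A \<in> sets EB"
  shows "flux G len v M A = (\<integral>x. indicator OX x * (indicator A (rep x) * v x) \<partial>M)"
    and "flux G len v M A = (\<integral>p. indicator A p * v (q p) \<partial>edge_part M)"
proof -
  show 1: "flux G len v M A = (\<integral>x. indicator OX x * (indicator A (rep x) * v x) \<partial>M)"
    unfolding flux_def set_lebesgue_integral_def image_open_edges_measurable(2)[OF assms]
    by (intro Bochner_Integration.integral_cong) (auto simp: indicator_def M_space)
  have "(\<integral>p. indicator A p * v (q p) \<partial>edge_part M) = (\<integral>x. indicator OX x * (indicator A (rep x) * v (q (rep x))) \<partial>M)"
    by (rule integral_edge_part) measurable
  also have "\<dots> = flux G len v M A"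
    unfolding 1 using rep(2) by (intro Bochner_Integration.integral_cong) (auto simp: M_space)
  finally show "flux G len v M A = (\<integral>p. indicator A p * v (q p) \<partial>edge_part M)" ..
qed

lemma flux_signed_measure: "signed_measure EB (flux G len v M)"
  by (rule signed_measure_density[OF sets_edge_part vq_integrable flux_eq(2)])

lemma flux_total_variation:
  "total_variation EB (flux G len v M) (space EB) = (\<integral>\<^sup>+x. indicator OX x * ennreal \<bar>v x\<bar> \<partial>M)"
proof -
  have "total_variation EB (flux G len v M) (space EB) = (\<integral>\<^sup>+p. ennreal \<bar>v (q p)\<bar> \<partial>edge_part M)"
    by (rule total_variation_density[OF sets_edge_part vq_integrable flux_eq(2)])
  also have "\<dots> = (\<integral>\<^sup>+x. indicator OX x * ennreal \<bar>v (q (rep x))\<bar> \<partial>M)"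
    by (rule nn_integral_edge_part) measurable
  also have "\<dots> = (\<integral>\<^sup>+x. indicator OX x * ennreal \<bar>v x\<bar> \<partial>M)"
    using rep(2) by (intro nn_integral_cong) (auto simp: M_space)
  finally show ?thesis .
qed

lemma flux_signed_integral:
  assumes f: "f \<in> borel_measurable EB" "\<And>p. p \<in> CE \<Longrightarrow> \<bar>f p\<bar> \<le> B"
  shows "signed_integral EB (flux G len v M) f = (\<integral>x. indicator OX x * (v x * f (rep x)) \<partial>M)"
proof -
  have "signed_integral EB (flux G len v M) f = (\<integral>p. v (q p) * f p \<partial>edge_part M)"
    by (rule signed_integral_density[OF sets_edge_part vq_integrable flux_eq(2) f(1)]) (use f(2) in auto)
  also have "\<dots> = (\<integral>x. indicator OX x * (v (q (rep x)) * f (rep x)) \<partial>M)"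
    using f(1) by (intro integral_edge_part) measurable
  also have "\<dots> = (\<integral>x. indicator OX x * (v x * f (rep x)) \<partial>M)"
    using rep(2) by (intro Bochner_Integration.integral_cong) (auto simp: M_space)
  finally show ?thesis .
qed

end

end

section \<open>Derivatives along edges\<close>

lemma grad_derivative:
  assumes "\<phi> \<in> C1_edges G len" "e \<in> arcs G" "s \<in> {0..len e}"
  shows "((\<lambda>r. \<phi> (e, r)) has_real_derivative grad len \<phi> (e, s)) (at s within {0..len e})"
proof -
  have "(\<lambda>r. \<phi> (e, r)) differentiable (at s within {0..len e})"
    using assms by (auto simp: C1_edges_def differentiable_on_def)
  then show ?thesis
    by (simp add: grad_def has_real_derivative_iff_has_vector_derivative vector_derivative_works)
qed

lemma grad_eqI:
  assumes "((\<lambda>r. \<phi> (e, r)) has_real_derivative d) (at s within {0..len e})" "e \<in> arcs G" "s \<in> {0..len e}"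
  shows "grad len \<phi> (e, s) = d"
  unfolding grad_def prod.case
  by (rule vector_derivative_within_cbox[of 0 "len e", unfolded box_real])
    (use assms len_pos in \<open>auto simp: has_real_derivative_iff_has_vector_derivative\<close>)

lemma grad_continuous: "\<phi> \<in> C1_edges G len \<Longrightarrow> e \<in> arcs G \<Longrightarrow> continuous_on {0..len e} (\<lambda>s. grad len \<phi> (e, s))"
  by (simp add: C1_edges_def)

lemma grad_measurable:
  assumes "\<phi> \<in> C1_edges G len" shows "grad len \<phi> \<in> borel_measurable EB"
  by (rule measurable_EB) (rule borel_measurable_continuous_on_restrict[OF grad_continuous[OF assms]])

lemma grad_bounded:
  assumes "\<phi> \<in> C1_edges G len"
  obtains B where "0 \<le> B" "\<And>p. p \<in> CE \<Longrightarrow> \<bar>grad len \<phi> p\<bar> \<le> B"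
proof -
  have "\<exists>b. \<forall>s\<in>{0..len e}. \<bar>grad len \<phi> (e, s)\<bar> \<le> b" if "e \<in> arcs G" for e
  proof -
    have "bounded ((\<lambda>s. grad len \<phi> (e, s)) ` {0..len e})"
      using compact_continuous_image[OF grad_continuous[OF assms that]] compact_imp_bounded by blast
    then show ?thesis by (auto simp: bounded_iff)
  qed
  then obtain b where b: "\<And>e s. e \<in> arcs G \<Longrightarrow> s \<in> {0..len e} \<Longrightarrow> \<bar>grad len \<phi> (e, s)\<bar> \<le> b e" by metis
  show thesis
  proof (rule that[of "\<Sum>e\<in>arcs G. \<bar>b e\<bar>"])
    fix p assume "p \<in> CE"
    then obtain e s where p: "p = (e, s)" "e \<in> arcs G" "s \<in> {0..len e}" by auto
    then have "\<bar>grad len \<phi> p\<bar> \<le> \<bar>b e\<bar>" using b[of e s] by simp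
    also have "\<dots> \<le> (\<Sum>e\<in>arcs G. \<bar>b e\<bar>)" using p finite_arcs by (intro member_le_sum) auto
    finally show "\<bar>grad len \<phi> p\<bar> \<le> (\<Sum>e\<in>arcs G. \<bar>b e\<bar>)" .
  qed (simp add: sum_nonneg)
qed

lemma grad_lipschitz:
  assumes "\<phi> \<in> C1_edges G len" "\<And>p. p \<in> CE \<Longrightarrow> \<bar>grad len \<phi> p\<bar> \<le> B"
    "e \<in> arcs G" "s \<in> {0..len e}" "t \<in> {0..len e}"
  shows "\<bar>\<phi> (e, t) - \<phi> (e, s)\<bar> \<le> B * \<bar>t - s\<bar>"
proof -
  have "norm (\<phi> (e, t) - \<phi> (e, s)) \<le> B * norm (t - s)"
    using assms
    by (intro field_differentiable_bound[where S="{0..len e}" and f'="\<lambda>s. grad len \<phi> (e, s)"])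
       (auto intro!: grad_derivative)
  then show ?thesis by simp
qed

end

section \<open>Hamilton--Jacobi subsolutions along the continuity equation\<close>

text \<open>The gauge integral may converge only conditionally. If the integral of the positive part
  is finite, the positive part is also gauge integrable and dominates \<open>f\<close>; otherwise
  the bound is infinite.\<close>

lemma has_integral_le_nn_integral:
  fixes f :: "real \<Rightarrow> real"
  assumes f: "(f has_integral I) S"
  shows "ennreal I \<le> (\<integral>\<^sup>+x. ennreal (f x * indicator S x) \<partial>lebesgue)"
proof (cases "(\<integral>\<^sup>+x. ennreal (f x * indicator S x) \<partial>lebesgue) = \<infinity>")
  case False
  define p where "p x = max 0 (f x * indicator S x)" for x
  have meas: "(\<lambda>x. f x * indicator S x) \<in> borel_measurable lebesgue"
    using f by (rule has_integral_implies_lebesgue_measurable_real)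
  then have pm: "p \<in> borel_measurable lebesgue" unfolding p_def[abs_def] by measurable
  have pe: "ennreal (p x) = ennreal (f x * indicator S x)" for x
    by (auto simp: p_def max_def ennreal_neg)
  have pint: "integrable lebesgue p"
    using False pm by (intro integrableI_nonneg) (auto simp: pe less_top[symmetric], auto simp: p_def)
  have "((\<lambda>x. if x \<in> S then f x else 0) has_integral I) UNIV"
    using f by (simp add: has_integral_restrict_UNIV)
  moreover have "(p has_integral (\<integral>x. p x \<partial>lebesgue)) UNIV"
    by (rule has_integral_integral_lebesgue[OF pint])
  ultimately have "I \<le> (\<integral>x. p x \<partial>lebesgue)"
    by (rule has_integral_le) (auto simp: p_def indicator_def)
  then have "ennreal I \<le> ennreal (\<integral>x. p x \<partial>lebesgue)" by (rule ennreal_leI)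
  also have "\<dots> = (\<integral>\<^sup>+x. ennreal (p x) \<partial>lebesgue)"
    by (rule nn_integral_eq_integral[symmetric, OF pint]) (simp add: p_def)
  finally show ?thesis by (simp add: pe)
qed simp

text \<open>\<open>ennreal\<close> cuts off at 0, so for arguments of arbitrary sign it is
  subadditive and not additive.\<close>

lemma ennreal_add_le: "ennreal (a + b) \<le> ennreal a + ennreal b"
proof -
  have "ennreal (a + b) \<le> ennreal (max 0 a + max 0 b)" by (intro ennreal_leI) auto
  also have "\<dots> = ennreal a + ennreal b" by (subst ennreal_plus) (auto simp: max_def ennreal_neg)
  finally show ?thesis .
qed

context metric_graph
begin

lemma continuous_map_GB_M: "M \<in> prob_measures G len \<Longrightarrow> continuous_map (graph_topology G len) euclideanreal \<phi> \<Longrightarrow> \<phi> \<in> borel_measurable M"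
  using continuous_map_GB measurable_cong_sets[OF prob_measuresD(2) refl] by blast

lemma integrable_continuous_map:
  assumes M: "M \<in> prob_measures G len" and \<phi>: "continuous_map (graph_topology G len) euclideanreal \<phi>"
  shows "integrable M \<phi>"
proof -
  interpret prob_space M using prob_measuresD[OF M] by simp
  obtain b where "\<And>x. x \<in> X \<Longrightarrow> \<bar>\<phi> x\<bar> \<le> b" using continuous_map_bounded[OF \<phi>] by blast
  then show ?thesis
    using continuous_map_GB_M[OF M \<phi>] prob_measuresD(3)[OF M] by (intro integrable_const_bound[of _ b]) auto
qed

lemma integral_le_bound:
  fixes \<phi> :: "('e \<times> real) set \<Rightarrow> real"
  assumes M: "M \<in> prob_measures G len" and \<phi>: "integrable M \<phi>" and le: "\<And>x. x \<in> X \<Longrightarrow> \<phi> x \<le> b"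
  shows "(\<integral>x. \<phi> x \<partial>M) \<le> b"
proof -
  interpret prob_space M using prob_measuresD[OF M] by simp
  have "(\<integral>x. \<phi> x \<partial>M) \<le> (\<integral>x. b \<partial>M)"
    using le prob_measuresD(3)[OF M] by (intro Bochner_Integration.integral_mono \<phi>) auto
  then show ?thesis by (simp add: prob_space)
qed

text \<open>Measurable minorants on adjacent intervals are concatenated. \<open>B\<close> is an
  arbitrary function here, so the integral of \<open>B\<close> itself could not be split. At the
  point \<open>b\<close> the new minorant is 0.\<close>

lemma action_density_le_sum:
  assumes ab: "a \<le> b" "b \<le> c" and h1: "h1 \<in> borel_measurable lebesgue" "\<And>r. r \<in> {a<..<b} \<Longrightarrow> h1 r \<le> B r"
    and h2: "h2 \<in> borel_measurable lebesgue" "\<And>r. r \<in> {b<..<c} \<Longrightarrow> h2 r \<le> (B r :: ennreal)"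
  obtains h :: "real \<Rightarrow> ennreal" where "h \<in> borel_measurable lebesgue" "\<And>r. r \<in> {a<..<c} \<Longrightarrow> h r \<le> B r"
    "(\<integral>\<^sup>+r. h r * indicator {a<..<c} r \<partial>lebesgue) =
     (\<integral>\<^sup>+r. h1 r * indicator {a<..<b} r \<partial>lebesgue) + (\<integral>\<^sup>+r. h2 r * indicator {b<..<c} r \<partial>lebesgue)"
proof -
  define h where "h r = h1 r * indicator {a<..<b} r + h2 r * indicator {b<..<c} r" for r
  have m: "(\<lambda>r. h1 r * indicator {a<..<b} r) \<in> borel_measurable lebesgue"
    "(\<lambda>r. h2 r * indicator {b<..<c} r) \<in> borel_measurable lebesgue"
    by (intro borel_measurable_times_ennreal h1(1) h2(1) borel_measurable_indicator; simp)+
  show thesis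
  proof (rule that[of h])
    show "h \<in> borel_measurable lebesgue" unfolding h_def[abs_def] using m by (rule borel_measurable_add)
    show "h r \<le> B r" if "r \<in> {a<..<c}" for r
      using that h1(2)[of r] h2(2)[of r] by (auto simp: h_def indicator_def)
    have "(\<integral>\<^sup>+r. h r * indicator {a<..<c} r \<partial>lebesgue) = (\<integral>\<^sup>+r. h r \<partial>lebesgue)"
      using ab by (intro nn_integral_cong) (auto simp: h_def indicator_def)
    also have "\<dots> = (\<integral>\<^sup>+r. h1 r * indicator {a<..<b} r \<partial>lebesgue) + (\<integral>\<^sup>+r. h2 r * indicator {b<..<c} r \<partial>lebesgue)"
      unfolding h_def using m by (rule nn_integral_add)
    finally show "(\<integral>\<^sup>+r. h r * indicator {a<..<c} r \<partial>lebesgue) =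
     (\<integral>\<^sup>+r. h1 r * indicator {a<..<b} r \<partial>lebesgue) + (\<integral>\<^sup>+r. h2 r * indicator {b<..<c} r \<partial>lebesgue)" .
  qed
qed

text \<open>Here \<open>\<partial>\<^sub>t u = -w \<le> -|\<nabla>u|\<^sup>2/2\<close>, so that \<open>u\<close> is a subsolution of the Hamilton--Jacobi equation.\<close>

lemma hamilton_jacobi_action_bound:
  fixes m :: "real \<Rightarrow> ('e \<times> real) set measure" and v :: "real \<Rightarrow> ('e \<times> real) set \<Rightarrow> real"
    and u w :: "real \<Rightarrow> ('e \<times> real) set \<Rightarrow> real"
  assumes adm: "(m, v) \<in> admissible G len m0 m1"
    and test: "\<And>t. t \<in> {0..1} \<Longrightarrow> u t \<in> test_functions G len"
    and dt: "\<And>t x. t \<in> {0..1} \<Longrightarrow> x \<in> X \<Longrightarrow> ((\<lambda>t. u t x) has_real_derivative - w t x) (at t within {0..1})"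
    and hj: "\<And>t p. t \<in> {0..1} \<Longrightarrow> p \<in> CE \<Longrightarrow> (grad len (u t \<circ> q) p)\<^sup>2 / 2 \<le> w t (q p)"
    and wc: "\<And>t. t \<in> {0..1} \<Longrightarrow> continuous_map (graph_topology G len) euclideanreal (w t)"
    and wu: "\<And>\<eta>. 0 < \<eta> \<Longrightarrow> \<exists>\<delta>>0. \<forall>t\<in>{0..1}. \<forall>t'\<in>{0..1}. \<bar>t - t'\<bar> < \<delta> \<longrightarrow> (\<forall>x\<in>X. \<bar>w t x - w t' x\<bar> < \<eta>)"
  shows "ennreal (2 * ((\<integral>x. u 1 x \<partial>m1) - (\<integral>x. u 0 x \<partial>m0))) \<le> action G len m v"
proof -
  have vL: "\<And>t. t \<in> {0<..<1} \<Longrightarrow> v t \<in> L2 (m t)"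
    and ws: "weak_solution G len 1 m (\<lambda>t. flux G len (v t) (m t))"
    and mP: "\<And>t. t \<in> {0..1} \<Longrightarrow> m t \<in> prob_measures G len"
    and wk: "\<And>\<phi>. continuous_map (graph_topology G len) euclideanreal \<phi> \<Longrightarrow> continuous_on {0..1} (\<lambda>t. \<integral>x. \<phi> x \<partial>m t)"
    and ends: "m 0 = m0" "m 1 = m1"
    using adm by (auto simp: admissible_def weak_solution_closed_def weakly_continuous_on_def)
  have uc: "continuous_map (graph_topology G len) euclideanreal (u t)" if "t \<in> {0..1}" for t
    using test[OF that] by (simp add: test_functions_def)
  have uC1: "u t \<circ> q \<in> C1_edges G len" if "t \<in> {0..1}" for t
    using test[OF that] by (simp add: test_functions_def)
  have uint: "integrable (m r) (u t)" if "t \<in> {0..1}" "r \<in> {0..1}" for t r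
    by (rule integrable_continuous_map[OF mP[OF that(2)] uc[OF that(1)]])
  have wint: "integrable (m r) (w t)" if "t \<in> {0..1}" "r \<in> {0..1}" for t r
    by (rule integrable_continuous_map[OF mP[OF that(2)] wc[OF that(1)]])
  have w0: "0 \<le> w t x" if "t \<in> {0..1}" "x \<in> X" for t x
    using hj[OF that(1) rep(1)[OF that(2)]] unfolding rep(2)[OF that(2)] by (rule order_trans[rotated]) simp
  define F where "F s t = (\<integral>x. u s x \<partial>m t)" for s t
  define W where "W s t = (\<integral>x. w s x \<partial>m t)" for s t
  define B where "B t = (\<integral>\<^sup>+x \<in> OX. ennreal (\<bar>v t x\<bar>\<^sup>2) \<partial>m t)" for t
  have Bact: "action G len m v = (\<integral>\<^sup>+t \<in> {0<..<1}. B t \<partial>lborel)"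
    by (simp add: action_def B_def)
  have Wc: "continuous_on {0..1} (W s)" if "s \<in> {0..1}" for s
    unfolding W_def[abs_def] by (rule wk[OF wc[OF that]])
  have Wdiff: "\<bar>W s t - W s' t\<bar> \<le> \<eta>"
    if st: "s \<in> {0..1}" "s' \<in> {0..1}" "t \<in> {0..1}" and close: "\<forall>x\<in>X. \<bar>w s x - w s' x\<bar> < \<eta>" for s s' t \<eta>
  proof -
    have "W s t - W s' t = (\<integral>x. w s x - w s' x \<partial>m t)" "W s' t - W s t = (\<integral>x. w s' x - w s x \<partial>m t)"
      unfolding W_def using wint st by (auto intro!: Bochner_Integration.integral_diff[symmetric])
    moreover have "(\<integral>x. w s x - w s' x \<partial>m t) \<le> \<eta>" "(\<integral>x. w s' x - w s x \<partial>m t) \<le> \<eta>"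
    proof -
      have "w s x - w s' x \<le> \<eta>" "w s' x - w s x \<le> \<eta>" if "x \<in> X" for x
        using close that by (fastforce simp: abs_less_iff)+
      then show "(\<integral>x. w s x - w s' x \<partial>m t) \<le> \<eta>" "(\<integral>x. w s' x - w s x \<partial>m t) \<le> \<eta>"
        using st by (auto intro!: integral_le_bound[OF mP[OF st(3)]] Bochner_Integration.integrable_diff wint)
    qed
    ultimately show ?thesis by linarith
  qed
  \<comment> \<open>By \<open>Wdiff\<close>, closeness in \<open>s\<close> is uniform in
    \<open>t\<close>; with continuity in \<open>t\<close> this yields joint continuity, hence
    uniform continuity on the compact square.\<close>
  have Wunif: "\<exists>\<delta>>0. \<forall>s\<in>{0..1}. \<forall>s'\<in>{0..1}. \<forall>t\<in>{0..1}. \<forall>t'\<in>{0..1}. \<bar>s - s'\<bar> < \<delta> \<longrightarrow> \<bar>t - t'\<bar> < \<delta> \<longrightarrow> \<bar>W s t - W s' t'\<bar> < \<eta>"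
    if \<eta>: "0 < \<eta>" for \<eta>
  proof -
    have "continuous_on ({0..1} \<times> {0..1}) (\<lambda>(s, t). W s t)"
      unfolding continuous_on_iff
    proof (intro ballI allI impI)
      fix z and \<epsilon> :: real assume z: "z \<in> {0..1::real} \<times> {0..1::real}" and "0 < \<epsilon>"
      then obtain s t where z_eq: "z = (s, t)" and st: "0 \<le> s" "s \<le> 1" "0 \<le> t" "t \<le> 1" "0 < \<epsilon>"
        by (cases z) auto
      obtain d1 where d1: "d1 > 0" "\<And>t'. t' \<in> {0..1} \<Longrightarrow> dist t' t < d1 \<Longrightarrow> dist (W s t') (W s t) < \<epsilon> / 2"
        using Wc[of s] st unfolding continuous_on_iff by (metis atLeastAtMost_iff half_gt_zero)
      obtain d2 where d2: "d2 > 0" "\<forall>t\<in>{0..1}. \<forall>t'\<in>{0..1}. \<bar>t - t'\<bar> < d2 \<longrightarrow> (\<forall>x\<in>X. \<bar>w t x - w t' x\<bar> < \<epsilon> / 2)"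
        using wu[of "\<epsilon> / 2"] st by auto
      have "dist (W s' t') (W s t) < \<epsilon>"
        if "0 \<le> s'" "s' \<le> 1" "0 \<le> t'" "t' \<le> 1" "dist (s', t') (s, t) < min d1 d2" for s' t'
      proof -
        have "dist s' s < d2" "dist t' t < d1"
          using that(5) dist_fst_le[of "(s', t')" "(s, t)"] dist_snd_le[of "(s', t')" "(s, t)"] by auto
        moreover from this have "\<forall>x\<in>X. \<bar>w s' x - w s x\<bar> < \<epsilon> / 2"
          using d2(2) that st by (simp add: dist_real_def)
        ultimately have "\<bar>W s' t' - W s t'\<bar> \<le> \<epsilon> / 2" "dist (W s t') (W s t) < \<epsilon> / 2"
          using that st d1(2)[of t'] Wdiff[of s' s t' "\<epsilon> / 2"] by auto
        then show ?thesis unfolding dist_real_def by linarith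
      qed
      then show "\<exists>d>0. \<forall>z'\<in>{0..1} \<times> {0..1}. dist z' z < d \<longrightarrow>
          dist (case z' of (s, t) \<Rightarrow> W s t) (case z of (s, t) \<Rightarrow> W s t) < \<epsilon>"
        unfolding z_eq using d1(1) d2(1) by (intro exI[of _ "min d1 d2"]) auto
    qed
    then have "uniformly_continuous_on ({0..1} \<times> {0..1}) (\<lambda>(s, t). W s t)"
      by (rule compact_uniformly_continuous) (auto intro: compact_Times)
    then obtain d where d: "d > 0" "\<And>z z'. z \<in> {0..1} \<times> {0..1} \<Longrightarrow> z' \<in> {0..1} \<times> {0..1} \<Longrightarrow> dist z z' < d \<Longrightarrow>
        dist (case z of (s, t) \<Rightarrow> W s t) (case z' of (s, t) \<Rightarrow> W s t) < \<eta>"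
      using \<eta> unfolding uniformly_continuous_on_def by (metis dist_commute)
    have "\<bar>W s t - W s' t'\<bar> < \<eta>" if "s \<in> {0..1}" "s' \<in> {0..1}" "t \<in> {0..1}" "t' \<in> {0..1}" "\<bar>s - s'\<bar> < d / 2" "\<bar>t - t'\<bar> < d / 2" for s s' t t'
    proof -
      have "dist (s, t) (s', t') \<le> dist s s' + dist t t'"
        using norm_Pair_le[of "s - s'" "t - t'"] by (simp add: dist_norm)
      then have "dist (s, t) (s', t') < d" using that by (simp add: dist_real_def)
      then show ?thesis using d(2)[of "(s, t)" "(s', t')"] that by (simp add: dist_real_def)
    qed
    then show ?thesis using d(1) by (intro exI[of _ "d / 2"]) auto
  qed
  \<comment> \<open>One \<eta> pays for freezing \<open>w\<close> in time, the other for replacing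
    the time integral of \<open>W s\<close> by its value at the right end. The property is additive
    over adjacent intervals because it carries a minorant \<open>h\<close> and not the integral of
    \<open>B\<close>.\<close>
  define P where "P \<eta> a b \<longleftrightarrow> (\<exists>h::real \<Rightarrow> ennreal. h \<in> borel_measurable lebesgue \<and> (\<forall>r\<in>{a<..<b}. h r \<le> B r) \<and>
     ennreal (2 * (F b b - F a a - 2 * \<eta> * (b - a))) \<le> (\<integral>\<^sup>+r. h r * indicator {a<..<b} r \<partial>lebesgue))" for \<eta> a b
  have concat: "P \<eta> a c" if P: "P \<eta> a b" "P \<eta> b c" and abc: "a \<le> b" "b \<le> c" for \<eta> a b c
  proof -
    obtain h1 :: "real \<Rightarrow> ennreal" where h1: "h1 \<in> borel_measurable lebesgue" "\<And>r. r \<in> {a<..<b} \<Longrightarrow> h1 r \<le> B r"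
      "ennreal (2 * (F b b - F a a - 2 * \<eta> * (b - a))) \<le> (\<integral>\<^sup>+r. h1 r * indicator {a<..<b} r \<partial>lebesgue)"
      using P(1) unfolding P_def by blast
    obtain h2 :: "real \<Rightarrow> ennreal" where h2: "h2 \<in> borel_measurable lebesgue" "\<And>r. r \<in> {b<..<c} \<Longrightarrow> h2 r \<le> B r"
      "ennreal (2 * (F c c - F b b - 2 * \<eta> * (c - b))) \<le> (\<integral>\<^sup>+r. h2 r * indicator {b<..<c} r \<partial>lebesgue)"
      using P(2) unfolding P_def by blast
    obtain h :: "real \<Rightarrow> ennreal" where h: "h \<in> borel_measurable lebesgue" "\<And>r. r \<in> {a<..<c} \<Longrightarrow> h r \<le> B r"
      "(\<integral>\<^sup>+r. h r * indicator {a<..<c} r \<partial>lebesgue) =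
       (\<integral>\<^sup>+r. h1 r * indicator {a<..<b} r \<partial>lebesgue) + (\<integral>\<^sup>+r. h2 r * indicator {b<..<c} r \<partial>lebesgue)"
      using action_density_le_sum[OF abc h1(1,2) h2(1,2)] by blast
    have "ennreal (2 * (F c c - F a a - 2 * \<eta> * (c - a))) =
      ennreal (2 * (F b b - F a a - 2 * \<eta> * (b - a)) + 2 * (F c c - F b b - 2 * \<eta> * (c - b)))"
      by (simp add: algebra_simps)
    also have "\<dots> \<le> ennreal (2 * (F b b - F a a - 2 * \<eta> * (b - a))) + ennreal (2 * (F c c - F b b - 2 * \<eta> * (c - b)))"
      by (rule ennreal_add_le)
    also have "\<dots> \<le> (\<integral>\<^sup>+r. h r * indicator {a<..<c} r \<partial>lebesgue)"
      unfolding h(3) by (intro add_mono h1 h2)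
    finally show ?thesis unfolding P_def using h(1,2) by blast
  qed
  \<comment> \<open>On a short interval the continuity equation is tested with the single function
    \<open>u s\<close>, so one exceptional null set of times suffices. The change from
    \<open>u s\<close> to \<open>u s'\<close> is then measured at the fixed measure
    \<open>m s'\<close>.\<close>
  have base: "\<exists>\<delta>>0. \<forall>s s'. 0 < s \<longrightarrow> s \<le> s' \<longrightarrow> s' < 1 \<longrightarrow> s' - s < \<delta> \<longrightarrow> P \<eta> s s'" if \<eta>: "0 < \<eta>" for \<eta>
  proof -
    obtain d1 where d1: "d1 > 0" "\<forall>t\<in>{0..1}. \<forall>t'\<in>{0..1}. \<bar>t - t'\<bar> < d1 \<longrightarrow> (\<forall>x\<in>X. \<bar>w t x - w t' x\<bar> < \<eta>)"
      using wu[OF \<eta>] by blast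
    obtain d2 where d2: "d2 > 0" "\<forall>s\<in>{0..1}. \<forall>s'\<in>{0..1}. \<forall>t\<in>{0..1}. \<forall>t'\<in>{0..1}. \<bar>s - s'\<bar> < d2 \<longrightarrow> \<bar>t - t'\<bar> < d2 \<longrightarrow> \<bar>W s t - W s' t'\<bar> < \<eta>"
      using Wunif[OF \<eta>] by blast
    have "P \<eta> s s'" if s: "0 < s" "s \<le> s'" "s' < 1" "s' - s < min d1 d2" for s s'
    proof -
      have s01: "s \<in> {0..1}" "s' \<in> {0..1}" using s by auto
      define g where "g r = signed_integral EB (flux G len (v r) (m r)) (grad len (u s \<circ> q))" for r
      have "absolutely_continuous_on {0<..<1} (\<lambda>t. F s t)"
        "AE t in lborel. t \<in> {0<..<1} \<longrightarrow> ((\<lambda>t. F s t) has_real_derivative g t) (at t)"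
        using ws test[OF s01(1)] unfolding weak_solution_def F_def g_def by auto
      moreover have "{s..s'} \<subseteq> {0<..<1}" using s by auto
      ultimately have g: "(g has_integral (F s s' - F s s)) {s..s'}"
        using absolutely_continuous_fundamental_theorem[OF _ s(2)] by blast
      have Wcs: "continuous_on {s..s'} (W s)" using s by (intro continuous_on_subset[OF Wc[OF s01(1)]]) auto
      define I where "I = integral {s..s'} (W s)"
      have WI: "(W s has_integral I) {s..s'}"
        unfolding I_def using integrable_continuous_real[OF Wcs] by (rule integrable_integral)
      have gW: "((\<lambda>r. 2 * (g r - W s r)) has_integral (2 * (F s s' - F s s - I))) {s..s'}"
        by (intro has_integral_mult_right has_integral_diff g WI)
      define h where "h r = ennreal (2 * (g r - W s r) * indicator {s..s'} r)" for r
      have hm: "h \<in> borel_measurable lebesgue"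
        unfolding h_def[abs_def] using has_integral_implies_lebesgue_measurable_real[OF gW] by measurable
      have hB: "h r \<le> B r" if r: "r \<in> {s<..<s'}" for r
      proof -
        have r01: "r \<in> {0<..<1}" "r \<in> {0..1}" using r s by auto
        note mr = mP[OF r01(2)] and vr = vL[OF r01(1)]
        have [measurable]: "OX \<in> sets (m r)" by (rule OX_M[OF mr])
        have [measurable]: "rep \<in> measurable (m r) EB" by (rule rep_M[OF mr])
        have [measurable]: "v r \<in> borel_measurable (m r)" using vr by (simp add: L2_def)
        have v2: "integrable (m r) (\<lambda>x. indicator OX x * (v r x)\<^sup>2)"
          using integrable_real_mult_indicator[of OX "m r" "\<lambda>x. (v r x)\<^sup>2"] vr
          by (simp add: L2_def mult.commute)
        obtain C where C: "0 \<le> C" "\<And>p. p \<in> CE \<Longrightarrow> \<bar>grad len (u s \<circ> q) p\<bar> \<le> C"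
          using grad_bounded[OF uC1[OF s01(1)]] by blast
        note gm[measurable] = grad_measurable[OF uC1[OF s01(1)]]
        have gr: "g r = (\<integral>x. indicator OX x * (v r x * grad len (u s \<circ> q) (rep x)) \<partial>m r)"
          unfolding g_def by (rule flux_signed_integral[OF mr vr gm C(2)])
        \<comment> \<open>Young's inequality, combined with the bound of the squared slope by
          \<open>2 * w s x\<close>. Off the open edges only nonnegativity of \<open>w\<close> is
          left to check.\<close>
        have le: "2 * (indicator OX x * (v r x * grad len (u s \<circ> q) (rep x))) \<le> indicator OX x * (v r x)\<^sup>2 + 2 * w s x"
          if x: "x \<in> X" for x
        proof -
          define G where "G = grad len (u s \<circ> q) (rep x)"
          have "G\<^sup>2 \<le> 2 * w s x" using hj[OF s01(1) rep(1)[OF x]] rep(2)[OF x] by (simp add: G_def)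
          moreover have "2 * (v r x * G) \<le> (v r x)\<^sup>2 + G\<^sup>2"
            using sum_squares_bound[of "v r x" G] by (simp add: algebra_simps)
          ultimately have "2 * (v r x * G) \<le> (v r x)\<^sup>2 + 2 * w s x" by linarith
          then show ?thesis using w0[OF s01(1) x] by (auto simp: indicator_def G_def)
        qed
        have gint: "integrable (m r) (\<lambda>x. indicator OX x * (v r x * grad len (u s \<circ> q) (rep x)))"
        proof (rule Bochner_Integration.integrable_bound)
          show "integrable (m r) (\<lambda>x. C * v r x)" using v_integrable[OF mr vr] by simp
          show "AE x in m r. norm (indicator OX x * (v r x * grad len (u s \<circ> q) (rep x))) \<le> norm (C * v r x)"
          proof (rule AE_I2)
            fix x assume "x \<in> space (m r)"
            then have "\<bar>grad len (u s \<circ> q) (rep x)\<bar> \<le> C" using C(2)[OF rep(1)] prob_measuresD(3)[OF mr] by simp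
            then have "\<bar>v r x\<bar> * \<bar>grad len (u s \<circ> q) (rep x)\<bar> \<le> \<bar>v r x\<bar> * C" by (rule mult_left_mono) simp
            then show "norm (indicator OX x * (v r x * grad len (u s \<circ> q) (rep x))) \<le> norm (C * v r x)"
              using C(1) by (auto simp: indicator_def abs_mult mult.commute)
          qed
        qed measurable
        have "2 * g r = (\<integral>x. 2 * (indicator OX x * (v r x * grad len (u s \<circ> q) (rep x))) \<partial>m r)"
          unfolding gr by simp
        also have "\<dots> \<le> (\<integral>x. indicator OX x * (v r x)\<^sup>2 + 2 * w s x \<partial>m r)"
          using gint v2 wint[OF s01(1) r01(2)] le prob_measuresD(3)[OF mr]
          by (intro Bochner_Integration.integral_mono Bochner_Integration.integrable_add integrable_mult_right) auto
        also have "\<dots> = (\<integral>x. indicator OX x * (v r x)\<^sup>2 \<partial>m r) + 2 * W s r"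
          using v2 wint[OF s01(1) r01(2)] by (simp add: W_def)
        finally have "2 * (g r - W s r) \<le> (\<integral>x. indicator OX x * (v r x)\<^sup>2 \<partial>m r)" by simp
        then have "h r \<le> ennreal (\<integral>x. indicator OX x * (v r x)\<^sup>2 \<partial>m r)"
          using r by (auto simp: h_def intro!: ennreal_leI)
        also have "\<dots> = (\<integral>\<^sup>+x. ennreal (indicator OX x * (v r x)\<^sup>2) \<partial>m r)"
          by (rule nn_integral_eq_integral[symmetric, OF v2]) simp
        also have "\<dots> = B r"
          unfolding B_def by (intro nn_integral_cong) (auto simp: indicator_def)
        finally show ?thesis .
      qed
      have I_le: "(s' - s) * W s s' - \<eta> * (s' - s) \<le> - I + 2 * (s' - s) * W s s'"
      proof -
        have "I \<le> (W s s' + \<eta>) * (s' - s)"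
        proof (rule has_integral_le[OF WI])
          show "((\<lambda>_. W s s' + \<eta>) has_integral ((W s s' + \<eta>) * (s' - s))) {s..s'}"
            using has_integral_const_real[of "W s s' + \<eta>" s s'] s(2) by (simp add: mult.commute)
          fix r assume "r \<in> {s..s'}"
          then have "\<bar>W s r - W s s'\<bar> < \<eta>" using d2 s by auto
          then show "W s r \<le> W s s' + \<eta>" by linarith
        qed
        then show ?thesis by (simp add: algebra_simps)
      qed
      \<comment> \<open>By the mean value theorem the increment of \<open>u\<close> is governed by
        \<open>w\<close> at an intermediate time, which differs from \<open>w s\<close> by less than
        \<eta> uniformly in \<open>x\<close>; so the estimate can be integrated.\<close>
      have F1: "F s' s' - F s s' \<le> (\<eta> - W s s') * (s' - s)"
      proof (cases "s = s'")
        case False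
        have "u s' x - u s x \<le> (\<eta> - w s x) * (s' - s)" if x: "x \<in> X" for x
        proof -
          have "\<exists>\<xi>\<in>{s<..<s'}. u s' x - u s x = - w \<xi> x * (s' - s)"
          proof (rule mvt_simple[where f = "\<lambda>t. u t x" and f' = "\<lambda>\<xi> h. - w \<xi> x * h"])
            show "s < s'" using False s by simp
            fix r assume "s \<le> r" "r \<le> s'"
            then have "((\<lambda>t. u t x) has_real_derivative - w r x) (at r within {s..s'})"
              using s x by (intro has_field_derivative_subset[OF dt]) auto
            then show "((\<lambda>t. u t x) has_derivative (\<lambda>h. - w r x * h)) (at r within {s..s'})"
              unfolding has_field_derivative_def .
          qed
          then obtain \<xi> where \<xi>: "\<xi> \<in> {s<..<s'}" "u s' x - u s x = - w \<xi> x * (s' - s)" by blast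
          have "\<bar>w \<xi> x - w s x\<bar> < \<eta>" using d1(2) \<xi>(1) s x by auto
          then have "- w \<xi> x \<le> \<eta> - w s x" by linarith
          then show ?thesis unfolding \<xi>(2) using s by (intro mult_right_mono) auto
        qed
        then have "(\<integral>x. u s' x - u s x + w s x * (s' - s) \<partial>m s') \<le> \<eta> * (s' - s)"
          using uint wint s01 by (intro integral_le_bound[OF mP]) (auto simp: algebra_simps)
        moreover have "(\<integral>x. u s' x - u s x + w s x * (s' - s) \<partial>m s') = F s' s' - F s s' + W s s' * (s' - s)"
          unfolding F_def W_def using uint wint s01 by simp
        ultimately show ?thesis by (simp add: algebra_simps)
      qed simp
      have "F s' s' - F s s - 2 * \<eta> * (s' - s) \<le> F s s' - F s s - I"
      proof -
        have "(\<eta> - W s s') * (s' - s) \<le> 2 * \<eta> * (s' - s) - I"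
          using I_le by (simp add: algebra_simps)
        then show ?thesis using F1 by linarith
      qed
      then have "ennreal (2 * (F s' s' - F s s - 2 * \<eta> * (s' - s))) \<le> ennreal (2 * (F s s' - F s s - I))"
        by (intro ennreal_leI) simp
      also have "\<dots> \<le> (\<integral>\<^sup>+r. h r \<partial>lebesgue)"
        unfolding h_def by (rule has_integral_le_nn_integral[OF gW])
      also have "\<dots> = (\<integral>\<^sup>+r. h r * indicator {s<..<s'} r \<partial>lebesgue)"
      proof (rule nn_integral_cong_AE)
        have "AE r in lebesgue. r \<notin> {s, s'}"
          by (intro AE_completion AE_not_in finite_imp_null_set_lborel) auto
        then show "AE r in lebesgue. h r = h r * indicator {s<..<s'} r"
          by eventually_elim (auto simp: h_def indicator_def)
      qed
      finally show ?thesis unfolding P_def using hm hB by blast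
    qed
    then show ?thesis using d1(1) d2(1) by (intro exI[of _ "min d1 d2"]) auto
  qed
  have all: "P \<eta> a b" if \<eta>: "0 < \<eta>" and ab: "0 < a" "a \<le> b" "b < 1" for \<eta> a b
  proof -
    obtain \<delta> where \<delta>: "\<delta> > 0" "\<And>s s'. 0 < s \<Longrightarrow> s \<le> s' \<Longrightarrow> s' < 1 \<Longrightarrow> s' - s < \<delta> \<Longrightarrow> P \<eta> s s'"
      using base[OF \<eta>] by blast
    obtain n :: nat where n: "(b - a) / \<delta> < real n" using reals_Archimedean2 by blast
    \<comment> \<open>Induction on the number of steps of length \<open>\<delta> / 2\<close>; half
      of \<delta> keeps each step strictly shorter than \<delta>.\<close>
    have "P \<eta> a t" if "a \<le> t" "t \<le> b" "t - a \<le> real k * (\<delta> / 2)" for k t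
      using that
    proof (induction k arbitrary: t)
      case 0
      then show ?case using \<delta>(2)[of a a] \<delta>(1) ab by auto
    next
      case (Suc k)
      define t' where "t' = max a (t - \<delta> / 2)"
      have "real (Suc k) * (\<delta> / 2) = real k * (\<delta> / 2) + \<delta> / 2" by (simp add: distrib_right)
      moreover have "0 \<le> real k * (\<delta> / 2)" using \<delta>(1) by simp
      ultimately have "a \<le> t'" "t' \<le> b" "t' - a \<le> real k * (\<delta> / 2)"
        using Suc.prems \<delta>(1) unfolding t'_def by linarith+
      then have "P \<eta> a t'" by (rule Suc.IH)
      moreover have "P \<eta> t' t" using Suc.prems \<delta> ab by (intro \<delta>(2)) (auto simp: t'_def)
      moreover have "t' \<le> t" using Suc.prems(1) \<delta>(1) unfolding t'_def by simp
      ultimately show ?case using concat[of \<eta> a t' t] \<open>a \<le> t'\<close> by blast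
    qed
    from this[of b "2 * n"] show ?thesis using n \<delta>(1) ab by (simp add: field_simps)
  qed
  have le_action: "ennreal (2 * (F b b - F a a - 2 * \<eta> * (b - a))) \<le> action G len m v"
    if \<eta>: "0 < \<eta>" and ab: "0 < a" "a \<le> b" "b < 1" for \<eta> a b
  proof -
    obtain h :: "real \<Rightarrow> ennreal" where h: "\<And>r. r \<in> {a<..<b} \<Longrightarrow> h r \<le> B r"
      "ennreal (2 * (F b b - F a a - 2 * \<eta> * (b - a))) \<le> (\<integral>\<^sup>+r. h r * indicator {a<..<b} r \<partial>lebesgue)"
      using all[OF \<eta> ab] unfolding P_def by blast
    note h(2)
    \<comment> \<open>Gauge integration yields only Lebesgue measurability of \<open>h\<close>; the
      nonnegative integral is the same for the completed measure.\<close>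
    also have "(\<integral>\<^sup>+r. h r * indicator {a<..<b} r \<partial>lebesgue) = (\<integral>\<^sup>+r. h r * indicator {a<..<b} r \<partial>lborel)"
      by (rule nn_integral_completion)
    also have "\<dots> \<le> action G len m v"
      unfolding Bact using h(1) ab by (intro nn_integral_mono) (auto simp: indicator_def)
    finally show ?thesis .
  qed
  show ?thesis
  proof (cases "action G len m v")
    case top
    then show ?thesis by simp
  next
    case (real c)
    \<comment> \<open>The estimate is available on compact subintervals of the open time interval,
      where the equation is posed. Continuity along the diagonal carries it to the prescribed end
      measures.\<close>
    have Fc: "continuous_on {0..1} (\<lambda>t. F t t)"
    proof -
      obtain \<delta> where \<delta>: "\<delta> > 0" "\<forall>s\<in>{0..1}. \<forall>s'\<in>{0..1}. \<forall>t\<in>{0..1}. \<forall>t'\<in>{0..1}. \<bar>s - s'\<bar> < \<delta> \<longrightarrow> \<bar>t - t'\<bar> < \<delta> \<longrightarrow> \<bar>W s t - W s' t'\<bar> < 1"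
        using Wunif[of 1] by auto
      obtain w1 where w1: "w1 > 0" "\<forall>t\<in>{0..1}. \<forall>t'\<in>{0..1}. \<bar>t - t'\<bar> < w1 \<longrightarrow> (\<forall>x\<in>X. \<bar>w t x - w t' x\<bar> < 1)"
        using wu[of 1] by auto
      show ?thesis
        unfolding continuous_on_iff
      proof safe
        fix t \<epsilon> :: real assume t: "t \<in> {0..1}" "0 < \<epsilon>"
        obtain b where b: "0 \<le> b" "\<And>x. x \<in> X \<Longrightarrow> \<bar>w t x\<bar> \<le> b" using continuous_map_bounded[OF wc[OF t(1)]] by blast
        have "continuous_on {0..1} (F t)" unfolding F_def[abs_def] by (rule wk[OF uc[OF t(1)]])
        then obtain d1 where d1: "d1 > 0" "\<And>t'. t' \<in> {0..1} \<Longrightarrow> dist t' t < d1 \<Longrightarrow> dist (F t t') (F t t) < \<epsilon> / 2"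
          using t unfolding continuous_on_iff by (metis half_gt_zero)
        define d where "d = Min {d1, w1, \<epsilon> / (2 * (b + 1))}"
        have d: "d > 0" "d \<le> d1" "d \<le> w1" "d \<le> \<epsilon> / (2 * (b + 1))" using d1 w1 b t by (auto simp: d_def)
        have "dist (F t' t') (F t t) < \<epsilon>" if t': "t' \<in> {0..1}" "dist t' t < d" for t'
        proof -
          have ux: "\<bar>u t' x - u t x\<bar> \<le> (b + 1) * \<bar>t' - t\<bar>" if x: "x \<in> X" for x
          proof -
            define S where "S = {0..1} \<inter> {t - d<..<t + d}"
            have "norm (u t' x - u t x) \<le> (b + 1) * norm (t' - t)"
            proof (rule field_differentiable_bound[where S = S and f' = "\<lambda>t. - w t x"])
              show "convex S" unfolding S_def by (intro convex_Int convex_real_interval)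
              fix r assume r: "r \<in> S"
              show "((\<lambda>t. u t x) has_real_derivative - w r x) (at r within S)"
                using r x by (intro has_field_derivative_subset[OF dt]) (auto simp: S_def)
              have "\<bar>w r x - w t x\<bar> < 1" using w1(2) r t d x by (auto simp: S_def)
              then show "norm (- w r x) \<le> b + 1" using b(2)[OF x] by simp
            qed (use t t' d in \<open>auto simp: S_def dist_real_def\<close>)
            then show ?thesis by simp
          qed
          have "\<bar>F t' t' - F t t'\<bar> \<le> (b + 1) * \<bar>t' - t\<bar>"
          proof -
            have "F t' t' - F t t' = (\<integral>x. u t' x - u t x \<partial>m t')" "F t t' - F t' t' = (\<integral>x. u t x - u t' x \<partial>m t')"
              unfolding F_def using uint t t' by (auto intro!: Bochner_Integration.integral_diff[symmetric])
            moreover have "(\<integral>x. u t' x - u t x \<partial>m t') \<le> (b + 1) * \<bar>t' - t\<bar>" "(\<integral>x. u t x - u t' x \<partial>m t') \<le> (b + 1) * \<bar>t' - t\<bar>"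
            proof -
              have "u t' x - u t x \<le> (b + 1) * \<bar>t' - t\<bar>" "u t x - u t' x \<le> (b + 1) * \<bar>t' - t\<bar>" if "x \<in> X" for x
                using ux[OF that] unfolding abs_le_iff by linarith+
              then show "(\<integral>x. u t' x - u t x \<partial>m t') \<le> (b + 1) * \<bar>t' - t\<bar>" "(\<integral>x. u t x - u t' x \<partial>m t') \<le> (b + 1) * \<bar>t' - t\<bar>"
                using t t' by (auto intro!: integral_le_bound[OF mP[OF t'(1)]] Bochner_Integration.integrable_diff uint)
            qed
            ultimately show ?thesis by linarith
          qed
          also have "\<dots> < (b + 1) * (\<epsilon> / (2 * (b + 1)))"
            using t' d(4) b by (intro mult_strict_left_mono) (auto simp: dist_real_def)
          also have "\<dots> = \<epsilon> / 2" using b by (simp add: field_simps)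
          finally have "\<bar>F t' t' - F t t'\<bar> < \<epsilon> / 2" .
          moreover have "dist (F t t') (F t t) < \<epsilon> / 2" using d1(2)[of t'] t' d by auto
          ultimately show ?thesis unfolding dist_real_def by linarith
        qed
        then show "\<exists>d>0. \<forall>x'\<in>{0..1}. dist x' t < d \<longrightarrow> dist (F x' x') (F t t) < \<epsilon>" using d(1) by blast
      qed
    qed
    \<comment> \<open>The distance to the ends of the time interval and the error parameter are both
      \<epsilon>, so that a single limit removes both.\<close>
    have ineq: "2 * (F (1 - \<epsilon>) (1 - \<epsilon>) - F \<epsilon> \<epsilon> - 2 * \<epsilon> * (1 - \<epsilon> - \<epsilon>)) \<le> c" if "0 < \<epsilon>" "\<epsilon> < 1/2" for \<epsilon>
      using le_action[of \<epsilon> \<epsilon> "1 - \<epsilon>"] that real by (simp add: ennreal_le_iff)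
    have l1: "((\<lambda>\<epsilon>. F \<epsilon> \<epsilon>) \<longlongrightarrow> F 0 0) (at_right 0)"
      using Fc continuous_on_Icc_at_rightD[of 0 1 "\<lambda>t. F t t"] by simp
    have "filterlim (\<lambda>\<epsilon>::real. 1 - \<epsilon>) (at_left 1) (at_right 0)"
      unfolding filterlim_at
    proof
      show "\<forall>\<^sub>F \<epsilon> in at_right 0. 1 - \<epsilon> \<in> {..<1} \<and> 1 - \<epsilon> \<noteq> (1::real)"
        using eventually_at_right_less[of "0::real"] by eventually_elim auto
    qed (auto intro!: tendsto_eq_intros)
    from filterlim_compose[OF _ this, of "\<lambda>t. F t t" "nhds (F 1 1)"]
    have l2: "((\<lambda>\<epsilon>. F (1 - \<epsilon>) (1 - \<epsilon>)) \<longlongrightarrow> F 1 1) (at_right 0)"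
      using Fc continuous_on_Icc_at_leftD[of 0 1 "\<lambda>t. F t t"] by simp
    have "((\<lambda>\<epsilon>. 2 * (F (1 - \<epsilon>) (1 - \<epsilon>) - F \<epsilon> \<epsilon> - 2 * \<epsilon> * (1 - \<epsilon> - \<epsilon>))) \<longlongrightarrow> 2 * (F 1 1 - F 0 0 - 2 * 0 * (1 - 0 - 0))) (at_right 0)"
      by (intro tendsto_intros l1 l2)
    then have "2 * (F 1 1 - F 0 0 - 2 * 0 * (1 - 0 - 0)) \<le> c"
    proof (rule tendsto_upperbound)
      show "\<forall>\<^sub>F \<epsilon> in at_right 0. 2 * (F (1 - \<epsilon>) (1 - \<epsilon>) - F \<epsilon> \<epsilon> - 2 * \<epsilon> * (1 - \<epsilon> - \<epsilon>)) \<le> c"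
        unfolding eventually_at_right_field
        by (intro exI[of _ "1/2"] conjI allI impI ineq; assumption?) simp
    qed simp
    then show ?thesis using real ends by (simp add: F_def ennreal_leI)
  qed
qed

section \<open>Smoothed Hopf--Lax subsolutions\<close>

text \<open>The preimage of a closed set is a finite union of continuous images of compact subsets
  of edges, hence closed in the Hausdorff space. In contrast to the Lipschitz criterion this covers
  functions that are merely continuous on each edge.\<close>

lemma edgewise_continuous_map:
  assumes "\<And>e. e \<in> arcs G \<Longrightarrow> continuous_on {0..len e} (\<lambda>s. g (q (e, s)))"
  shows "continuous_map (graph_topology G len) euclideanreal g"
  unfolding continuous_map_closedin
proof (intro conjI allI impI)
  fix C :: "real set" assume "closedin euclidean C"
  then have C: "closed C" by simp
  define K where "K e = {s \<in> {0..len e}. g (q (e, s)) \<in> C}" for e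
  have "{x \<in> topspace (graph_topology G len). g x \<in> C} = (\<Union>e\<in>arcs G. (\<lambda>s. q (e, s)) ` K e)"
    by (auto simp: K_def graph_topology_eq intro: q_in elim!: X_cases)
  also have "closedin (graph_topology G len) \<dots>"
  proof (rule closedin_Union, goal_cases)
    case 1 show ?case using finite_arcs by simp
  next
    case (2 S)
    then obtain e where e: "e \<in> arcs G" "S = (\<lambda>s. q (e, s)) ` K e" by blast
    have K: "K e = {0..len e} \<inter> (\<lambda>s. g (q (e, s))) -` C" by (auto simp: K_def)
    have "closed (K e)" unfolding K by (rule continuous_closed_preimage[OF assms[OF e(1)] closed_atLeastAtMost C])
    moreover have "bounded (K e)" by (rule bounded_subset[OF bounded_closed_interval[of 0 "len e"]]) (auto simp: K)
    ultimately have "compact (K e)" by (simp add: compact_eq_bounded_closed)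
    then have "compactin (top_of_set {0..len e}) (K e)"
      by (auto simp: compactin_subtopology K_def)
    from image_compactin[OF this continuous_map_edge[OF e(1)]]
    show ?case unfolding e(2) graph_topology_eq
      by (rule compactin_imp_closedin[OF GM.Hausdorff_space_mtopology])
  qed
  finally show "closedin (graph_topology G len) {x \<in> topspace (graph_topology G len). g x \<in> C}" .
qed auto

text \<open>\<open>u t x\<close> is the soft minimum at temperature \<open>\<kappa>\<close> of \<open>\<phi> j + a\<^sup>2 / (2 * (t + \<epsilon>))\<close> over \<open>j\<close>, where \<open>a\<close> is a
  \<open>C\<^sup>1\<close> approximation of the distance to \<open>y j\<close> on each edge which keeps the values at the endpoints and the
  slope bound. Its gradient is an average of gradients, hence the Hamilton--Jacobi inequality holds by Cauchy--Schwarz.\<close>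

lemma hopf_lax_subsolution:
  fixes \<phi> :: "'i \<Rightarrow> real" and y :: "'i \<Rightarrow> ('e \<times> real) set"
  assumes J: "finite J" "J \<noteq> {}" and y: "\<And>j. j \<in> J \<Longrightarrow> y j \<in> X"
    and pos: "0 < \<epsilon>" "0 < \<kappa>" "0 < \<beta>"
  obtains u w :: "real \<Rightarrow> ('e \<times> real) set \<Rightarrow> real" where
    "\<And>t. t \<in> {0..1} \<Longrightarrow> u t \<in> test_functions G len"
    "\<And>t x. t \<in> {0..1} \<Longrightarrow> x \<in> X \<Longrightarrow> ((\<lambda>t. u t x) has_real_derivative - w t x) (at t within {0..1})"
    "\<And>t p. t \<in> {0..1} \<Longrightarrow> p \<in> CE \<Longrightarrow> (grad len (u t \<circ> q) p)\<^sup>2 / 2 \<le> w t (q p)"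
    "\<And>t. t \<in> {0..1} \<Longrightarrow> continuous_map (graph_topology G len) euclideanreal (w t)"
    "\<And>\<eta>. 0 < \<eta> \<Longrightarrow> \<exists>\<delta>>0. \<forall>t\<in>{0..1}. \<forall>t'\<in>{0..1}. \<bar>t - t'\<bar> < \<delta> \<longrightarrow> (\<forall>x\<in>X. \<bar>w t x - w t' x\<bar> < \<eta>)"
    "\<And>t x j. t \<in> {0..1} \<Longrightarrow> x \<in> X \<Longrightarrow> j \<in> J \<Longrightarrow> u t x \<le> \<phi> j + (D x (y j) + \<beta>)\<^sup>2 / (2 * (t + \<epsilon>))"
    "\<And>t x. t \<in> {0..1} \<Longrightarrow> x \<in> X \<Longrightarrow>
       \<exists>j\<in>J. \<phi> j + (max 0 (D x (y j) - \<beta>))\<^sup>2 / (2 * (t + \<epsilon>)) - \<kappa> * ln (card J) \<le> u t x"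
proof -
  have "\<exists>a a'. (\<forall>s. (a has_real_derivative a' s) (at s)) \<and> continuous_on UNIV a' \<and>
     (\<forall>s\<in>{0..len e}. \<bar>a' s\<bar> \<le> 1) \<and> (\<forall>s\<in>{0..len e}. \<bar>a s - D (q (e, s)) (y j)\<bar> \<le> \<beta>) \<and>
     a 0 = D (q (e, 0)) (y j) \<and> a (len e) = D (q (e, len e)) (y j)" if "e \<in> arcs G" "j \<in> J" for e j
  proof -
    have lip: "\<bar>D (q (e, s)) (y j) - D (q (e, t)) (y j)\<bar> \<le> \<bar>s - t\<bar>" if "s \<in> {0..len e}" "t \<in> {0..len e}" for s t
    proof -
      have pts: "q (e, s) \<in> X" "q (e, t) \<in> X" "y j \<in> X" using that \<open>e \<in> arcs G\<close> \<open>j \<in> J\<close> y by (auto intro: q_in)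
      have "D (q (e, s)) (y j) \<le> D (q (e, s)) (q (e, t)) + D (q (e, t)) (y j)"
        "D (q (e, t)) (y j) \<le> D (q (e, t)) (q (e, s)) + D (q (e, s)) (y j)"
        using pts by (auto intro: GM.triangle)
      moreover have "D (q (e, s)) (q (e, t)) \<le> \<bar>s - t\<bar>" "D (q (e, t)) (q (e, s)) \<le> \<bar>s - t\<bar>"
        using graph_dist_edge[of e s t] graph_dist_edge[of e t s] that \<open>e \<in> arcs G\<close> by (auto simp: abs_minus_commute)
      ultimately show ?thesis by linarith
    qed
    show ?thesis
      by (rule C1_approximation_fixing_endpoints[of "len e" \<beta> "\<lambda>s. D (q (e, s)) (y j)"])
        (use len_pos[OF that(1)] pos(3) lip in \<open>blast+\<close>)
  qed
  then obtain a a' where aa: "\<And>e j. e \<in> arcs G \<Longrightarrow> j \<in> J \<Longrightarrow>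
     (\<forall>s. (a e j has_real_derivative a' e j s) (at s)) \<and> continuous_on UNIV (a' e j) \<and>
     (\<forall>s\<in>{0..len e}. \<bar>a' e j s\<bar> \<le> 1) \<and> (\<forall>s\<in>{0..len e}. \<bar>a e j s - D (q (e, s)) (y j)\<bar> \<le> \<beta>) \<and>
     a e j 0 = D (q (e, 0)) (y j) \<and> a e j (len e) = D (q (e, len e)) (y j)"
    by metis
  have ad: "(a e j has_real_derivative a' e j s) (at s)" if "e \<in> arcs G" "j \<in> J" for e j s using aa[OF that] by blast
  have a'c: "continuous_on UNIV (a' e j)" if "e \<in> arcs G" "j \<in> J" for e j using aa[OF that] by blast
  have a'1: "\<bar>a' e j s\<bar> \<le> 1" if "e \<in> arcs G" "j \<in> J" "s \<in> {0..len e}" for e j s using aa that by blast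
  have aD: "\<bar>a e j s - D (q (e, s)) (y j)\<bar> \<le> \<beta>" if "e \<in> arcs G" "j \<in> J" "s \<in> {0..len e}" for e j s using aa that by blast
  have aends: "a e j (end_param e b) = D (q (e, end_param e b)) (y j)" if "e \<in> arcs G" "j \<in> J" for e j b
    using aa[OF that] by (auto simp: end_param_def)
  have ac: "continuous_on UNIV (a e j)" if "e \<in> arcs G" "j \<in> J" for e j
    using ad[OF that] by (intro DERIV_continuous_on[where D="a' e j"]) (auto intro: has_field_derivative_at_within)
  \<comment> \<open>\<open>U\<close> is \<open>- \<kappa>\<close> times the logarithm of a partition
    function \<open>Z\<close>. \<open>V\<close> is minus its time derivative and \<open>g\<close>
    its slope; both are averages with weights \<open>E / Z\<close> of the corresponding quantities
    for \<open>c\<close>. The shift \<epsilon> removes the singularity at time 0.\<close>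
  define c where "c j t p = \<phi> j + (a (fst p) j (snd p))\<^sup>2 / (2 * (t + \<epsilon>))" for j t p
  define E where "E j t p = exp (- (c j t p) / \<kappa>)" for j t p
  define Z where "Z t p = (\<Sum>j\<in>J. E j t p)" for t p
  define U where "U t p = - \<kappa> * ln (Z t p)" for t p
  define V where "V t p = (\<Sum>j\<in>J. E j t p * ((a (fst p) j (snd p))\<^sup>2 / (2 * (t + \<epsilon>)\<^sup>2))) / Z t p" for t p
  define g where "g t p = (\<Sum>j\<in>J. E j t p * (a (fst p) j (snd p) * a' (fst p) j (snd p) / (t + \<epsilon>))) / Z t p" for t p
  have E0: "0 < E j t p" for j t p by (simp add: E_def)
  have Z0: "0 < Z t p" for t p unfolding Z_def using J E0 by (intro sum_pos) auto
  have Zne: "Z t p \<noteq> 0" for t p using Z0[of t p] by simp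
  \<comment> \<open>Here the exact endpoint values of \<open>a\<close> pay off: although built
    separately on each edge, \<open>a\<close> agrees on glued ends, so everything defined from it
    descends to the graph.\<close>
  have inv: "a (fst p) j (snd p) = a (fst p') j (snd p')" if pp: "p \<in> CE" "p' \<in> CE" "q p = q p'" "j \<in> J" for p p' j
  proof (cases "p = p'")
    case False
    then obtain v where "lies_at G len p v" "lies_at G len p' v"
      using q_eq_iff[OF pp(1,2)] pp(3) by blast
    then obtain b b' where b: "snd p = end_param (fst p) b" "snd p' = end_param (fst p') b'"
      by (cases p; cases p') (auto simp: lies_at_iff)
    have "a (fst p) j (snd p) = D (q p) (y j)" "a (fst p') j (snd p') = D (q p') (y j)"
      using aends[of "fst p" j b] aends[of "fst p'" j b'] pp b by (cases p; cases p'; force)+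
    then show ?thesis using pp by simp
  qed simp
  have Urep: "U t (rep (q p)) = U t p" and Vrep: "V t (rep (q p)) = V t p" if "p \<in> CE" for t p
  proof -
    have "U t p = U t p'" "V t p = V t p'" if "p \<in> CE" "p' \<in> CE" "q p = q p'" for p p'
      using inv[OF that] unfolding U_def V_def Z_def E_def c_def by auto
    note I = this
    show "U t (rep (q p)) = U t p" by (rule rep_invariant[OF I(1) that])
    show "V t (rep (q p)) = V t p" by (rule rep_invariant[OF I(2) that])
  qed
  have Ut: "((\<lambda>t. U t p) has_real_derivative - V t p) (at t within {0..1})" if t: "t \<in> {0..1}" for t p
  proof -
    have "((\<lambda>t. c j t p) has_real_derivative - ((a (fst p) j (snd p))\<^sup>2 / (2 * (t + \<epsilon>)\<^sup>2))) (at t within {0..1})" for j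
    proof -
      define A x where "A = (a (fst p) j (snd p))\<^sup>2" and "x = t + \<epsilon>"
      have x: "x > 0" using t pos by (auto simp: x_def)
      have "((\<lambda>t. \<phi> j + A / (2 * (t + \<epsilon>))) has_real_derivative - (A * 2) / ((2 * x) * (2 * x))) (at t within {0..1})"
        using x unfolding x_def by (auto intro!: derivative_eq_intros)
      also have "- (A * 2) / ((2 * x) * (2 * x)) = - (A / (2 * x\<^sup>2))"
        using x by (simp add: power2_eq_square field_simps)
      finally show ?thesis unfolding c_def A_def x_def .
    qed
    note dc = this
    have "((\<lambda>t. E j t p) has_real_derivative E j t p * ((a (fst p) j (snd p))\<^sup>2 / (2 * (t + \<epsilon>)\<^sup>2)) / \<kappa>) (at t within {0..1})" for j
      unfolding E_def using DERIV_chain2[OF DERIV_exp DERIV_cdivide[OF DERIV_minus[OF dc]]] by simp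
    then have "((\<lambda>t. Z t p) has_real_derivative (\<Sum>j\<in>J. E j t p * ((a (fst p) j (snd p))\<^sup>2 / (2 * (t + \<epsilon>)\<^sup>2)) / \<kappa>)) (at t within {0..1})"
      unfolding Z_def by (intro DERIV_sum) auto
    then have "((\<lambda>t. U t p) has_real_derivative - \<kappa> * (1 / Z t p * (\<Sum>j\<in>J. E j t p * ((a (fst p) j (snd p))\<^sup>2 / (2 * (t + \<epsilon>)\<^sup>2)) / \<kappa>))) (at t within {0..1})"
      unfolding U_def using Z0[of t p]
      by (intro DERIV_cmult DERIV_chain2[OF DERIV_ln_divide]) auto
    also have "- \<kappa> * (1 / Z t p * (\<Sum>j\<in>J. E j t p * ((a (fst p) j (snd p))\<^sup>2 / (2 * (t + \<epsilon>)\<^sup>2)) / \<kappa>)) = - V t p"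
      unfolding V_def sum_divide_distrib[symmetric] using pos by simp
    finally show ?thesis .
  qed
  have Us: "((\<lambda>s. U t (e, s)) has_real_derivative g t (e, s)) (at s)" if t: "t \<in> {0..1}" and e: "e \<in> arcs G" for t e s
  proof -
    have t0: "t + \<epsilon> > 0" using t pos by auto
    have "((\<lambda>s. c j t (e, s)) has_real_derivative a e j s * a' e j s / (t + \<epsilon>)) (at s)" if "j \<in> J" for j
    proof -
      have "((\<lambda>s. (a e j s)\<^sup>2) has_real_derivative 2 * a e j s * a' e j s) (at s)"
        using DERIV_power[OF ad[OF e that], of 2] by (simp add: mult_ac)
      from DERIV_add[OF DERIV_const DERIV_cdivide[OF this, of "2 * (t + \<epsilon>)"], of "\<phi> j"]
      have "((\<lambda>s. c j t (e, s)) has_real_derivative 2 * a e j s * a' e j s / (2 * (t + \<epsilon>))) (at s)"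
        unfolding c_def by simp
      also have "2 * a e j s * a' e j s / (2 * (t + \<epsilon>)) = a e j s * a' e j s / (t + \<epsilon>)"
        using t0 by (simp only: mult.assoc mult_divide_mult_cancel_left)
      finally show ?thesis .
    qed
    note dc = this
    have "((\<lambda>s. E j t (e, s)) has_real_derivative - (E j t (e, s) * (a e j s * a' e j s / (t + \<epsilon>)) / \<kappa>)) (at s)" if "j \<in> J" for j
      unfolding E_def using DERIV_chain2[OF DERIV_exp DERIV_cdivide[OF DERIV_minus[OF dc[OF that]]], of \<kappa>] by simp
    then have "((\<lambda>s. Z t (e, s)) has_real_derivative (\<Sum>j\<in>J. - (E j t (e, s) * (a e j s * a' e j s / (t + \<epsilon>)) / \<kappa>))) (at s)"
      unfolding Z_def by (intro DERIV_sum) auto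
    then have "((\<lambda>s. U t (e, s)) has_real_derivative - \<kappa> * (1 / Z t (e, s) * (\<Sum>j\<in>J. - (E j t (e, s) * (a e j s * a' e j s / (t + \<epsilon>)) / \<kappa>)))) (at s)"
      unfolding U_def using Z0[of t "(e, s)"]
      by (intro DERIV_cmult DERIV_chain2[OF DERIV_ln_divide]) auto
    also have "- \<kappa> * (1 / Z t (e, s) * (\<Sum>j\<in>J. - (E j t (e, s) * (a e j s * a' e j s / (t + \<epsilon>)) / \<kappa>))) = g t (e, s)"
      unfolding g_def sum_negf sum_divide_distrib[symmetric] using pos by simp
    finally show ?thesis .
  qed
  have cont: "continuous_on ({0..1} \<times> UNIV) (\<lambda>(t, s). V t (e, s))" "continuous_on UNIV (\<lambda>s. V t (e, s))"
      "continuous_on UNIV (\<lambda>s. g t (e, s))"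
    if e: "e \<in> arcs G" and t: "t \<in> {0..1}" for e t
  proof -
    have cfs: "continuous_on S (\<lambda>x. f (h x))" if "continuous_on UNIV f" "continuous_on S h" for f :: "real \<Rightarrow> real" and h :: "'z::topological_space \<Rightarrow> real" and S
      using continuous_on_compose2[OF that] by auto
    have aS: "continuous_on S (\<lambda>x. a e j (snd x))" if "j \<in> J" for S :: "(real \<times> real) set" and j
      by (rule cfs[OF ac[OF e that]]) (intro continuous_intros)
    have a'S: "continuous_on S (\<lambda>x. a' e j (snd x))" if "j \<in> J" for S :: "(real \<times> real) set" and j
      by (rule cfs[OF a'c[OF e that]]) (intro continuous_intros)
    define S :: "(real \<times> real) set" where "S = {0..1} \<times> UNIV"
    have ES: "continuous_on S (\<lambda>x. E j (fst x) (e, snd x))" if "j \<in> J" for j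
      unfolding E_def c_def fst_conv snd_conv using pos by (intro continuous_intros aS[OF that]) (auto simp: S_def)
    have ZS: "continuous_on S (\<lambda>x. Z (fst x) (e, snd x))"
      unfolding Z_def by (intro continuous_intros ES)
    have VS: "continuous_on S (\<lambda>x. V (fst x) (e, snd x))"
      unfolding V_def fst_conv snd_conv using pos Zne by (intro continuous_intros ES ZS aS) (auto simp: S_def)
    have gS: "continuous_on S (\<lambda>x. g (fst x) (e, snd x))"
      unfolding g_def fst_conv snd_conv using pos Zne by (intro continuous_intros ES ZS aS a'S) (auto simp: S_def)
    have P: "continuous_on UNIV (Pair t)" "range (Pair t) \<subseteq> S"
      using t by (auto simp: S_def intro!: continuous_intros)
    show "continuous_on ({0..1} \<times> UNIV) (\<lambda>(t, s). V t (e, s))"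
      using VS by (simp add: S_def case_prod_unfold)
    show "continuous_on UNIV (\<lambda>s. V t (e, s))" "continuous_on UNIV (\<lambda>s. g t (e, s))"
      using continuous_on_compose2[OF VS P] continuous_on_compose2[OF gS P] by simp_all
  qed
  define u where "u t x = U t (rep x)" for t x
  define w where "w t x = V t (rep x)" for t x
  have uq: "u t (q p) = U t p" and wq: "w t (q p) = V t p" if "p \<in> CE" for t p
    using Urep[OF that] Vrep[OF that] by (auto simp: u_def w_def)
  have duq: "((\<lambda>r. (u t \<circ> q) (e, r)) has_real_derivative g t (e, s)) (at s within {0..len e})"
    if "t \<in> {0..1}" "e \<in> arcs G" "s \<in> {0..len e}" for t e s
  proof (rule has_field_derivative_transform_within[OF has_field_derivative_at_within[OF Us[OF that(1,2)]] zero_less_one that(3)])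
    fix r assume "r \<in> {0..len e}"
    then show "U t (e, r) = (u t \<circ> q) (e, r)" using uq[of "(e, r)" t] that by simp
  qed
  have grad_u: "grad len (u t \<circ> q) (e, s) = g t (e, s)" if "t \<in> {0..1}" "e \<in> arcs G" "s \<in> {0..len e}" for t e s
    by (rule grad_eqI[OF duq[OF that] that(2,3)])
  have cauchy: "(g t (e, s))\<^sup>2 / 2 \<le> V t (e, s)" if "t \<in> {0..1}" "e \<in> arcs G" "s \<in> {0..len e}" for t e s
  proof -
    have t0: "t + \<epsilon> > 0" using that pos by auto
    define b where "b j = a e j s * a' e j s / (t + \<epsilon>)" for j
    have bj: "(b j)\<^sup>2 \<le> (a e j s)\<^sup>2 / (t + \<epsilon>)\<^sup>2" if "j \<in> J" for j
    proof -
      have "(a' e j s)\<^sup>2 \<le> 1" using a'1[OF \<open>e \<in> arcs G\<close> that \<open>s \<in> {0..len e}\<close>] by (simp add: abs_square_le_1)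
      then have "(a e j s)\<^sup>2 * (a' e j s)\<^sup>2 \<le> (a e j s)\<^sup>2" by (simp add: mult_left_le)
      then show ?thesis by (simp add: b_def power_divide power_mult_distrib divide_right_mono)
    qed
    have "(\<Sum>j\<in>J. E j t (e, s) * b j)\<^sup>2 = (\<Sum>j\<in>J. sqrt (E j t (e, s)) * (sqrt (E j t (e, s)) * b j))\<^sup>2"
      using E0 by (simp add: mult.assoc[symmetric] less_imp_le)
    also have "\<dots> \<le> (\<Sum>j\<in>J. (sqrt (E j t (e, s)))\<^sup>2) * (\<Sum>j\<in>J. (sqrt (E j t (e, s)) * b j)\<^sup>2)"
      by (rule Cauchy_Schwarz_ineq_sum)
    also have "\<dots> = Z t (e, s) * (\<Sum>j\<in>J. E j t (e, s) * (b j)\<^sup>2)"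
      using E0 by (simp add: Z_def power_mult_distrib less_imp_le)
    also have "\<dots> \<le> Z t (e, s) * (\<Sum>j\<in>J. E j t (e, s) * ((a e j s)\<^sup>2 / (t + \<epsilon>)\<^sup>2))"
      using E0 Z0 bj by (intro mult_left_mono sum_mono) (auto simp: less_imp_le)
    also have "\<dots> = Z t (e, s) * (2 * (V t (e, s) * Z t (e, s)))"
      using Zne by (simp add: V_def sum_distrib_left)
    finally have "(\<Sum>j\<in>J. E j t (e, s) * b j)\<^sup>2 / (Z t (e, s))\<^sup>2 \<le> 2 * V t (e, s)"
      using Z0[of t "(e, s)"] by (simp add: divide_le_eq power2_eq_square mult_ac)
    then show ?thesis by (simp add: g_def b_def power_divide)
  qed
  show thesis
  proof (rule that[of u w])
    fix t :: real assume t: "t \<in> {0..1}"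
    show "u t \<in> test_functions G len"
      unfolding test_functions_def mem_Collect_eq
    proof
      show C1: "u t \<circ> q \<in> C1_edges G len"
        unfolding C1_edges_def mem_Collect_eq
      proof (intro ballI conjI)
        fix e assume e: "e \<in> arcs G"
        show "(\<lambda>r. (u t \<circ> q) (e, r)) differentiable_on {0..len e}"
          unfolding differentiable_on_def
          using duq[OF t e] by (meson differentiableI has_field_derivative_imp_has_derivative)
        show "continuous_on {0..len e} (\<lambda>r. grad len (u t \<circ> q) (e, r))"
          by (rule continuous_on_cong[THEN iffD2, OF refl grad_u[OF t e]])
            (auto intro: continuous_on_subset[OF cont(3)[OF e t]])
      qed
      show "continuous_map (graph_topology G len) euclideanreal (u t)"
      proof (rule edgewise_continuous_map)
        fix e assume e: "e \<in> arcs G"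
        show "continuous_on {0..len e} (\<lambda>s. u t (q (e, s)))"
          using duq[OF t e] by (intro DERIV_continuous_on[where D = "\<lambda>s. g t (e, s)"]) auto
      qed
    qed
    show "continuous_map (graph_topology G len) euclideanreal (w t)"
    proof (rule edgewise_continuous_map)
      fix e assume e: "e \<in> arcs G"
      show "continuous_on {0..len e} (\<lambda>s. w t (q (e, s)))"
        by (rule continuous_on_cong[THEN iffD2, OF refl wq])
          (use e in \<open>auto intro: continuous_on_subset[OF cont(2)[OF e t]]\<close>)
    qed
    fix x assume x: "x \<in> X"
    show "((\<lambda>t. u t x) has_real_derivative - w t x) (at t within {0..1})"
      unfolding u_def w_def by (rule Ut[OF t])
    obtain e s where r: "rep x = (e, s)" and es: "e \<in> arcs G" "s \<in> {0..len e}" using rep(1)[OF x] by auto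
    have xq: "q (e, s) = x" using rep(2)[OF x] r by simp
    have t0: "t + \<epsilon> > 0" using t pos by auto
    have lnE: "- \<kappa> * ln (E j t p) = c j t p" for j p using pos by (simp add: E_def)
    show "u t x \<le> \<phi> j + (D x (y j) + \<beta>)\<^sup>2 / (2 * (t + \<epsilon>))" if j: "j \<in> J" for j
    proof -
      have "E j t (e, s) \<le> Z t (e, s)"
        unfolding Z_def using j J E0 by (intro member_le_sum) (auto simp: less_imp_le)
      then have "ln (E j t (e, s)) \<le> ln (Z t (e, s))" using ln_le_cancel_iff[OF E0 Z0] by blast
      then have "u t x \<le> c j t (e, s)"
        unfolding u_def r U_def lnE[symmetric] using pos by simp
      moreover have "(a e j s)\<^sup>2 \<le> (D x (y j) + \<beta>)\<^sup>2"
      proof -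
        have "\<bar>a e j s\<bar> \<le> D x (y j) + \<beta>"
          using aD[OF es(1) j es(2)] GM.nonneg[of x "y j"] unfolding xq by linarith
        then have "\<bar>a e j s\<bar>\<^sup>2 \<le> (D x (y j) + \<beta>)\<^sup>2" by (rule power_mono) simp
        then show ?thesis by simp
      qed
      then have "c j t (e, s) \<le> \<phi> j + (D x (y j) + \<beta>)\<^sup>2 / (2 * (t + \<epsilon>))"
        using t0 by (simp add: c_def divide_right_mono)
      ultimately show ?thesis by linarith
    qed
    show "\<exists>j\<in>J. \<phi> j + (max 0 (D x (y j) - \<beta>))\<^sup>2 / (2 * (t + \<epsilon>)) - \<kappa> * ln (card J) \<le> u t x"
    proof -
      \<comment> \<open>The largest weight belongs to the smallest \<open>c\<close>. Bounding
        \<open>Z\<close> by \<open>card J\<close> times this weight costs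
        \<open>\<kappa> * ln (card J)\<close>.\<close>
      obtain j where j: "j \<in> J" "\<And>i. i \<in> J \<Longrightarrow> E i t (e, s) \<le> E j t (e, s)"
        using Max_in[of "(\<lambda>j. E j t (e, s)) ` J"] Max_ge[of "(\<lambda>j. E j t (e, s)) ` J"] J by fastforce
      have "Z t (e, s) \<le> (\<Sum>i\<in>J. E j t (e, s))" unfolding Z_def by (intro sum_mono j(2))
      then have "Z t (e, s) \<le> card J * E j t (e, s)" by simp
      then have "ln (Z t (e, s)) \<le> ln (card J * E j t (e, s))" using ln_le_cancel_iff[OF Z0 order_less_le_trans[OF Z0]] by blast
      also have "\<dots> = ln (card J) + ln (E j t (e, s))" using J E0[of j t "(e, s)"] by (subst ln_mult) (auto simp: card_gt_0_iff)
      finally have "\<kappa> * ln (Z t (e, s)) \<le> \<kappa> * (ln (card J) + ln (E j t (e, s)))" using pos by simp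
      then have "c j t (e, s) - \<kappa> * ln (card J) \<le> u t x"
        unfolding u_def r U_def lnE[symmetric] by (simp add: algebra_simps)
      moreover have "(max 0 (D x (y j) - \<beta>))\<^sup>2 \<le> (a e j s)\<^sup>2"
      proof -
        have "max 0 (D x (y j) - \<beta>) \<le> \<bar>a e j s\<bar>"
          using aD[OF es(1) j(1) es(2)] unfolding xq by linarith
        then have "(max 0 (D x (y j) - \<beta>))\<^sup>2 \<le> \<bar>a e j s\<bar>\<^sup>2" by (rule power_mono) simp
        then show ?thesis by simp
      qed
      then have "\<phi> j + (max 0 (D x (y j) - \<beta>))\<^sup>2 / (2 * (t + \<epsilon>)) \<le> c j t (e, s)"
        using t0 by (simp add: c_def divide_right_mono)
      ultimately show ?thesis using j(1) by (intro bexI[of _ j]) auto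
    qed
  next
    fix t :: real and p assume t: "t \<in> {0..1}" and p: "p \<in> CE"
    then obtain e s where es: "p = (e, s)" "e \<in> arcs G" "s \<in> {0..len e}" by auto
    show "(grad len (u t \<circ> q) p)\<^sup>2 / 2 \<le> w t (q p)"
      using cauchy[OF t es(2,3)] grad_u[OF t es(2,3)] wq[OF p] by (simp add: es(1))
  next
    fix \<eta> :: real assume \<eta>: "0 < \<eta>"
    have "\<exists>d>0. \<forall>t\<in>{0..1}. \<forall>t'\<in>{0..1}. \<bar>t - t'\<bar> < d \<longrightarrow> (\<forall>s\<in>{0..len e}. \<bar>V t (e, s) - V t' (e, s)\<bar> < \<eta>)"
      if e: "e \<in> arcs G" for e
    proof -
      have "continuous_on ({0..1} \<times> {0..len e}) (\<lambda>(t, s). V t (e, s))"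
        using cont(1)[OF e, of 0] by (rule continuous_on_subset) auto
      then have "uniformly_continuous_on ({0..1} \<times> {0..len e}) (\<lambda>(t, s). V t (e, s))"
        by (rule compact_uniformly_continuous) (auto intro: compact_Times)
      then obtain d where d: "d > 0" "\<And>z z'. z \<in> {0..1} \<times> {0..len e} \<Longrightarrow> z' \<in> {0..1} \<times> {0..len e} \<Longrightarrow> dist z' z < d \<Longrightarrow>
          dist (case z' of (t, s) \<Rightarrow> V t (e, s)) (case z of (t, s) \<Rightarrow> V t (e, s)) < \<eta>"
        using \<eta> unfolding uniformly_continuous_on_def by metis
      show ?thesis
      proof (intro exI[of _ d] conjI ballI impI d(1))
        fix t t' s assume "t \<in> {0..1::real}" "t' \<in> {0..1::real}" "\<bar>t - t'\<bar> < d" "s \<in> {0..len e}"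
        then show "\<bar>V t (e, s) - V t' (e, s)\<bar> < \<eta>"
          using d(2)[of "(t', s)" "(t, s)"] by (simp add: dist_Pair_Pair dist_real_def)
      qed
    qed
    then obtain d where d: "\<And>e. e \<in> arcs G \<Longrightarrow> d e > 0" "\<And>e t t' s. e \<in> arcs G \<Longrightarrow> t \<in> {0..1} \<Longrightarrow> t' \<in> {0..1} \<Longrightarrow>
       \<bar>t - t'\<bar> < d e \<Longrightarrow> s \<in> {0..len e} \<Longrightarrow> \<bar>V t (e, s) - V t' (e, s)\<bar> < \<eta>" by metis
    define \<delta> where "\<delta> = Min (insert 1 (d ` arcs G))"
    have \<delta>: "\<delta> > 0" "\<And>e. e \<in> arcs G \<Longrightarrow> \<delta> \<le> d e" using d(1) finite_arcs by (auto simp: \<delta>_def)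
    show "\<exists>\<delta>>0. \<forall>t\<in>{0..1}. \<forall>t'\<in>{0..1}. \<bar>t - t'\<bar> < \<delta> \<longrightarrow> (\<forall>x\<in>X. \<bar>w t x - w t' x\<bar> < \<eta>)"
    proof (intro exI[of _ \<delta>] conjI ballI impI \<delta>(1))
      fix t t' :: real and x assume *: "t \<in> {0..1}" "t' \<in> {0..1}" "\<bar>t - t'\<bar> < \<delta>" "x \<in> X"
      obtain e s where "rep x = (e, s)" "e \<in> arcs G" "s \<in> {0..len e}" using rep(1)[OF *(4)] by auto
      then show "\<bar>w t x - w t' x\<bar> < \<eta>" using d(2)[of e t t' s] \<delta>(2)[of e] * by (simp add: w_def)
    qed
  qed
qed

section \<open>The action bounds the transport cost\<close>

abbreviation "GG \<equiv> GB \<Otimes>\<^sub>M GB"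

section \<open>Measurability of the distance\<close>

lemma route_length_measurable[measurable]:
  "(\<lambda>\<omega>. route_length k (rep (fst \<omega>)) (rep (snd \<omega>))) \<in> borel_measurable GG"
proof -
  have a[measurable]: "(\<lambda>\<omega>. fst (rep (fst \<omega>))) \<in> measurable GG (count_space (arcs G))"
    "(\<lambda>\<omega>. fst (rep (snd \<omega>))) \<in> measurable GG (count_space (arcs G))"
    by measurable
  have f[measurable]: "(\<lambda>\<omega>. F (fst (rep (fst \<omega>)))) \<in> borel_measurable GG" "(\<lambda>\<omega>. F (fst (rep (snd \<omega>)))) \<in> borel_measurable GG" for F :: "'e \<Rightarrow> real"
    using measurable_compose[OF a(1), of F borel] measurable_compose[OF a(2), of F borel] by auto
  have f2[measurable]: "(\<lambda>\<omega>. F (fst (rep (fst \<omega>))) (fst (rep (snd \<omega>)))) \<in> borel_measurable GG" for F :: "'e \<Rightarrow> 'e \<Rightarrow> real"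
    by (rule measurable_compose_countable'[OF f(2) a(1)]) (simp add: countable_finite)
  show ?thesis
  proof (cases k)
    case None
    have "route_length None p p' = \<bar>snd p' - snd p\<bar>" for p p' by (cases p; cases p') simp
    then show ?thesis unfolding None by simp
  next
    case (Some ab)
    obtain \<alpha> \<beta> where ab: "ab = (\<alpha>, \<beta>)" by (cases ab)
    have "route_length (Some (\<alpha>, \<beta>)) p p' = \<bar>end_param (fst p) \<alpha> - snd p\<bar> +
      vertex_dist (end_vertex (fst p) \<alpha>) (end_vertex (fst p') \<beta>) + \<bar>snd p' - end_param (fst p') \<beta>\<bar>" for p p'
      by (cases p; cases p') simp
    then show ?thesis unfolding Some ab
      using f2[of "\<lambda>e f. vertex_dist (end_vertex e \<alpha>) (end_vertex f \<beta>)"] f(1)[of "\<lambda>e. end_param e \<alpha>"] f(2)[of "\<lambda>e. end_param e \<beta>"]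
      by simp
  qed
qed

lemma route_valid_measurable[measurable]:
  "Measurable.pred GG (\<lambda>\<omega>. route_valid k (rep (fst \<omega>)) (rep (snd \<omega>)))"
proof (cases "k = None")
  case True
  have a[measurable]: "(\<lambda>\<omega>. fst (rep (fst \<omega>))) \<in> measurable GG (count_space (arcs G))"
    "(\<lambda>\<omega>. fst (rep (snd \<omega>))) \<in> measurable GG (count_space (arcs G))"
    by measurable
  have "Measurable.pred GG (\<lambda>\<omega>. (\<exists>e\<in>arcs G. fst (rep (fst \<omega>)) = e \<and> fst (rep (snd \<omega>)) = e))"
    by (intro pred_intros_finite pred_intros_logic) (auto simp: finite_arcs)
  moreover have "route_valid k (rep (fst \<omega>)) (rep (snd \<omega>)) \<longleftrightarrow> (\<exists>e\<in>arcs G. fst (rep (fst \<omega>)) = e \<and> fst (rep (snd \<omega>)) = e)"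
    if "\<omega> \<in> space GG" for \<omega>
    using that rep(1)[of "fst \<omega>"] True by (auto simp: route_valid_def space_pair_measure)
  ultimately show ?thesis by (simp cong: measurable_cong)
next
  case False
  then have "(\<lambda>\<omega>. route_valid k (rep (fst \<omega>)) (rep (snd \<omega>))) = (\<lambda>_. True)" by (auto simp: route_valid_def)
  then show ?thesis by simp
qed

text \<open>The distance is a minimum over finitely many routes, so a sublevel set is a finite union
  of sets on which a route is valid and short enough.\<close>

lemma graph_dist_measurable[measurable]: "(\<lambda>\<omega>. D (fst \<omega>) (snd \<omega>)) \<in> borel_measurable GG"
  unfolding borel_measurable_iff_le
proof
  fix a :: real
  have "{\<omega> \<in> space GG. D (fst \<omega>) (snd \<omega>) \<le> a} =
    (\<Union>k. {\<omega> \<in> space GG. route_valid k (rep (fst \<omega>)) (rep (snd \<omega>)) \<and> route_length k (rep (fst \<omega>)) (rep (snd \<omega>)) \<le> a})"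
  proof (intro set_eqI iffI; clarsimp simp: space_pair_measure)
    fix x y assume xy: "x \<in> X" "y \<in> X"
    note r = graph_dist_routes(1,2)[OF rep(1)[OF xy(1)] rep(1)[OF xy(2)], unfolded rep(2)[OF xy(1)] rep(2)[OF xy(2)]]
    show "\<exists>k. route_valid k (rep x) (rep y) \<and> route_length k (rep x) (rep y) \<le> a" if "D x y \<le> a"
      using r(1) that by auto
    show "D x y \<le> a" if "route_valid k (rep x) (rep y)" "route_length k (rep x) (rep y) \<le> a" for k
      using r(2)[OF that(1)] that(2) by simp
  qed
  also have "\<dots> \<in> sets GG" by (intro sets.finite_UN) auto
  finally show "{\<omega> \<in> space GG. D (fst \<omega>) (snd \<omega>) \<le> a} \<in> sets GG" .
qed

subsection \<open>Discretization\<close>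

text \<open>Cells are read off from the chosen representative, so each vertex belongs to the cell of
  one edge end only and the cells form a genuine partition of the graph.\<close>

definition cell :: "real \<Rightarrow> ('e \<times> real) set \<Rightarrow> 'e \<times> int" where
  "cell \<delta> x = (fst (rep x), \<lfloor>snd (rep x) / \<delta>\<rfloor>)"

definition cells :: "real \<Rightarrow> ('e \<times> int) set" where "cells \<delta> = cell \<delta> ` X"

definition cell_point :: "real \<Rightarrow> 'e \<times> int \<Rightarrow> ('e \<times> real) set" where
  "cell_point \<delta> i = (SOME x. x \<in> X \<and> cell \<delta> x = i)"

lemma rep_components: "x \<in> X \<Longrightarrow> fst (rep x) \<in> arcs G" "x \<in> X \<Longrightarrow> snd (rep x) \<in> {0..len (fst (rep x))}"
  using rep(1)[of x] by auto

lemma cells_finite: assumes "0 < \<delta>" shows "finite (cells \<delta>)"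
proof (rule finite_subset)
  show "cells \<delta> \<subseteq> (SIGMA e:arcs G. {0..\<lfloor>len e / \<delta>\<rfloor>})"
  proof
    fix i assume "i \<in> cells \<delta>"
    then obtain x where x: "x \<in> X" "i = cell \<delta> x" by (auto simp: cells_def)
    then show "i \<in> (SIGMA e:arcs G. {0..\<lfloor>len e / \<delta>\<rfloor>})"
      using rep(1)[OF x(1)] assms by (auto simp: cell_def intro!: floor_mono divide_right_mono)
  qed
qed (use finite_arcs in auto)

lemma cell_measurable: assumes "0 < \<delta>" shows "cell \<delta> \<in> measurable GB (count_space (cells \<delta>))"
proof (rule measurable_count_space_eq2[THEN iffD2, OF cells_finite[OF assms]], intro conjI ballI)
  show "cell \<delta> \<in> space GB \<rightarrow> cells \<delta>" by (auto simp: cells_def)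
  fix i assume "i \<in> cells \<delta>"
  then have i: "fst i \<in> arcs G" using rep_components(1) by (auto simp: cells_def cell_def)
  have "cell \<delta> -` {i} \<inter> space GB = ((\<lambda>x. fst (rep x)) -` {fst i} \<inter> space GB) \<inter> {x \<in> space GB. \<lfloor>snd (rep x) / \<delta>\<rfloor> = snd i}"
    by (cases i) (auto simp: cell_def)
  also have "\<dots> \<in> sets GB"
  proof (rule sets.Int)
    show "(\<lambda>x. fst (rep x)) -` {fst i} \<inter> space GB \<in> sets GB"
      using i by (intro measurable_sets[OF rep_arc_measurable(1)]) auto
    have "{x \<in> space GB. \<lfloor>snd (rep x) / \<delta>\<rfloor> = snd i} =
      (\<lambda>x. snd (rep x) / \<delta>) -` {of_int (snd i)..<of_int (snd i) + 1} \<inter> space GB"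
      by (auto simp: floor_eq_iff)
    also have "\<dots> \<in> sets GB" by measurable
    finally show "{x \<in> space GB. \<lfloor>snd (rep x) / \<delta>\<rfloor> = snd i} \<in> sets GB" .
  qed
  finally show "cell \<delta> -` {i} \<inter> space GB \<in> sets GB" .
qed

lemma cell_point: "i \<in> cells \<delta> \<Longrightarrow> cell_point \<delta> i \<in> X \<and> cell \<delta> (cell_point \<delta> i) = i"
  unfolding cell_point_def by (rule someI_ex) (auto simp: cells_def)

lemma cell_dist: assumes "x \<in> X" "y \<in> X" "cell \<delta> x = cell \<delta> y" "0 < \<delta>" shows "D x y \<le> \<delta>"
proof -
  have eq: "fst (rep x) = fst (rep y)" "\<lfloor>snd (rep x) / \<delta>\<rfloor> = \<lfloor>snd (rep y) / \<delta>\<rfloor>"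
    using assms(3) by (auto simp: cell_def)
  have "\<bar>snd (rep y) / \<delta> - snd (rep x) / \<delta>\<bar> \<le> 1"
    using eq(2) by linarith
  then have "\<bar>snd (rep y) - snd (rep x)\<bar> \<le> \<delta>"
    using assms(4) by (simp add: diff_divide_distrib[symmetric] field_simps abs_divide)
  moreover have "D (q (rep x)) (q (rep y)) \<le> \<bar>snd (rep y) - snd (rep x)\<bar>"
    using graph_dist_edge[of "fst (rep x)" "snd (rep x)" "snd (rep y)"] rep(1)[OF assms(1)] rep(1)[OF assms(2)] eq(1)
    by (cases "rep x"; cases "rep y") auto
  ultimately show ?thesis using rep(2) assms by simp
qed

lemma cell_point_dist: "x \<in> X \<Longrightarrow> 0 < \<delta> \<Longrightarrow> D x (cell_point \<delta> (cell \<delta> x)) \<le> \<delta>"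
  using cell_point[of "cell \<delta> x" \<delta>] by (intro cell_dist) (auto simp: cells_def)

context
  fixes M :: "('e \<times> real) set measure" and \<delta> :: real
  assumes M: "M \<in> prob_measures G len" and \<delta>: "0 < \<delta>"
begin

definition cell_mass :: "'e \<times> int \<Rightarrow> real" where
  "cell_mass i = measure M {x \<in> X. cell \<delta> x = i}"

lemma cell_M: "cell \<delta> \<in> measurable M (count_space (cells \<delta>))"
  using cell_measurable[OF \<delta>] measurable_cong_sets[OF prob_measuresD(2)[OF M] refl] by blast

lemma cell_set: assumes "i \<in> cells \<delta>" shows "{x \<in> X. cell \<delta> x = i} \<in> sets M"
proof -
  have "{x \<in> X. cell \<delta> x = i} = cell \<delta> -` {i} \<inter> space M" using prob_measuresD(3)[OF M] by auto
  then show ?thesis using measurable_sets[OF cell_M, of "{i}"] assms by simp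
qed

lemma nn_integral_cell: "(\<integral>\<^sup>+x. f (cell \<delta> x) \<partial>M) = (\<Sum>i\<in>cells \<delta>. f i * ennreal (cell_mass i))"
proof -
  interpret prob_space M using prob_measuresD[OF M] by simp
  have "(\<integral>\<^sup>+x. f (cell \<delta> x) \<partial>M) = (\<integral>\<^sup>+x. (\<Sum>i\<in>cells \<delta>. f i * indicator {x \<in> X. cell \<delta> x = i} x) \<partial>M)"
  proof (rule nn_integral_cong)
    fix x assume "x \<in> space M"
    then have x: "x \<in> X" using prob_measuresD(3)[OF M] by simp
    have "(\<Sum>i\<in>cells \<delta>. f i * indicator {x \<in> X. cell \<delta> x = i} x) = (\<Sum>i\<in>cells \<delta>. if i = cell \<delta> x then f i else 0)"
      using x by (intro sum.cong) auto
    then show "f (cell \<delta> x) = (\<Sum>i\<in>cells \<delta>. f i * indicator {x \<in> X. cell \<delta> x = i} x)"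
      using cells_finite[OF \<delta>] x by (simp add: cells_def)
  qed
  also have "\<dots> = (\<Sum>i\<in>cells \<delta>. \<integral>\<^sup>+x. f i * indicator {x \<in> X. cell \<delta> x = i} x \<partial>M)"
    using cell_set by (intro nn_integral_sum) auto
  also have "\<dots> = (\<Sum>i\<in>cells \<delta>. f i * ennreal (cell_mass i))"
    using cell_set by (intro sum.cong refl) (auto simp: nn_integral_cmult_indicator emeasure_eq_measure cell_mass_def)
  finally show ?thesis .
qed

lemma cell_mass_nonneg: "0 \<le> cell_mass i" by (simp add: cell_mass_def)

lemma cell_mass_sum: "sum cell_mass (cells \<delta>) = 1"
proof -
  interpret prob_space M using prob_measuresD[OF M] by simp
  have "ennreal (sum cell_mass (cells \<delta>)) = (\<Sum>i\<in>cells \<delta>. 1 * ennreal (cell_mass i))"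
    by (simp add: sum_ennreal cell_mass_nonneg)
  also have "\<dots> = ennreal 1" unfolding nn_integral_cell[symmetric] by (simp add: emeasure_space_1)
  finally show ?thesis by (simp add: sum_nonneg cell_mass_nonneg)
qed

lemma integral_cell: fixes f :: "'e \<times> int \<Rightarrow> real"
  shows "(\<integral>x. f (cell \<delta> x) \<partial>M) = (\<Sum>i\<in>cells \<delta>. f i * cell_mass i)" "integrable M (\<lambda>x. f (cell \<delta> x))"
proof -
  interpret prob_space M using prob_measuresD[OF M] by simp
  define A where "A i = {x \<in> X. cell \<delta> x = i}" for i
  have A: "A i \<in> sets M" if "i \<in> cells \<delta>" for i unfolding A_def by (rule cell_set[OF that])
  have eq: "f (cell \<delta> x) = (\<Sum>i\<in>cells \<delta>. f i * indicator (A i) x)" if "x \<in> X" for x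
  proof -
    have "(\<Sum>i\<in>cells \<delta>. f i * indicator (A i) x) = (\<Sum>i\<in>cells \<delta>. if i = cell \<delta> x then f i else 0)"
      using that by (intro sum.cong) (auto simp: A_def)
    then show ?thesis using cells_finite[OF \<delta>] that by (simp add: cells_def)
  qed
  have int: "integrable M (\<lambda>x. f i * indicator (A i) x)" if "i \<in> cells \<delta>" for i
    using A[OF that] by (simp add: integrable_real_indicator emeasure_eq_measure)
  have cong: "integrable M (\<lambda>x. f (cell \<delta> x)) = integrable M (\<lambda>x. \<Sum>i\<in>cells \<delta>. f i * indicator (A i) x)"
    "(\<integral>x. f (cell \<delta> x) \<partial>M) = (\<integral>x. (\<Sum>i\<in>cells \<delta>. f i * indicator (A i) x) \<partial>M)"
    using eq prob_measuresD(3)[OF M] by (auto intro!: Bochner_Integration.integrable_cong Bochner_Integration.integral_cong)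
  show "integrable M (\<lambda>x. f (cell \<delta> x))" unfolding cong using int by (intro Bochner_Integration.integrable_sum) auto
  have "(\<integral>x. (\<Sum>i\<in>cells \<delta>. f i * indicator (A i) x) \<partial>M) = (\<Sum>i\<in>cells \<delta>. \<integral>x. f i * indicator (A i) x \<partial>M)"
    using int by (intro Bochner_Integration.integral_sum) auto
  also have "\<dots> = (\<Sum>i\<in>cells \<delta>. f i * cell_mass i)"
    using A sets.sets_into_space by (intro sum.cong) (auto simp: cell_mass_def A_def[symmetric] Int_absorb2)
  finally show "(\<integral>x. f (cell \<delta> x) \<partial>M) = (\<Sum>i\<in>cells \<delta>. f i * cell_mass i)" unfolding cong .
qed

end

text \<open>On a product of two cells the coupling is the product measure rescaled to the mass
  prescribed by \<pi>. The row and column sums of \<pi> then give the marginals, not only their cell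
  masses but the measures themselves.\<close>

lemma coupling_of_cell_masses:
  assumes M: "M \<in> prob_measures G len" and N: "N \<in> prob_measures G len" and \<delta>: "0 < \<delta>"
    and \<pi>: "\<And>i j. 0 \<le> \<pi> (i, j)" "\<And>i. i \<in> cells \<delta> \<Longrightarrow> (\<Sum>j\<in>cells \<delta>. \<pi> (i, j)) = cell_mass M \<delta> i"
      "\<And>j. j \<in> cells \<delta> \<Longrightarrow> (\<Sum>i\<in>cells \<delta>. \<pi> (i, j)) = cell_mass N \<delta> j"
  obtains \<sigma> where "\<sigma> \<in> couplings G len M N"
    "\<And>f :: _ \<Rightarrow> _ \<Rightarrow> ennreal. (\<integral>\<^sup>+\<omega>. f (cell \<delta> (fst \<omega>)) (cell \<delta> (snd \<omega>)) \<partial>\<sigma>) = (\<Sum>i\<in>cells \<delta>. \<Sum>j\<in>cells \<delta>. f i j * ennreal (\<pi> (i, j)))"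
proof -
  define I where "I = cells \<delta>"
  define a b where "a = cell_mass M \<delta>" and "b = cell_mass N \<delta>"
  have fin: "finite I" unfolding I_def by (rule cells_finite[OF \<delta>])
  interpret M: prob_space M using prob_measuresD[OF M] by simp
  interpret N: prob_space N using prob_measuresD[OF N] by simp
  interpret MN: pair_prob_space M N ..
  \<comment> \<open>Cells of mass zero get density 0. The marginal conditions force \<pi> to vanish
    there, so no mass is lost.\<close>
  define h where "h i j = (if a i = 0 \<or> b j = 0 then 0 else ennreal (\<pi> (i, j) / (a i * b j)))" for i j
  have a0: "0 \<le> a i" and b0: "0 \<le> b i" for i by (simp_all add: a_def b_def cell_mass_nonneg[OF M \<delta>] cell_mass_nonneg[OF N \<delta>])
  have h\<pi>: "h i j * ennreal (a i) * ennreal (b j) = ennreal (\<pi> (i, j))" if "i \<in> I" "j \<in> I" for i j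
  proof (cases "a i = 0 \<or> b j = 0")
    case True
    have "\<pi> (i, j) \<le> a i" "\<pi> (i, j) \<le> b j"
      using member_le_sum[of j I "\<lambda>j. \<pi> (i, j)"] member_le_sum[of i I "\<lambda>i. \<pi> (i, j)"] that fin \<pi>
      by (auto simp: a_def b_def I_def)
    then have "\<pi> (i, j) = 0" using True \<pi>(1)[of i j] by auto
    then show ?thesis using True by (auto simp: h_def)
  next
    case False
    then have "0 < a i" "0 < b j" using a0[of i] b0[of j] by auto
    then show ?thesis using \<pi>(1)[of i j] by (simp add: h_def ennreal_mult[symmetric])
  qed
  have cM: "cell \<delta> \<in> measurable M (count_space I)" and cN: "cell \<delta> \<in> measurable N (count_space I)"
    unfolding I_def by (rule cell_M[OF M \<delta>], rule cell_M[OF N \<delta>])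
  have gM: "(\<lambda>y. g (cell \<delta> y)) \<in> borel_measurable M" and gN: "(\<lambda>y. g (cell \<delta> y)) \<in> borel_measurable N" for g :: "_ \<Rightarrow> ennreal"
    by (rule measurable_compose[OF cM], simp, rule measurable_compose[OF cN], simp)
  have c1: "(\<lambda>\<omega>. cell \<delta> (fst \<omega>)) \<in> measurable (M \<Otimes>\<^sub>M N) (count_space I)"
    by (rule measurable_compose[OF measurable_fst cM])
  have c2: "(\<lambda>\<omega>. cell \<delta> (snd \<omega>)) \<in> measurable (M \<Otimes>\<^sub>M N) (count_space I)"
    by (rule measurable_compose[OF measurable_snd cN])
  have fm: "(\<lambda>\<omega>. f (cell \<delta> (fst \<omega>)) (cell \<delta> (snd \<omega>))) \<in> borel_measurable (M \<Otimes>\<^sub>M N)" for f :: "_ \<Rightarrow> _ \<Rightarrow> ennreal"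
    by (rule measurable_compose_countable'[OF measurable_compose[OF c2] c1]) (use fin in \<open>auto intro: countable_finite\<close>)
  have sMN: "sets (M \<Otimes>\<^sub>M N) = sets GG"
    by (intro sets_pair_measure_cong prob_measuresD(2) M N)
  have spM: "space M = X" "space N = X" using prob_measuresD(3)[OF M] prob_measuresD(3)[OF N] .
  have cI: "cell \<delta> x \<in> I" if "x \<in> X" for x using that by (auto simp: I_def cells_def)
  define \<sigma> where "\<sigma> = density (M \<Otimes>\<^sub>M N) (\<lambda>\<omega>. h (cell \<delta> (fst \<omega>)) (cell \<delta> (snd \<omega>)))"
  have s\<sigma>: "sets \<sigma> = sets GG" by (simp add: \<sigma>_def sMN)
  have row: "AE x in M. (\<integral>\<^sup>+y. h (cell \<delta> x) (cell \<delta> y) \<partial>N) = 1"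
  proof -
    have "(\<integral>\<^sup>+x. (if a (cell \<delta> x) = 0 then 1 else 0) \<partial>M) = (\<Sum>i\<in>I. (if a i = 0 then 1 else 0) * ennreal (a i))"
      unfolding I_def a_def by (rule nn_integral_cell[OF M \<delta>])
    also have "\<dots> = 0" by (intro sum.neutral) auto
    finally have "AE x in M. (if a (cell \<delta> x) = 0 then 1 else 0 :: ennreal) = 0"
      using measurable_compose[OF cM, of "\<lambda>i. if a i = 0 then 1 else 0 :: ennreal" borel]
      by (subst (asm) nn_integral_0_iff_AE) auto
    then show ?thesis
    proof (rule AE_mp, intro AE_I2 impI)
      fix x assume x: "x \<in> space M" "(if a (cell \<delta> x) = 0 then 1 else 0 :: ennreal) = 0"
      define i where "i = cell \<delta> x"
      have i: "i \<in> I" "a i > 0" using x cI[of x] a0[of i] spM by (auto simp: i_def split: if_splits)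
      have "(\<integral>\<^sup>+y. h i (cell \<delta> y) \<partial>N) = (\<Sum>j\<in>I. h i j * ennreal (b j))"
        unfolding I_def b_def by (rule nn_integral_cell[OF N \<delta>])
      also have "\<dots> = (\<Sum>j\<in>I. ennreal (\<pi> (i, j) / a i))"
      proof (intro sum.cong refl)
        fix j assume "j \<in> I"
        have "ennreal (a i) * (h i j * ennreal (b j)) = ennreal (a i) * ennreal (\<pi> (i, j) / a i)"
          using h\<pi>[OF i(1) \<open>j \<in> I\<close>] i(2) \<pi>(1)[of i j] by (simp add: ennreal_mult[symmetric] mult_ac)
        then show "h i j * ennreal (b j) = ennreal (\<pi> (i, j) / a i)"
          using i(2) by (simp add: ennreal_mult_cancel_left)
      qed
      also have "\<dots> = ennreal ((\<Sum>j\<in>I. \<pi> (i, j)) / a i)"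
        using \<pi>(1) i(2) by (subst sum_ennreal) (auto simp: sum_divide_distrib)
      also have "\<dots> = 1" using \<pi>(2)[of i] i by (simp add: a_def I_def)
      finally show "(\<integral>\<^sup>+y. h (cell \<delta> x) (cell \<delta> y) \<partial>N) = 1" by (simp add: i_def)
    qed
  qed
  have col: "AE y in N. (\<integral>\<^sup>+x. h (cell \<delta> x) (cell \<delta> y) \<partial>M) = 1"
  proof -
    have "(\<integral>\<^sup>+x. (if b (cell \<delta> x) = 0 then 1 else 0) \<partial>N) = (\<Sum>i\<in>I. (if b i = 0 then 1 else 0) * ennreal (b i))"
      unfolding I_def b_def by (rule nn_integral_cell[OF N \<delta>])
    also have "\<dots> = 0" by (intro sum.neutral) auto
    finally have "AE x in N. (if b (cell \<delta> x) = 0 then 1 else 0 :: ennreal) = 0"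
      using measurable_compose[OF cN, of "\<lambda>i. if b i = 0 then 1 else 0 :: ennreal" borel]
      by (subst (asm) nn_integral_0_iff_AE) auto
    then show ?thesis
    proof (rule AE_mp, intro AE_I2 impI)
      fix x assume x: "x \<in> space N" "(if b (cell \<delta> x) = 0 then 1 else 0 :: ennreal) = 0"
      define j where "j = cell \<delta> x"
      have j: "j \<in> I" "b j > 0" using x cI[of x] b0[of j] spM by (auto simp: j_def split: if_splits)
      have "(\<integral>\<^sup>+y. h (cell \<delta> y) j \<partial>M) = (\<Sum>i\<in>I. h i j * ennreal (a i))"
        unfolding I_def a_def by (rule nn_integral_cell[OF M \<delta>])
      also have "\<dots> = (\<Sum>i\<in>I. ennreal (\<pi> (i, j) / b j))"
      proof (intro sum.cong refl)
        fix i assume "i \<in> I"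
        have "ennreal (b j) * (h i j * ennreal (a i)) = ennreal (b j) * ennreal (\<pi> (i, j) / b j)"
          using h\<pi>[OF \<open>i \<in> I\<close> j(1)] j(2) \<pi>(1)[of i j] by (simp add: ennreal_mult[symmetric] mult_ac)
        then show "h i j * ennreal (a i) = ennreal (\<pi> (i, j) / b j)"
          using j(2) by (simp add: ennreal_mult_cancel_left)
      qed
      also have "\<dots> = ennreal ((\<Sum>i\<in>I. \<pi> (i, j)) / b j)"
        using \<pi>(1) j(2) by (subst sum_ennreal) (auto simp: sum_divide_distrib)
      also have "\<dots> = 1" using \<pi>(3)[of j] j by (simp add: b_def I_def)
      finally show "(\<integral>\<^sup>+y. h (cell \<delta> y) (cell \<delta> x) \<partial>M) = 1" by (simp add: j_def)
    qed
  qed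
  have marg1: "(\<integral>\<^sup>+\<omega>. f (fst \<omega>) \<partial>\<sigma>) = (\<integral>\<^sup>+x. f x \<partial>M)" if [measurable]: "f \<in> borel_measurable M" for f
  proof -
    have "(\<integral>\<^sup>+\<omega>. f (fst \<omega>) \<partial>\<sigma>) = (\<integral>\<^sup>+\<omega>. h (cell \<delta> (fst \<omega>)) (cell \<delta> (snd \<omega>)) * f (fst \<omega>) \<partial>(M \<Otimes>\<^sub>M N))"
      unfolding \<sigma>_def using fm by (subst nn_integral_density) auto
    also have "\<dots> = (\<integral>\<^sup>+x. (\<integral>\<^sup>+y. h (cell \<delta> x) (cell \<delta> y) * f x \<partial>N) \<partial>M)"
      using fm by (subst N.nn_integral_fst[symmetric]) auto
    also have "\<dots> = (\<integral>\<^sup>+x. (\<integral>\<^sup>+y. h (cell \<delta> x) (cell \<delta> y) \<partial>N) * f x \<partial>M)"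
      by (intro nn_integral_cong nn_integral_multc gN)
    also have "\<dots> = (\<integral>\<^sup>+x. f x \<partial>M)"
      using row by (intro nn_integral_cong_AE) auto
    finally show ?thesis .
  qed
  have marg2: "(\<integral>\<^sup>+\<omega>. f (snd \<omega>) \<partial>\<sigma>) = (\<integral>\<^sup>+x. f x \<partial>N)" if [measurable]: "f \<in> borel_measurable N" for f
  proof -
    have "(\<integral>\<^sup>+\<omega>. f (snd \<omega>) \<partial>\<sigma>) = (\<integral>\<^sup>+\<omega>. h (cell \<delta> (fst \<omega>)) (cell \<delta> (snd \<omega>)) * f (snd \<omega>) \<partial>(M \<Otimes>\<^sub>M N))"
      unfolding \<sigma>_def using fm by (subst nn_integral_density) auto
    also have "\<dots> = (\<integral>\<^sup>+y. (\<integral>\<^sup>+x. h (cell \<delta> x) (cell \<delta> y) * f y \<partial>M) \<partial>N)"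
      using fm by (subst MN.nn_integral_snd[symmetric]) auto
    also have "\<dots> = (\<integral>\<^sup>+y. (\<integral>\<^sup>+x. h (cell \<delta> x) (cell \<delta> y) \<partial>M) * f y \<partial>N)"
      by (intro nn_integral_cong nn_integral_multc gM[of "\<lambda>i. h i _"])
    also have "\<dots> = (\<integral>\<^sup>+x. f x \<partial>N)"
      using col by (intro nn_integral_cong_AE) auto
    finally show ?thesis .
  qed
  have d1: "distr \<sigma> GB fst = M"
  proof (rule measure_eqI)
    fix A assume "A \<in> sets (distr \<sigma> GB fst)"
    then have A: "A \<in> sets GB" "A \<in> sets M" using prob_measuresD(2)[OF M] by auto
    have "emeasure (distr \<sigma> GB fst) A = (\<integral>\<^sup>+x. indicator A x \<partial>distr \<sigma> GB fst)" using A by simp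
    also have "\<dots> = (\<integral>\<^sup>+\<omega>. indicator A (fst \<omega>) \<partial>\<sigma>)"
      using A measurable_cong_sets[OF s\<sigma> refl] by (intro nn_integral_distr) auto
    also have "\<dots> = emeasure M A" using marg1[of "indicator A"] A by simp
    finally show "emeasure (distr \<sigma> GB fst) A = emeasure M A" .
  qed (simp add: prob_measuresD(2)[OF M])
  have d2: "distr \<sigma> GB snd = N"
  proof (rule measure_eqI)
    fix A assume "A \<in> sets (distr \<sigma> GB snd)"
    then have A: "A \<in> sets GB" "A \<in> sets N" using prob_measuresD(2)[OF N] by auto
    have "emeasure (distr \<sigma> GB snd) A = (\<integral>\<^sup>+x. indicator A x \<partial>distr \<sigma> GB snd)" using A by simp
    also have "\<dots> = (\<integral>\<^sup>+\<omega>. indicator A (snd \<omega>) \<partial>\<sigma>)"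
      using A measurable_cong_sets[OF s\<sigma> refl] by (intro nn_integral_distr) auto
    also have "\<dots> = emeasure N A" using marg2[of "indicator A"] A by simp
    finally show "emeasure (distr \<sigma> GB snd) A = emeasure N A" .
  qed (simp add: prob_measuresD(2)[OF N])
  have "prob_space \<sigma>"
  proof (rule prob_spaceI)
    have "emeasure \<sigma> (space \<sigma>) = (\<integral>\<^sup>+\<omega>. (\<lambda>_. 1) (fst \<omega>) \<partial>\<sigma>)" by simp
    also have "\<dots> = 1" by (subst marg1) (auto simp: M.emeasure_space_1)
    finally show "emeasure \<sigma> (space \<sigma>) = 1" .
  qed
  then have coup: "\<sigma> \<in> couplings G len M N"
    using s\<sigma> d1 d2 by (simp add: couplings_def space_prob_algebra)
  show thesis
  proof (rule that[OF coup])
    fix f :: "'e \<times> int \<Rightarrow> 'e \<times> int \<Rightarrow> ennreal"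
    have "(\<integral>\<^sup>+\<omega>. f (cell \<delta> (fst \<omega>)) (cell \<delta> (snd \<omega>)) \<partial>\<sigma>)
      = (\<integral>\<^sup>+\<omega>. h (cell \<delta> (fst \<omega>)) (cell \<delta> (snd \<omega>)) * f (cell \<delta> (fst \<omega>)) (cell \<delta> (snd \<omega>)) \<partial>(M \<Otimes>\<^sub>M N))"
      unfolding \<sigma>_def using fm by (subst nn_integral_density) auto
    also have "\<dots> = (\<integral>\<^sup>+x. (\<integral>\<^sup>+y. h (cell \<delta> x) (cell \<delta> y) * f (cell \<delta> x) (cell \<delta> y) \<partial>N) \<partial>M)"
      using fm[of "\<lambda>i j. h i j * f i j"] by (subst N.nn_integral_fst[symmetric]) auto
    also have "\<dots> = (\<integral>\<^sup>+x. (\<Sum>j\<in>I. h (cell \<delta> x) j * f (cell \<delta> x) j * ennreal (b j)) \<partial>M)"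
      unfolding I_def b_def by (intro nn_integral_cong nn_integral_cell[OF N \<delta>])
    also have "\<dots> = (\<Sum>i\<in>I. (\<Sum>j\<in>I. h i j * f i j * ennreal (b j)) * ennreal (a i))"
      unfolding I_def a_def by (rule nn_integral_cell[OF M \<delta>])
    also have "\<dots> = (\<Sum>i\<in>I. \<Sum>j\<in>I. f i j * (h i j * ennreal (a i) * ennreal (b j)))"
      unfolding sum_distrib_right by (intro sum.cong refl) (simp add: mult_ac)
    also have "\<dots> = (\<Sum>i\<in>I. \<Sum>j\<in>I. f i j * ennreal (\<pi> (i, j)))"
      using h\<pi> by (intro sum.cong) auto
    finally show "(\<integral>\<^sup>+\<omega>. f (cell \<delta> (fst \<omega>)) (cell \<delta> (snd \<omega>)) \<partial>\<sigma>) = (\<Sum>i\<in>cells \<delta>. \<Sum>j\<in>cells \<delta>. f i j * ennreal (\<pi> (i, j)))"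
      by (simp add: I_def)
  qed
qed

text \<open>The loss in the squared distance when \<open>r\<close> is shortened by \<eta>. A bound
  \<open>d\<close> on all distances makes it linear in \<eta>.\<close>

lemma square_pos_part_ge:
  fixes r \<eta> d :: real
  assumes "0 \<le> r" "r \<le> d" "0 \<le> \<eta>"
  shows "r\<^sup>2 - 2 * \<eta> * d \<le> (max 0 (r - \<eta>))\<^sup>2"
proof (cases "r \<le> \<eta>")
  case True
  then have "r * r \<le> \<eta> * d" using assms by (intro mult_mono) auto
  moreover have "0 \<le> \<eta> * d" using assms by auto
  ultimately show ?thesis using True by (simp add: power2_eq_square)
next
  case False
  have "\<eta> * r \<le> \<eta> * d" using assms by (intro mult_left_mono) auto
  moreover have "0 \<le> \<eta> * \<eta>" by simp
  moreover have "(max 0 (r - \<eta>))\<^sup>2 = r\<^sup>2 - 2 * (\<eta> * r) + \<eta> * \<eta>"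
    using False by (simp add: power2_eq_square algebra_simps max_def)
  moreover have "2 * \<eta> * d = 2 * (\<eta> * d)" by simp
  ultimately show ?thesis by linarith
qed

text \<open>One parameter \<delta> serves as mesh of the cells, as time shift and as accuracy of the
  smoothed distances, and it fixes the temperature. Each of these errors is of order \<delta> with a
  factor depending only on the diameter, so \<delta> can be sent to 0.\<close>

lemma W2_squared_le_action:
  assumes M: "M \<in> prob_measures G len" and N: "N \<in> prob_measures G len"
    and adm: "(m, v) \<in> admissible G len M N"
  shows "W2_squared G len M N \<le> action G len m v"
proof (cases "action G len m v")
  case top
  then show ?thesis by simp
next
  case (real A)
  define d where "d = diam_bound"
  have d0: "0 \<le> d" unfolding d_def by (rule diam_bound_nonneg)
  have Dd: "D x y \<le> d" if "x \<in> X" "y \<in> X" for x y unfolding d_def using diam_bound[OF that] .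
  interpret M: prob_space M using prob_measuresD[OF M] by simp
  interpret N: prob_space N using prob_measuresD[OF N] by simp
  have ne: "X \<noteq> {}" using M.not_empty prob_measuresD(3)[OF M] by simp
  have bound: "W2_squared G len M N \<le> ennreal (A + \<delta> * (8 * d + d\<^sup>2 + 10))" if \<delta>: "0 < \<delta>" "\<delta> \<le> 1" for \<delta>
  proof -
    define I where "I = cells \<delta>"
    define y where "y = cell_point \<delta>"
    define a b where "a = cell_mass M \<delta>" and "b = cell_mass N \<delta>"
    define c where "c i j = (D (y i) (y j))\<^sup>2" for i j
    have fin: "finite I" unfolding I_def by (rule cells_finite[OF \<delta>(1)])
    have Ine: "I \<noteq> {}" using ne by (auto simp: I_def cells_def)
    have cI: "cell \<delta> x \<in> I" if "x \<in> X" for x using that by (auto simp: I_def cells_def)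
    have yX: "y i \<in> X" if "i \<in> I" for i using cell_point[of i \<delta>] that by (auto simp: I_def y_def)
    have yd: "D x (y (cell \<delta> x)) \<le> \<delta>" if "x \<in> X" for x unfolding y_def by (rule cell_point_dist[OF that \<delta>(1)])
    \<comment> \<open>The potentials lose \<open>\<delta> * (4 * d + d\<^sup>2 + 2)\<close> at time
      1 and \<open>4 * \<delta>\<close> at time 0.\<close>
    define C where "C = A + \<delta> * (4 * d + d\<^sup>2 + 6)"
    have dual: "(\<Sum>j\<in>I. \<psi> j * b j) - (\<Sum>i\<in>I. \<phi> i * a i) \<le> C"
      if feas: "\<And>i j. i \<in> I \<Longrightarrow> j \<in> I \<Longrightarrow> \<psi> j - \<phi> i \<le> c i j" for \<phi> \<psi>
    proof -
      \<comment> \<open>Chosen so that the soft minimum errs by at most \<delta>. The summand 1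
        keeps the denominator positive when there is only one cell.\<close>
      define \<kappa> where "\<kappa> = \<delta> / (ln (card I) + 1)"
      have card1: "1 \<le> real (card I)" using fin Ine by (simp add: Suc_le_eq card_gt_0_iff)
      then have ln0: "0 \<le> ln (real (card I))" by simp
      have \<kappa>: "0 < \<kappa>" "\<kappa> * ln (card I) \<le> \<delta>"
        using \<delta>(1) ln0 by (auto simp: \<kappa>_def divide_simps mult_left_mono)
      show ?thesis
      \<comment> \<open>The potential is halved because Hopf--Lax works with half of the squared
        distance; the factor 2 returns in the comparison with the action.\<close>
      proof (rule hopf_lax_subsolution[where J = I and y = y and \<epsilon> = \<delta> and \<kappa> = \<kappa> and \<beta> = \<delta> and \<phi> = "\<lambda>j. \<phi> j / 2"])
        fix u w :: "real \<Rightarrow> ('e \<times> real) set \<Rightarrow> real"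
        assume uw:
        "\<And>t. t \<in> {0..1} \<Longrightarrow> u t \<in> test_functions G len"
        "\<And>t x. t \<in> {0..1} \<Longrightarrow> x \<in> X \<Longrightarrow> ((\<lambda>t. u t x) has_real_derivative - w t x) (at t within {0..1})"
        "\<And>t p. t \<in> {0..1} \<Longrightarrow> p \<in> CE \<Longrightarrow> (grad len (u t \<circ> q) p)\<^sup>2 / 2 \<le> w t (q p)"
        "\<And>t. t \<in> {0..1} \<Longrightarrow> continuous_map (graph_topology G len) euclideanreal (w t)"
        "\<And>\<eta>. 0 < \<eta> \<Longrightarrow> \<exists>\<delta>>0. \<forall>t\<in>{0..1}. \<forall>t'\<in>{0..1}. \<bar>t - t'\<bar> < \<delta> \<longrightarrow> (\<forall>x\<in>X. \<bar>w t x - w t' x\<bar> < \<eta>)"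
        and up: "\<And>t x j. t \<in> {0..1} \<Longrightarrow> x \<in> X \<Longrightarrow> j \<in> I \<Longrightarrow> u t x \<le> \<phi> j / 2 + (D x (y j) + \<delta>)\<^sup>2 / (2 * (t + \<delta>))"
        and low: "\<And>t x. t \<in> {0..1} \<Longrightarrow> x \<in> X \<Longrightarrow>
           \<exists>j\<in>I. \<phi> j / 2 + (max 0 (D x (y j) - \<delta>))\<^sup>2 / (2 * (t + \<delta>)) - \<kappa> * ln (card I) \<le> u t x"
      have hj: "2 * ((\<integral>x. u 1 x \<partial>N) - (\<integral>x. u 0 x \<partial>M)) \<le> A"
        using hamilton_jacobi_action_bound[OF adm uw] real
        by (auto simp: ennreal_le_iff2)
      have ui: "integrable N (u 1)" "integrable M (u 0)"
        using uw(1)[of 1] uw(1)[of 0] M N by (auto intro!: integrable_continuous_map simp: test_functions_def)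
      \<comment> \<open>The competitor is the cell of \<open>x\<close> itself. Its point is within
        \<delta> of \<open>x\<close>, so the factor \<open>1 / (2 * \<delta>)\<close> at time 0
        meets a square of size at most \<open>4 * \<delta>\<^sup>2\<close>.\<close>
      have u0: "2 * u 0 x \<le> \<phi> (cell \<delta> x) + 4 * \<delta>" if x: "x \<in> X" for x
      proof -
        have "(D x (y (cell \<delta> x)) + \<delta>)\<^sup>2 \<le> (\<delta> + \<delta>)\<^sup>2" using yd[OF x] \<delta>(1) by (intro power_mono) auto
        then have "(D x (y (cell \<delta> x)) + \<delta>)\<^sup>2 / (2 * (0 + \<delta>)) \<le> (\<delta> + \<delta>)\<^sup>2 / (2 * (0 + \<delta>))"
          using \<delta>(1) by (intro divide_right_mono) auto
        also have "\<dots> = 2 * \<delta>" using \<delta>(1) by (simp add: power2_eq_square)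
        finally show ?thesis using up[OF _ x cI[OF x], of 0] by simp
      qed
      \<comment> \<open>The nearly minimizing cell \<open>i\<close> is compared with the cell
        \<open>j\<close> of \<open>x\<close> through the dual constraint. The term
        \<open>4 * d\<close> comes from shortening the distance by \<open>2 * \<delta>\<close>,
        \<open>d\<^sup>2\<close> from the factor \<open>1 / (1 + \<delta>)\<close>, and 2 from the
        soft minimum.\<close>
      have u1: "\<psi> (cell \<delta> x) - \<delta> * (4 * d + d\<^sup>2 + 2) \<le> 2 * u 1 x" if x: "x \<in> X" for x
      proof -
        obtain i where i: "i \<in> I" "\<phi> i / 2 + (max 0 (D x (y i) - \<delta>))\<^sup>2 / (2 * (1 + \<delta>)) - \<kappa> * ln (card I) \<le> u 1 x"
          using low[OF _ x, of 1] by auto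
        define j where "j = cell \<delta> x"
        have j: "j \<in> I" using cI[OF x] by (simp add: j_def)
        define r where "r = D (y i) (y j)"
        have r: "0 \<le> r" "r \<le> d" using Dd yX i(1) j by (auto simp: r_def)
        have "r \<le> D x (y i) + \<delta>"
          using GM.triangle[OF yX[OF i(1)] x yX[OF j]] yd[OF x] GM.commute[of x "y i"] by (simp add: r_def j_def)
        then have "max 0 (r - 2 * \<delta>) \<le> max 0 (D x (y i) - \<delta>)" by auto
        then have "(max 0 (r - 2 * \<delta>))\<^sup>2 \<le> (max 0 (D x (y i) - \<delta>))\<^sup>2" by (intro power_mono) auto
        moreover have "r\<^sup>2 - 2 * (2 * \<delta>) * d \<le> (max 0 (r - 2 * \<delta>))\<^sup>2"
          using r \<delta>(1) by (intro square_pos_part_ge) auto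
        moreover have "2 * (2 * \<delta>) * d = 4 * \<delta> * d" by simp
        ultimately have s1: "r\<^sup>2 - 4 * \<delta> * d \<le> (max 0 (D x (y i) - \<delta>))\<^sup>2" by linarith
        define s where "s = (max 0 (D x (y i) - \<delta>))\<^sup>2"
        have s0: "0 \<le> s" "s \<le> d\<^sup>2"
        proof -
          have "max 0 (D x (y i) - \<delta>) \<le> d" using Dd[OF x yX[OF i(1)]] \<delta>(1) d0 by auto
          then show "s \<le> d\<^sup>2" unfolding s_def by (intro power_mono) auto
        qed (simp add: s_def)
        have "s - \<delta> * d\<^sup>2 \<le> s / (1 + \<delta>)"
        proof -
          have "(s - \<delta> * s) * (1 + \<delta>) = s - \<delta> * \<delta> * s" by (simp add: algebra_simps)
          also have "\<dots> \<le> s" using s0 by simp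
          finally have "s - \<delta> * s \<le> s / (1 + \<delta>)" using \<delta>(1) by (simp add: pos_le_divide_eq)
          moreover have "\<delta> * s \<le> \<delta> * d\<^sup>2" using s0 \<delta>(1) by (intro mult_left_mono) auto
          ultimately show ?thesis by linarith
        qed
        moreover have "2 * (s / (2 * (1 + \<delta>))) = s / (1 + \<delta>)" using \<delta>(1) by (simp add: field_simps)
        ultimately have p1: "s - \<delta> * d\<^sup>2 \<le> 2 * (s / (2 * (1 + \<delta>)))" by simp
        define p where "p = s / (2 * (1 + \<delta>))"
        have "\<phi> i / 2 + p - \<kappa> * ln (card I) \<le> u 1 x" using i(2) unfolding p_def s_def .
        then have "\<phi> i + (r\<^sup>2 - 4 * \<delta> * d) - \<delta> * d\<^sup>2 - 2 * \<delta> \<le> 2 * u 1 x"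
          using s1 \<kappa>(2) p1 unfolding s_def[symmetric] p_def[symmetric] by argo
        moreover have "\<psi> j - \<phi> i \<le> r\<^sup>2" using feas[OF i(1) j] by (simp add: c_def r_def)
        moreover have "\<delta> * (4 * d + d\<^sup>2 + 2) = 4 * \<delta> * d + \<delta> * d\<^sup>2 + 2 * \<delta>" by (simp add: algebra_simps)
        ultimately show ?thesis unfolding j_def by linarith
      qed
      have "(\<Sum>j\<in>I. \<psi> j * b j) = (\<integral>x. \<psi> (cell \<delta> x) \<partial>N)"
        unfolding I_def b_def by (rule integral_cell(1)[OF N \<delta>(1), symmetric])
      also have "\<dots> \<le> (\<integral>x. 2 * u 1 x + \<delta> * (4 * d + d\<^sup>2 + 2) \<partial>N)"
      proof (rule Bochner_Integration.integral_mono)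
        fix x assume "x \<in> space N"
        then show "\<psi> (cell \<delta> x) \<le> 2 * u 1 x + \<delta> * (4 * d + d\<^sup>2 + 2)"
          using u1[of x] prob_measuresD(3)[OF N] by simp
      qed (use ui integral_cell(2)[OF N \<delta>(1)] in auto)
      also have "\<dots> = 2 * (\<integral>x. u 1 x \<partial>N) + \<delta> * (4 * d + d\<^sup>2 + 2)"
        using ui by (simp add: N.prob_space)
      finally have 1: "(\<Sum>j\<in>I. \<psi> j * b j) \<le> 2 * (\<integral>x. u 1 x \<partial>N) + \<delta> * (4 * d + d\<^sup>2 + 2)" .
      have "2 * (\<integral>x. u 0 x \<partial>M) = (\<integral>x. 2 * u 0 x \<partial>M)" by simp
      also have "\<dots> \<le> (\<integral>x. \<phi> (cell \<delta> x) + 4 * \<delta> \<partial>M)"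
      proof (rule Bochner_Integration.integral_mono)
        fix x assume "x \<in> space M"
        then show "2 * u 0 x \<le> \<phi> (cell \<delta> x) + 4 * \<delta>" using u0[of x] prob_measuresD(3)[OF M] by simp
      qed (use ui integral_cell(2)[OF M \<delta>(1)] in auto)
      also have "\<dots> = (\<Sum>i\<in>I. \<phi> i * a i) + 4 * \<delta>"
        unfolding I_def a_def using integral_cell[OF M \<delta>(1), of \<phi>] by (simp add: M.prob_space)
      finally have 2: "2 * (\<integral>x. u 0 x \<partial>M) \<le> (\<Sum>i\<in>I. \<phi> i * a i) + 4 * \<delta>" .
      have "\<delta> * (4 * d + d\<^sup>2 + 6) = \<delta> * (4 * d + d\<^sup>2 + 2) + 4 * \<delta>" by (simp add: algebra_simps)
      then show ?thesis using 1 2 hj unfolding C_def by argo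
      qed (use fin Ine yX \<delta>(1) \<kappa>(1) in auto)
    qed
    obtain \<pi> where \<pi>: "\<And>i j. 0 \<le> \<pi> (i, j)" "\<And>i. i \<in> I \<Longrightarrow> (\<Sum>j\<in>I. \<pi> (i, j)) = a i"
      "\<And>j. j \<in> I \<Longrightarrow> (\<Sum>i\<in>I. \<pi> (i, j)) = b j" "(\<Sum>i\<in>I. \<Sum>j\<in>I. c i j * \<pi> (i, j)) \<le> C"
      by (rule finite_transport_duality[OF fin, of a b c C])
        (auto simp: a_def b_def I_def cell_mass_nonneg cell_mass_sum M N \<delta> c_def intro: dual[unfolded I_def a_def b_def c_def])
    obtain \<sigma> where \<sigma>: "\<sigma> \<in> couplings G len M N"
      "\<And>f :: _ \<Rightarrow> _ \<Rightarrow> ennreal. (\<integral>\<^sup>+\<omega>. f (cell \<delta> (fst \<omega>)) (cell \<delta> (snd \<omega>)) \<partial>\<sigma>) = (\<Sum>i\<in>I. \<Sum>j\<in>I. f i j * ennreal (\<pi> (i, j)))"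
      using coupling_of_cell_masses[OF M N \<delta>(1), of \<pi>] \<pi>(1-3) unfolding I_def a_def b_def by blast
    have sp: "space \<sigma> = X \<times> X"
      using \<sigma>(1) by (auto simp: couplings_def space_prob_algebra space_pair_measure dest: sets_eq_imp_space_eq)
    have K: "(D x z)\<^sup>2 \<le> c (cell \<delta> x) (cell \<delta> z) + \<delta> * (4 * d + 4)" if "x \<in> X" "z \<in> X" for x z
    proof -
      define r where "r = D (y (cell \<delta> x)) (y (cell \<delta> z))"
      have r: "0 \<le> r" "r \<le> d" using Dd yX cI that by (auto simp: r_def)
      have "D x z \<le> D x (y (cell \<delta> x)) + D (y (cell \<delta> x)) z" using that yX cI by (intro GM.triangle) auto
      moreover have "D (y (cell \<delta> x)) z \<le> r + D (y (cell \<delta> z)) z"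
        unfolding r_def using that yX cI by (intro GM.triangle) auto
      ultimately have "D x z \<le> r + 2 * \<delta>"
        using yd[OF that(1)] yd[OF that(2)] GM.commute[of z "y (cell \<delta> z)"] by linarith
      then have "(D x z)\<^sup>2 \<le> (r + 2 * \<delta>)\<^sup>2" by (intro power_mono) auto
      also have "\<dots> = r\<^sup>2 + \<delta> * (4 * r + 4 * \<delta>)" by (simp add: power2_eq_square algebra_simps)
      also have "\<dots> \<le> r\<^sup>2 + \<delta> * (4 * d + 4)" using r \<delta> by (intro add_left_mono mult_left_mono) auto
      finally show ?thesis by (simp add: c_def r_def)
    qed
    have "W2_squared G len M N \<le> (\<integral>\<^sup>+(x, y). ennreal ((D x y)\<^sup>2) \<partial>\<sigma>)"
      unfolding W2_squared_def by (rule INF_lower[OF \<sigma>(1)])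
    also have "\<dots> \<le> (\<integral>\<^sup>+\<omega>. ennreal (c (cell \<delta> (fst \<omega>)) (cell \<delta> (snd \<omega>)) + \<delta> * (4 * d + 4)) \<partial>\<sigma>)"
      using K sp by (intro nn_integral_mono) (auto intro!: ennreal_leI)
    also have "\<dots> = (\<Sum>i\<in>I. \<Sum>j\<in>I. ennreal (c i j + \<delta> * (4 * d + 4)) * ennreal (\<pi> (i, j)))"
      by (rule \<sigma>(2))
    also have "\<dots> = (\<Sum>i\<in>I. \<Sum>j\<in>I. ennreal ((c i j + \<delta> * (4 * d + 4)) * \<pi> (i, j)))"
      using \<pi>(1) \<delta> d0 by (intro sum.cong refl ennreal_mult[symmetric]) (auto simp: c_def)
    also have "\<dots> = ennreal (\<Sum>i\<in>I. \<Sum>j\<in>I. (c i j + \<delta> * (4 * d + 4)) * \<pi> (i, j))"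
      using \<pi>(1) \<delta> d0 by (subst sum_ennreal | auto intro!: sum_nonneg mult_nonneg_nonneg add_nonneg_nonneg simp: c_def)+
    also have "(\<Sum>i\<in>I. \<Sum>j\<in>I. (c i j + \<delta> * (4 * d + 4)) * \<pi> (i, j)) =
      (\<Sum>i\<in>I. \<Sum>j\<in>I. c i j * \<pi> (i, j)) + \<delta> * (4 * d + 4) * (\<Sum>i\<in>I. \<Sum>j\<in>I. \<pi> (i, j))"
      by (simp add: distrib_right sum.distrib sum_distrib_left)
    also have "(\<Sum>i\<in>I. \<Sum>j\<in>I. \<pi> (i, j)) = 1"
      using \<pi>(2) cell_mass_sum[OF M \<delta>(1)] by (simp add: a_def I_def)
    finally have "W2_squared G len M N \<le> ennreal ((\<Sum>i\<in>I. \<Sum>j\<in>I. c i j * \<pi> (i, j)) + \<delta> * (4 * d + 4) * 1)" .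
    \<comment> \<open>The loss \<open>4 * d + d\<^sup>2 + 6\<close> of the dual bound and the loss
      \<open>4 * d + 4\<close> from moving points to cell points add up.\<close>
    also have "\<dots> \<le> ennreal (A + \<delta> * (8 * d + d\<^sup>2 + 10))"
      using \<pi>(4) by (intro ennreal_leI) (simp add: C_def algebra_simps)
    finally show ?thesis .
  qed
  define K where "K = 8 * d + d\<^sup>2 + 10"
  have K: "0 < K" using d0 by (auto simp: K_def intro: add_nonneg_pos)
  show ?thesis
  proof (rule ennreal_le_epsilon)
    fix \<epsilon> :: real assume \<epsilon>: "0 < \<epsilon>"
    define \<delta> where "\<delta> = min 1 (\<epsilon> / K)"
    have \<delta>: "0 < \<delta>" "\<delta> \<le> 1" using K \<epsilon> by (auto simp: \<delta>_def)
    have "\<delta> * K \<le> \<epsilon> / K * K" using K by (intro mult_right_mono) (auto simp: \<delta>_def)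
    then have "\<delta> * K \<le> \<epsilon>" using K by simp
    then have "ennreal (A + \<delta> * K) \<le> ennreal (A + \<epsilon>)" by (intro ennreal_leI) simp
    also have "\<dots> = action G len m v + ennreal \<epsilon>" using real \<epsilon> by (simp add: ennreal_plus)
    finally show "W2_squared G len M N \<le> action G len m v + ennreal \<epsilon>"
      using bound[OF \<delta>] unfolding K_def by (rule order_trans[rotated])
  qed
qed

end

section \<open>Existence of optimal couplings\<close>

text \<open>The indicator of a closed set is a decreasing limit of continuous functions of the
  distance to it, and the closed sets are an intersection-stable generator of the Borel
  sets.\<close>

lemma measure_eqI_continuous:
  fixes M N :: "'a::metric_space measure"
  assumes M: "prob_space M" "sets M = sets borel" and N: "prob_space N" "sets N = sets borel"
    and eq: "\<And>f :: 'a \<Rightarrow> real. continuous_on UNIV f \<Longrightarrow> (\<And>x. 0 \<le> f x \<and> f x \<le> 1) \<Longrightarrow> (\<integral>x. f x \<partial>M) = (\<integral>x. f x \<partial>N)"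
  shows "M = N"
proof -
  interpret M: prob_space M by (rule M(1))
  interpret N: prob_space N by (rule N(1))
  have closed_eq: "emeasure M F = emeasure N F" if F: "closed F" for F
  proof (cases "F = {}")
    case False
    define f where "f n x = max 0 (1 - real n * infdist x F)" for n x
    have fc: "continuous_on UNIV (f n)" for n unfolding f_def by (intro continuous_intros)
    have fb: "0 \<le> f n x \<and> f n x \<le> 1" for n x by (auto simp: f_def infdist_nonneg)
    have lim: "(\<lambda>n. f n x) \<longlonglongrightarrow> indicator F x" for x
    proof (cases "x \<in> F")
      case True
      then show ?thesis by (simp add: f_def)
    next
      case x: False
      then have "0 < infdist x F" using F False by (metis in_closed_iff_infdist_zero infdist_nonneg less_eq_real_def)
      then obtain k :: nat where k: "1 / infdist x F < real k" using reals_Archimedean2 by blast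
      have "f n x = 0" if "n \<ge> k" for n
      proof -
        have "1 < real k * infdist x F" using k \<open>0 < infdist x F\<close> by (simp add: field_simps)
        also have "\<dots> \<le> real n * infdist x F" using that \<open>0 < infdist x F\<close> by (intro mult_right_mono) auto
        finally show ?thesis by (simp add: f_def)
      qed
      then have "eventually (\<lambda>n. f n x = indicator F x) sequentially"
        using x by (auto simp: eventually_sequentially)
      then show ?thesis by (rule tendsto_eventually)
    qed
    have conv: "(\<lambda>n. \<integral>x. f n x \<partial>P) \<longlonglongrightarrow> measure P F" if "prob_space P" "sets P = sets borel" for P
    proof -
      interpret P: prob_space P by (rule that(1))
      note [measurable_cong] = that(2)
      have [measurable]: "F \<in> sets borel" using F by simp
      have [measurable]: "f n \<in> borel_measurable borel" for n using fc by (rule borel_measurable_continuous_onI)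
      have "(\<lambda>n. \<integral>x. f n x \<partial>P) \<longlonglongrightarrow> (\<integral>x. indicator F x \<partial>P)"
        by (rule integral_dominated_convergence[where w = "\<lambda>_. 1"]) (use lim fb in auto)
      then show ?thesis using sets_eq_imp_space_eq[OF that(2)] by simp
    qed
    have "measure M F = measure N F"
      using conv[OF M] conv[OF N] eq[OF fc fb] LIMSEQ_unique by fastforce
    then show ?thesis by (simp add: M.emeasure_eq_measure N.emeasure_eq_measure)
  qed simp
  show ?thesis
  proof (rule measure_eqI_generator_eq[where E = "Collect closed" and \<Omega> = UNIV and A = "\<lambda>_. UNIV"])
    show "Int_stable (Collect closed :: 'a set set)" by (auto simp: Int_stable_def)
    show "sets M = sigma_sets UNIV (Collect closed)" "sets N = sigma_sets UNIV (Collect closed)"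
      unfolding M N borel_eq_closed by simp_all
  qed (use closed_eq in auto)
qed

context metric_graph
begin

section \<open>Coding of the graph by a compact subset of the plane\<close>

definition arc_index :: "'e \<Rightarrow> real" where
  "arc_index e = real (to_nat_on (arcs G) e)"

lemma arc_index_eq_iff: "e \<in> arcs G \<Longrightarrow> f \<in> arcs G \<Longrightarrow> arc_index e = arc_index f \<longleftrightarrow> e = f"
  using finite_arcs by (simp add: arc_index_def countable_finite inj_on_eq_iff[OF inj_on_to_nat_on])

lemma arc_index_dist: "e \<in> arcs G \<Longrightarrow> f \<in> arcs G \<Longrightarrow> \<bar>arc_index e - arc_index f\<bar> < 1 \<Longrightarrow> e = f"
proof -
  assume *: "e \<in> arcs G" "f \<in> arcs G" "\<bar>arc_index e - arc_index f\<bar> < 1"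
  then have "real (to_nat_on (arcs G) e) < real (to_nat_on (arcs G) f + 1)" "real (to_nat_on (arcs G) f) < real (to_nat_on (arcs G) e + 1)"
    unfolding arc_index_def by (auto simp: abs_less_iff)
  then have "to_nat_on (arcs G) e = to_nat_on (arcs G) f" unfolding of_nat_less_iff by simp
  then have "arc_index e = arc_index f" by (simp add: arc_index_def)
  then show ?thesis using arc_index_eq_iff * by blast
qed

text \<open>Disjoint vertical segments, one for each edge: a concrete compact set in which sequences
  of laws have weak limits. \<open>decode\<close> glues the ends together and is continuous on this
  set, while \<open>encode\<close> is only Borel.\<close>

definition code_set :: "(real \<times> real) set" where
  "code_set = (\<Union>e\<in>arcs G. {arc_index e} \<times> {0..len e})"

definition encode :: "('e \<times> real) set \<Rightarrow> real \<times> real" where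
  "encode x = (arc_index (fst (rep x)), snd (rep x))"

definition decode :: "real \<times> real \<Rightarrow> ('e \<times> real) set" where
  "decode z = q (THE e. e \<in> arcs G \<and> arc_index e = fst z, snd z)"

lemma code_set_compact: "compact code_set"
  unfolding code_set_def using finite_arcs by (intro compact_UN compact_Times) auto

lemma encode_in: "x \<in> X \<Longrightarrow> encode x \<in> code_set"
  using rep_components[of x] by (auto simp: encode_def code_set_def)

lemma decode_eq: "e \<in> arcs G \<Longrightarrow> decode (arc_index e, s) = q (e, s)"
proof -
  assume "e \<in> arcs G"
  then have "(THE f. f \<in> arcs G \<and> arc_index f = arc_index e) = e"
    by (intro the_equality) (auto simp: arc_index_eq_iff)
  then show ?thesis by (simp add: decode_def)
qed

lemma decode_encode: "x \<in> X \<Longrightarrow> decode (encode x) = x"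
  using rep(2)[of x] rep_components[of x] by (simp add: encode_def decode_eq)

lemma decode_in: "z \<in> code_set \<Longrightarrow> decode z \<in> X"
  using q_in by (auto simp: code_set_def decode_eq)

lemma encode_measurable: "encode \<in> borel_measurable GB"
proof -
  have "(\<lambda>x. arc_index (fst (rep x))) \<in> borel_measurable GB"
    by (rule measurable_compose[OF rep_arc_measurable(1)]) simp
  then show ?thesis unfolding encode_def[abs_def] by measurable
qed

lemma decode_measurable: "decode \<in> measurable (restrict_space borel code_set) GB"
proof (rule measurableI)
  fix z assume "z \<in> space (restrict_space borel code_set)"
  then show "decode z \<in> space GB" using decode_in by (simp add: space_restrict_space)
next
  fix A assume A: "A \<in> sets GB"
  have "\<forall>e\<in>arcs G. \<exists>B. B \<in> sets borel \<and> {s \<in> {0..len e}. q (e, s) \<in> A} = {0..len e} \<inter> B"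
  proof
    fix e assume that: "e \<in> arcs G"
    have "(\<lambda>s. q (e, s)) \<in> measurable (restrict_space borel {0..len e}) GB"
      by (rule measurable_compose[OF edge_inclusion_measurable[OF that] q_measurable])
    from measurable_sets[OF this A]
    have "(\<lambda>s. q (e, s)) -` A \<inter> space (restrict_space borel {0..len e}) \<in> sets (restrict_space borel {0..len e})" .
    moreover have "{s \<in> {0..len e}. q (e, s) \<in> A} = (\<lambda>s. q (e, s)) -` A \<inter> space (restrict_space borel {0..len e})"
      by (auto simp: space_restrict_space)
    ultimately show "\<exists>B. B \<in> sets borel \<and> {s \<in> {0..len e}. q (e, s) \<in> A} = {0..len e} \<inter> B" by (auto simp: sets_restrict_space)
  qed
  from bchoice[OF this] obtain B where B: "\<And>e. e \<in> arcs G \<Longrightarrow> B e \<in> sets borel"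
     "\<And>e. e \<in> arcs G \<Longrightarrow> {s \<in> {0..len e}. q (e, s) \<in> A} = {0..len e} \<inter> B e" by blast
  have B': "q (e, s) \<in> A \<longleftrightarrow> s \<in> B e" if "e \<in> arcs G" "s \<in> {0..len e}" for e s
    using arg_cong[OF B(2)[OF that(1)], of "\<lambda>Z. s \<in> Z"] that by auto
  have "decode -` A \<inter> space (restrict_space borel code_set) = code_set \<inter> (\<Union>e\<in>arcs G. {arc_index e} \<times> B e)"
  proof (intro set_eqI iffI)
    fix z assume "z \<in> decode -` A \<inter> space (restrict_space borel code_set)"
    then obtain e where "e \<in> arcs G" "fst z = arc_index e" "snd z \<in> {0..len e}" "decode z \<in> A" "z \<in> code_set"
      unfolding space_restrict_space code_set_def by fastforce
    then show "z \<in> code_set \<inter> (\<Union>e\<in>arcs G. {arc_index e} \<times> B e)"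
      using B'[of e "snd z"] decode_eq[of e "snd z"] by (cases z) auto
  next
    fix z assume "z \<in> code_set \<inter> (\<Union>e\<in>arcs G. {arc_index e} \<times> B e)"
    then obtain e f where "z \<in> code_set" "e \<in> arcs G" "f \<in> arcs G" "fst z = arc_index e" "snd z \<in> {0..len e}" "fst z = arc_index f" "snd z \<in> B f"
      by (auto simp: code_set_def)
    then show "z \<in> decode -` A \<inter> space (restrict_space borel code_set)"
      using B'[of e "snd z"] decode_eq[of e "snd z"] arc_index_eq_iff[of e f] by (cases z) (auto simp: space_restrict_space)
  qed
  also have "\<dots> \<in> sets (restrict_space borel code_set)"
  proof -
    have "{arc_index e} \<times> B e \<in> sets (borel \<Otimes>\<^sub>M borel)" if "e \<in> arcs G" for e using B(1)[OF that] by auto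
    then have "(\<Union>e\<in>arcs G. {arc_index e} \<times> B e) \<in> sets (borel :: (real \<times> real) measure)"
      using finite_arcs unfolding borel_prod by (intro sets.finite_UN) auto
    then show ?thesis by (simp add: sets_restrict_space)
  qed
  finally show "decode -` A \<inter> space (restrict_space borel code_set) \<in> sets (restrict_space borel code_set)" .
qed

text \<open>Edge indices are integers, so codes at distance below 1 lie on the same segment.\<close>

lemma decode_dist:
  assumes "z \<in> code_set" "z' \<in> code_set" "dist z z' < 1"
  shows "D (decode z) (decode z') \<le> dist z z'"
proof -
  obtain e s where z: "z = (arc_index e, s)" "e \<in> arcs G" "s \<in> {0..len e}" using assms by (auto simp: code_set_def)
  obtain f t where z': "z' = (arc_index f, t)" "f \<in> arcs G" "t \<in> {0..len f}" using assms by (auto simp: code_set_def)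
  have "\<bar>arc_index e - arc_index f\<bar> < 1"
    using dist_fst_le[of z z'] assms(3) by (simp add: z z' dist_real_def)
  then have "e = f" by (rule arc_index_dist[OF z(2) z'(2)])
  then have "D (decode z) (decode z') \<le> \<bar>t - s\<bar>"
    using z z' graph_dist_edge[of e s t] by (simp add: decode_eq)
  also have "\<dots> \<le> dist z z'" using dist_snd_le[of z z'] by (simp add: z z' dist_real_def abs_minus_commute)
  finally show ?thesis .
qed

lemma cost_continuous:
  "continuous_on (code_set \<times> code_set) (\<lambda>z. (D (decode (fst z)) (decode (snd z)))\<^sup>2)"
proof -
  have "continuous_on (code_set \<times> code_set) (\<lambda>z. D (decode (fst z)) (decode (snd z)))"
    unfolding continuous_on_iff
  proof (intro ballI allI impI)
    fix z and \<epsilon> :: real assume z: "z \<in> code_set \<times> code_set" and \<epsilon>: "0 < \<epsilon>"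
    show "\<exists>d>0. \<forall>z'\<in>code_set \<times> code_set. dist z' z < d \<longrightarrow>
        dist (D (decode (fst z')) (decode (snd z'))) (D (decode (fst z)) (decode (snd z))) < \<epsilon>"
    proof (intro exI[of _ "min 1 (\<epsilon> / 2)"] conjI ballI impI)
      fix z' assume z': "z' \<in> code_set \<times> code_set" "dist z' z < min 1 (\<epsilon> / 2)"
      have c: "fst z \<in> code_set" "snd z \<in> code_set" "fst z' \<in> code_set" "snd z' \<in> code_set" using z z' by auto
      note X = c[THEN decode_in]
      have d: "dist (fst z') (fst z) < min 1 (\<epsilon> / 2)" "dist (snd z') (snd z) < min 1 (\<epsilon> / 2)"
        using z'(2) dist_fst_le[of z' z] dist_snd_le[of z' z] by linarith+
      have "D (decode (fst z')) (decode (fst z)) < \<epsilon> / 2" "D (decode (snd z')) (decode (snd z)) < \<epsilon> / 2"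
        using decode_dist[OF c(3,1)] decode_dist[OF c(4,2)] d by auto
      moreover have "D (decode (fst z')) (decode (snd z')) \<le> D (decode (fst z')) (decode (fst z)) + D (decode (fst z)) (decode (snd z'))"
        "D (decode (fst z)) (decode (snd z')) \<le> D (decode (fst z)) (decode (snd z)) + D (decode (snd z)) (decode (snd z'))"
        "D (decode (fst z)) (decode (snd z)) \<le> D (decode (fst z)) (decode (fst z')) + D (decode (fst z')) (decode (snd z))"
        "D (decode (fst z')) (decode (snd z)) \<le> D (decode (fst z')) (decode (snd z')) + D (decode (snd z')) (decode (snd z))"
        using X by (auto intro: GM.triangle)
      moreover have "D (decode (snd z)) (decode (snd z')) = D (decode (snd z')) (decode (snd z))"
        "D (decode (fst z)) (decode (fst z')) = D (decode (fst z')) (decode (fst z))" by (rule GM.commute)+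
      ultimately show "dist (D (decode (fst z')) (decode (snd z'))) (D (decode (fst z)) (decode (snd z))) < \<epsilon>"
        unfolding dist_real_def by linarith
    qed (use \<epsilon> in auto)
  qed
  then show ?thesis by (intro continuous_intros)
qed

text \<open>With the cost bounded by the squared diameter bound, the existence of one coupling makes
  \<open>W2_squared\<close> finite.\<close>

lemma product_coupling:
  assumes M: "M \<in> prob_measures G len" and N: "N \<in> prob_measures G len"
  shows "M \<Otimes>\<^sub>M N \<in> couplings G len M N"
proof -
  interpret M: prob_space M using prob_measuresD[OF M] by simp
  interpret N: prob_space N using prob_measuresD[OF N] by simp
  interpret MN: pair_prob_space M N ..
  have s: "sets (M \<Otimes>\<^sub>M N) = sets GG" by (intro sets_pair_measure_cong prob_measuresD(2) M N)
  have "distr (M \<Otimes>\<^sub>M N) GB fst = distr (M \<Otimes>\<^sub>M N) M fst" "distr (M \<Otimes>\<^sub>M N) GB snd = distr (M \<Otimes>\<^sub>M N) N snd"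
    using prob_measuresD(2)[OF M] prob_measuresD(2)[OF N] by (auto intro: distr_cong)
  moreover have "distr (M \<Otimes>\<^sub>M N) M fst = M" "distr (M \<Otimes>\<^sub>M N) N snd = N"
  proof -
    show "distr (M \<Otimes>\<^sub>M N) M fst = M" by (rule N.distr_pair_fst)
    show "distr (M \<Otimes>\<^sub>M N) N snd = N"
    proof (rule measure_eqI)
      fix A assume "A \<in> sets (distr (M \<Otimes>\<^sub>M N) N snd)"
      then have A: "A \<in> sets N" by simp
      then have "snd -` A \<inter> space (M \<Otimes>\<^sub>M N) = space M \<times> A"
        using sets.sets_into_space by (auto simp: space_pair_measure)
      then show "emeasure (distr (M \<Otimes>\<^sub>M N) N snd) A = emeasure N A"
        using A by (simp add: emeasure_distr N.emeasure_pair_measure_Times M.emeasure_space_1)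
    qed simp
  qed
  ultimately show ?thesis using s by (simp add: couplings_def space_prob_algebra MN.prob_space_axioms)
qed

lemma couplingsD:
  assumes "\<sigma> \<in> couplings G len M N"
  shows "prob_space \<sigma>" "sets \<sigma> = sets GG" "space \<sigma> = X \<times> X" "distr \<sigma> GB fst = M" "distr \<sigma> GB snd = N"
  using assms by (auto simp: couplings_def space_prob_algebra space_pair_measure dest: sets_eq_imp_space_eq)

lemma coupling_cost:
  assumes \<sigma>: "\<sigma> \<in> couplings G len M N"
  shows "integrable \<sigma> (\<lambda>\<omega>. (D (fst \<omega>) (snd \<omega>))\<^sup>2)"
    "(\<integral>\<^sup>+(x, y). ennreal ((D x y)\<^sup>2) \<partial>\<sigma>) = ennreal (\<integral>\<omega>. (D (fst \<omega>) (snd \<omega>))\<^sup>2 \<partial>\<sigma>)"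
proof -
  interpret prob_space \<sigma> by (rule couplingsD[OF \<sigma>])
  have m: "(\<lambda>\<omega>. D (fst \<omega>) (snd \<omega>)) \<in> borel_measurable \<sigma>"
    using graph_dist_measurable measurable_cong_sets[OF couplingsD(2)[OF \<sigma>] refl] by blast
  show int: "integrable \<sigma> (\<lambda>\<omega>. (D (fst \<omega>) (snd \<omega>))\<^sup>2)"
  proof (rule integrable_const_bound[of _ "diam_bound\<^sup>2"])
    show "AE \<omega> in \<sigma>. norm ((D (fst \<omega>) (snd \<omega>))\<^sup>2) \<le> diam_bound\<^sup>2"
    proof (rule AE_I2)
      fix \<omega> assume "\<omega> \<in> space \<sigma>"
      then have "D (fst \<omega>) (snd \<omega>) \<le> diam_bound" using couplingsD(3)[OF \<sigma>] by (auto intro: diam_bound)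
      then show "norm ((D (fst \<omega>) (snd \<omega>))\<^sup>2) \<le> diam_bound\<^sup>2" by (simp add: power_mono)
    qed
  qed (rule borel_measurable_power[OF m])
  have "(\<integral>\<^sup>+(x, y). ennreal ((D x y)\<^sup>2) \<partial>\<sigma>) = (\<integral>\<^sup>+\<omega>. ennreal ((D (fst \<omega>) (snd \<omega>))\<^sup>2) \<partial>\<sigma>)"
    by (simp add: case_prod_unfold)
  also have "\<dots> = ennreal (\<integral>\<omega>. (D (fst \<omega>) (snd \<omega>))\<^sup>2 \<partial>\<sigma>)" by (rule nn_integral_eq_integral[OF int]) simp
  finally show "(\<integral>\<^sup>+(x, y). ennreal ((D x y)\<^sup>2) \<partial>\<sigma>) = ennreal (\<integral>\<omega>. (D (fst \<omega>) (snd \<omega>))\<^sup>2 \<partial>\<sigma>)" .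
qed

text \<open>A minimizing sequence is moved to pairs of codes, where a weak limit exists and the cost
  is continuous. The limit is moved back by decoding, which is legitimate because
  \<open>decode\<close> undoes \<open>encode\<close>.\<close>

lemma optimal_coupling_exists:
  assumes M: "M \<in> prob_measures G len" and N: "N \<in> prob_measures G len"
  obtains \<sigma> where "\<sigma> \<in> couplings G len M N" "W2_squared G len M N = (\<integral>\<^sup>+(x, y). ennreal ((D x y)\<^sup>2) \<partial>\<sigma>)"
proof -
  define W where "W = enn2real (W2_squared G len M N)"
  have Wle: "W2_squared G len M N \<le> (\<integral>\<^sup>+(x, y). ennreal ((D x y)\<^sup>2) \<partial>\<sigma>)" if "\<sigma> \<in> couplings G len M N" for \<sigma>
    unfolding W2_squared_def by (rule INF_lower[OF that])
  have "W2_squared G len M N < \<infinity>"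
    using Wle[OF product_coupling[OF M N]] unfolding coupling_cost(2)[OF product_coupling[OF M N]]
    by (rule order_le_less_trans) simp
  then have W: "W2_squared G len M N = ennreal W" by (simp add: W_def)
  have "\<exists>\<sigma>\<in>couplings G len M N. (\<integral>\<omega>. (D (fst \<omega>) (snd \<omega>))\<^sup>2 \<partial>\<sigma>) < W + 1 / real (Suc n)" for n
  proof (rule ccontr)
    assume "\<not> ?thesis"
    then have "W + 1 / real (Suc n) \<le> (\<integral>\<omega>. (D (fst \<omega>) (snd \<omega>))\<^sup>2 \<partial>\<sigma>)" if "\<sigma> \<in> couplings G len M N" for \<sigma>
      using that by force
    then have "ennreal (W + 1 / real (Suc n)) \<le> W2_squared G len M N"
      unfolding W2_squared_def by (intro INF_greatest) (simp add: coupling_cost(2) ennreal_leI)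
    then show False unfolding W by (subst (asm) ennreal_le_iff) (auto simp: W_def field_simps)
  qed
  then have "\<forall>n. \<exists>\<sigma>. \<sigma> \<in> couplings G len M N \<and> (\<integral>\<omega>. (D (fst \<omega>) (snd \<omega>))\<^sup>2 \<partial>\<sigma>) < W + 1 / real (Suc n)"
    by blast
  from choice[OF this] obtain s where s: "\<And>n. s n \<in> couplings G len M N" "\<And>n. (\<integral>\<omega>. (D (fst \<omega>) (snd \<omega>))\<^sup>2 \<partial>s n) < W + 1 / real (Suc n)"
    by blast
  define K where "K = code_set \<times> code_set"
  define enc where "enc \<omega> = (encode (fst \<omega>), encode (snd \<omega>))" for \<omega>
  define dec where "dec z = (decode (fst z), decode (snd z))" for z
  have enc_m: "enc \<in> borel_measurable GG"
    unfolding enc_def[abs_def] using encode_measurable by measurable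
  have enc_s: "enc \<in> borel_measurable (s n)" for n
    using enc_m measurable_cong_sets[OF couplingsD(2)[OF s(1)] refl] by blast
  have Kc: "compact K" unfolding K_def by (intro compact_Times code_set_compact)
  have Kb: "K \<in> sets borel" by (rule borel_closed[OF compact_imp_closed[OF Kc]])
  have cb: "code_set \<in> sets borel" by (rule borel_closed[OF compact_imp_closed[OF code_set_compact]])
  define S where "S n = distr (s n) borel enc" for n
  have S_sets: "sets (S n) = sets borel" for n by (simp add: S_def)
  have S_prob: "prob_space (S n)" for n
    unfolding S_def by (intro prob_space.prob_space_distr enc_s couplingsD(1)[OF s(1)])
  have S_K: "AE z in S n. z \<in> K" for n
    unfolding S_def using Kb enc_s couplingsD(3)[OF s(1)] encode_in
    by (subst AE_distr_iff) (auto simp: enc_def K_def intro!: AE_I2)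
  obtain r L where r: "strict_mono (r :: nat \<Rightarrow> nat)" and L: "prob_space L" "sets L = sets borel" "AE z in L. z \<in> K"
    and lim: "\<And>f :: (real \<times> real) \<times> (real \<times> real) \<Rightarrow> real. continuous_on K f \<Longrightarrow> (\<lambda>n. LINT z:K|S (r n). f z) \<longlonglongrightarrow> (LINT z:K|L. f z)"
    by (rule compact_probability_subsequence[where M = S, OF Kc S_sets S_prob S_K]) blast
  interpret L: prob_space L by (rule L(1))
  have LK: "(LINT z:K|L. f z) = (\<integral>z. f z \<partial>L)" if "continuous_on UNIV f" for f :: "_ \<Rightarrow> real"
    unfolding set_lebesgue_integral_def
    using L(3) Kb borel_measurable_continuous_onI[OF that] measurable_cong_sets[OF L(2) refl]
    by (intro integral_cong_AE) (auto elim!: eventually_mono)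
  have SK: "(LINT z:K|S n. f z) = (\<integral>\<omega>. f (enc \<omega>) \<partial>s n)" if f: "continuous_on K f" for f :: "_ \<Rightarrow> real" and n
  proof -
    have "(LINT z:K|S n. f z) = (\<integral>\<omega>. indicator K (enc \<omega>) *\<^sub>R f (enc \<omega>) \<partial>s n)"
      unfolding set_lebesgue_integral_def S_def
      by (rule integral_distr[OF enc_s borel_measurable_continuous_on_indicator[OF Kb f]])
    also have "\<dots> = (\<integral>\<omega>. f (enc \<omega>) \<partial>s n)"
      using couplingsD(3)[OF s(1)] encode_in by (intro Bochner_Integration.integral_cong) (auto simp: enc_def K_def)
    finally show ?thesis .
  qed
  \<comment> \<open>The coded marginals are constant along the sequence. Testing with continuous
    functions of the codes therefore identifies the marginals of the limit, although
    \<open>encode\<close> itself is not continuous.\<close>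
  have marg: "distr L borel fst = distr M borel encode" "distr L borel snd = distr N borel encode"
  proof -
    have em: "encode \<in> borel_measurable M" "encode \<in> borel_measurable N"
      using encode_measurable measurable_cong_sets[OF prob_measuresD(2)[OF M] refl] measurable_cong_sets[OF prob_measuresD(2)[OF N] refl] by auto
    have fsm: "fst \<in> borel_measurable L" "snd \<in> borel_measurable L"
      using L(2) by (auto simp: measurable_cong_sets[OF L(2) refl] borel_prod[symmetric])
    have main: "(\<integral>z. f z \<partial>distr L borel fst) = (\<integral>z. f z \<partial>distr M borel encode)" "(\<integral>z. f z \<partial>distr L borel snd) = (\<integral>z. f z \<partial>distr N borel encode)"
      if f: "continuous_on UNIV f" for f :: "real \<times> real \<Rightarrow> real"
    proof -
      have fm: "f \<in> borel_measurable borel" using f by (rule borel_measurable_continuous_onI)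
      have fc: "continuous_on UNIV (\<lambda>z. f (fst z))" "continuous_on UNIV (\<lambda>z. f (snd z))"
        by (auto intro!: continuous_on_compose2[OF f] continuous_intros)
      have e: "(\<integral>\<omega>. f (encode (fst \<omega>)) \<partial>s n) = (\<integral>x. f (encode x) \<partial>M)" "(\<integral>\<omega>. f (encode (snd \<omega>)) \<partial>s n) = (\<integral>x. f (encode x) \<partial>N)" for n
      proof -
        have "fst \<in> measurable (s n) GB" "snd \<in> measurable (s n) GB"
          by (simp_all add: measurable_cong_sets[OF couplingsD(2)[OF s(1)] refl])
        then have "(\<integral>x. f (encode x) \<partial>distr (s n) GB fst) = (\<integral>\<omega>. f (encode (fst \<omega>)) \<partial>s n)"
          "(\<integral>x. f (encode x) \<partial>distr (s n) GB snd) = (\<integral>\<omega>. f (encode (snd \<omega>)) \<partial>s n)"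
          by (auto intro!: integral_distr measurable_compose[OF encode_measurable fm])
        then show "(\<integral>\<omega>. f (encode (fst \<omega>)) \<partial>s n) = (\<integral>x. f (encode x) \<partial>M)" "(\<integral>\<omega>. f (encode (snd \<omega>)) \<partial>s n) = (\<integral>x. f (encode x) \<partial>N)"
          using couplingsD(4,5)[OF s(1)] by auto
      qed
      have "(LINT z:K|S (r n). f (fst z)) = (\<integral>x. f (encode x) \<partial>M)" "(LINT z:K|S (r n). f (snd z)) = (\<integral>x. f (encode x) \<partial>N)" for n
        using SK[OF continuous_on_subset[OF fc(1)]] SK[OF continuous_on_subset[OF fc(2)]] e by (auto simp: enc_def)
      then have "(LINT z:K|L. f (fst z)) = (\<integral>x. f (encode x) \<partial>M)" "(LINT z:K|L. f (snd z)) = (\<integral>x. f (encode x) \<partial>N)"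
        using lim[OF continuous_on_subset[OF fc(1)]] lim[OF continuous_on_subset[OF fc(2)]]
        by (simp_all add: LIMSEQ_const_iff)
      then show "(\<integral>z. f z \<partial>distr L borel fst) = (\<integral>z. f z \<partial>distr M borel encode)" "(\<integral>z. f z \<partial>distr L borel snd) = (\<integral>z. f z \<partial>distr N borel encode)"
        using LK[OF fc(1)] LK[OF fc(2)] by (simp_all add: integral_distr[OF fsm(1) fm] integral_distr[OF fsm(2) fm] integral_distr[OF em(1) fm] integral_distr[OF em(2) fm])
    qed
    have pM: "prob_space M" "prob_space N" using prob_measuresD(1) M N by auto
    show "distr L borel fst = distr M borel encode" "distr L borel snd = distr N borel encode"
      using main by (auto intro!: measure_eqI_continuous L.prob_space_distr prob_space.prob_space_distr pM em fsm)
  qed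
  define L' where "L' = restrict_space L K"
  have KL: "K \<in> sets L" using Kb L(2) by simp
  obtain x0 where x0: "x0 \<in> X" using prob_space.not_empty[OF prob_measuresD(1)[OF M]] prob_measuresD(3)[OF M] by blast
  \<comment> \<open>\<open>decode\<close> is controlled only on \<open>code_set\<close>; the value
    \<open>x0\<close> elsewhere gives a total Borel map, and the limit law does not charge that
    region.\<close>
  define d1 where "d1 z = (if z \<in> code_set then decode z else x0)" for z
  have d1m: "d1 \<in> measurable borel GB"
    unfolding d1_def[abs_def] using cb decode_measurable x0
    by (subst measurable_If_restrict_space_iff) (auto simp: space_restrict_space)
  define \<sigma> where "\<sigma> = distr L GG (\<lambda>z. (d1 (fst z), d1 (snd z)))"
  have fsm: "fst \<in> borel_measurable L" "snd \<in> borel_measurable L"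
    using L(2) by (auto simp: measurable_cong_sets[OF L(2) refl] borel_prod[symmetric])
  have d2m: "(\<lambda>z. (d1 (fst z), d1 (snd z))) \<in> measurable L GG"
    by (intro measurable_Pair measurable_compose[OF fsm(1) d1m] measurable_compose[OF fsm(2) d1m])
  have dd: "distr P GB (d1 \<circ> encode) = P" if P: "P \<in> prob_measures G len" for P
  proof -
    have "distr P GB (d1 \<circ> encode) = distr P P (\<lambda>x. x)"
      using prob_measuresD(2,3)[OF P] encode_in decode_encode by (intro distr_cong) (auto simp: d1_def)
    then show ?thesis by simp
  qed
  have coup: "\<sigma> \<in> couplings G len M N"
  proof -
    have em: "encode \<in> borel_measurable M" "encode \<in> borel_measurable N"
      using encode_measurable measurable_cong_sets[OF prob_measuresD(2)[OF M] refl] measurable_cong_sets[OF prob_measuresD(2)[OF N] refl] by auto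
    have "distr \<sigma> GB fst = distr (distr L borel fst) GB d1"
      unfolding \<sigma>_def using d2m fsm d1m by (simp add: distr_distr o_def)
    also have "\<dots> = M" unfolding marg(1) using em(1) d1m dd[OF M] by (simp add: distr_distr)
    finally have 1: "distr \<sigma> GB fst = M" .
    have "distr \<sigma> GB snd = distr (distr L borel snd) GB d1"
      unfolding \<sigma>_def using d2m fsm d1m by (simp add: distr_distr o_def)
    also have "\<dots> = N" unfolding marg(2) using em(2) d1m dd[OF N] by (simp add: distr_distr)
    finally have 2: "distr \<sigma> GB snd = N" .
    show ?thesis
      using 1 2 L.prob_space_distr[OF d2m] by (simp add: couplings_def space_prob_algebra \<sigma>_def)
  qed
  define c where "c z = (D (decode (fst z)) (decode (snd z)))\<^sup>2" for z
  have cc: "continuous_on K c" unfolding K_def c_def by (rule cost_continuous)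
  have "(\<integral>\<omega>. (D (fst \<omega>) (snd \<omega>))\<^sup>2 \<partial>\<sigma>) = (\<integral>z. (D (d1 (fst z)) (d1 (snd z)))\<^sup>2 \<partial>L)"
    unfolding \<sigma>_def by (subst integral_distr[OF d2m]) (auto intro!: borel_measurable_power graph_dist_measurable)
  also have "\<dots> = (LINT z:K|L. c z)"
    unfolding set_lebesgue_integral_def
  proof (rule integral_cong_AE)
    show "(\<lambda>z. (D (d1 (fst z)) (d1 (snd z)))\<^sup>2) \<in> borel_measurable L"
      using measurable_compose[OF d2m graph_dist_measurable] by simp
    show "(\<lambda>z. indicat_real K z *\<^sub>R c z) \<in> borel_measurable L"
      unfolding measurable_cong_sets[OF L(2) refl] by (rule borel_measurable_continuous_on_indicator[OF Kb cc])
    show "AE z in L. (D (d1 (fst z)) (d1 (snd z)))\<^sup>2 = indicat_real K z *\<^sub>R c z"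
      using L(3) by eventually_elim (auto simp: K_def c_def d1_def)
  qed
  finally have cost\<sigma>: "(\<integral>\<omega>. (D (fst \<omega>) (snd \<omega>))\<^sup>2 \<partial>\<sigma>) = (LINT z:K|L. c z)" .
  have costs: "(LINT z:K|S n. c z) = (\<integral>\<omega>. (D (fst \<omega>) (snd \<omega>))\<^sup>2 \<partial>s n)" for n
    unfolding SK[OF cc] using couplingsD(3)[OF s(1)] decode_encode
    by (intro Bochner_Integration.integral_cong) (auto simp: c_def enc_def)
  have "(LINT z:K|L. c z) \<le> W"
  proof (rule LIMSEQ_le[OF lim[OF cc]])
    have "(\<lambda>n. W + 1 / real (Suc n)) \<longlonglongrightarrow> W + 0" by (intro tendsto_intros LIMSEQ_Suc[OF lim_1_over_n])
    from LIMSEQ_subseq_LIMSEQ[OF this r] show "(\<lambda>n. W + 1 / real (Suc (r n))) \<longlonglongrightarrow> W" by (simp add: o_def)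
    show "\<exists>N. \<forall>n\<ge>N. (LINT z:K|S (r n). c z) \<le> W + 1 / real (Suc (r n))"
      using s(2) unfolding costs by (auto intro: less_imp_le)
  qed
  then have "(\<integral>\<^sup>+(x, y). ennreal ((D x y)\<^sup>2) \<partial>\<sigma>) \<le> W2_squared G len M N"
    unfolding coupling_cost(2)[OF coup] cost\<sigma> W by (rule ennreal_leI)
  with Wle[OF coup] have "W2_squared G len M N = (\<integral>\<^sup>+(x, y). ennreal ((D x y)\<^sup>2) \<partial>\<sigma>)" by (rule antisym)
  then show thesis using that[OF coup] by blast
qed

section \<open>Arc-length parametrization of paths\<close>

text \<open>\<open>brk\<close> marks the parameters at which a path may change its segment.\<close>

fun pos :: "('e \<times> real \<times> real) list \<Rightarrow> real \<Rightarrow> 'e \<times> real" where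
  "pos [] a = undefined"
| "pos ((e, s, t) # p) a = (if a \<le> \<bar>t - s\<bar> \<or> p = [] then (e, s + sgn (t - s) * a) else pos p (a - \<bar>t - s\<bar>))"

text \<open>The derivative of the edge coordinate of \<open>pos\<close>, with sign relative to the
  orientation of the edge. At a junction it takes the value of the segment that ends there; such
  parameters are caught by \<open>brk\<close>.\<close>

fun vel :: "('e \<times> real \<times> real) list \<Rightarrow> real \<Rightarrow> real" where
  "vel [] a = 0"
| "vel ((e, s, t) # p) a = (if a \<le> \<bar>t - s\<bar> \<or> p = [] then sgn (t - s) else vel p (a - \<bar>t - s\<bar>))"

fun brk :: "('e \<times> real \<times> real) list \<Rightarrow> real \<Rightarrow> bool" where
  "brk [] a \<longleftrightarrow> a = 0"
| "brk ((e, s, t) # p) a \<longleftrightarrow> a = 0 \<or> brk p (a - \<bar>t - s\<bar>)"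

lemma brk_0: "brk p 0" by (cases p) auto

lemma brk_finite: "finite {a. brk p a}"
proof (induction p)
  case (Cons seg p)
  obtain e s t where seg: "seg = (e, s, t)" by (metis surj_pair)
  have "{a. brk (seg # p) a} \<subseteq> insert 0 ((\<lambda>a. a + \<bar>t - s\<bar>) ` {a. brk p a})"
    by (auto simp: seg intro!: image_eqI[where x="_ - \<bar>t - s\<bar>"])
  then show ?case using Cons finite_subset by blast
qed simp

lemma vel_abs: "\<bar>vel p a\<bar> \<le> 1"
proof (induction p arbitrary: a)
  case (Cons seg p)
  obtain e s t where seg: "seg = (e, s, t)" by (metis surj_pair)
  have "\<bar>sgn (t - s)\<bar> \<le> 1" by (auto simp: sgn_if)
  then show ?case using Cons by (simp add: seg)
qed simp

lemma sgn_between: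
  fixes s t a l :: real
  assumes "s \<in> {0..l}" "t \<in> {0..l}" "0 \<le> a" "a \<le> \<bar>t - s\<bar>"
  shows "s + sgn (t - s) * a \<in> {0..l}"
    and "0 < a \<Longrightarrow> a < \<bar>t - s\<bar> \<Longrightarrow> s + sgn (t - s) * a \<in> {0<..<l}"
    and "a = \<bar>t - s\<bar> \<Longrightarrow> s + sgn (t - s) * a = t"
  using assms by (auto simp: sgn_if split: if_splits)

lemma pos_in:
  assumes "is_path G len x p y" "p \<noteq> []" "0 \<le> a" "a \<le> path_length p"
  shows "pos p a \<in> CE"
  using assms
proof (induction p arbitrary: x a)
  case (Cons seg p)
  obtain e s t where seg: "seg = (e, s, t)" by (metis surj_pair)
  show ?case
  proof (cases "a \<le> \<bar>t - s\<bar> \<or> p = []")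
    case True
    then have "a \<le> \<bar>t - s\<bar>" using Cons.prems(4) by (auto simp: seg)
    then show ?thesis using sgn_between(1)[of s "len e" t a] Cons.prems True by (auto simp: seg)
  next
    case False
    then show ?thesis using Cons.IH[of "q (e, t)" "a - \<bar>t - s\<bar>"] Cons.prems by (auto simp: seg)
  qed
qed simp

lemma pos_start:
  assumes "is_path G len x p y" "p \<noteq> []" shows "q (pos p 0) = x"
  using assms by (cases p) auto

lemma pos_end:
  assumes "is_path G len x p y" "p \<noteq> []" shows "q (pos p (path_length p)) = y"
  using assms
proof (induction p arbitrary: x)
  case (Cons seg p)
  obtain e s t where seg: "seg = (e, s, t)" by (metis surj_pair)
  have est: "e \<in> arcs G" "s \<in> {0..len e}" "t \<in> {0..len e}" "is_path G len (q (e, t)) p y" using Cons.prems by (auto simp: seg)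
  show ?case
  \<comment> \<open>Trailing segments of length 0 are not reached by \<open>pos\<close>, which stops
    at the end of the first segment. In the quotient this is the same point.\<close>
  proof (cases "path_length p = 0")
    case True
    then have "q (e, t) = y" using graph_dist_zero_path[OF est(4)] by simp
    then show ?thesis using True sgn_between(3)[OF est(2,3), of "\<bar>t - s\<bar>"] by (simp add: seg)
  next
    case False
    then have "\<not> path_length p \<le> 0" using path_length_nonneg[of p] by simp
    moreover have "p \<noteq> []" using False by auto
    ultimately show ?thesis using Cons.IH[OF est(4)] by (simp add: seg)
  qed
qed simp

text \<open>Arc length moves at speed at most 1 inside an edge, and pieces in different segments are
  joined at the junction by the triangle inequality.\<close>

lemma pos_dist:
  assumes "is_path G len x p y" "p \<noteq> []" "0 \<le> a" "a \<le> b" "b \<le> path_length p"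
  shows "D (q (pos p a)) (q (pos p b)) \<le> b - a"
  using assms
proof (induction p arbitrary: x a b)
  case (Cons seg p)
  obtain e s t where seg: "seg = (e, s, t)" by (metis surj_pair)
  have est: "e \<in> arcs G" "s \<in> {0..len e}" "t \<in> {0..len e}" "is_path G len (q (e, t)) p y" using Cons.prems by (auto simp: seg)
  define l where "l = \<bar>t - s\<bar>"
  have edge: "D (q (e, s + sgn (t - s) * a)) (q (e, s + sgn (t - s) * b)) \<le> b - a" if "0 \<le> a" "a \<le> b" "b \<le> l" for a b
  proof -
    have "D (q (e, s + sgn (t - s) * a)) (q (e, s + sgn (t - s) * b)) \<le> \<bar>(s + sgn (t - s) * b) - (s + sgn (t - s) * a)\<bar>"
      using that sgn_between(1)[OF est(2,3), of a] sgn_between(1)[OF est(2,3), of b]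
      by (intro graph_dist_edge est) (auto simp: l_def)
    also have "\<dots> = \<bar>sgn (t - s)\<bar> * (b - a)"
      using that by (simp add: abs_mult[symmetric] right_diff_distrib abs_of_nonneg flip: right_diff_distrib)
        (simp add: abs_mult)
    also have "\<dots> \<le> b - a" using that by (auto simp: sgn_if)
    finally show ?thesis .
  qed
  show ?case
  proof (cases "b \<le> l \<or> p = []")
    case True
    then have "b \<le> l" using Cons.prems(5) by (auto simp: seg l_def)
    then show ?thesis using edge[of a b] Cons.prems by (simp add: seg l_def)
  next
    case False
    then have bl: "l < b" "p \<noteq> []" by auto
    have bp: "b - l \<le> path_length p" using Cons.prems(5) by (simp add: seg l_def)
    show ?thesis
    proof (cases "a \<le> l")
      case True
      have "D (q (e, s + sgn (t - s) * a)) (q (e, s + sgn (t - s) * l)) \<le> l - a"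
        using True Cons.prems by (intro edge) auto
      moreover have "s + sgn (t - s) * l = t" using sgn_between(3)[OF est(2,3), of l] by (simp add: l_def)
      moreover have "D (q (e, t)) (q (pos p (b - l))) \<le> b - l"
        using Cons.IH[OF est(4) bl(2), of 0 "b - l"] bl bp pos_start[OF est(4) bl(2)] by simp
      moreover have "D (q (e, s + sgn (t - s) * a)) (q (pos p (b - l))) \<le>
         D (q (e, s + sgn (t - s) * a)) (q (e, t)) + D (q (e, t)) (q (pos p (b - l)))"
        using est True Cons.prems sgn_between(1)[OF est(2,3), of a] pos_in[OF est(4) bl(2), of "b - l"] bl bp
        by (intro GM.triangle q_in) (auto simp: l_def)
      ultimately show ?thesis using True bl by (simp add: seg l_def[symmetric])
    next
      case False
      then show ?thesis using Cons.IH[OF est(4) bl(2), of "a - l" "b - l"] bl bp Cons.prems by (simp add: seg l_def[symmetric])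
    qed
  qed
qed simp

text \<open>Away from breaks the curve runs inside an open edge with slope 1 or -1 in the edge
  coordinate, so the chain rule applies; \<open>vel\<close> records the sign.\<close>

lemma pos_derivative:
  assumes "is_path G len x p y" "p \<noteq> []" "0 < a" "a < path_length p" "\<not> brk p a"
  shows "pos p a \<in> open_edges G len" (is ?A)
    and "\<psi> \<circ> q \<in> C1_edges G len \<Longrightarrow>
      ((\<lambda>b. \<psi> (q (pos p b))) has_real_derivative grad len (\<psi> \<circ> q) (pos p a) * vel p a) (at a)" (is "_ \<Longrightarrow> ?B")
proof -
  have "?A \<and> (\<psi> \<circ> q \<in> C1_edges G len \<longrightarrow> ?B)"
    using assms
  proof (induction p arbitrary: x a)
    case (Cons seg p)
    obtain e s t where seg: "seg = (e, s, t)" by (metis surj_pair)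
    have est: "e \<in> arcs G" "s \<in> {0..len e}" "t \<in> {0..len e}" "is_path G len (q (e, t)) p y" using Cons.prems by (auto simp: seg)
    define l where "l = \<bar>t - s\<bar>"
    have nb: "a \<noteq> 0" "\<not> brk p (a - l)" using Cons.prems(5) by (auto simp: seg l_def)
    \<comment> \<open>The end of the first segment is the start of the rest, and a start always
      counts as a break.\<close>
    have al: "a \<noteq> l" using nb(2) brk_0[of p] by auto
    show ?case
    proof (cases "a < l \<or> p = []")
      case True
      then have a: "0 < a" "a < l" using Cons.prems by (auto simp: seg l_def)
      have in1: "s + sgn (t - s) * a \<in> {0<..<len e}" using sgn_between(2)[OF est(2,3), of a] a by (simp add: l_def)
      have pa: "pos (seg # p) a = (e, s + sgn (t - s) * a)" "vel (seg # p) a = sgn (t - s)"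
        using a by (auto simp: seg l_def)
      have op: "(e, s + sgn (t - s) * a) \<in> open_edges G len" using in1 est by (auto simp: open_edges_def)
      have "?thesis" if C1: "\<psi> \<circ> q \<in> C1_edges G len"
      proof -
        have "((\<lambda>r. (\<psi> \<circ> q) (e, r)) has_real_derivative grad len (\<psi> \<circ> q) (e, s + sgn (t - s) * a)) (at (s + sgn (t - s) * a))"
          using grad_derivative[OF C1 est(1), of "s + sgn (t - s) * a"] in1 at_within_Icc_at[of 0 "s + sgn (t - s) * a" "len e"] by auto
        moreover have "((\<lambda>b. s + sgn (t - s) * b) has_real_derivative sgn (t - s)) (at a)"
          by (auto intro!: derivative_eq_intros)
        ultimately have "((\<lambda>b. (\<psi> \<circ> q) (e, s + sgn (t - s) * b)) has_real_derivative grad len (\<psi> \<circ> q) (e, s + sgn (t - s) * a) * sgn (t - s)) (at a)"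
          by (rule DERIV_chain2)
        then have "((\<lambda>b. \<psi> (q (pos (seg # p) b))) has_real_derivative grad len (\<psi> \<circ> q) (e, s + sgn (t - s) * a) * sgn (t - s)) (at a)"
        proof (rule has_field_derivative_transform_within_open[of _ _ _ "{..<l}"])
          fix b assume "b \<in> {..<l}"
          then show "(\<psi> \<circ> q) (e, s + sgn (t - s) * b) = \<psi> (q (pos (seg # p) b))" by (auto simp: seg l_def)
        qed (use a in auto)
        then show ?thesis unfolding pa using op by blast
      qed
      then show ?thesis unfolding pa using op by blast
    next
      case False
      then have la: "l < a" "p \<noteq> []" using al by auto
      have alp: "0 < a - l" "a - l < path_length p" using la Cons.prems by (auto simp: seg l_def)
      note IH = Cons.IH[OF est(4) la(2) alp nb(2)]
      have pa: "pos (seg # p) a = pos p (a - l)" "vel (seg # p) a = vel p (a - l)"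
        using la by (auto simp: seg l_def)
      have "((\<lambda>b. \<psi> (q (pos (seg # p) b))) has_real_derivative grad len (\<psi> \<circ> q) (pos p (a - l)) * vel p (a - l)) (at a)"
        if C1: "\<psi> \<circ> q \<in> C1_edges G len"
      proof -
        have "((\<lambda>b. \<psi> (q (pos p b))) has_real_derivative grad len (\<psi> \<circ> q) (pos p (a - l)) * vel p (a - l)) (at (a - l))"
          using IH C1 by blast
        moreover have "((\<lambda>b. b - l) has_real_derivative 1) (at a)" by (auto intro!: derivative_eq_intros)
        ultimately have "((\<lambda>b. \<psi> (q (pos p (b - l)))) has_real_derivative grad len (\<psi> \<circ> q) (pos p (a - l)) * vel p (a - l) * 1) (at a)"
          by (rule DERIV_chain2)
        then show ?thesis
          unfolding mult_1_right
        proof (rule has_field_derivative_transform_within_open[of _ _ _ "{l<..}"])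
          fix b assume "b \<in> {l<..}"
          then show "\<psi> (q (pos p (b - l))) = \<psi> (q (pos (seg # p) b))" using la by (auto simp: seg l_def)
        qed (use la in auto)
      qed
      then show ?thesis unfolding pa using IH by blast
    qed
  qed simp
  then show ?A "\<psi> \<circ> q \<in> C1_edges G len \<Longrightarrow> ?B" by blast+
qed

lemma route_nonempty: "route k p p' \<noteq> []"
  by (cases p; cases p'; cases k) auto

subsection \<open>Measurability\<close>

text \<open>Symbolic paths whose segment parameters are functions of a sample point. The list of
  edges is fixed, so measurability in the sample point can be proved by induction on the
  list.\<close>

definition instantiate :: "'w \<Rightarrow> ('e \<times> ('w \<Rightarrow> real) \<times> ('w \<Rightarrow> real)) list \<Rightarrow> ('e \<times> real \<times> real) list" where
  "instantiate w ps = map (\<lambda>(e, S, T). (e, S w, T w)) ps"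

lemma pos_vel_measurable:
  assumes "\<And>e S T. (e, S, T) \<in> set ps \<Longrightarrow> e \<in> arcs G \<and> S \<in> borel_measurable M \<and> T \<in> borel_measurable M"
    and "A \<in> borel_measurable M"
  shows "ps \<noteq> [] \<Longrightarrow> (\<lambda>w. fst (pos (instantiate w ps) (A w))) \<in> measurable M (count_space (arcs G))"
    and "ps \<noteq> [] \<Longrightarrow> (\<lambda>w. snd (pos (instantiate w ps) (A w))) \<in> borel_measurable M"
    and "(\<lambda>w. vel (instantiate w ps) (A w)) \<in> borel_measurable M"
    and "Measurable.pred M (\<lambda>w. brk (instantiate w ps) (A w))"
proof -
  have "(ps \<noteq> [] \<longrightarrow> (\<lambda>w. fst (pos (instantiate w ps) (A w))) \<in> measurable M (count_space (arcs G))) \<and>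
    (ps \<noteq> [] \<longrightarrow> (\<lambda>w. snd (pos (instantiate w ps) (A w))) \<in> borel_measurable M) \<and>
    (\<lambda>w. vel (instantiate w ps) (A w)) \<in> borel_measurable M \<and>
    Measurable.pred M (\<lambda>w. brk (instantiate w ps) (A w))"
    using assms
  proof (induction ps arbitrary: A)
    case Nil
    note [measurable] = Nil(2)
    show ?case by (simp add: instantiate_def)
  next
    case (Cons seg ps)
    obtain e S T where seg: "seg = (e, S, T)" by (metis surj_pair)
    have e: "e \<in> arcs G" and [measurable]: "S \<in> borel_measurable M" "T \<in> borel_measurable M" "A \<in> borel_measurable M"
      using Cons.prems by (auto simp: seg)
    define A' where "A' w = A w - \<bar>T w - S w\<bar>" for w
    have [measurable]: "A' \<in> borel_measurable M" unfolding A'_def[abs_def] by measurable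
    have IH: "ps \<noteq> [] \<Longrightarrow> (\<lambda>w. fst (pos (instantiate w ps) (A' w))) \<in> measurable M (count_space (arcs G))"
      "ps \<noteq> [] \<Longrightarrow> (\<lambda>w. snd (pos (instantiate w ps) (A' w))) \<in> borel_measurable M"
      and [measurable]: "(\<lambda>w. vel (instantiate w ps) (A' w)) \<in> borel_measurable M"
      "Measurable.pred M (\<lambda>w. brk (instantiate w ps) (A' w))"
      using Cons.IH[of A'] Cons.prems(1) by auto
    have eq: "pos (instantiate w (seg # ps)) (A w) = (if A w \<le> \<bar>T w - S w\<bar> \<or> ps = [] then (e, S w + sgn (T w - S w) * A w) else pos (instantiate w ps) (A' w))"
      "vel (instantiate w (seg # ps)) (A w) = (if A w \<le> \<bar>T w - S w\<bar> \<or> ps = [] then sgn (T w - S w) else vel (instantiate w ps) (A' w))"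
      "brk (instantiate w (seg # ps)) (A w) \<longleftrightarrow> A w = 0 \<or> brk (instantiate w ps) (A' w)" for w
      by (simp_all add: instantiate_def seg A'_def)
    have bm: "Measurable.pred M (\<lambda>w. A w = 0 \<or> brk (instantiate w ps) (A' w))" by measurable
    show ?case
    proof (cases "ps = []")
      case True
      show ?thesis unfolding eq using True e bm by simp
    next
      case False
      note [measurable] = IH(1,2)[OF False]
      have "(\<lambda>w. if A w \<le> \<bar>T w - S w\<bar> then e else fst (pos (instantiate w ps) (A' w))) \<in> measurable M (count_space (arcs G))"
        using e by (intro measurable_If) auto
      moreover have "(\<lambda>w. if A w \<le> \<bar>T w - S w\<bar> then S w + sgn (T w - S w) * A w else snd (pos (instantiate w ps) (A' w))) \<in> borel_measurable M"
        by measurable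
      moreover have "(\<lambda>w. if A w \<le> \<bar>T w - S w\<bar> then sgn (T w - S w) else vel (instantiate w ps) (A' w)) \<in> borel_measurable M"
        by measurable
      moreover have "fst (pos (instantiate w (seg # ps)) (A w)) = (if A w \<le> \<bar>T w - S w\<bar> then e else fst (pos (instantiate w ps) (A' w)))"
        "snd (pos (instantiate w (seg # ps)) (A w)) = (if A w \<le> \<bar>T w - S w\<bar> then S w + sgn (T w - S w) * A w else snd (pos (instantiate w ps) (A' w)))"
        "vel (instantiate w (seg # ps)) (A w) = (if A w \<le> \<bar>T w - S w\<bar> then sgn (T w - S w) else vel (instantiate w ps) (A' w))" for w
        using False by (simp_all add: eq)
      ultimately show ?thesis using bm by (simp only: eq(3)) simp
    qed
  qed
  then show "ps \<noteq> [] \<Longrightarrow> (\<lambda>w. fst (pos (instantiate w ps) (A w))) \<in> measurable M (count_space (arcs G))"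
    and "ps \<noteq> [] \<Longrightarrow> (\<lambda>w. snd (pos (instantiate w ps) (A w))) \<in> borel_measurable M"
    and "(\<lambda>w. vel (instantiate w ps) (A w)) \<in> borel_measurable M"
    and "Measurable.pred M (\<lambda>w. brk (instantiate w ps) (A w))" by auto
qed

text \<open>Once the two edges and the kind of route are fixed, only the outermost parameters vary
  with the sample point; the walk in between is constant.\<close>

lemma route_instantiate:
  assumes "e \<in> arcs G" "f \<in> arcs G" "S \<in> borel_measurable M" "T \<in> borel_measurable M"
  obtains ps where "ps \<noteq> []" "\<And>e' S' T'. (e', S', T') \<in> set ps \<Longrightarrow> e' \<in> arcs G \<and> S' \<in> borel_measurable M \<and> T' \<in> borel_measurable M"
    "\<And>w. instantiate w ps = route k (e, S w) (f, T w)"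
proof (cases k)
  case None
  show thesis by (rule that[of "[(e, S, T)]"]) (use assms None in \<open>auto simp: instantiate_def\<close>)
next
  case (Some ab)
  obtain \<alpha> \<beta> where ab: "ab = (\<alpha>, \<beta>)" by (cases ab)
  define W where "W = shortest_walk (end_vertex e \<alpha>) (end_vertex f \<beta>)"
  have W: "set W \<subseteq> arcs G \<times> UNIV"
    unfolding W_def using assms by (intro walk_arcs[OF shortest_walk(1)]) (auto intro: end_vertex_in)
  show thesis
    by (rule that[of "(e, S, \<lambda>_. end_param e \<alpha>) # map (\<lambda>(g, \<gamma>). (g, \<lambda>_. end_param g \<gamma>, \<lambda>_. end_param g (\<not> \<gamma>))) W @ [(f, \<lambda>_. end_param f \<beta>, T)]"])
      (use assms Some ab W in \<open>auto simp: instantiate_def W_def[symmetric] case_prod_unfold o_def\<close>)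
qed

lemma measurable_into_EB:
  assumes E: "E \<in> measurable M (count_space (arcs G))" and S: "S \<in> borel_measurable M"
    and in_CE: "\<And>w. w \<in> space M \<Longrightarrow> (E w, S w) \<in> CE"
  shows "(\<lambda>w. (E w, S w)) \<in> measurable M EB"
proof (rule measurableI)
  fix w assume "w \<in> space M" then show "(E w, S w) \<in> space EB" using in_CE by simp
next
  fix A assume A: "A \<in> sets EB"
  have "\<exists>B. B \<in> sets borel \<and> {s \<in> {0..len e}. (e, s) \<in> A} = {0..len e} \<inter> B" if "e \<in> arcs G" for e
  proof -
    have "{s \<in> {0..len e}. (e, s) \<in> A} = Pair e -` A \<inter> space (restrict_space borel {0..len e})"
      by (auto simp: space_restrict_space)
    with measurable_sets[OF edge_inclusion_measurable[OF that] A] show ?thesis by (auto simp: sets_restrict_space)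
  qed
  then obtain B where B: "\<And>e. e \<in> arcs G \<Longrightarrow> B e \<in> sets borel"
     "\<And>e. e \<in> arcs G \<Longrightarrow> {s \<in> {0..len e}. (e, s) \<in> A} = {0..len e} \<inter> B e" by metis
  have "(E w, S w) \<in> A \<longleftrightarrow> S w \<in> B (E w)" if "w \<in> space M" for w
    using arg_cong[OF B(2)[of "E w"], of "\<lambda>Z. S w \<in> Z"] in_CE[OF that] by auto
  then have "(\<lambda>w. (E w, S w)) -` A \<inter> space M = (\<Union>e\<in>arcs G. (E -` {e} \<inter> space M) \<inter> (S -` B e \<inter> space M))"
    using in_CE by auto
  also have "\<dots> \<in> sets M"
    by (intro sets.finite_UN sets.Int finite_arcs measurable_sets[OF E] measurable_sets[OF S] B(1)) auto
  finally show "(\<lambda>w. (E w, S w)) -` A \<inter> space M \<in> sets M" .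
qed

section \<open>Measurable selection of geodesics\<close>

text \<open>Taking the first optimal route in a fixed enumeration makes the choice measurable, which
  an arbitrary choice would not guarantee.\<close>

definition geodesic_index :: "('e \<times> real) set \<times> ('e \<times> real) set \<Rightarrow> nat" where
  "geodesic_index \<omega> = (LEAST n. route_valid (from_nat n) (rep (fst \<omega>)) (rep (snd \<omega>)) \<and>
     D (fst \<omega>) (snd \<omega>) = route_length (from_nat n) (rep (fst \<omega>)) (rep (snd \<omega>)))"

definition geodesic :: "('e \<times> real) set \<times> ('e \<times> real) set \<Rightarrow> ('e \<times> real \<times> real) list" where
  "geodesic \<omega> = route (from_nat (geodesic_index \<omega>)) (rep (fst \<omega>)) (rep (snd \<omega>))"

lemma geodesic:
  assumes "\<omega> \<in> X \<times> X"
  shows "is_path G len (fst \<omega>) (geodesic \<omega>) (snd \<omega>)" "path_length (geodesic \<omega>) = D (fst \<omega>) (snd \<omega>)" "geodesic \<omega> \<noteq> []"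
proof -
  have r: "rep (fst \<omega>) \<in> CE" "rep (snd \<omega>) \<in> CE" "q (rep (fst \<omega>)) = fst \<omega>" "q (rep (snd \<omega>)) = snd \<omega>"
    using assms by (auto simp: rep mem_Times_iff)
  obtain k where "route_valid k (rep (fst \<omega>)) (rep (snd \<omega>)) \<and> D (fst \<omega>) (snd \<omega>) = route_length k (rep (fst \<omega>)) (rep (snd \<omega>))"
    by (rule exE[OF graph_dist_routes(1)[OF r(1,2), unfolded r(3,4)]])
  then have "route_valid (from_nat (geodesic_index \<omega>)) (rep (fst \<omega>)) (rep (snd \<omega>)) \<and>
     D (fst \<omega>) (snd \<omega>) = route_length (from_nat (geodesic_index \<omega>)) (rep (fst \<omega>)) (rep (snd \<omega>))"
    unfolding geodesic_index_def
    by (intro LeastI_ex[where P = "\<lambda>n. route_valid (from_nat n) (rep (fst \<omega>)) (rep (snd \<omega>)) \<and>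
     D (fst \<omega>) (snd \<omega>) = route_length (from_nat n) (rep (fst \<omega>)) (rep (snd \<omega>))"] exI[of _ "to_nat k"]) simp
  then show "is_path G len (fst \<omega>) (geodesic \<omega>) (snd \<omega>)" "path_length (geodesic \<omega>) = D (fst \<omega>) (snd \<omega>)"
    using route_path[OF r(1,2), of "from_nat (geodesic_index \<omega>)"] by (simp_all add: geodesic_def r)
  show "geodesic \<omega> \<noteq> []" unfolding geodesic_def by (rule route_nonempty)
qed

lemma geodesic_index_measurable: "geodesic_index \<in> measurable GG (count_space UNIV)"
  unfolding geodesic_index_def[abs_def]
proof (rule measurable_Least)
  fix n
  have [measurable]: "(\<lambda>\<omega>. route_length (from_nat n) (rep (fst \<omega>)) (rep (snd \<omega>))) \<in> borel_measurable GG"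
    by (rule route_length_measurable)
  have v: "Measurable.pred GG (\<lambda>\<omega>. route_valid (from_nat n) (rep (fst \<omega>)) (rep (snd \<omega>)))"
    by (rule route_valid_measurable)
  show "Measurable.pred GG (\<lambda>\<omega>. route_valid (from_nat n) (rep (fst \<omega>)) (rep (snd \<omega>)) \<and>
     D (fst \<omega>) (snd \<omega>) = route_length (from_nat n) (rep (fst \<omega>)) (rep (snd \<omega>)))"
    by (intro pred_intros_logic v) measurable
qed

text \<open>A geodesic depends on discrete data, namely its route and the edges of its two ends, and
  on two real parameters. For fixed discrete data it is an instantiated path, and the countably many
  cases are glued.\<close>

lemma geodesic_measurable_compose:
  assumes Z: "Z \<in> measurable P GG" and A: "A \<in> borel_measurable P"
    and F: "\<And>ps. ps \<noteq> [] \<Longrightarrow> (\<And>e S T. (e, S, T) \<in> set ps \<Longrightarrow> e \<in> arcs G \<and> S \<in> borel_measurable P \<and> T \<in> borel_measurable P) \<Longrightarrow>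
      (\<lambda>w. F (instantiate w ps) (A w)) \<in> measurable P R"
  shows "(\<lambda>w. F (geodesic (Z w)) (A w)) \<in> measurable P R"
proof -
  have 1: "(\<lambda>w. rep (fst (Z w))) \<in> measurable P EB" "(\<lambda>w. rep (snd (Z w))) \<in> measurable P EB"
    using Z by measurable
  have idx: "(\<lambda>w. geodesic_index (Z w)) \<in> measurable P (count_space UNIV)"
    by (rule measurable_compose[OF Z geodesic_index_measurable])
  have arc: "(\<lambda>w. fst (rep (fst (Z w)))) \<in> measurable P (count_space (arcs G))" "(\<lambda>w. fst (rep (snd (Z w)))) \<in> measurable P (count_space (arcs G))"
    by (intro measurable_compose[OF 1(1) rep_arc_measurable(2)] measurable_compose[OF 1(2) rep_arc_measurable(2)])+
  have par: "(\<lambda>w. snd (rep (fst (Z w)))) \<in> borel_measurable P" "(\<lambda>w. snd (rep (snd (Z w)))) \<in> borel_measurable P"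
    by (intro measurable_compose[OF 1(1) snd_EB] measurable_compose[OF 1(2) snd_EB])+
  have base: "(\<lambda>w. F (route (from_nat n) (e, snd (rep (fst (Z w)))) (f, snd (rep (snd (Z w))))) (A w)) \<in> measurable P R"
    if ef: "e \<in> arcs G" "f \<in> arcs G" for n e f
  proof -
    show ?thesis
    proof (rule route_instantiate[OF ef par, of "from_nat n"])
      fix ps
      assume ps: "ps \<noteq> []" "\<And>e' S' T'. (e', S', T') \<in> set ps \<Longrightarrow> e' \<in> arcs G \<and> S' \<in> borel_measurable P \<and> T' \<in> borel_measurable P"
        "\<And>w. instantiate w ps = route (from_nat n) (e, snd (rep (fst (Z w)))) (f, snd (rep (snd (Z w))))"
      from F[OF ps(1,2)] show ?thesis by (simp add: ps(3))
    qed
  qed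
  have "(\<lambda>w. F (route (from_nat n) (fst (rep (fst (Z w))), snd (rep (fst (Z w)))) (f, snd (rep (snd (Z w))))) (A w)) \<in> measurable P R"
    if "f \<in> arcs G" for n f
    by (rule measurable_compose_countable'[OF base[OF _ that] arc(1) countable_finite[OF finite_arcs]])
  from measurable_compose_countable'[OF this arc(2) countable_finite[OF finite_arcs]]
  have "(\<lambda>w. F (route (from_nat n) (fst (rep (fst (Z w))), snd (rep (fst (Z w)))) (fst (rep (snd (Z w))), snd (rep (snd (Z w))))) (A w)) \<in> measurable P R" for n .
  from measurable_compose_countable'[OF this idx]
  show ?thesis by (simp add: geodesic_def)
qed

section \<open>Constant-speed geodesics and their velocities\<close>

text \<open>Clamping defines the curves for all real times with a global Lipschitz bound, so
  difference quotients can be formed without watching the ends of the time interval.\<close>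

definition clamp01 :: "real \<Rightarrow> real" where
  "clamp01 t = max 0 (min 1 t)"

lemma clamp01: "0 \<le> clamp01 t" "clamp01 t \<le> 1" "t \<in> {0..1} \<Longrightarrow> clamp01 t = t" "\<bar>clamp01 t - clamp01 s\<bar> \<le> \<bar>t - s\<bar>"
  by (auto simp: clamp01_def)

lemma clamp01_measurable[measurable]: "clamp01 \<in> borel_measurable borel"
  unfolding clamp01_def[abs_def] by measurable

definition ray :: "real \<Rightarrow> ('e \<times> real) set \<times> ('e \<times> real) set \<Rightarrow> ('e \<times> real) set" where
  "ray t \<omega> = q (pos (geodesic \<omega>) (clamp01 t * D (fst \<omega>) (snd \<omega>)))"

text \<open>The signed velocity in the edge coordinate, multiplied by the distance because the
  geodesic is traversed in unit time. It is cut off at vertices, which carry no flux.\<close>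

definition speed :: "real \<Rightarrow> ('e \<times> real) set \<times> ('e \<times> real) set \<Rightarrow> real" where
  "speed t \<omega> = indicator OX (ray t \<omega>) * (vel (geodesic \<omega>) (clamp01 t * D (fst \<omega>) (snd \<omega>)) * D (fst \<omega>) (snd \<omega>))"

definition smooth_at :: "real \<Rightarrow> ('e \<times> real) set \<times> ('e \<times> real) set \<Rightarrow> bool" where
  "smooth_at t \<omega> \<longleftrightarrow> D (fst \<omega>) (snd \<omega>) = 0 \<or> \<not> brk (geodesic \<omega>) (clamp01 t * D (fst \<omega>) (snd \<omega>))"

lemma clamp01_dist:
  "0 \<le> clamp01 t * D x y" "clamp01 t * D x y \<le> D x y"
  using clamp01[of t] graph_dist_nonneg[of x y] by (auto intro: mult_left_le_one_le)

lemma graph_dist_le_diam_bound: "D x y \<le> diam_bound"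
  using diam_bound[of x y] diam_bound_nonneg by (cases "x \<in> X \<and> y \<in> X") (auto simp: graph_dist_def)

lemma ray_param_measurable: "(\<lambda>z. clamp01 (fst z) * D (fst (snd z)) (snd (snd z))) \<in> borel_measurable (borel \<Otimes>\<^sub>M GG)"
proof -
  have "(\<lambda>z. D (fst (snd z)) (snd (snd z))) \<in> borel_measurable (borel \<Otimes>\<^sub>M GG)"
    by (rule measurable_compose[OF measurable_snd graph_dist_measurable])
  then show ?thesis by measurable
qed

lemma ray_pos_in: "\<omega> \<in> X \<times> X \<Longrightarrow> pos (geodesic \<omega>) (clamp01 t * D (fst \<omega>) (snd \<omega>)) \<in> CE"
  using geodesic[of \<omega>] by (intro pos_in) (auto simp: clamp01_dist)

lemma ray_in: "\<omega> \<in> X \<times> X \<Longrightarrow> ray t \<omega> \<in> X"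
  unfolding ray_def by (intro q_in ray_pos_in)

lemma ray_0: "\<omega> \<in> X \<times> X \<Longrightarrow> ray 0 \<omega> = fst \<omega>"
  using pos_start geodesic[of \<omega>] by (simp add: ray_def clamp01)

lemma ray_1: "\<omega> \<in> X \<times> X \<Longrightarrow> ray 1 \<omega> = snd \<omega>"
  using pos_end[of "fst \<omega>" "geodesic \<omega>" "snd \<omega>"] geodesic[of \<omega>] by (simp add: ray_def clamp01)

lemma ray_measurable: "(\<lambda>z. ray (fst z) (snd z)) \<in> measurable (borel \<Otimes>\<^sub>M GG) GB"
proof -
  let ?A = "\<lambda>z. clamp01 (fst z) * D (fst (snd z)) (snd (snd z))"
  have 1: "(\<lambda>z. fst (pos (geodesic (snd z)) (?A z))) \<in> measurable (borel \<Otimes>\<^sub>M GG) (count_space (arcs G))"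
    by (rule geodesic_measurable_compose[OF measurable_snd ray_param_measurable, where F = "\<lambda>p a. fst (pos p a)"])
      (rule pos_vel_measurable(1)[OF _ ray_param_measurable])
  have 2: "(\<lambda>z. snd (pos (geodesic (snd z)) (?A z))) \<in> borel_measurable (borel \<Otimes>\<^sub>M GG)"
    by (rule geodesic_measurable_compose[OF measurable_snd ray_param_measurable, where F = "\<lambda>p a. snd (pos p a)"])
      (rule pos_vel_measurable(2)[OF _ ray_param_measurable])
  have "(\<lambda>z. (fst (pos (geodesic (snd z)) (?A z)), snd (pos (geodesic (snd z)) (?A z)))) \<in> measurable (borel \<Otimes>\<^sub>M GG) EB"
    using ray_pos_in by (intro measurable_into_EB[OF 1 2]) (auto simp: space_pair_measure)
  from measurable_compose[OF this q_measurable] show ?thesis by (simp add: ray_def)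
qed

lemma ray_measurable_at: "ray t \<in> measurable GG GB"
  using measurable_compose[OF measurable_Pair1'[of t borel GG] ray_measurable] by simp

lemma speed_measurable: "(\<lambda>z. speed (fst z) (snd z)) \<in> borel_measurable (borel \<Otimes>\<^sub>M GG)"
proof -
  have [measurable]: "(\<lambda>z. vel (geodesic (snd z)) (clamp01 (fst z) * D (fst (snd z)) (snd (snd z)))) \<in> borel_measurable (borel \<Otimes>\<^sub>M GG)"
    by (rule geodesic_measurable_compose[OF measurable_snd ray_param_measurable])
      (rule pos_vel_measurable(3)[OF _ ray_param_measurable])
  have [measurable]: "(\<lambda>z. indicat_real OX (ray (fst z) (snd z))) \<in> borel_measurable (borel \<Otimes>\<^sub>M GG)"
    by (rule measurable_compose[OF ray_measurable borel_measurable_indicator[OF OX_measurable]])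
  have [measurable]: "(\<lambda>z. D (fst (snd z)) (snd (snd z))) \<in> borel_measurable (borel \<Otimes>\<^sub>M GG)"
    by (rule measurable_compose[OF measurable_snd graph_dist_measurable])
  show ?thesis unfolding speed_def by measurable
qed

lemma speed_measurable_at: "speed t \<in> borel_measurable GG"
  using measurable_compose[OF measurable_Pair1'[of t borel GG] speed_measurable] by simp

lemma smooth_at_measurable: "Measurable.pred (borel \<Otimes>\<^sub>M GG) (\<lambda>z. smooth_at (fst z) (snd z))"
proof -
  have [measurable]: "Measurable.pred (borel \<Otimes>\<^sub>M GG) (\<lambda>z. brk (geodesic (snd z)) (clamp01 (fst z) * D (fst (snd z)) (snd (snd z))))"
    by (rule geodesic_measurable_compose[OF measurable_snd ray_param_measurable])
      (rule pos_vel_measurable(4)[OF _ ray_param_measurable])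
  have [measurable]: "(\<lambda>z. D (fst (snd z)) (snd (snd z))) \<in> borel_measurable (borel \<Otimes>\<^sub>M GG)"
    by (rule measurable_compose[OF measurable_snd graph_dist_measurable])
  show ?thesis unfolding smooth_at_def by measurable
qed

lemma speed_abs: "\<bar>speed t \<omega>\<bar> \<le> D (fst \<omega>) (snd \<omega>)"
proof -
  have "\<bar>speed t \<omega>\<bar> \<le> \<bar>vel (geodesic \<omega>) (clamp01 t * D (fst \<omega>) (snd \<omega>))\<bar> * D (fst \<omega>) (snd \<omega>)"
    using graph_dist_nonneg[of "fst \<omega>" "snd \<omega>"] by (auto simp: speed_def abs_mult indicator_def)
  also have "\<dots> \<le> 1 * D (fst \<omega>) (snd \<omega>)"
    by (intro mult_right_mono vel_abs graph_dist_nonneg)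
  finally show ?thesis by simp
qed

lemma speed_bounded: "\<bar>speed t \<omega>\<bar> \<le> diam_bound"
  using speed_abs[of t \<omega>] graph_dist_le_diam_bound[of "fst \<omega>" "snd \<omega>"] by linarith

lemma ray_dist:
  assumes \<omega>: "\<omega> \<in> X \<times> X"
  shows "D (ray s \<omega>) (ray t \<omega>) \<le> D (fst \<omega>) (snd \<omega>) * \<bar>t - s\<bar>"
proof -
  have le: "D (ray s \<omega>) (ray t \<omega>) \<le> D (fst \<omega>) (snd \<omega>) * \<bar>t - s\<bar>" if "clamp01 s \<le> clamp01 t" for s t
  proof -
    have "D (ray s \<omega>) (ray t \<omega>) \<le> clamp01 t * D (fst \<omega>) (snd \<omega>) - clamp01 s * D (fst \<omega>) (snd \<omega>)"
      unfolding ray_def using geodesic[OF \<omega>] that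
      by (intro pos_dist[of "fst \<omega>" _ "snd \<omega>"] mult_right_mono) (auto simp: clamp01_dist graph_dist_nonneg)
    also have "\<dots> = D (fst \<omega>) (snd \<omega>) * (clamp01 t - clamp01 s)" by (simp add: algebra_simps)
    also have "\<dots> \<le> D (fst \<omega>) (snd \<omega>) * \<bar>t - s\<bar>"
      using clamp01(4)[of t s] by (intro mult_left_mono graph_dist_nonneg) linarith
    finally show ?thesis .
  qed
  show ?thesis
    using le[of s t] le[of t s] GM.commute[of "ray s \<omega>" "ray t \<omega>"] by (cases "clamp01 s \<le> clamp01 t") (auto simp: abs_minus_commute)
qed

text \<open>Near an interior time the clamp is the identity, and rescaling arc length by the
  distance gives the factor in \<open>speed\<close>. At a smooth time of a nonconstant geodesic the
  position lies in an open edge, where \<open>rep\<close> returns the coordinates of the path; a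
  constant geodesic has derivative and \<open>speed\<close> equal to 0.\<close>

lemma ray_derivative:
  assumes \<omega>: "\<omega> \<in> X \<times> X" and t: "t \<in> {0<..<1}" and sm: "smooth_at t \<omega>" and \<psi>: "\<psi> \<circ> q \<in> C1_edges G len"
  shows "((\<lambda>s. \<psi> (ray s \<omega>)) has_real_derivative speed t \<omega> * grad len (\<psi> \<circ> q) (rep (ray t \<omega>))) (at t)"
proof (cases "D (fst \<omega>) (snd \<omega>) = 0")
  case True
  then show ?thesis by (simp add: speed_def ray_def)
next
  case False
  define l where "l = D (fst \<omega>) (snd \<omega>)"
  have l: "0 < l" using False graph_dist_nonneg[of "fst \<omega>" "snd \<omega>"] unfolding l_def by linarith
  have tl: "0 < t * l" "t * l < l" using l t by auto
  have ct: "clamp01 t = t" using t by (intro clamp01) auto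
  note g = geodesic[OF \<omega>, folded l_def]
  have nb: "\<not> brk (geodesic \<omega>) (t * l)" using sm False by (simp add: smooth_at_def l_def ct)
  note pd = pos_derivative[OF g(1,3) tl(1) _ nb, unfolded g(2), OF tl(2)]
  have rt: "ray t \<omega> = q (pos (geodesic \<omega>) (t * l))" by (simp add: ray_def ct l_def)
  have "ray t \<omega> \<in> OX" unfolding rt using pd(1) by blast
  then have sp: "speed t \<omega> = vel (geodesic \<omega>) (t * l) * l" by (simp add: speed_def ct l_def)
  have rr: "rep (ray t \<omega>) = pos (geodesic \<omega>) (t * l)" unfolding rt by (rule rep_open[OF pd(1)])
  have "((\<lambda>s. s * l) has_real_derivative l) (at t)" by (auto intro!: derivative_eq_intros)
  from DERIV_chain2[OF pd(2)[OF \<psi>] this]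
  have "((\<lambda>s. \<psi> (q (pos (geodesic \<omega>) (s * l)))) has_real_derivative speed t \<omega> * grad len (\<psi> \<circ> q) (rep (ray t \<omega>))) (at t)"
    by (simp add: sp rr mult_ac)
  then show ?thesis
    by (rule has_field_derivative_transform_within_open[of _ _ _ "{0<..<1}"]) (use t in \<open>auto simp: ray_def clamp01 l_def\<close>)
qed

lemma smooth_at_AE:
  assumes "\<omega> \<in> X \<times> X"
  shows "AE t in lborel. t \<in> {0<..<1} \<longrightarrow> smooth_at t \<omega>"
proof (cases "D (fst \<omega>) (snd \<omega>) = 0")
  case False
  define l where "l = D (fst \<omega>) (snd \<omega>)"
  have "finite ((\<lambda>a. a / l) ` {a. brk (geodesic \<omega>) a})" using brk_finite by simp
  then have "AE t in lborel. t \<notin> (\<lambda>a. a / l) ` {a. brk (geodesic \<omega>) a}"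
    by (intro AE_not_in finite_imp_null_set_lborel)
  then show ?thesis
  proof eventually_elim
    case (elim t)
    have "t \<in> (\<lambda>a. a / l) ` {a. brk (geodesic \<omega>) a}" if "brk (geodesic \<omega>) (t * l)"
      using that False by (intro image_eqI[of _ _ "t * l"]) (auto simp: l_def)
    then show ?case using elim by (auto simp: smooth_at_def l_def clamp01)
  qed
qed (simp add: smooth_at_def)

end

section \<open>Displacement interpolation\<close>

lemma lipschitz_absolutely_continuous_on:
  fixes f :: "real \<Rightarrow> real"
  assumes K: "0 \<le> K" and lip: "\<And>s t. s \<in> S \<Longrightarrow> t \<in> S \<Longrightarrow> \<bar>f t - f s\<bar> \<le> K * \<bar>t - s\<bar>"
  shows "absolutely_continuous_on S f"
  unfolding absolutely_continuous_on_def
proof (intro allI impI)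
  fix \<epsilon> :: real assume \<epsilon>: "0 < \<epsilon>"
  show "\<exists>\<delta>>0. \<forall>I. finite I \<longrightarrow> (\<forall>(a, b)\<in>I. a < b \<and> {a..b} \<subseteq> S) \<longrightarrow>
      disjoint_family_on (\<lambda>(a, b). {a<..<b}) I \<longrightarrow> (\<Sum>(a, b)\<in>I. b - a) < \<delta> \<longrightarrow> (\<Sum>(a, b)\<in>I. \<bar>f b - f a\<bar>) < \<epsilon>"
  proof (intro exI[of _ "\<epsilon> / (K + 1)"] conjI allI impI)
    fix I assume I: "\<forall>(a, b)\<in>I. a < b \<and> {a..b} \<subseteq> S" "(\<Sum>(a, b)\<in>I. b - a) < \<epsilon> / (K + 1)"
    have "\<bar>f (snd z) - f (fst z)\<bar> \<le> K * (snd z - fst z)" if "z \<in> I" for z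
    proof -
      have "fst z < snd z" "{fst z..snd z} \<subseteq> S" using I(1) that by (auto simp: case_prod_unfold)
      moreover from this have "fst z \<in> S" "snd z \<in> S" by (auto intro: subsetD)
      ultimately show ?thesis using lip[of "fst z" "snd z"] by simp
    qed
    then have "(\<Sum>(a, b)\<in>I. \<bar>f b - f a\<bar>) \<le> (\<Sum>z\<in>I. K * (snd z - fst z))"
      unfolding case_prod_unfold by (rule sum_mono)
    also have "\<dots> = K * (\<Sum>(a, b)\<in>I. b - a)" by (simp add: sum_distrib_left case_prod_unfold)
    also have "\<dots> \<le> K * (\<epsilon> / (K + 1))" using I(2) K by (intro mult_left_mono) auto
    also have "\<dots> < \<epsilon>" using K \<epsilon> by (simp add: field_simps)
    finally show "(\<Sum>(a, b)\<in>I. \<bar>f b - f a\<bar>) < \<epsilon>" .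
  qed (use K \<epsilon> in auto)
qed

context metric_graph
begin

lemma test_function_lipschitz:
  assumes "\<psi> \<in> test_functions G len"
  obtains L where "0 \<le> L" "\<And>x y. x \<in> X \<Longrightarrow> y \<in> X \<Longrightarrow> \<bar>\<psi> y - \<psi> x\<bar> \<le> L * D x y"
proof -
  have C1: "\<psi> \<circ> q \<in> C1_edges G len" using assms by (simp add: test_functions_def)
  show thesis
  proof (rule grad_bounded[OF C1])
    fix L assume L: "0 \<le> L" "\<And>p. p \<in> CE \<Longrightarrow> \<bar>grad len (\<psi> \<circ> q) p\<bar> \<le> L"
    show thesis
    proof (rule that[OF L(1)])
      fix x y assume "x \<in> X" "y \<in> X"
      then show "\<bar>\<psi> y - \<psi> x\<bar> \<le> L * D x y"
        using grad_lipschitz[OF C1 L(2)] by (intro edgewise_lipschitz L(1)) auto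
    qed
  qed
qed

lemma ray_continuous:
  assumes \<phi>: "continuous_map (graph_topology G len) euclideanreal \<phi>" and \<omega>: "\<omega> \<in> X \<times> X" and u: "u \<longlonglongrightarrow> t"
  shows "(\<lambda>n. \<phi> (ray (u n) \<omega>)) \<longlonglongrightarrow> \<phi> (ray t \<omega>)"
proof -
  have "(\<lambda>n. D (fst \<omega>) (snd \<omega>) * \<bar>t - u n\<bar>) \<longlonglongrightarrow> D (fst \<omega>) (snd \<omega>) * \<bar>t - t\<bar>"
    using u by (intro tendsto_intros)
  then have *: "eventually (\<lambda>n. D (fst \<omega>) (snd \<omega>) * \<bar>t - u n\<bar> < \<epsilon>) sequentially" if "0 < \<epsilon>" for \<epsilon>
    using that by (intro order_tendstoD(2)[where y = 0]) auto
  have "limitin GM.mtopology (\<lambda>n. ray (u n) \<omega>) (ray t \<omega>) sequentially"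
    unfolding GM.limitin_metric
  proof (intro conjI allI impI ray_in[OF \<omega>])
    fix \<epsilon> :: real assume "0 < \<epsilon>"
    from *[OF this] show "\<forall>\<^sub>F n in sequentially. ray (u n) \<omega> \<in> X \<and> D (ray (u n) \<omega>) (ray t \<omega>) < \<epsilon>"
    proof eventually_elim
      case (elim n)
      then show ?case using ray_dist[OF \<omega>, of "u n" t] ray_in[OF \<omega>] by auto
    qed
  qed
  from continuous_map_limit[OF \<phi>[unfolded graph_topology_eq] this]
  show ?thesis by (simp add: o_def)
qed

section \<open>The flow of measures induced by a coupling\<close>

context
  fixes M N \<sigma>
  assumes \<sigma>: "\<sigma> \<in> couplings G len M N"
begin

interpretation S: prob_space \<sigma> by (rule couplingsD[OF \<sigma>])

lemma \<sigma>_sets[measurable_cong]: "sets \<sigma> = sets GG"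
  by (rule couplingsD[OF \<sigma>])

definition flow :: "real \<Rightarrow> ('e \<times> real) set measure" where
  "flow t = distr \<sigma> GB (ray t)"

lemma ray_coupling[measurable]: "ray t \<in> measurable \<sigma> GB"
  using ray_measurable_at measurable_cong_sets[OF \<sigma>_sets refl] by blast

lemma speed_coupling[measurable]: "speed t \<in> borel_measurable \<sigma>"
  using speed_measurable_at measurable_cong_sets[OF \<sigma>_sets refl] by blast

lemma pair_coupling: "sets (borel \<Otimes>\<^sub>M \<sigma>) = sets (borel \<Otimes>\<^sub>M GG)" "sets (lborel \<Otimes>\<^sub>M \<sigma>) = sets (borel \<Otimes>\<^sub>M GG)"
  by (intro sets_pair_measure_cong \<sigma>_sets; simp)+

lemma ray_pair_coupling: "(\<lambda>z. ray (fst z) (snd z)) \<in> measurable (borel \<Otimes>\<^sub>M \<sigma>) GB"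
  and speed_pair_coupling: "(\<lambda>z. speed (fst z) (snd z)) \<in> borel_measurable (borel \<Otimes>\<^sub>M \<sigma>)"
  using ray_measurable speed_measurable by (simp_all add: measurable_cong_sets[OF pair_coupling(1) refl])

lemma flow_in: "flow t \<in> prob_measures G len"
  unfolding flow_def by (intro prob_measuresI S.prob_space_distr ray_coupling) simp

lemma flow_0: "flow 0 = M" and flow_1: "flow 1 = N"
proof -
  have "flow 0 = distr \<sigma> GB fst" "flow 1 = distr \<sigma> GB snd"
    unfolding flow_def using couplingsD(3)[OF \<sigma>] ray_0 ray_1 by (auto intro!: distr_cong)
  then show "flow 0 = M" "flow 1 = N" using couplingsD(4,5)[OF \<sigma>] by simp_all
qed

lemma flow_integral: "f \<in> borel_measurable GB \<Longrightarrow> (\<integral>x. f x \<partial>flow t) = (\<integral>\<omega>. f (ray t \<omega>) \<partial>\<sigma>)" for f :: "_ \<Rightarrow> real"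
  unfolding flow_def by (rule integral_distr[OF ray_coupling])

lemma ray_integrable:
  assumes "continuous_map (graph_topology G len) euclideanreal \<phi>"
  shows "integrable \<sigma> (\<lambda>\<omega>. \<phi> (ray t \<omega>))"
proof (rule continuous_map_bounded[OF assms])
  fix b assume b: "\<And>x. x \<in> X \<Longrightarrow> \<bar>\<phi> x\<bar> \<le> b"
  show ?thesis
  proof (rule S.integrable_const_bound[of _ b])
    show "AE \<omega> in \<sigma>. norm (\<phi> (ray t \<omega>)) \<le> b"
      using couplingsD(3)[OF \<sigma>] b ray_in by (intro AE_I2) simp
  qed (rule measurable_compose[OF ray_coupling continuous_map_GB[OF assms]])
qed

lemma flow_weakly_continuous: "weakly_continuous_on G len T flow"
  unfolding weakly_continuous_on_def
proof (intro conjI ballI allI impI flow_in)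
  fix \<phi> assume \<phi>: "continuous_map (graph_topology G len) euclideanreal \<phi>"
  show "continuous_on T (\<lambda>t. \<integral>x. \<phi> x \<partial>flow t)"
  proof (rule continuous_on_sequentiallyI)
    fix u and t :: real assume u: "u \<longlonglongrightarrow> t"
    show "(\<lambda>n. \<integral>x. \<phi> x \<partial>flow (u n)) \<longlonglongrightarrow> (\<integral>x. \<phi> x \<partial>flow t)"
      unfolding flow_integral[OF continuous_map_GB[OF \<phi>]]
    proof (rule continuous_map_bounded[OF \<phi>])
      fix b assume b: "\<And>x. x \<in> X \<Longrightarrow> \<bar>\<phi> x\<bar> \<le> b"
      show "(\<lambda>n. \<integral>\<omega>. \<phi> (ray (u n) \<omega>) \<partial>\<sigma>) \<longlonglongrightarrow> (\<integral>\<omega>. \<phi> (ray t \<omega>) \<partial>\<sigma>)"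
      proof (rule integral_dominated_convergence[where w = "\<lambda>_. b"])
        show "AE \<omega> in \<sigma>. (\<lambda>n. \<phi> (ray (u n) \<omega>)) \<longlonglongrightarrow> \<phi> (ray t \<omega>)"
          using couplingsD(3)[OF \<sigma>] ray_continuous[OF \<phi> _ u] by (intro AE_I2) simp
        show "AE \<omega> in \<sigma>. norm (\<phi> (ray (u n) \<omega>)) \<le> b" for n
          using couplingsD(3)[OF \<sigma>] b ray_in by (intro AE_I2) simp
      qed (simp_all add: borel_measurable_integrable[OF ray_integrable[OF \<phi>]])
    qed
  qed
qed

lemma flow_absolutely_continuous:
  assumes \<psi>: "\<psi> \<in> test_functions G len"
  shows "absolutely_continuous_on T (\<lambda>t. \<integral>x. \<psi> x \<partial>flow t)"
proof (rule test_function_lipschitz[OF \<psi>])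
  fix L assume L: "0 \<le> L" "\<And>x y. x \<in> X \<Longrightarrow> y \<in> X \<Longrightarrow> \<bar>\<psi> y - \<psi> x\<bar> \<le> L * D x y"
  have \<psi>c: "continuous_map (graph_topology G len) euclideanreal \<psi>" using \<psi> by (simp add: test_functions_def)
  show ?thesis
  proof (rule lipschitz_absolutely_continuous_on[where K = "L * diam_bound"])
    fix s t
    have "\<bar>(\<integral>\<omega>. \<psi> (ray t \<omega>) \<partial>\<sigma>) - (\<integral>\<omega>. \<psi> (ray s \<omega>) \<partial>\<sigma>)\<bar> = \<bar>\<integral>\<omega>. \<psi> (ray t \<omega>) - \<psi> (ray s \<omega>) \<partial>\<sigma>\<bar>"
      by (simp add: ray_integrable[OF \<psi>c])
    also have "\<dots> \<le> (\<integral>\<omega>. \<bar>\<psi> (ray t \<omega>) - \<psi> (ray s \<omega>)\<bar> \<partial>\<sigma>)"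
      by (rule integral_abs_bound)
    also have "\<dots> \<le> (\<integral>\<omega>. L * diam_bound * \<bar>t - s\<bar> \<partial>\<sigma>)"
    proof (rule integral_mono)
      fix \<omega> assume "\<omega> \<in> space \<sigma>"
      then have \<omega>: "\<omega> \<in> X \<times> X" using couplingsD(3)[OF \<sigma>] by simp
      have "\<bar>\<psi> (ray t \<omega>) - \<psi> (ray s \<omega>)\<bar> \<le> L * D (ray s \<omega>) (ray t \<omega>)" by (intro L(2) ray_in \<omega>)
      also have "\<dots> \<le> L * (D (fst \<omega>) (snd \<omega>) * \<bar>t - s\<bar>)" by (intro mult_left_mono ray_dist \<omega> L(1))
      also have "\<dots> \<le> L * (diam_bound * \<bar>t - s\<bar>)"
        by (intro mult_left_mono mult_right_mono graph_dist_le_diam_bound L(1)) simp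
      finally show "\<bar>\<psi> (ray t \<omega>) - \<psi> (ray s \<omega>)\<bar> \<le> L * diam_bound * \<bar>t - s\<bar>" by (simp add: mult.assoc)
    qed (auto intro!: integrable_abs Bochner_Integration.integrable_diff ray_integrable[OF \<psi>c])
    finally show "\<bar>(\<integral>x. \<psi> x \<partial>flow t) - (\<integral>x. \<psi> x \<partial>flow s)\<bar> \<le> L * diam_bound * \<bar>t - s\<bar>"
      by (simp add: flow_integral[OF continuous_map_GB[OF \<psi>c]] S.prob_space)
  qed (simp add: L(1) diam_bound_nonneg)
qed

text \<open>Fubini: every pair is smooth at almost every time, hence at almost every time almost
  every pair is smooth. The exceptional times depend on the coupling and not on a test
  function.\<close>

lemma smooth_at_coupling: "AE t in lborel. t \<in> {0<..<1} \<longrightarrow> (AE \<omega> in \<sigma>. smooth_at t \<omega>)"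
proof -
  interpret pair_sigma_finite lborel \<sigma> ..
  have "Measurable.pred (lborel \<Otimes>\<^sub>M \<sigma>) (\<lambda>z. smooth_at (fst z) (snd z))"
    using smooth_at_measurable by (simp add: measurable_cong_sets[OF pair_coupling(2) refl])
  then have pred: "Measurable.pred (lborel \<Otimes>\<^sub>M \<sigma>) (\<lambda>z. fst z \<in> {0<..<1} \<longrightarrow> smooth_at (fst z) (snd z))" by measurable
  have "AE \<omega> in \<sigma>. AE t in lborel. t \<in> {0<..<1} \<longrightarrow> smooth_at t \<omega>"
    using couplingsD(3)[OF \<sigma>] by (intro AE_I2 smooth_at_AE) simp
  then have "AE t in lborel. AE \<omega> in \<sigma>. t \<in> {0<..<1} \<longrightarrow> smooth_at t \<omega>"
    by (subst AE_commute[OF predE[OF pred]])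
  then show ?thesis by eventually_elim auto
qed

text \<open>Differentiation under the integral: the difference quotients are dominated by a
  Lipschitz constant of \<psi> times the diameter bound.\<close>

lemma flow_derivative:
  assumes \<psi>: "\<psi> \<in> test_functions G len" and t: "t \<in> {0<..<1}" and sm: "AE \<omega> in \<sigma>. smooth_at t \<omega>"
  shows "((\<lambda>s. \<integral>x. \<psi> x \<partial>flow s) has_real_derivative (\<integral>\<omega>. speed t \<omega> * grad len (\<psi> \<circ> q) (rep (ray t \<omega>)) \<partial>\<sigma>)) (at t)"
proof -
  have \<psi>c: "continuous_map (graph_topology G len) euclideanreal \<psi>" and C1: "\<psi> \<circ> q \<in> C1_edges G len"
    using \<psi> by (auto simp: test_functions_def)
  obtain L where L: "0 \<le> L" "\<And>x y. x \<in> X \<Longrightarrow> y \<in> X \<Longrightarrow> \<bar>\<psi> y - \<psi> x\<bar> \<le> L * D x y"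
    by (rule test_function_lipschitz[OF \<psi>]) blast
  have gm: "(\<lambda>\<omega>. grad len (\<psi> \<circ> q) (rep (ray t \<omega>))) \<in> borel_measurable \<sigma>"
    by (rule measurable_compose[OF ray_coupling measurable_compose[OF rep_measurable grad_measurable[OF C1]]])
  have "(\<lambda>h. ((\<integral>x. \<psi> x \<partial>flow (t + h)) - (\<integral>x. \<psi> x \<partial>flow t)) / h) \<midarrow>0\<rightarrow> (\<integral>\<omega>. speed t \<omega> * grad len (\<psi> \<circ> q) (rep (ray t \<omega>)) \<partial>\<sigma>)"
    unfolding tendsto_at_iff_sequentially
  proof (intro allI impI)
    fix h :: "nat \<Rightarrow> real" assume h: "\<forall>i. h i \<in> UNIV - {0}" "h \<longlonglongrightarrow> 0"
    have "(\<lambda>n. \<integral>\<omega>. (\<psi> (ray (t + h n) \<omega>) - \<psi> (ray t \<omega>)) / h n \<partial>\<sigma>) \<longlonglongrightarrow> (\<integral>\<omega>. speed t \<omega> * grad len (\<psi> \<circ> q) (rep (ray t \<omega>)) \<partial>\<sigma>)"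
    proof (rule integral_dominated_convergence[where w = "\<lambda>_. L * diam_bound"])
      have "AE \<omega> in \<sigma>. \<omega> \<in> X \<times> X" using couplingsD(3)[OF \<sigma>] by (intro AE_I2) simp
      with sm show "AE \<omega> in \<sigma>. (\<lambda>n. (\<psi> (ray (t + h n) \<omega>) - \<psi> (ray t \<omega>)) / h n) \<longlonglongrightarrow> speed t \<omega> * grad len (\<psi> \<circ> q) (rep (ray t \<omega>))"
      proof eventually_elim
        case (elim \<omega>)
        from ray_derivative[OF elim(2) t elim(1) C1, unfolded DERIV_def tendsto_at_iff_sequentially, rule_format, OF h(1)[rule_format] h(2)]
        show ?case by (simp add: o_def)
      qed
      show "AE \<omega> in \<sigma>. norm ((\<psi> (ray (t + h n) \<omega>) - \<psi> (ray t \<omega>)) / h n) \<le> L * diam_bound" for n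
      proof (rule AE_I2)
        fix \<omega> assume "\<omega> \<in> space \<sigma>"
        then have \<omega>: "\<omega> \<in> X \<times> X" using couplingsD(3)[OF \<sigma>] by simp
        have hn: "0 < \<bar>h n\<bar>" using h(1) by auto
        have "\<bar>\<psi> (ray (t + h n) \<omega>) - \<psi> (ray t \<omega>)\<bar> \<le> L * D (ray t \<omega>) (ray (t + h n) \<omega>)" by (intro L(2) ray_in \<omega>)
        also have "\<dots> \<le> L * (D (fst \<omega>) (snd \<omega>) * \<bar>h n\<bar>)" using ray_dist[OF \<omega>, of t "t + h n"] by (intro mult_left_mono L(1)) simp
        also have "\<dots> \<le> L * (diam_bound * \<bar>h n\<bar>)"
          by (intro mult_left_mono mult_right_mono graph_dist_le_diam_bound L(1)) simp
        finally show "norm ((\<psi> (ray (t + h n) \<omega>) - \<psi> (ray t \<omega>)) / h n) \<le> L * diam_bound"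
          using hn by (simp add: abs_divide pos_divide_le_eq mult.assoc)
      qed
    qed (auto intro!: borel_measurable_times gm borel_measurable_divide borel_measurable_diff borel_measurable_integrable[OF ray_integrable[OF \<psi>c]])
    moreover have "(\<integral>\<omega>. (\<psi> (ray (t + h n) \<omega>) - \<psi> (ray t \<omega>)) / h n \<partial>\<sigma>) = ((\<integral>x. \<psi> x \<partial>flow (t + h n)) - (\<integral>x. \<psi> x \<partial>flow t)) / h n" for n
      by (simp add: flow_integral[OF continuous_map_GB[OF \<psi>c]] ray_integrable[OF \<psi>c])
    ultimately have "(\<lambda>n. ((\<integral>x. \<psi> x \<partial>flow (t + h n)) - (\<integral>x. \<psi> x \<partial>flow t)) / h n) \<longlonglongrightarrow> (\<integral>\<omega>. speed t \<omega> * grad len (\<psi> \<circ> q) (rep (ray t \<omega>)) \<partial>\<sigma>)"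
      by (simp only:)
    then show "((\<lambda>h. ((\<integral>x. \<psi> x \<partial>flow (t + h)) - (\<integral>x. \<psi> x \<partial>flow t)) / h) \<circ> h) \<longlonglongrightarrow> (\<integral>\<omega>. speed t \<omega> * grad len (\<psi> \<circ> q) (rep (ray t \<omega>)) \<partial>\<sigma>)"
      by (simp add: o_def)
  qed
  then show ?thesis by (simp add: DERIV_def)
qed

lemma flow_velocity_exists:
  "\<exists>v. v \<in> borel_measurable GB \<and> (\<forall>x. \<bar>v x\<bar> \<le> diam_bound) \<and>
     (\<forall>h B. h \<in> borel_measurable GB \<longrightarrow> (\<forall>y. \<bar>h y\<bar> \<le> B) \<longrightarrow> (\<integral>\<omega>. speed t \<omega> * h (ray t \<omega>) \<partial>\<sigma>) = (\<integral>y. v y * h y \<partial>flow t)) \<and>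
     (\<integral>y. (v y)\<^sup>2 \<partial>flow t) \<le> (\<integral>\<omega>. (speed t \<omega>)\<^sup>2 \<partial>\<sigma>)"
proof (rule velocity_projection[OF S.prob_space_axioms ray_coupling[of t] speed_coupling[of t] speed_bounded])
  fix v :: "_ \<Rightarrow> real"
  assume "v \<in> borel_measurable GB" "\<And>x. \<bar>v x\<bar> \<le> diam_bound"
    "\<And>(h :: _ \<Rightarrow> real) B. h \<in> borel_measurable GB \<Longrightarrow> (\<And>y. \<bar>h y\<bar> \<le> B) \<Longrightarrow>
       (\<integral>\<omega>. speed t \<omega> * h (ray t \<omega>) \<partial>\<sigma>) = (\<integral>y. v y * h y \<partial>distr \<sigma> GB (ray t))"
    "(\<integral>y. (v y)\<^sup>2 \<partial>distr \<sigma> GB (ray t)) \<le> (\<integral>\<omega>. (speed t \<omega>)\<^sup>2 \<partial>\<sigma>)"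
  then show ?thesis unfolding flow_def by (intro exI[of _ v]) blast
qed

text \<open>The field is chosen separately for each time, so nothing is claimed about joint
  measurability in time and space. Measurability of the fluxes in time comes from
  \<open>flow_flux\<close>, which expresses them through the jointly measurable
  \<open>speed\<close>.\<close>

definition velocity :: "real \<Rightarrow> ('e \<times> real) set \<Rightarrow> real" where
  "velocity t = (SOME v. v \<in> borel_measurable GB \<and> (\<forall>x. \<bar>v x\<bar> \<le> diam_bound) \<and>
     (\<forall>h B. h \<in> borel_measurable GB \<longrightarrow> (\<forall>y. \<bar>h y\<bar> \<le> B) \<longrightarrow> (\<integral>\<omega>. speed t \<omega> * h (ray t \<omega>) \<partial>\<sigma>) = (\<integral>y. v y * h y \<partial>flow t)) \<and>
     (\<integral>y. (v y)\<^sup>2 \<partial>flow t) \<le> (\<integral>\<omega>. (speed t \<omega>)\<^sup>2 \<partial>\<sigma>))"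

lemma velocity:
  shows "velocity t \<in> borel_measurable GB" "\<bar>velocity t x\<bar> \<le> diam_bound"
    "h \<in> borel_measurable GB \<Longrightarrow> (\<And>y. \<bar>h y\<bar> \<le> B) \<Longrightarrow> (\<integral>\<omega>. speed t \<omega> * h (ray t \<omega>) \<partial>\<sigma>) = (\<integral>y. velocity t y * h y \<partial>flow t)"
    "(\<integral>y. (velocity t y)\<^sup>2 \<partial>flow t) \<le> (\<integral>\<omega>. (speed t \<omega>)\<^sup>2 \<partial>\<sigma>)"
  using someI_ex[OF flow_velocity_exists[of t], folded velocity_def] by blast+

lemma velocity_measurable[measurable]: "velocity t \<in> borel_measurable (flow t)"
  using velocity(1) by (simp add: flow_def)

lemma velocity_L2: "velocity t \<in> L2 (flow t)"
proof -
  interpret F: prob_space "flow t" by (rule prob_measuresD[OF flow_in])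
  have "norm ((velocity t x)\<^sup>2) \<le> diam_bound\<^sup>2" for x using velocity(2)[of t x] diam_bound_nonneg by (simp add: abs_le_square_iff[symmetric])
  then have "integrable (flow t) (\<lambda>x. (velocity t x)\<^sup>2)"
    by (intro F.integrable_const_bound[of _ "diam_bound\<^sup>2"]) auto
  then show ?thesis by (simp add: L2_def)
qed

lemma speed_OX: "speed t \<omega> * (indicator OX (ray t \<omega>) * c) = speed t \<omega> * c"
  by (simp add: speed_def indicator_def)

lemma flow_flux:
  assumes A: "A \<in> sets EB"
  shows "flux G len (velocity t) (flow t) A = (\<integral>\<omega>. speed t \<omega> * indicator A (rep (ray t \<omega>)) \<partial>\<sigma>)"
proof -
  have m: "(\<lambda>x. indicator OX x * indicat_real A (rep x)) \<in> borel_measurable GB"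
    using A by measurable
  have "flux G len (velocity t) (flow t) A = (\<integral>x. velocity t x * (indicator OX x * indicator A (rep x)) \<partial>flow t)"
    unfolding flux_eq(1)[OF flow_in velocity_L2 A] by (simp add: mult_ac)
  also have "\<dots> = (\<integral>\<omega>. speed t \<omega> * (indicator OX (ray t \<omega>) * indicator A (rep (ray t \<omega>))) \<partial>\<sigma>)"
    by (rule velocity(3)[OF m, symmetric, of 1]) (simp add: indicator_def)
  finally show ?thesis by (simp add: speed_OX)
qed

lemma flow_signed_integral:
  assumes f: "f \<in> borel_measurable EB" "\<And>p. p \<in> CE \<Longrightarrow> \<bar>f p\<bar> \<le> B" "0 \<le> B"
  shows "signed_integral EB (flux G len (velocity t) (flow t)) f = (\<integral>\<omega>. speed t \<omega> * f (rep (ray t \<omega>)) \<partial>\<sigma>)"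
proof -
  have m: "(\<lambda>x. indicator OX x * f (rep x)) \<in> borel_measurable GB"
    using f(1) by measurable
  have b: "\<bar>indicator OX y * f (rep y)\<bar> \<le> B" for y
  proof (cases "y \<in> OX")
    case True
    then show ?thesis using f(2)[OF rep(1)[OF subsetD[OF OX_subset]]] by simp
  qed (simp add: f(3))
  have "signed_integral EB (flux G len (velocity t) (flow t)) f = (\<integral>x. velocity t x * (indicator OX x * f (rep x)) \<partial>flow t)"
    using flux_signed_integral[OF flow_in velocity_L2 f(1,2)] by (simp add: mult_ac)
  also have "\<dots> = (\<integral>\<omega>. speed t \<omega> * (indicator OX (ray t \<omega>) * f (rep (ray t \<omega>))) \<partial>\<sigma>)"
    by (rule velocity(3)[OF m b, symmetric])
  finally show ?thesis by (simp add: speed_OX)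
qed

lemma flow_total_variation:
  "total_variation EB (flux G len (velocity t) (flow t)) (space EB) \<le> ennreal diam_bound"
proof -
  interpret F: prob_space "flow t" by (rule prob_measuresD[OF flow_in])
  have "(\<integral>\<^sup>+x. indicator OX x * ennreal \<bar>velocity t x\<bar> \<partial>flow t) \<le> (\<integral>\<^sup>+x. ennreal diam_bound \<partial>flow t)"
    using velocity(2) by (intro nn_integral_mono) (auto simp: indicator_def ennreal_leI)
  also have "\<dots> = ennreal diam_bound" by (simp add: F.emeasure_space_1)
  finally show ?thesis unfolding flux_total_variation[OF flow_in velocity_L2] .
qed

lemma flow_weak_solution: "weak_solution G len 1 flow (\<lambda>t. flux G len (velocity t) (flow t))"
  unfolding weak_solution_def
proof (intro conjI ballI)
  show "flow t \<in> prob_measures G len" "signed_measure EB (flux G len (velocity t) (flow t))" for t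
    by (intro flow_in flux_signed_measure velocity_L2)+
  show "(\<lambda>t. measure (flow t) A) \<in> borel_measurable (restrict_space borel {0<..<1})" if A: "A \<in> sets GB" for A
  proof -
    have "(\<lambda>z. indicat_real A (ray (fst z) (snd z))) \<in> borel_measurable (borel \<Otimes>\<^sub>M \<sigma>)"
      by (rule measurable_compose[OF ray_pair_coupling borel_measurable_indicator[OF A]])
    then have "(\<lambda>t. \<integral>\<omega>. indicat_real A (ray t \<omega>) \<partial>\<sigma>) \<in> borel_measurable borel"
      by (intro S.borel_measurable_lebesgue_integral) (simp add: case_prod_unfold)
    moreover have "(\<integral>\<omega>. indicat_real A (ray t \<omega>) \<partial>\<sigma>) = measure (flow t) A" for t
    proof -
      have "(\<integral>\<omega>. indicat_real A (ray t \<omega>) \<partial>\<sigma>) = (\<integral>x. indicat_real A x \<partial>flow t)"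
        using A by (intro flow_integral[symmetric]) simp
      also have "\<dots> = measure (flow t) A"
        using prob_measuresD(3)[OF flow_in[of t]] sets.sets_into_space[OF A] by (simp add: Int_absorb2)
      finally show ?thesis .
    qed
    ultimately show ?thesis by (simp add: measurable_restrict_space1)
  qed
  show "(\<lambda>t. flux G len (velocity t) (flow t) A) \<in> borel_measurable (restrict_space borel {0<..<1})" if A: "A \<in> sets EB" for A
  proof -
    have "(\<lambda>z. indicat_real A (rep (ray (fst z) (snd z)))) \<in> borel_measurable (borel \<Otimes>\<^sub>M \<sigma>)"
      by (rule measurable_compose[OF ray_pair_coupling measurable_compose[OF rep_measurable borel_measurable_indicator[OF A]]])
    then have "(\<lambda>t. \<integral>\<omega>. speed t \<omega> * indicator A (rep (ray t \<omega>)) \<partial>\<sigma>) \<in> borel_measurable borel"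
      using speed_pair_coupling by (intro S.borel_measurable_lebesgue_integral) (simp add: case_prod_unfold)
    then show ?thesis unfolding flow_flux[OF A] by (rule measurable_restrict_space1)
  qed
  show "absolutely_continuous_on {0<..<1} (\<lambda>t. \<integral>x. \<psi> x \<partial>flow t)" if "\<psi> \<in> test_functions G len" for \<psi>
    by (rule flow_absolutely_continuous[OF that])
  have "(\<integral>\<^sup>+t\<in>{0<..<1}. total_variation EB (flux G len (velocity t) (flow t)) (space EB) \<partial>lborel)
      \<le> (\<integral>\<^sup>+t\<in>{0<..<1::real}. ennreal diam_bound \<partial>lborel)"
    by (rule nn_integral_mono) (simp add: indicator_def flow_total_variation[unfolded space_EB])
  also have "\<dots> < \<infinity>" by (simp add: nn_integral_cmult_indicator ennreal_mult_less_top)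
  finally show "(\<integral>\<^sup>+t\<in>{0<..<1}. total_variation EB (flux G len (velocity t) (flow t)) (space EB) \<partial>lborel) < \<infinity>" .
  show "AE t in lborel. t \<in> {0<..<1} \<longrightarrow> ((\<lambda>s. \<integral>x. \<psi> x \<partial>flow s) has_real_derivative
      signed_integral EB (flux G len (velocity t) (flow t)) (grad len (\<psi> \<circ> q))) (at t)" if \<psi>: "\<psi> \<in> test_functions G len" for \<psi>
    using smooth_at_coupling
  proof eventually_elim
    case (elim t)
    have C1: "\<psi> \<circ> q \<in> C1_edges G len" using \<psi> by (simp add: test_functions_def)
    have "signed_integral EB (flux G len (velocity t) (flow t)) (grad len (\<psi> \<circ> q)) = (\<integral>\<omega>. speed t \<omega> * grad len (\<psi> \<circ> q) (rep (ray t \<omega>)) \<partial>\<sigma>)"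
      by (rule grad_bounded[OF C1]) (rule flow_signed_integral[OF grad_measurable[OF C1]])
    then show ?case using flow_derivative[OF \<psi>] elim by simp
  qed
qed

lemma flow_admissible: "(flow, velocity) \<in> admissible G len M N"
  unfolding admissible_def weak_solution_closed_def
  using flow_weak_solution flow_weakly_continuous velocity_L2 flow_0 flow_1 by simp

text \<open>The projection does not increase the square integral, and the speed is at most the
  distance; time runs over an interval of length 1. For an optimal coupling the reverse inequality
  is supplied by \<open>W2_squared_le_action\<close>.\<close>

lemma flow_action: "action G len flow velocity \<le> (\<integral>\<^sup>+(x, y). ennreal ((D x y)\<^sup>2) \<partial>\<sigma>)"
proof -
  have "(\<integral>\<^sup>+x\<in>OX. ennreal (\<bar>velocity t x\<bar>\<^sup>2) \<partial>flow t) \<le> ennreal (\<integral>\<omega>. (D (fst \<omega>) (snd \<omega>))\<^sup>2 \<partial>\<sigma>)" for t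
  proof -
    have "(\<integral>\<^sup>+x\<in>OX. ennreal (\<bar>velocity t x\<bar>\<^sup>2) \<partial>flow t) \<le> (\<integral>\<^sup>+x. ennreal ((velocity t x)\<^sup>2) \<partial>flow t)"
      by (intro nn_integral_mono) (simp add: indicator_def)
    also have "\<dots> = ennreal (\<integral>x. (velocity t x)\<^sup>2 \<partial>flow t)"
      using velocity_L2[of t] by (intro nn_integral_eq_integral) (auto simp: L2_def)
    also have "\<dots> \<le> ennreal (\<integral>\<omega>. (speed t \<omega>)\<^sup>2 \<partial>\<sigma>)" by (rule ennreal_leI[OF velocity(4)])
    also have "\<dots> \<le> ennreal (\<integral>\<omega>. (D (fst \<omega>) (snd \<omega>))\<^sup>2 \<partial>\<sigma>)"
    proof (rule ennreal_leI, rule integral_mono)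
      show le: "(speed t \<omega>)\<^sup>2 \<le> (D (fst \<omega>) (snd \<omega>))\<^sup>2" for \<omega>
        using speed_abs[of t \<omega>] by (simp add: abs_le_square_iff[symmetric])
      show "integrable \<sigma> (\<lambda>\<omega>. (speed t \<omega>)\<^sup>2)"
        by (rule Bochner_Integration.integrable_bound[OF coupling_cost(1)[OF \<sigma>]]) (use le in auto)
    qed (rule coupling_cost(1)[OF \<sigma>])
    finally show ?thesis .
  qed
  then have "action G len flow velocity \<le> (\<integral>\<^sup>+t\<in>{0<..<1::real}. ennreal (\<integral>\<omega>. (D (fst \<omega>) (snd \<omega>))\<^sup>2 \<partial>\<sigma>) \<partial>lborel)"
    unfolding action_def by (intro nn_integral_mono) (simp add: indicator_def)
  also have "\<dots> = (\<integral>\<^sup>+(x, y). ennreal ((D x y)\<^sup>2) \<partial>\<sigma>)"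
    unfolding coupling_cost(2)[OF \<sigma>] by (simp add: nn_integral_cmult_indicator)
  finally show ?thesis .
qed

end

end

theorem corollary3p18:
  fixes G :: "('v, 'e) pre_digraph" and len :: "'e \<Rightarrow> real"
    and \<mu> \<nu> :: "('e \<times> real) set measure"
  assumes "metric_graph G len"
    and "\<mu> \<in> prob_measures G len" and "\<nu> \<in> prob_measures G len"
  shows "(\<exists>(\<mu>t, v) \<in> admissible G len \<mu> \<nu>. W2_squared G len \<mu> \<nu> = action G len \<mu>t v)
       \<and> (\<forall>(\<mu>t, v) \<in> admissible G len \<mu> \<nu>. W2_squared G len \<mu> \<nu> \<le> action G len \<mu>t v)"
proof -
  interpret metric_graph G len by (rule assms(1))
  have lower: "W2_squared G len \<mu> \<nu> \<le> action G len m v" if "(m, v) \<in> admissible G len \<mu> \<nu>" for m v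
    by (rule W2_squared_le_action[OF assms(2,3) that])
  show ?thesis
  proof (rule optimal_coupling_exists[OF assms(2,3)])
    fix \<sigma> assume \<sigma>: "\<sigma> \<in> couplings G len \<mu> \<nu>" "W2_squared G len \<mu> \<nu> = (\<integral>\<^sup>+(x, y). ennreal ((graph_dist G len x y)\<^sup>2) \<partial>\<sigma>)"
    note adm = flow_admissible[OF \<sigma>(1)]
    have "W2_squared G len \<mu> \<nu> = action G len (flow \<sigma>) (velocity \<sigma>)"
      using lower[OF adm] flow_action[OF \<sigma>(1)] unfolding \<sigma>(2) by (rule antisym)
    then show ?thesis using adm lower by blast
  qed
qed

end
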